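(* Assume that $\mathsf a>0$ and $\mathsf a\ne\frac14$, and consider on $L^2(\mathbb R^2)$ the operator $$\mathcal K_{\mathsf a}=v\partial_x-\mathsf a x\partial_v-\partial_v^2+\frac{v^2}{4}-\frac12 .$$ Then: (i) there exist $t_0\in(0,1)$ and $c_{\mathsf a,0},c_{\mathsf a,1}>0$ such that for every $t\in(0,t_0)$, $$c_{\mathsf a,0}\,t^{-4}\le\|e^{-t\mathcal K_{\mathsf a}}\|_{\mathrm{tr}}\le c_{\mathsf a,1}\,t^{-4};$$ (ii) the trace satisfies $$\mathrm{tr}(e^{-t\mathcal K_{\mathsf a}})\underset{t\to0^+}{\sim}\frac1{\mathsf a}\,t^{-2};$$ (iii) the counting function satisfies $$\mathcal N_{\mathcal K_{\mathsf a}}(\lambda)\underset{\lambda\to+\infty}{\sim}2\max\Big(1,\frac1{4\mathsf a}\Big)\lambda^2 .$$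
   Context: Points of $\mathbb R^2$ are written $(x,v)$. $\mathcal K_{\mathsf a}$ denotes the closed operator on $L^2(\mathbb R^2)$ with domain $\{f\in L^2:\mathcal K_{\mathsf a}f\in L^2\}$ (distributional sense), which is the closure of the differential operator on $C_c^\infty(\mathbb R^2)$ (it is the Fokker--Planck operator with potential $V(x)=\frac{\mathsf a}{2}x^2$ in dimension $n=1$ with all physical constants equal to $1$). $(e^{-t\mathcal K_{\mathsf a}})_{t\ge0}$ is the strongly continuous semigroup with infinitesimal generator $-\mathcal K_{\mathsf a}$, and $\|\cdot\|_{\mathrm{tr}}$ is the trace class norm on $L^2(\mathbb R^2)$. The spectrum of $\mathcal K_{\mathsf a}$ is discrete, and the counting function is $\mathcal N_{\mathcal K_{\mathsf a}}(\lambda)=\sum_{z_j\in\mathrm{Sp}(\mathcal K_{\mathsf a}),\ \mathrm{Re}(z_j)\le\lambda}\mathrm{mult}(z_j)$, where $\mathrm{mult}(z_j)$ is the algebraic multiplicity, i.e. the rank of the Riesz projector $\frac{i}{2\pi}\oint_{|z-z_j|=\varepsilon}(\mathcal K_{\mathsf a}-z)^{-1}dz$ (small counterclockwise circle). *)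

theory Defs
  imports "HOL-Complex_Analysis.Complex_Analysis" "HOL-Library.Landau_Symbols"
begin

section \<open>The complex Hilbert space of square-integrable functions on the plane\<close>

definition sq_int :: "(real \<times> real \<Rightarrow> complex) \<Rightarrow> bool" where
  "sq_int f \<longleftrightarrow> f \<in> borel_measurable lborel \<and> integrable lborel (\<lambda>p. (cmod (f p))\<^sup>2)"

definition l2_rel :: "(real \<times> real \<Rightarrow> complex) \<Rightarrow> (real \<times> real \<Rightarrow> complex) \<Rightarrow> bool" where
  "l2_rel f g \<longleftrightarrow> sq_int f \<and> sq_int g \<and> (AE p in lborel. f p = g p)"

lemma sq_int_zero: "sq_int (\<lambda>_. 0)"
  by (simp add: sq_int_def)

lemma sq_int_add:
  assumes "sq_int f" "sq_int g"
  shows "sq_int (\<lambda>p. f p + g p)"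
proof -
  have m: "f \<in> borel_measurable lborel" "g \<in> borel_measurable lborel"
    and i: "integrable lborel (\<lambda>p. (cmod (f p))\<^sup>2)" "integrable lborel (\<lambda>p. (cmod (g p))\<^sup>2)"
    using assms by (auto simp: sq_int_def)
  have b: "(cmod (f p + g p))\<^sup>2 \<le> 2 * (cmod (f p))\<^sup>2 + 2 * (cmod (g p))\<^sup>2" for p
  proof -
    have "(cmod (f p + g p))\<^sup>2 \<le> (cmod (f p) + cmod (g p))\<^sup>2"
      by (intro power_mono norm_triangle_ineq norm_ge_zero)
    also have "\<dots> \<le> 2 * (cmod (f p))\<^sup>2 + 2 * (cmod (g p))\<^sup>2"
      using sum_squares_bound[of "cmod (f p)" "cmod (g p)"] by (simp add: power2_sum)
    finally show ?thesis .
  qed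
  have "integrable lborel (\<lambda>p. (cmod (f p + g p))\<^sup>2)"
    by (rule Bochner_Integration.integrable_bound
          [of lborel "\<lambda>p. 2 * (cmod (f p))\<^sup>2 + 2 * (cmod (g p))\<^sup>2"])
       (use m i b in \<open>auto intro!: AE_I2\<close>)
  with m show ?thesis by (auto simp: sq_int_def)
qed

lemma sq_int_scale:
  assumes "sq_int f"
  shows "sq_int (\<lambda>p. c * f p)"
  using assms by (auto simp: sq_int_def norm_mult power_mult_distrib)

lemma sq_int_prod:
  assumes "sq_int f" "sq_int g"
  shows "integrable lborel (\<lambda>p. f p * cnj (g p))"
proof -
  have m: "f \<in> borel_measurable lborel" "g \<in> borel_measurable lborel"
    and i: "integrable lborel (\<lambda>p. (cmod (f p))\<^sup>2)" "integrable lborel (\<lambda>p. (cmod (g p))\<^sup>2)"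
    using assms by (auto simp: sq_int_def)
  have m': "(\<lambda>p. f p * cnj (g p)) \<in> borel_measurable lborel"
    using m by (intro borel_measurable_times)
       (auto intro: borel_measurable_continuous_on[OF continuous_on_cnj[OF continuous_on_id]])
  have b: "cmod (f p * cnj (g p)) \<le> (cmod (f p))\<^sup>2 + (cmod (g p))\<^sup>2" for p
  proof -
    have "2 * (cmod (f p) * cmod (g p)) \<le> (cmod (f p))\<^sup>2 + (cmod (g p))\<^sup>2"
      using sum_squares_bound[of "cmod (f p)" "cmod (g p)"] by simp
    moreover have "0 \<le> cmod (f p) * cmod (g p)" by simp
    ultimately show ?thesis unfolding norm_mult complex_mod_cnj by linarith
  qed
  show ?thesis
    by (rule Bochner_Integration.integrable_bound
          [of lborel "\<lambda>p. (cmod (f p))\<^sup>2 + (cmod (g p))\<^sup>2"])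
       (use m' i b in \<open>auto intro!: AE_I2\<close>)
qed

quotient_type l2 = "real \<times> real \<Rightarrow> complex" / partial: l2_rel
proof (rule part_equivpI)
  show "\<exists>f. l2_rel f f" using sq_int_zero by (auto simp: l2_rel_def)
  show "symp l2_rel" by (auto simp: symp_def l2_rel_def elim: AE_mp)
  show "transp l2_rel"
  proof (rule transpI)
    fix f g h assume "l2_rel f g" "l2_rel g h"
    moreover from this have "AE p in lborel. f p = h p"
      unfolding l2_rel_def by (auto elim: AE_mp)
    ultimately show "l2_rel f h" by (auto simp: l2_rel_def)
  qed
qed

text \<open>The inner product is linear in its first argument. The real structure of
  \<open>l2\<close>, i.e. scalar multiplication by reals and the real inner product below,
  gives access to the norm, limits and integrals of the library.\<close>

lift_definition cinner :: "l2 \<Rightarrow> l2 \<Rightarrow> complex" is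
  "\<lambda>f g. integral\<^sup>L lborel (\<lambda>p. f p * cnj (g p))"
proof -
  fix f f' g g' assume fg: "l2_rel f f'" "l2_rel g g'"
  then have "AE p in lborel. f p * cnj (g p) = f' p * cnj (g' p)"
    unfolding l2_rel_def by (auto elim: AE_mp)
  with fg show "integral\<^sup>L lborel (\<lambda>p. f p * cnj (g p)) = integral\<^sup>L lborel (\<lambda>p. f' p * cnj (g' p))"
    by (intro integral_cong_AE)
       (auto simp: l2_rel_def dest: sq_int_prod borel_measurable_integrable)
qed

lift_definition cscale :: "complex \<Rightarrow> l2 \<Rightarrow> l2" is "\<lambda>c f p. c * f p"
  unfolding l2_rel_def by (auto intro: sq_int_scale elim: AE_mp)

instantiation l2 :: real_inner
begin

lift_definition zero_l2 :: l2 is "\<lambda>_. 0"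
  by (simp add: l2_rel_def sq_int_zero)

lift_definition plus_l2 :: "l2 \<Rightarrow> l2 \<Rightarrow> l2" is "\<lambda>f g p. f p + g p"
  unfolding l2_rel_def by (auto intro: sq_int_add elim: AE_mp)

definition uminus_l2 :: "l2 \<Rightarrow> l2" where "- f = cscale (- 1) f"
definition minus_l2 :: "l2 \<Rightarrow> l2 \<Rightarrow> l2" where "f - g = f + - (g :: l2)"
definition scaleR_l2 :: "real \<Rightarrow> l2 \<Rightarrow> l2" where "r *\<^sub>R f = cscale (of_real r) f"
definition inner_l2 :: "l2 \<Rightarrow> l2 \<Rightarrow> real" where "f \<bullet> g = Re (cinner f g)"
definition norm_l2 :: "l2 \<Rightarrow> real" where "norm f = sqrt (f \<bullet> (f :: l2))"
definition sgn_l2 :: "l2 \<Rightarrow> l2" where "sgn f = inverse (norm f) *\<^sub>R (f :: l2)"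
definition dist_l2 :: "l2 \<Rightarrow> l2 \<Rightarrow> real" where "dist f g = norm (f - g :: l2)"
definition uniformity_l2 :: "(l2 \<times> l2) filter" where
  "uniformity_l2 = (INF e\<in>{0<..}. principal {(x, y). dist x y < e})"
definition open_l2 :: "l2 set \<Rightarrow> bool" where
  "open_l2 U \<longleftrightarrow> (\<forall>x\<in>U. \<forall>\<^sub>F (x', y) in uniformity. x' = x \<longrightarrow> y \<in> U)"

lemma cinner_add_left: "cinner (f + g) h = cinner f h + cinner g h"
  by transfer
     (auto simp: l2_rel_def distrib_right intro!: Bochner_Integration.integral_add sq_int_prod)

lemma cinner_cscale_left: "cinner (cscale c f) g = c * cinner f g"
  by transfer (simp add: mult.assoc)

lemma cinner_commute: "cinner f g = cnj (cinner g f)"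
proof transfer
  fix f g assume "l2_rel f f" "l2_rel g g"
  have "integral\<^sup>L lborel (\<lambda>p. f p * cnj (g p)) = integral\<^sup>L lborel (\<lambda>p. cnj (g p * cnj (f p)))"
    by (simp add: mult.commute)
  also have "\<dots> = cnj (integral\<^sup>L lborel (\<lambda>p. g p * cnj (f p)))"
    by (rule Bochner_Integration.integral_cnj)
  finally show "integral\<^sup>L lborel (\<lambda>p. f p * cnj (g p)) = cnj (integral\<^sup>L lborel (\<lambda>p. g p * cnj (f p)))" .
qed

lemma inner_l2_self_ge_zero: "0 \<le> Re (cinner f f)"
proof transfer
  fix f :: "real \<times> real \<Rightarrow> complex" assume "l2_rel f f"
  have "integral\<^sup>L lborel (\<lambda>p. f p * cnj (f p)) = of_real (integral\<^sup>L lborel (\<lambda>p. (cmod (f p))\<^sup>2))"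
    by (simp only: complex_norm_square[symmetric] integral_complex_of_real)
  then show "0 \<le> Re (integral\<^sup>L lborel (\<lambda>p. f p * cnj (f p)))"
    by (simp add: integral_nonneg_AE)
qed

lemma inner_l2_self_eq_zero: "Re (cinner f f) = 0 \<longleftrightarrow> f = 0"
proof transfer
  fix f :: "real \<times> real \<Rightarrow> complex" assume f: "l2_rel f f"
  have "integral\<^sup>L lborel (\<lambda>p. f p * cnj (f p)) = of_real (integral\<^sup>L lborel (\<lambda>p. (cmod (f p))\<^sup>2))"
    by (simp only: complex_norm_square[symmetric] integral_complex_of_real)
  then have "Re (integral\<^sup>L lborel (\<lambda>p. f p * cnj (f p))) = integral\<^sup>L lborel (\<lambda>p. (cmod (f p))\<^sup>2)"
    by simp
  moreover have "integral\<^sup>L lborel (\<lambda>p. (cmod (f p))\<^sup>2) = 0 \<longleftrightarrow> (AE p in lborel. (cmod (f p))\<^sup>2 = 0)"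
    using f by (intro integral_nonneg_eq_0_iff_AE) (auto simp: l2_rel_def sq_int_def)
  ultimately show "Re (integral\<^sup>L lborel (\<lambda>p. f p * cnj (f p))) = 0 \<longleftrightarrow> l2_rel f (\<lambda>_. 0)"
    using f by (simp add: l2_rel_def sq_int_zero)
qed

instance
proof
  fix f g h :: l2 and r s :: real
  show "f + g + h = f + (g + h)"
    by transfer (auto simp: l2_rel_def add.assoc intro!: sq_int_add)
  show "f + g = g + f"
    by transfer (auto simp: l2_rel_def add.commute intro!: sq_int_add)
  show "0 + f = f"
    by transfer (auto simp: l2_rel_def)
  show "- f + f = 0"
    unfolding uminus_l2_def
    by transfer (auto simp: l2_rel_def sq_int_zero)
  show "f - g = f + - g"
    by (simp add: minus_l2_def)
  show "r *\<^sub>R (f + g) = r *\<^sub>R f + r *\<^sub>R g"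
    unfolding scaleR_l2_def
    by transfer (auto simp: l2_rel_def distrib_left intro!: sq_int_add sq_int_scale)
  show "(r + s) *\<^sub>R f = r *\<^sub>R f + s *\<^sub>R f"
    unfolding scaleR_l2_def
    by transfer (auto simp: l2_rel_def distrib_right intro!: sq_int_add sq_int_scale)
  show "r *\<^sub>R s *\<^sub>R f = (r * s) *\<^sub>R f"
    unfolding scaleR_l2_def
    by transfer (auto simp: l2_rel_def mult.assoc intro!: sq_int_scale)
  show "1 *\<^sub>R f = f"
    unfolding scaleR_l2_def
    by transfer (auto simp: l2_rel_def)
  show "dist f g = norm (f - g)" by (rule dist_l2_def)
  show "sgn f = inverse (norm f) *\<^sub>R f" by (rule sgn_l2_def)
  show "f \<bullet> g = g \<bullet> f"
    unfolding inner_l2_def by (subst cinner_commute) simp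
  show "(f + g) \<bullet> h = f \<bullet> h + g \<bullet> h"
    by (simp add: inner_l2_def cinner_add_left)
  show "(r *\<^sub>R f) \<bullet> g = r * (f \<bullet> g)"
    by (simp add: inner_l2_def scaleR_l2_def cinner_cscale_left)
  show "0 \<le> f \<bullet> f"
    by (simp add: inner_l2_def inner_l2_self_ge_zero)
  show "f \<bullet> f = 0 \<longleftrightarrow> f = 0"
    by (simp add: inner_l2_def inner_l2_self_eq_zero)
  show "norm f = sqrt (f \<bullet> f)" by (rule norm_l2_def)
  show "uniformity = (INF e\<in>{0<..}. principal {(x, y :: l2). dist x y < e})"
    by (rule uniformity_l2_def)
next
  fix U :: "l2 set"
  show "open U \<longleftrightarrow> (\<forall>x\<in>U. \<forall>\<^sub>F (x', y) in uniformity. x' = x \<longrightarrow> y \<in> U)"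
    by (rule open_l2_def)
qed

end

text \<open>\<open>l2\<close> as a complex vector space; \<open>l2c.span\<close> and \<open>l2c.dim\<close> are
  the complex span and dimension.\<close>

interpretation l2c: vector_space cscale
proof
  fix c d :: complex and f g :: l2
  show "cscale c (f + g) = cscale c f + cscale c g"
    by transfer (auto simp: l2_rel_def distrib_left intro!: sq_int_add sq_int_scale)
  show "cscale (c + d) f = cscale c f + cscale d f"
    by transfer (auto simp: l2_rel_def distrib_right intro!: sq_int_add sq_int_scale)
  show "cscale c (cscale d f) = cscale (c * d) f"
    by transfer (auto simp: l2_rel_def mult.assoc intro!: sq_int_scale)
  show "cscale 1 f = f"
    by transfer (auto simp: l2_rel_def)
qed

lemma norm_cscale: "norm (cscale c f) = cmod c * norm f"
proof -
  have r: "cinner (cscale c f) (cscale c f) = c * cnj c * cinner f f"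
    by (metis cinner_commute cinner_cscale_left complex_cnj_cnj complex_cnj_mult mult.assoc)
  have "cinner (cscale c f) (cscale c f) = complex_of_real ((cmod c)\<^sup>2) * cinner f f"
    unfolding r complex_norm_square ..
  then have "Re (cinner (cscale c f) (cscale c f)) = (cmod c)\<^sup>2 * Re (cinner f f)"
    by simp
  then show ?thesis
    by (simp add: norm_l2_def inner_l2_def real_sqrt_mult)
qed

text \<open>Bounded operators are elements of \<open>l2 \<Rightarrow>\<^sub>L l2\<close>, which is the space of bounded
  real-linear maps; complex linearity is imposed separately where it is not automatic.\<close>

definition clinear_op :: "(l2 \<Rightarrow>\<^sub>L l2) \<Rightarrow> bool" where
  "clinear_op T \<longleftrightarrow> (\<forall>c f. T (cscale c f) = cscale c (T f))"

lift_definition cmult_op :: "complex \<Rightarrow> (l2 \<Rightarrow>\<^sub>L l2)" is cscale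
proof (rule bounded_linear_intro)
  fix c :: complex and f g :: l2 and r :: real
  show "cscale c (f + g) = cscale c f + cscale c g"
    by (rule l2c.scale_right_distrib)
  show "cscale c (r *\<^sub>R f) = r *\<^sub>R cscale c f"
    by (simp add: scaleR_l2_def mult.commute)
  show "norm (cscale c f) \<le> norm f * cmod c"
    by (simp add: norm_cscale)
qed


section \<open>Trace and trace norm\<close>

definition onb :: "(nat \<Rightarrow> l2) \<Rightarrow> bool" where
  "onb e \<longleftrightarrow> (\<forall>m n. cinner (e m) (e n) = (if m = n then 1 else 0)) \<and>
             closure (l2c.span (range e)) = UNIV"

definition adj_op :: "(l2 \<Rightarrow>\<^sub>L l2) \<Rightarrow> (l2 \<Rightarrow>\<^sub>L l2)" where
  "adj_op T = (THE U :: l2 \<Rightarrow>\<^sub>L l2. \<forall>f g. cinner (T f) g = cinner f (U g))"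

definition positive_op :: "(l2 \<Rightarrow>\<^sub>L l2) \<Rightarrow> bool" where
  "positive_op P \<longleftrightarrow> clinear_op P \<and> (\<forall>f. cinner (P f) f \<in> \<real>\<^sub>\<ge>\<^sub>0)"

text \<open>\<open>\<bar>T\<bar>\<close>, the positive square root of \<open>T\<^sup>* T\<close>\<close>
definition abs_op :: "(l2 \<Rightarrow>\<^sub>L l2) \<Rightarrow> (l2 \<Rightarrow>\<^sub>L l2)" where
  "abs_op T = (THE P. positive_op P \<and> P o\<^sub>L P = adj_op T o\<^sub>L T)"

text \<open>The trace norm is the trace of \<open>\<bar>T\<bar>\<close>, a sum of nonnegative terms that does not
  depend on the orthonormal basis; it is \<open>\<infinity>\<close> unless \<open>T\<close> is trace class.
  For trace class \<open>T\<close> the trace is likewise independent of the basis.\<close>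

definition trace_norm :: "(l2 \<Rightarrow>\<^sub>L l2) \<Rightarrow> ennreal" where
  "trace_norm T =
     (THE c. \<forall>e. onb e \<longrightarrow> (\<Sum>n. ennreal (Re (cinner (abs_op T (e n)) (e n)))) = c)"

definition op_trace :: "(l2 \<Rightarrow>\<^sub>L l2) \<Rightarrow> complex" where
  "op_trace T = (THE c. \<forall>e. onb e \<longrightarrow> (\<lambda>n. cinner (T (e n)) (e n)) sums c)"


section \<open>Unbounded operators, represented by their graphs\<close>

text \<open>\<open>(f, u + z f) \<in> A\<close> says that \<open>f\<close> is in the domain of \<open>A\<close> and \<open>(A - z) f = u\<close>.\<close>
definition resolvent_at :: "l2 rel \<Rightarrow> complex \<Rightarrow> (l2 \<Rightarrow>\<^sub>L l2) \<Rightarrow> bool" where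
  "resolvent_at A z R \<longleftrightarrow> (\<forall>u f. R u = f \<longleftrightarrow> (f, u + cscale z f) \<in> A)"

definition spectrum :: "l2 rel \<Rightarrow> complex set" where
  "spectrum A = {z. \<not> (\<exists>R. resolvent_at A z R)}"

definition resolvent :: "l2 rel \<Rightarrow> complex \<Rightarrow> (l2 \<Rightarrow>\<^sub>L l2)" where
  "resolvent A z = (THE R. resolvent_at A z R)"

text \<open>The operator-valued analogue of \<^const>\<open>contour_integral\<close>\<close>
definition op_contour_integral :: "(real \<Rightarrow> complex) \<Rightarrow> (complex \<Rightarrow> (l2 \<Rightarrow>\<^sub>L l2)) \<Rightarrow> (l2 \<Rightarrow>\<^sub>L l2)" where
  "op_contour_integral \<gamma> F =
     integral {0..1} (\<lambda>s. cmult_op (vector_derivative \<gamma> (at s within {0..1})) o\<^sub>L F (\<gamma> s))"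

definition riesz_projector :: "l2 rel \<Rightarrow> complex \<Rightarrow> (l2 \<Rightarrow>\<^sub>L l2)" where
  "riesz_projector A z = (THE P. \<forall>\<^sub>F \<epsilon> in at_right 0.
     P = cmult_op (\<i> / (2 * of_real pi)) o\<^sub>L op_contour_integral (circlepath z \<epsilon>) (resolvent A))"

definition op_rank :: "(l2 \<Rightarrow>\<^sub>L l2) \<Rightarrow> enat" where
  "op_rank T = (if \<exists>B. finite B \<and> range T \<subseteq> l2c.span B then enat (l2c.dim (range T)) else \<infinity>)"

text \<open>A non-isolated point of the spectrum has no Riesz projector and is given
  multiplicity \<open>\<infinity>\<close>, so that it can never be missed by the counting function.\<close>
definition alg_mult :: "l2 rel \<Rightarrow> complex \<Rightarrow> enat" where
  "alg_mult A z = (if z isolated_in spectrum A then op_rank (riesz_projector A z) else \<infinity>)"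

definition counting :: "l2 rel \<Rightarrow> real \<Rightarrow> ennreal" where
  "counting A r = (\<Sum>\<^sub>\<infinity>z\<in>{z \<in> spectrum A. Re z \<le> r}. ennreal_of_enat (alg_mult A z))"

definition C0_semigroup :: "(real \<Rightarrow> (l2 \<Rightarrow>\<^sub>L l2)) \<Rightarrow> bool" where
  "C0_semigroup S \<longleftrightarrow>
     (\<forall>t\<ge>0. clinear_op (S t)) \<and> S 0 = id_blinfun \<and>
     (\<forall>s\<ge>0. \<forall>t\<ge>0. S (s + t) = S s o\<^sub>L S t) \<and>
     (\<forall>f. ((\<lambda>t. S t f) \<longlongrightarrow> f) (at_right 0))"

definition generator :: "(real \<Rightarrow> (l2 \<Rightarrow>\<^sub>L l2)) \<Rightarrow> l2 rel" where
  "generator S = {(f, g). ((\<lambda>t. (1 / t) *\<^sub>R (S t f - f)) \<longlongrightarrow> g) (at_right 0)}"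

text \<open>\<open>exp_minus A t\<close> is \<open>e\<^sup>-\<^sup>t\<^sup>A\<close> for \<open>t \<ge> 0\<close>: the value at \<open>t\<close> of the
  strongly continuous semigroup with generator \<open>- A\<close>.\<close>
definition exp_minus :: "l2 rel \<Rightarrow> real \<Rightarrow> (l2 \<Rightarrow>\<^sub>L l2)" where
  "exp_minus A t =
     (THE T. \<exists>S. C0_semigroup S \<and> generator S = {(f, - g) | f g. (f, g) \<in> A} \<and> S t = T)"


section \<open>The Fokker--Planck operator\<close>

text \<open>Points of the plane are \<open>(x, v)\<close>.\<close>

definition dx :: "(real \<times> real \<Rightarrow> complex) \<Rightarrow> real \<times> real \<Rightarrow> complex" where
  "dx \<phi> = (\<lambda>(x, v). vector_derivative (\<lambda>s. \<phi> (s, v)) (at x))"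

definition dv :: "(real \<times> real \<Rightarrow> complex) \<Rightarrow> real \<times> real \<Rightarrow> complex" where
  "dv \<phi> = (\<lambda>(x, v). vector_derivative (\<lambda>s. \<phi> (x, s)) (at v))"

primrec Ck :: "nat \<Rightarrow> (real \<times> real \<Rightarrow> complex) \<Rightarrow> bool" where
  "Ck 0 \<phi> \<longleftrightarrow> continuous_on UNIV \<phi>"
| "Ck (Suc k) \<phi> \<longleftrightarrow> (\<forall>p. \<phi> differentiable (at p)) \<and> Ck k (dx \<phi>) \<and> Ck k (dv \<phi>)"

definition test_fun :: "(real \<times> real \<Rightarrow> complex) \<Rightarrow> bool" where
  "test_fun \<phi> \<longleftrightarrow> (\<forall>k. Ck k \<phi>) \<and> compact (closure {p. \<phi> p \<noteq> 0})"

text \<open>The formal transpose of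
  \<open>v \<partial>\<^sub>x - a x \<partial>\<^sub>v - \<partial>\<^sub>v\<^sup>2 + v\<^sup>2/4 - 1/2\<close> (for the bilinear pairing
  \<open>\<integral> f \<phi>\<close>): multiplications are moved onto the test function first, then each
  derivative is moved with a minus sign.\<close>
definition K_transpose :: "real \<Rightarrow> (real \<times> real \<Rightarrow> complex) \<Rightarrow> real \<times> real \<Rightarrow> complex" where
  "K_transpose a \<phi> = (\<lambda>(x, v).
     - dx (\<lambda>(x, v). of_real v * \<phi> (x, v)) (x, v)
     + dv (\<lambda>(x, v). of_real (a * x) * \<phi> (x, v)) (x, v)
     - dv (dv \<phi>) (x, v)
     + of_real (v\<^sup>2 / 4 - 1 / 2) * \<phi> (x, v))"

text \<open>\<open>\<integral> f \<psi>\<close>; the measurability guard only makes the value independent of the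
  representative of \<open>f\<close> and is satisfied by all continuous \<open>\<psi>\<close>.\<close>
lift_definition pairing :: "l2 \<Rightarrow> (real \<times> real \<Rightarrow> complex) \<Rightarrow> complex" is
  "\<lambda>f \<psi>. if \<psi> \<in> borel_measurable lborel then integral\<^sup>L lborel (\<lambda>p. f p * \<psi> p) else 0"
proof (rule ext)
  fix f f' \<psi> assume ff: "l2_rel f f'"
  then have "AE p in lborel. f p * \<psi> p = f' p * \<psi> p"
    unfolding l2_rel_def by (auto elim: AE_mp)
  with ff show "(if \<psi> \<in> borel_measurable lborel then integral\<^sup>L lborel (\<lambda>p. f p * \<psi> p) else 0)
       = (if \<psi> \<in> borel_measurable lborel then integral\<^sup>L lborel (\<lambda>p. f' p * \<psi> p) else 0)"
    by (auto intro!: integral_cong_AE simp: l2_rel_def sq_int_def)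
qed

text \<open>The maximal realisation: \<open>f\<close> is in the domain, with image \<open>g\<close>, iff
  \<open>f, g \<in> L\<^sup>2\<close> and the differential operator maps \<open>f\<close> to \<open>g\<close> in the
  sense of distributions.\<close>
definition K_op :: "real \<Rightarrow> l2 rel" where
  "K_op a = {(f, g). \<forall>\<phi>. test_fun \<phi> \<longrightarrow> pairing f (K_transpose a \<phi>) = pairing g \<phi>}"

end

theory Submission
  imports Defs "HOL-Probability.Probability" "HOL-Real_Asymp.Real_Asymp"
begin

text \<open>In the Hermite basis of \<open>L\<^sup>2\<close> with scale \<open>s = \<surd>a\<close> in \<open>x\<close>, the operator is block diagonal: on the span
  of the products of total degree \<open>N\<close> it acts as the \<open>N\<close>-th symmetric power of one \<open>2 \<times> 2\<close> matrix with
  eigenvalues \<open>\<mu>\<^sub>1, \<mu>\<^sub>2\<close>, where \<open>\<mu>\<^sub>1 + \<mu>\<^sub>2 = 1\<close> and \<open>\<mu>\<^sub>1 \<mu>\<^sub>2 = a\<close>; these differ because \<open>a \<noteq> 1/4\<close>. Hence the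
  spectrum is \<open>p \<mu>\<^sub>1 + q \<mu>\<^sub>2\<close>, counted by lattice points in a triangle, and \<open>e\<^sup>-\<^sup>t\<^sup>K\<close> is the second
  quantisation of a \<open>2 \<times> 2\<close> matrix \<open>A(t)\<close> with eigenvalues \<open>e\<^sub>i = exp(-t \<mu>\<^sub>i)\<close>. Its trace is
  \<open>1/((1 - e\<^sub>1)(1 - e\<^sub>2))\<close>. Its singular values are the products of powers of the singular values
  \<open>s\<^sub>1, s\<^sub>2\<close> of \<open>A(t)\<close>, so the trace norm is \<open>1/((1 - s\<^sub>1)(1 - s\<^sub>2))\<close>, which is comparable with
  \<open>1/((1 - s\<^sub>1\<^sup>2)(1 - s\<^sub>2\<^sup>2)) = 1/(1 + |det A|\<^sup>2 - |A|\<^sub>H\<^sub>S\<^sup>2)\<close>; the last denominator is \<open>\<sim> a t\<^sup>4/3\<close>.\<close>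

section \<open>The Hilbert space\<close>

text \<open>The operator is not normal: its eigenvectors are not orthogonal, so a bound on the
  eigenvalues of a function of the operator does not bound its norm. All norm estimates are
  therefore made on one level of total degree at a time, in an orthonormal basis of singular
  vectors, and must be uniform in the level. The resolvent bound comes from the decay of the
  semigroup on high levels instead of from diagonalisation. That the semigroup contracts is read off
  from (1 - s1^2)(1 - s2^2) > 0, which is checked for small times and propagated by the semigroup
  law. The order t^4 of this product reflects hypoellipticity: one factor is of order t, the
  friction in v, the other of order t^3, friction that reaches x only through transport. Adjoint,
  absolute value, trace, semigroup, resolvent and projector are definite descriptions, so each value
  also requires a uniqueness proof; the one for the semigroup is why uniform boundedness
  appears.\<close>

lemma cinner_add_right: "cinner h (f + g) = cinner h f + cinner h g"
  by (metis cinner_add_left cinner_commute complex_cnj_add)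

lemma cinner_cscale_right: "cinner f (cscale c g) = cnj c * cinner f g"
  by (metis cinner_commute cinner_cscale_left complex_cnj_mult)

lemma cinner_zero_left [simp]: "cinner 0 g = 0"
  using cinner_cscale_left[of 0 0 g] by (simp only: l2c.scale_zero_left mult_zero_left)

lemma cinner_zero_right [simp]: "cinner g 0 = 0"
  using cinner_cscale_right[of g 0 0] by (simp only: l2c.scale_zero_left mult_zero_left complex_cnj_zero)

lemma cinner_uminus_left: "cinner (- f) g = - cinner f g"
  unfolding uminus_l2_def cinner_cscale_left by simp

lemma cinner_uminus_right: "cinner g (- f) = - cinner g f"
  unfolding uminus_l2_def cinner_cscale_right by simp

lemma cinner_diff_left: "cinner (f - h) g = cinner f g - cinner h g"
  by (simp only: diff_conv_add_uminus cinner_add_left cinner_uminus_left)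

lemma cinner_diff_right: "cinner g (f - h) = cinner g f - cinner g h"
  by (simp only: diff_conv_add_uminus cinner_add_right cinner_uminus_right)

lemma cinner_scaleR_left: "cinner (r *\<^sub>R f) g = of_real r * cinner f g"
  by (simp add: scaleR_l2_def cinner_cscale_left)

lemma cinner_scaleR_right: "cinner g (r *\<^sub>R f) = of_real r * cinner g f"
  by (simp add: scaleR_l2_def cinner_cscale_right)

lemma cinner_sum_left: "cinner (sum f A) g = (\<Sum>i\<in>A. cinner (f i) g)"
  by (induction A rule: infinite_finite_induct) (simp_all add: cinner_add_left)

lemma cinner_sum_right: "cinner g (sum f A) = (\<Sum>i\<in>A. cinner g (f i))"
  by (induction A rule: infinite_finite_induct) (simp_all add: cinner_add_right)

lemma cinner_self: "cinner f f = of_real ((norm f)\<^sup>2)"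
proof -
  have "Im (cinner f f) = 0"
    using cinner_commute[of f f] by (metis Reals_cnj_iff complex_is_Real_iff)
  moreover have "Re (cinner f f) = (norm f)\<^sup>2"
    using power2_norm_eq_inner[of f] by (simp add: inner_l2_def)
  ultimately show ?thesis by (simp add: complex_eq_iff)
qed

lemma cinner_self_eq_0_iff [simp]: "cinner f f = 0 \<longleftrightarrow> f = 0"
  by (simp add: cinner_self)

text \<open>A unimodular factor \<open>c\<close> rotates the inner product onto the positive real
  axis, where it coincides with the real inner product and the real Cauchy-Schwarz inequality
  applies.\<close>

lemma cmod_cinner_le: "cmod (cinner f g) \<le> norm f * norm g"
proof (cases "cinner f g = 0")
  case False
  define c where "c = cnj (sgn (cinner f g))"
  have c: "cmod c = 1" using False by (simp add: c_def norm_sgn)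
  have "cinner (cscale c f) g = of_real (cmod (cinner f g))"
    using False
    by (simp add: c_def cinner_cscale_left sgn_div_norm scaleR_conv_of_real complex_norm_square[symmetric]
        field_simps power2_eq_square)
  then have "cmod (cinner f g) = cscale c f \<bullet> g" by (simp add: inner_l2_def)
  also have "\<dots> \<le> norm (cscale c f) * norm g" by (rule norm_cauchy_schwarz)
  finally show ?thesis by (simp add: norm_cscale c)
qed simp

lemma bounded_linear_cinner_left: "bounded_linear (\<lambda>f. cinner f g)"
  by (rule bounded_linear_intro[where K = "norm g"])
     (simp_all add: cinner_add_left cinner_scaleR_left cmod_cinner_le scaleR_conv_of_real)

lemma bounded_linear_cinner_right: "bounded_linear (\<lambda>f. cinner g f)"
  by (rule bounded_linear_intro[where K = "norm g"])
     (simp_all add: cinner_add_right cinner_scaleR_right scaleR_conv_of_real cmod_cinner_le mult.commute[of "norm _" "norm g"])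

lemma bounded_linear_cscale: "bounded_linear (cscale c)"
  using blinfun.bounded_linear_right[of "cmult_op c"] by (simp add: cmult_op.rep_eq)

lemmas tendsto_cinner_left = bounded_linear.tendsto[OF bounded_linear_cinner_left]
lemmas tendsto_cscale_right = bounded_linear.tendsto[OF bounded_linear_cscale]

lemma bounded_linear_cscale_left: "bounded_linear (\<lambda>c. cscale c f)"
proof (rule bounded_linear_intro)
  fix c d :: complex and r :: real
  show "cscale (c + d) f = cscale c f + cscale d f" by (rule l2c.scale_left_distrib)
  show "cscale (r *\<^sub>R c) f = r *\<^sub>R cscale c f" by (simp add: scaleR_l2_def scaleR_conv_of_real)
  show "norm (cscale c f) \<le> norm c * norm f" by (simp add: norm_cscale)
qed

section \<open>Representatives, norms as integrals, and completeness\<close>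

lemma l2_rel_refl [simp]: "l2_rel f f \<longleftrightarrow> sq_int f"
  by (auto simp: l2_rel_def)

lemma sq_int_rep [simp]: "sq_int (rep_l2 f)"
  using Quotient_rep_reflp[OF Quotient_l2, of f] by simp

lemma abs_rep_l2 [simp]: "abs_l2 (rep_l2 f) = f"
  by (rule Quotient_abs_rep[OF Quotient_l2])

lemma abs_l2_eq_iff: "sq_int f \<Longrightarrow> sq_int g \<Longrightarrow> abs_l2 f = abs_l2 g \<longleftrightarrow> (AE p in lborel. f p = g p)"
  using Quotient_rel[OF Quotient_l2, of f g] by (auto simp: l2_rel_def)

lemma abs_l2_add: "sq_int f \<Longrightarrow> sq_int g \<Longrightarrow> abs_l2 f + abs_l2 g = abs_l2 (\<lambda>p. f p + g p)"
  by (simp add: plus_l2.abs_eq)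

lemma abs_l2_cscale: "sq_int f \<Longrightarrow> cscale c (abs_l2 f) = abs_l2 (\<lambda>p. c * f p)"
  by (simp add: cscale.abs_eq)

lemma sq_int_diff: "sq_int f \<Longrightarrow> sq_int g \<Longrightarrow> sq_int (\<lambda>p. f p - g p)"
  using sq_int_add[of f "\<lambda>p. (-1) * g p"] sq_int_scale[of g "-1"] by simp

lemma abs_l2_diff: "sq_int f \<Longrightarrow> sq_int g \<Longrightarrow> abs_l2 f - abs_l2 g = abs_l2 (\<lambda>p. f p - g p)"
  unfolding minus_l2_def uminus_l2_def
  by (subst abs_l2_cscale) (simp_all add: abs_l2_add sq_int_scale[of g "-1", simplified])

lemma cinner_abs_l2: "sq_int f \<Longrightarrow> sq_int g \<Longrightarrow>
    cinner (abs_l2 f) (abs_l2 g) = (\<integral>p. f p * cnj (g p) \<partial>lborel)"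
  by (simp add: cinner.abs_eq)

lemma norm_abs_l2: "sq_int f \<Longrightarrow> (norm (abs_l2 f))\<^sup>2 = (\<integral>p. (cmod (f p))\<^sup>2 \<partial>lborel)"
proof -
  assume f: "sq_int f"
  have "complex_of_real ((norm (abs_l2 f))\<^sup>2) = of_real (\<integral>p. (cmod (f p))\<^sup>2 \<partial>lborel)"
    using cinner_self[of "abs_l2 f"] cinner_abs_l2[OF f f]
    by (simp only: complex_norm_square[symmetric] integral_complex_of_real)
  then show ?thesis using of_real_eq_iff by blast
qed

lemma nn_integral_l2: "sq_int f \<Longrightarrow> (\<integral>\<^sup>+p. ennreal ((cmod (f p))\<^sup>2) \<partial>lborel) = ennreal ((norm (abs_l2 f))\<^sup>2)"
  by (subst norm_abs_l2) (auto simp: sq_int_def intro!: nn_integral_eq_integral)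

lemma sq_intI_nn: "f \<in> borel_measurable lborel \<Longrightarrow>
    (\<integral>\<^sup>+p. ennreal ((cmod (f p))\<^sup>2) \<partial>lborel) < \<infinity> \<Longrightarrow> sq_int f"
  unfolding sq_int_def by (auto intro!: integrableI_nonneg)

text \<open>Riesz-Fischer. A rapidly converging subsequence converges almost everywhere, its limit
  is identified in norm by Fatou's lemma, and a Cauchy sequence with a convergent subsequence
  converges.\<close>

instance l2 :: banach
proof
  fix X :: "nat \<Rightarrow> l2" assume C: "Cauchy X"
  have "\<forall>n. \<exists>M. \<forall>m\<ge>M. \<forall>k\<ge>M. norm (X m - X k) < (1/4)^n"
    using C by (auto simp: Cauchy_iff)
  then obtain M where M: "\<And>n m k. m \<ge> M n \<Longrightarrow> k \<ge> M n \<Longrightarrow> norm (X m - X k) < (1/4)^n" by metis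
  \<comment> \<open>Adding \<open>n\<close> makes the choice strictly increasing, and summing all
    earlier thresholds makes \<open>r m\<close> reach \<open>M n\<close> for every m \<ge>
    n.\<close>
  define r where "r n = n + (\<Sum>i\<le>n. M i)" for n
  have r: "strict_mono r" by (auto simp: r_def strict_mono_Suc_iff)
  have rM: "r m \<ge> M n" if "m \<ge> n" for m n
  proof -
    have "M n \<le> (\<Sum>i\<le>m. M i)" using that by (intro member_le_sum) auto
    then show ?thesis by (simp add: r_def)
  qed
  define F where "F n = rep_l2 (X (r n))" for n
  have sF: "sq_int (F n)" and XF: "abs_l2 (F n) = X (r n)" for n by (simp_all add: F_def)
  have mF [measurable]: "F n \<in> borel_measurable lborel" for n using sF by (auto simp: sq_int_def)
  have nD: "(\<integral>\<^sup>+p. ennreal ((cmod (F m p - F k p))\<^sup>2) \<partial>lborel) = ennreal ((norm (X (r m) - X (r k)))\<^sup>2)" for m k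
    using nn_integral_l2[OF sq_int_diff[OF sF[of m] sF[of k]]] abs_l2_diff[OF sF[of m] sF[of k]] by (simp add: XF)
  \<comment> \<open>The weight 2^n is affordable because the squared gaps are at most 16^-n;
    finiteness of the weighted sum then yields geometric decay of the increments at almost every
    point.\<close>
  define D where "D n p = 2^n * (cmod (F (Suc n) p - F n p))\<^sup>2" for n p
  have mD [measurable]: "D n \<in> borel_measurable lborel" for n unfolding D_def by measurable
  have D0: "D n p \<ge> 0" for n p by (simp add: D_def)
  have iD: "(\<integral>\<^sup>+p. ennreal (D n p) \<partial>lborel) \<le> ennreal ((1/2)^n)" for n
  proof -
    have "(\<integral>\<^sup>+p. ennreal (D n p) \<partial>lborel) = ennreal (2^n) * ennreal ((norm (X (r (Suc n)) - X (r n)))\<^sup>2)"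
      unfolding D_def by (subst nD[symmetric], subst nn_integral_cmult[symmetric]) (auto simp: ennreal_mult')
    also have "\<dots> = ennreal (2^n * (norm (X (r (Suc n)) - X (r n)))\<^sup>2)" by (simp add: ennreal_mult')
    also have "\<dots> \<le> ennreal (2^n * ((1/4)^n)\<^sup>2)"
      using M[of n "r (Suc n)" "r n"] rM[of n "Suc n"] rM[of n n]
      by (intro ennreal_leI mult_left_mono power_mono) (auto intro: less_imp_le)
    also have "2^n * ((1/4)^n)\<^sup>2 \<le> ((1/2::real)^n)"
    proof -
      have "2^n * ((1/4::real)^n)\<^sup>2 = (2 * (1/4)\<^sup>2)^n" by (simp add: power_mult_distrib power_mult[symmetric] mult.commute)
      also have "\<dots> \<le> (1/2)^n" by (intro power_mono) (auto simp: power2_eq_square)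
      finally show ?thesis .
    qed
    finally show ?thesis by (simp add: ennreal_leI)
  qed
  have "(\<integral>\<^sup>+p. (\<Sum>n. ennreal (D n p)) \<partial>lborel) = (\<Sum>n. \<integral>\<^sup>+p. ennreal (D n p) \<partial>lborel)"
    by (intro nn_integral_suminf) auto
  also have "\<dots> \<le> (\<Sum>n. ennreal ((1/2)^n))" by (intro suminf_le iD) auto
  also have "\<dots> = ennreal (\<Sum>n. (1/2)^n)" by (intro suminf_ennreal2 summable_geometric) auto
  also have "\<dots> < \<infinity>" by simp
  finally have "AE p in lborel. (\<Sum>n. ennreal (D n p)) \<noteq> \<infinity>"
    by (intro nn_integral_PInf_AE) auto
  then have conv: "AE p in lborel. convergent (\<lambda>n. F n p)"
  proof eventually_elim
    case (elim p)
    define B where "B = enn2real (\<Sum>n. ennreal (D n p))"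
    have DB: "D n p \<le> B" for n
    proof -
      have "ennreal (D n p) \<le> (\<Sum>n. ennreal (D n p))"
        using sum_le_suminf[of "\<lambda>n. ennreal (D n p)" "{n}"] by simp
      also have "\<dots> = ennreal B" using elim by (simp add: B_def less_top)
      finally show ?thesis using D0 order_trans by (fastforce simp: B_def ennreal_le_iff)
    qed
    have B0: "B \<ge> 0" by (simp add: B_def)
    have le: "cmod (F (Suc n) p - F n p) \<le> sqrt B * (1 / sqrt 2)^n" for n
    proof -
      have "(cmod (F (Suc n) p - F n p))\<^sup>2 \<le> B * (1/2)^n"
        using DB[of n] by (simp add: D_def field_simps)
      also have "\<dots> = (sqrt B * (1 / sqrt 2)^n)\<^sup>2"
      proof -
        have "((1 / sqrt 2)^n)\<^sup>2 = ((1 / sqrt 2)\<^sup>2)^n" by (simp only: power_mult[symmetric] mult.commute)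
        also have "\<dots> = (1/2::real)^n" by (simp add: power_divide)
        finally show ?thesis using B0 by (simp add: power_mult_distrib)
      qed
      finally show ?thesis by (rule power2_le_imp_le) (use B0 in simp)
    qed
    have "summable (\<lambda>n. F (Suc n) p - F n p)"
      by (rule summable_comparison_test[of _ "\<lambda>n. sqrt B * (1 / sqrt 2)^n"])
         (auto intro!: le summable_mult summable_geometric)
    then have "(\<lambda>m. \<Sum>n<m. F (Suc n) p - F n p) \<longlonglongrightarrow> (\<Sum>n. F (Suc n) p - F n p)"
      by (rule summable_LIMSEQ)
    then have "(\<lambda>m. (F m p - F 0 p) + F 0 p) \<longlonglongrightarrow> (\<Sum>n. F (Suc n) p - F n p) + F 0 p"
      by (intro tendsto_add tendsto_const) (simp add: sum_lessThan_telescope[of "\<lambda>n. F n p"])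
    then show ?case by (auto simp: convergent_def)
  qed
  define G where "G p = lim (\<lambda>n. F n p)" for p
  have mG [measurable]: "G \<in> borel_measurable lborel" unfolding G_def by measurable
  have GL: "AE p in lborel. (\<lambda>n. F n p) \<longlonglongrightarrow> G p"
    using conv by eventually_elim (simp add: G_def convergent_LIMSEQ_iff)
  \<comment> \<open>The difference to the limit is the pointwise limit of the differences to
    \<open>F k\<close>, so Fatou's lemma transfers their bound.\<close>
  have fat: "(\<integral>\<^sup>+p. ennreal ((cmod (F m p - G p))\<^sup>2) \<partial>lborel) \<le> ennreal (((1/4)^n)\<^sup>2)" if mn: "m \<ge> n" for m n
  proof -
    have "(\<integral>\<^sup>+p. ennreal ((cmod (F m p - G p))\<^sup>2) \<partial>lborel)
        = (\<integral>\<^sup>+p. liminf (\<lambda>k. ennreal ((cmod (F m p - F k p))\<^sup>2)) \<partial>lborel)"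
    proof (rule nn_integral_cong_AE)
      show "AE p in lborel. ennreal ((cmod (F m p - G p))\<^sup>2) = liminf (\<lambda>k. ennreal ((cmod (F m p - F k p))\<^sup>2))"
        using GL
      proof eventually_elim
        case (elim p)
        have "(\<lambda>k. ennreal ((cmod (F m p - F k p))\<^sup>2)) \<longlonglongrightarrow> ennreal ((cmod (F m p - G p))\<^sup>2)"
          by (intro tendsto_ennrealI tendsto_intros elim)
        from lim_imp_Liminf[OF trivial_limit_sequentially this] show ?case by (rule sym)
      qed
    qed
    also have "\<dots> \<le> liminf (\<lambda>k. \<integral>\<^sup>+p. ennreal ((cmod (F m p - F k p))\<^sup>2) \<partial>lborel)"
      by (intro nn_integral_liminf) auto
    also have "\<dots> \<le> liminf (\<lambda>k. ennreal (((1/4)^n)\<^sup>2))"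
    proof (rule Liminf_mono, rule eventually_sequentiallyI)
      fix k assume "k \<ge> n"
      then show "(\<integral>\<^sup>+p. ennreal ((cmod (F m p - F k p))\<^sup>2) \<partial>lborel) \<le> ennreal (((1/4)^n)\<^sup>2)"
        unfolding nD using M[of n "r m" "r k"] rM[of n m] rM[of n k] mn
        by (intro ennreal_leI power_mono) (auto intro: less_imp_le)
    qed
    also have "\<dots> = ennreal (((1/4)^n)\<^sup>2)" by (simp add: Liminf_const)
    finally show ?thesis .
  qed
  have sFG: "sq_int (\<lambda>p. F m p - G p)" for m
    by (rule sq_intI_nn) (use fat[of 0 m] in \<open>auto simp: order_le_less_trans\<close>)
  have sG: "sq_int G" using sq_int_diff[OF sF[of 0] sFG[of 0]] by simp
  have le: "norm (X (r n) - abs_l2 G) \<le> (1/4)^n" for n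
  proof -
    have "ennreal ((norm (X (r n) - abs_l2 G))\<^sup>2) \<le> ennreal (((1/4)^n)\<^sup>2)"
      using fat[of n n] nn_integral_l2[OF sFG[of n]] abs_l2_diff[OF sF sG, of n] by (simp add: XF)
    then have "(norm (X (r n) - abs_l2 G))\<^sup>2 \<le> ((1/4)^n)\<^sup>2" by simp
    then show ?thesis by (rule power2_le_imp_le) simp
  qed
  have "(\<lambda>n. X (r n) - abs_l2 G) \<longlonglongrightarrow> 0"
    by (rule Lim_null_comparison[of _ "\<lambda>n. (1/4)^n"]) (auto intro!: le LIMSEQ_realpow_zero always_eventually)
  then have "(X \<circ> r) \<longlonglongrightarrow> abs_l2 G" by (simp add: LIM_zero_iff o_def)
  then show "convergent X" using Cauchy_converges_subseq[OF C r] by (auto simp: convergent_def)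
qed

text \<open>Sokal's proof of the uniform boundedness principle.\<close>

lemma uniform_boundedness:
  fixes T :: "nat \<Rightarrow> 'a::banach \<Rightarrow>\<^sub>L 'b::real_normed_vector"
  assumes pb: "\<And>x. \<exists>B. \<forall>n. norm (T n x) \<le> B"
  shows "\<exists>C. \<forall>n. norm (T n) \<le> C"
proof (rule ccontr)
  assume "\<not> ?thesis"
  then have "\<forall>n. \<exists>k. norm (T k) > 4^n" by (meson not_less)
  then obtain k where k: "\<And>n. norm (T (k n)) > 4^n" by metis
  \<comment> \<open>Since 2 U v = U (x + v) - U (x - v), one of the points x + v and x - v does at
    least as well as v; the fraction 2/3 of the operator norm is attained by some v of norm
    r.\<close>
  have step: "\<exists>y. norm (y - x) \<le> r \<and> norm (U y) \<ge> 2/3 * r * norm U" if r: "r > 0"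
    for x :: 'a and r and U :: "'a \<Rightarrow>\<^sub>L 'b"
  proof (cases "norm U = 0")
    case True then show ?thesis using r by (intro exI[of _ x]) auto
  next
    case False
    have "\<exists>u. norm (U u) > 2/3 * norm U * norm u"
    proof (rule ccontr)
      assume "\<not> ?thesis"
      then have "norm U \<le> 2/3 * norm U" by (intro norm_blinfun_bound) (auto simp: not_less)
      then show False using False norm_ge_zero[of U] by linarith
    qed
    then obtain u where u: "norm (U u) > 2/3 * norm U * norm u" by blast
    then have u0: "u \<noteq> 0" by auto
    define v where "v = (r / norm u) *\<^sub>R u"
    have nv: "norm v = r" using u0 r by (simp add: v_def)
    have Uv: "norm (U v) \<ge> 2/3 * r * norm U"
      using u u0 r by (simp add: v_def blinfun.scaleR_right field_simps)
    have "2 * norm (U v) = norm (U (x + v) - U (x - v))"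
      by (simp add: blinfun.diff_right[symmetric] blinfun.add_right[symmetric])
         (metis blinfun.scaleR_right norm_scaleR abs_numeral scaleR_2)
    also have "\<dots> \<le> norm (U (x + v)) + norm (U (x - v))" by (rule norm_triangle_ineq4)
    finally have "norm (U v) \<le> norm (U (x + v)) \<or> norm (U v) \<le> norm (U (x - v))" by linarith
    then show ?thesis
    proof
      assume "norm (U v) \<le> norm (U (x + v))"
      then show ?thesis using Uv nv by (intro exI[of _ "x + v"]) auto
    next
      assume "norm (U v) \<le> norm (U (x - v))"
      then show ?thesis using Uv nv by (intro exI[of _ "x - v"]) auto
    qed
  qed
  have "\<forall>x n. \<exists>y. norm (y - x) \<le> (1/3)^n \<and> norm (T (k n) y) \<ge> 2/3 * (1/3)^n * norm (T (k n))"
    using step by simp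
  then obtain h where h: "\<And>x n. norm (h x n - x) \<le> (1/3)^n"
      "\<And>x n. norm (T (k n) (h x n)) \<ge> 2/3 * (1/3)^n * norm (T (k n))" by metis
  define x where "x = rec_nat 0 (\<lambda>n y. h y n)"
  have xS: "x (Suc n) = h (x n) n" for n by (simp add: x_def)
  have gap: "norm (x (n + m) - x n) \<le> 3/2 * ((1/3)^n - (1/3)^(n+m))" for n m
  proof (induction m)
    case (Suc m)
    have "norm (x (n + Suc m) - x n) \<le> norm (x (Suc (n + m)) - x (n + m)) + norm (x (n + m) - x n)"
      using norm_triangle_ineq[of "x (Suc (n + m)) - x (n + m)" "x (n + m) - x n"] by simp
    also have "\<dots> \<le> (1/3)^(n+m) + 3/2 * ((1/3)^n - (1/3)^(n+m))"
      unfolding xS using h(1)[of "x (n+m)" "n+m"] Suc by linarith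
    finally show ?case by (simp add: field_simps)
  qed simp
  have gap': "norm (x m - x n) \<le> 3/2 * (1/3)^n" if "m \<ge> n" for m n
  proof -
    have "norm (x m - x n) \<le> 3/2 * ((1/3)^n - (1/3)^m)" using gap[of n "m - n"] that by simp
    also have "\<dots> \<le> 3/2 * (1/3)^n" by simp
    finally show ?thesis .
  qed
  have "Cauchy x"
  proof (rule CauchyI')
    fix e :: real assume e: "e > 0"
    have "(\<lambda>n. 3/2 * (1/3::real)^n) \<longlonglongrightarrow> 3/2 * 0" by (intro tendsto_intros LIMSEQ_realpow_zero) auto
    then have "eventually (\<lambda>n. 3/2 * (1/3::real)^n < e) sequentially"
      by (rule order_tendstoD(2)) (use e in simp)
    then obtain N where N: "\<And>n. n \<ge> N \<Longrightarrow> 3/2 * (1/3::real)^n < e" by (auto simp: eventually_sequentially)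
    have "norm (x m - x n) < e" if "m \<ge> N" "n > m" for m n
      using gap'[of m n] N[OF that(1)] that by (simp add: norm_minus_commute)
    then show "\<exists>M. \<forall>m\<ge>M. \<forall>n>m. dist (x m) (x n) < e" by (auto simp: dist_norm)
  qed
  then obtain l where l: "x \<longlonglongrightarrow> l" by (auto simp: Cauchy_convergent_iff convergent_def)
  have lx: "norm (l - x n) \<le> 3/2 * (1/3)^n" for n
  proof (rule LIMSEQ_le_const2)
    show "(\<lambda>m. norm (x m - x n)) \<longlonglongrightarrow> norm (l - x n)" by (intro tendsto_intros l)
    show "\<exists>N. \<forall>m\<ge>N. norm (x m - x n) \<le> 3/2 * (1/3)^n" using gap' by blast
  qed
  \<comment> \<open>The point \<open>x (Suc n)\<close> gains 2/3 of (1/3)^n times the operator norm.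
    Its distance to the limit is at most 3/2 (1/3)^(n+1) = 1/2 (1/3)^n and costs 1/2, so 1/6 is
    left.\<close>
  have big: "norm (T (k n) l) \<ge> 1/6 * (4/3)^n" for n
  proof -
    have "2/3 * (1/3)^n * norm (T (k n)) \<le> norm (T (k n) (x (Suc n)))" using h(2) by (simp add: xS)
    also have "\<dots> \<le> norm (T (k n) l) + norm (T (k n) (l - x (Suc n)))"
      using norm_triangle_ineq4[of "T (k n) l" "T (k n) (l - x (Suc n))"] by (simp add: blinfun.diff_right)
    also have "norm (T (k n) (l - x (Suc n))) \<le> norm (T (k n)) * (1/2 * (1/3)^n)"
      by (rule order_trans[OF norm_blinfun mult_left_mono]) (use lx[of "Suc n"] in auto)
    finally have "1/6 * (1/3)^n * norm (T (k n)) \<le> norm (T (k n) l)" by (simp add: field_simps)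
    moreover have "1/6 * (1/3)^n * 4^n \<le> 1/6 * (1/3)^n * norm (T (k n))"
      using k[of n] by (intro mult_left_mono) auto
    moreover have "1/6 * (1/3)^n * 4^n = 1/6 * (4/3::real)^n" by (simp add: power_divide)
    ultimately show ?thesis by linarith
  qed
  obtain B where B: "\<And>n. norm (T n l) \<le> B" using pb by blast
  obtain n where "(4/3::real)^n > 6 * B" using real_arch_pow[of "4/3" "6*B"] by auto
  then show False using big[of n] B[of "k n"] by linarith
qed

text \<open>A closed complex subspace containing a total set is the whole space. This is how
  identities between bounded operators pass from basis vectors or eigenvectors to all of
  \<open>l2\<close>.\<close>

lemma dense_span_induct:
  assumes d: "closure (l2c.span B) = UNIV" and c: "closed {f. Q f}" and s: "l2c.subspace {f. Q f}"
    and b: "\<And>b. b \<in> B \<Longrightarrow> Q b"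
  shows "Q f"
proof -
  have "l2c.span B \<subseteq> {f. Q f}" using b s by (intro l2c.span_minimal) auto
  then have "closure (l2c.span B) \<subseteq> {f. Q f}" using c by (rule closure_minimal)
  then show ?thesis using d by auto
qed

lemma cinner_eq_0_dense:
  assumes d: "closure (l2c.span B) = UNIV" and b: "\<And>b. b \<in> B \<Longrightarrow> cinner f b = 0"
  shows "f = 0"
proof -
  have "cinner f g = 0" for g
    by (rule dense_span_induct[OF d])
       (auto intro!: closed_Collect_eq continuous_intros b linear_continuous_on bounded_linear_cinner_right
         simp: l2c.subspace_def cinner_add_right cinner_cscale_right)
  then show ?thesis using cinner_self_eq_0_iff by blast
qed

lemma blinfun_eq_dense:
  assumes d: "closure (l2c.span B) = UNIV" and S: "clinear_op S" and T: "clinear_op T"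
    and b: "\<And>b. b \<in> B \<Longrightarrow> S b = T b"
  shows "S = T"
proof (rule blinfun_eqI)
  fix f show "S f = T f"
    by (rule dense_span_induct[OF d, where Q = "\<lambda>f. S f = T f"])
       (use S T b in \<open>auto intro!: closed_Collect_eq continuous_intros linear_continuous_on blinfun.bounded_linear_right
          simp: l2c.subspace_def clinear_op_def blinfun.add_right\<close>)
qed

lemma norm_sum_orth:
  assumes "finite A" "\<And>i j. i \<in> A \<Longrightarrow> j \<in> A \<Longrightarrow> i \<noteq> j \<Longrightarrow> cinner (y i) (y j) = 0"
  shows "(norm (sum y A))\<^sup>2 = (\<Sum>i\<in>A. (norm (y i))\<^sup>2)"
proof -
  have "cinner (sum y A) (sum y A) = (\<Sum>i\<in>A. \<Sum>j\<in>A. cinner (y i) (y j))"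
    by (simp add: cinner_sum_left cinner_sum_right) (rule sum.swap)
  also have "\<dots> = (\<Sum>i\<in>A. \<Sum>j\<in>A. if i = j then cinner (y i) (y i) else 0)"
    using assms(2) by (intro sum.cong refl) auto
  also have "\<dots> = (\<Sum>i\<in>A. cinner (y i) (y i))" using assms(1) by simp
  finally have "complex_of_real ((norm (sum y A))\<^sup>2) = of_real (\<Sum>i\<in>A. (norm (y i))\<^sup>2)"
    by (simp add: cinner_self)
  then show ?thesis using of_real_eq_iff by blast
qed

text \<open>By Pythagoras the Cauchy criterion for the vectors is the one for their squared norms;
  completeness does the rest.\<close>

lemma orth_summable:
  fixes y :: "nat \<Rightarrow> l2"
  assumes o: "\<And>m n. m \<noteq> n \<Longrightarrow> cinner (y m) (y n) = 0" and s: "summable (\<lambda>n. (norm (y n))\<^sup>2)"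
  shows "summable y"
  unfolding summable_Cauchy
proof (intro allI impI)
  fix e :: real assume e: "e > 0"
  then obtain N where N: "\<And>m n. m \<ge> N \<Longrightarrow> norm (\<Sum>i\<in>{m..<n}. (norm (y i))\<^sup>2) < e\<^sup>2"
    using s[unfolded summable_Cauchy, rule_format, of "e\<^sup>2"] by auto
  show "\<exists>N. \<forall>m\<ge>N. \<forall>n. norm (sum y {m..<n}) < e"
  proof (intro exI[of _ N] allI impI)
    fix m n assume "N \<le> m"
    then have "(norm (sum y {m..<n}))\<^sup>2 < e\<^sup>2"
      using N[of m n] by (subst norm_sum_orth) (auto simp: o)
    then show "norm (sum y {m..<n}) < e" by (rule power2_less_imp_less) (use e in simp)
  qed
qed

text \<open>The index type is left open and exhausted by finite blocks, because two enumerations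
  occur: singletons for a sequence, and levels of total degree for pairs of Hermite indices. Series
  are summed block by block, the order in which level-preserving operators can be
  controlled.\<close>

locale orth_basis =
  fixes e :: "'i \<Rightarrow> l2" and J :: "nat \<Rightarrow> 'i set"
  assumes on: "\<And>i j. cinner (e i) (e j) = (if i = j then 1 else 0)"
    and fin [simp]: "\<And>n. finite (J n)" and disj: "\<And>m n. m \<noteq> n \<Longrightarrow> J m \<inter> J n = {}"
    and cover: "(\<Union>n. J n) = UNIV"
    and total: "\<And>f. (\<And>i. cinner f (e i) = 0) \<Longrightarrow> f = 0"
begin

definition proj :: "nat \<Rightarrow> l2 \<Rightarrow> l2" where "proj n f = (\<Sum>i\<in>J n. cscale (cinner f (e i)) (e i))"

lemma norm_e [simp]: "norm (e i) = 1"
proof -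
  have "complex_of_real ((norm (e i))\<^sup>2) = of_real 1" by (simp only: cinner_self[symmetric] on) simp
  then have "(norm (e i))\<^sup>2 = 1" using of_real_eq_iff by blast
  then show ?thesis by (simp add: norm_l2_def)
qed

lemma norm_comb: "finite A \<Longrightarrow> (norm (\<Sum>i\<in>A. cscale (c i) (e i)))\<^sup>2 = (\<Sum>i\<in>A. (cmod (c i))\<^sup>2)"
  by (subst norm_sum_orth) (auto simp: cinner_cscale_left cinner_cscale_right on norm_cscale)

lemma cinner_comb: "finite A \<Longrightarrow> cinner (\<Sum>i\<in>A. cscale (c i) (e i)) (e j) = (if j \<in> A then c j else 0)"
  by (simp add: cinner_sum_left cinner_cscale_left on if_distrib cong: if_cong)

lemma cinner_proj: "cinner (proj n f) (e j) = (if j \<in> J n then cinner f (e j) else 0)"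
  unfolding proj_def by (rule cinner_comb) simp

lemma proj_orth: "m \<noteq> n \<Longrightarrow> cinner (proj m f) (proj n g) = 0"
  unfolding proj_def[of n] using disj[of m n]
  by (auto simp: cinner_sum_right cinner_cscale_right cinner_proj intro!: sum.neutral)

lemma bessel: "(\<Sum>n<m. (norm (proj n f))\<^sup>2) \<le> (norm f)\<^sup>2"
proof -
  define S where "S = (\<Sum>n<m. proj n f)"
  have "cinner f (proj n f) = cinner (proj n f) (proj n f)" for n
    unfolding proj_def[of n f] cinner_sum_right cinner_sum_left cinner_cscale_right cinner_cscale_left on
    by (simp add: if_distrib cong: if_cong)
  moreover have "cinner S (proj n f) = cinner (proj n f) (proj n f)" if "n < m" for n
  proof -
    have "cinner S (proj n f) = (\<Sum>k<m. if k = n then cinner (proj n f) (proj n f) else 0)"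
      unfolding S_def cinner_sum_left by (intro sum.cong refl) (auto simp: proj_orth)
    then show ?thesis using that by simp
  qed
  ultimately have "cinner (f - S) S = 0"
    by (subst (2) S_def) (simp add: cinner_sum_right cinner_diff_left)
  then have "cinner f f = cinner (f - S) (f - S) + cinner S S"
    by (simp add: cinner_diff_left cinner_diff_right)
       (metis cinner_commute add.commute add_diff_cancel_left' cinner_self complex_cnj_complex_of_real diff_add_cancel eq_iff_diff_eq_0)
  then have "complex_of_real ((norm f)\<^sup>2) = of_real ((norm (f - S))\<^sup>2 + (norm S)\<^sup>2)" by (simp add: cinner_self)
  then have "(norm f)\<^sup>2 = (norm (f - S))\<^sup>2 + (norm S)\<^sup>2" using of_real_eq_iff by blast
  moreover have "(norm S)\<^sup>2 = (\<Sum>n<m. (norm (proj n f))\<^sup>2)"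
    unfolding S_def by (rule norm_sum_orth) (auto simp: proj_orth)
  ultimately show ?thesis by simp
qed

lemma summable_norm_proj: "summable (\<lambda>n. (norm (proj n f))\<^sup>2)"
  by (rule summableI_nonneg_bounded[OF _ bessel]) auto

lemma expansion: "(\<lambda>n. proj n f) sums f"
proof -
  have s: "summable (\<lambda>n. proj n f)"
    by (rule orth_summable) (auto simp: proj_orth summable_norm_proj)
  define g where "g = (\<Sum>n. proj n f)"
  have g: "(\<lambda>n. proj n f) sums g" using s by (simp add: g_def summable_sums)
  have "cinner (f - g) (e i) = 0" for i
  proof -
    obtain k where k: "i \<in> J k" using cover by blast
    have "(\<lambda>n. cinner (proj n f) (e i)) sums cinner g (e i)"
      using bounded_linear.sums[OF bounded_linear_cinner_left g] .
    moreover have "(\<lambda>n. cinner (proj n f) (e i)) = (\<lambda>n. if n = k then cinner f (e i) else 0)"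
      using k disj by (auto simp: cinner_proj fun_eq_iff)
    ultimately have "(\<lambda>n. if n = k then cinner f (e i) else 0) sums cinner g (e i)" by simp
    then have "cinner g (e i) = cinner f (e i)"
      using sums_single[of k "\<lambda>_. cinner f (e i)"] sums_unique2 by blast
    then show ?thesis by (simp add: cinner_diff_left)
  qed
  then have "f = g" using total[of "f - g"] by simp
  with g show ?thesis by simp
qed

lemma dense: "closure (l2c.span (range e)) = UNIV"
proof -
  have "f \<in> closure (l2c.span (range e))" for f
  proof -
    have "(\<Sum>n<m. proj n f) \<in> l2c.span (range e)" for m
      unfolding proj_def by (intro l2c.span_sum l2c.span_scale l2c.span_base) auto
    then show ?thesis unfolding closure_sequential using expansion[of f]
      by (intro exI[of _ "\<lambda>m. \<Sum>n<m. proj n f"]) (auto simp: sums_def)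
  qed
  then show ?thesis by auto
qed

lemma finite_cover: "finite X \<Longrightarrow> \<exists>N. X \<subseteq> (\<Union>m<N. J m)"
proof (induction X rule: finite_induct)
  case (insert x X)
  then obtain N where N: "X \<subseteq> (\<Union>m<N. J m)" by blast
  obtain k where k: "x \<in> J k" using cover by blast
  have "(\<Union>m<N. J m) \<subseteq> (\<Union>m<max N (Suc k). J m)" by (intro UN_mono) auto
  moreover have "x \<in> (\<Union>m<max N (Suc k). J m)" using k by (intro UN_I[of k]) auto
  ultimately have "insert x X \<subseteq> (\<Union>m<max N (Suc k). J m)" using N by (meson insert_subset order_trans)
  then show ?case by (rule exI)
qed simp

lemma has_sum_blocks:
  fixes g :: "'i \<Rightarrow> 'b::{comm_monoid_add,topological_space}"
  assumes "(g has_sum S) UNIV"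
  shows "(\<lambda>n. sum g (J n)) sums S"
proof -
  have "filterlim (\<lambda>n. \<Union>m<n. J m) (finite_subsets_at_top UNIV) sequentially"
    unfolding filterlim_finite_subsets_at_top
  proof (intro allI impI)
    fix X :: "'i set" assume "finite X \<and> X \<subseteq> UNIV"
    then have "\<exists>N. X \<subseteq> (\<Union>m<N. J m)" by (intro finite_cover) simp
    then obtain N where N: "X \<subseteq> (\<Union>m<N. J m)" by blast
    show "\<forall>\<^sub>F n in sequentially. finite (\<Union>m<n. J m) \<and> X \<subseteq> (\<Union>m<n. J m) \<and> (\<Union>m<n. J m) \<subseteq> UNIV"
    proof (rule eventually_sequentiallyI[of N])
      fix n assume "N \<le> n"
      then have "(\<Union>m<N. J m) \<subseteq> (\<Union>m<n. J m)" by (intro UN_mono) auto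
      then show "finite (\<Union>m<n. J m) \<and> X \<subseteq> (\<Union>m<n. J m) \<and> (\<Union>m<n. J m) \<subseteq> UNIV" using N by auto
    qed
  qed
  then have "(\<lambda>n. sum g (\<Union>m<n. J m)) \<longlonglongrightarrow> S"
    using assms unfolding has_sum_def by (rule filterlim_compose[rotated])
  moreover have "sum g (\<Union>m<n. J m) = (\<Sum>m<n. sum g (J m))" for n
    by (rule sum.UNION_disjoint) (use disj in auto)
  ultimately show ?thesis by (simp add: sums_def)
qed

text \<open>Nonnegative terms allow the grouping to be undone: every finite partial sum is dominated
  by finitely many blocks.\<close>

lemma has_sum_nonneg_blocks:
  fixes g :: "'i \<Rightarrow> real"
  assumes g: "\<And>i. 0 \<le> g i" and S: "(\<lambda>n. sum g (J n)) sums S"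
  shows "(g has_sum S) UNIV"
proof -
  have "g summable_on UNIV"
  proof (rule nonneg_bdd_above_summable_on)
    show "bdd_above (sum g ` {F. F \<subseteq> UNIV \<and> finite F})"
    proof (rule bdd_aboveI2)
      fix X assume "X \<in> {F. F \<subseteq> (UNIV :: 'i set) \<and> finite F}"
      then have "\<exists>N. X \<subseteq> (\<Union>m<N. J m)" by (intro finite_cover) simp
      then obtain N where N: "X \<subseteq> (\<Union>m<N. J m)" by blast
      have "sum g X \<le> sum g (\<Union>m<N. J m)" using N g by (intro sum_mono2) auto
      also have "\<dots> = (\<Sum>m<N. sum g (J m))" by (rule sum.UNION_disjoint) (use disj in auto)
      also have "\<dots> \<le> S" using sum_le_suminf[OF sums_summable[OF S], of "{..<N}"] sums_unique[OF S]
        by (simp add: sum_nonneg g)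
      finally show "sum g X \<le> S" .
    qed
  qed (use g in auto)
  then have "(g has_sum infsum g UNIV) UNIV" by simp
  moreover have "infsum g UNIV = S" using has_sum_blocks[OF calculation] S sums_unique2 by blast
  ultimately show ?thesis by simp
qed

lemma parseval_blocks: "(\<lambda>n. \<Sum>i\<in>J n. cinner f (e i) * cnj (cinner g (e i))) sums cinner f g"
proof -
  have "(\<lambda>n. cinner (proj n f) g) sums cinner f g"
    using bounded_linear.sums[OF bounded_linear_cinner_left expansion] .
  moreover have "cinner (proj n f) g = (\<Sum>i\<in>J n. cinner f (e i) * cnj (cinner g (e i)))" for n
    unfolding proj_def cinner_sum_left cinner_cscale_left
    by (intro sum.cong refl) (metis cinner_commute)
  ultimately show ?thesis by simp
qed

lemma parseval_norm: "((\<lambda>i. (cmod (cinner f (e i)))\<^sup>2) has_sum (norm f)\<^sup>2) UNIV"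
proof (rule has_sum_nonneg_blocks)
  have "(\<lambda>n. of_real (\<Sum>i\<in>J n. (cmod (cinner f (e i)))\<^sup>2)) sums complex_of_real ((norm f)\<^sup>2)"
    using parseval_blocks[of f f] by (simp only: of_real_sum complex_norm_square cinner_self)
  then show "(\<lambda>n. \<Sum>i\<in>J n. (cmod (cinner f (e i)))\<^sup>2) sums (norm f)\<^sup>2"
    by (simp only: sums_of_real_iff)
qed simp

lemma parseval_abs: "(\<lambda>i. norm (cinner f (e i) * cnj (cinner g (e i)))) summable_on UNIV"
proof (rule Infinite_Sum.abs_summable_on_comparison_test)
  have "(\<lambda>i. (cmod (cinner f (e i)))\<^sup>2 + (cmod (cinner g (e i)))\<^sup>2) summable_on UNIV"
    using parseval_norm[of f] parseval_norm[of g] by (intro summable_on_add) (auto simp: summable_on_def)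
  then show "(\<lambda>i. norm ((cmod (cinner f (e i)))\<^sup>2 + (cmod (cinner g (e i)))\<^sup>2)) summable_on UNIV" by simp
next
  fix i
  have "2 * (cmod (cinner f (e i)) * cmod (cinner g (e i))) \<le> (cmod (cinner f (e i)))\<^sup>2 + (cmod (cinner g (e i)))\<^sup>2"
    using sum_squares_bound[of "cmod (cinner f (e i))" "cmod (cinner g (e i))"] by simp
  moreover have "0 \<le> cmod (cinner f (e i)) * cmod (cinner g (e i))" by simp
  ultimately show "norm (cinner f (e i) * cnj (cinner g (e i)))
      \<le> norm ((cmod (cinner f (e i)))\<^sup>2 + (cmod (cinner g (e i)))\<^sup>2)"
    unfolding norm_mult complex_mod_cnj real_norm_def by linarith
qed

lemma parseval: "((\<lambda>i. cinner f (e i) * cnj (cinner g (e i))) has_sum cinner f g) UNIV"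
proof -
  have "(\<lambda>i. cinner f (e i) * cnj (cinner g (e i))) summable_on UNIV"
    using parseval_abs by (rule Infinite_Sum.abs_summable_summable)
  then have h: "((\<lambda>i. cinner f (e i) * cnj (cinner g (e i))) has_sum
      infsum (\<lambda>i. cinner f (e i) * cnj (cinner g (e i))) UNIV) UNIV" by simp
  with has_sum_blocks[OF h] parseval_blocks[of f g] show ?thesis using sums_unique2 by metis
qed

text \<open>Images of different blocks are orthogonal, so Pythagoras turns one constant for all
  blocks into a global operator bound. Inside a block the images \<open>u i\<close> may be far from
  orthogonal, which is the situation for the resolvent.\<close>

lemma block_op:
  assumes C: "C \<ge> 0"
    and o: "\<And>i j m n. i \<in> J m \<Longrightarrow> j \<in> J n \<Longrightarrow> m \<noteq> n \<Longrightarrow> cinner (u i) (u j) = 0"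
    and b: "\<And>n c. norm (\<Sum>i\<in>J n. cscale (c i) (u i)) \<le> C * norm (\<Sum>i\<in>J n. cscale (c i) (e i))"
  shows "\<exists>T. clinear_op T \<and> (\<forall>f. norm (T f) \<le> C * norm f) \<and> (\<forall>i. T (e i) = u i)"
proof -
  define Q where "Q n f = (\<Sum>i\<in>J n. cscale (cinner f (e i)) (u i))" for n f
  have Qb: "norm (Q n f) \<le> C * norm (proj n f)" for n f
    unfolding Q_def proj_def by (rule b)
  have Qo: "cinner (Q m f) (Q n f) = 0" if "m \<noteq> n" for m n f
    unfolding Q_def using that
    by (auto simp: cinner_sum_left cinner_sum_right cinner_cscale_left cinner_cscale_right o intro!: sum.neutral)
  have Q2: "(norm (Q n f))\<^sup>2 \<le> C\<^sup>2 * (norm (proj n f))\<^sup>2" for n f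
    using power_mono[OF Qb[of n f], of 2] by (simp add: power_mult_distrib)
  have sQ: "summable (\<lambda>n. Q n f)" for f
  proof (rule orth_summable)
    show "summable (\<lambda>n. (norm (Q n f))\<^sup>2)"
      by (rule summable_comparison_test[of _ "\<lambda>n. C\<^sup>2 * (norm (proj n f))\<^sup>2"])
         (auto intro!: Q2 summable_mult summable_norm_proj)
  qed (rule Qo)
  define T where "T f = (\<Sum>n. Q n f)" for f
  have Ts: "(\<lambda>n. Q n f) sums T f" for f using sQ by (simp add: T_def summable_sums)
  have Tn: "norm (T f) \<le> C * norm f" for f
  proof (rule LIMSEQ_le_const2)
    show "(\<lambda>m. norm (\<Sum>n<m. Q n f)) \<longlonglongrightarrow> norm (T f)" using Ts[of f] by (auto simp: sums_def intro: tendsto_norm)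
    have "norm (\<Sum>n<m. Q n f) \<le> C * norm f" for m
    proof (rule power2_le_imp_le)
      have "(norm (\<Sum>n<m. Q n f))\<^sup>2 = (\<Sum>n<m. (norm (Q n f))\<^sup>2)" by (rule norm_sum_orth) (auto simp: Qo)
      also have "\<dots> \<le> (\<Sum>n<m. C\<^sup>2 * (norm (proj n f))\<^sup>2)" by (intro sum_mono Q2)
      also have "\<dots> \<le> C\<^sup>2 * (norm f)\<^sup>2" unfolding sum_distrib_left[symmetric]
        by (intro mult_left_mono bessel) auto
      finally show "(norm (\<Sum>n<m. Q n f))\<^sup>2 \<le> (C * norm f)\<^sup>2" by (simp add: power_mult_distrib)
    qed (use C in auto)
    then show "\<exists>N. \<forall>m\<ge>N. norm (\<Sum>n<m. Q n f) \<le> C * norm f" by blast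
  qed
  have Tadd: "T (f + g) = T f + T g" for f g
  proof -
    have "(\<lambda>n. Q n f + Q n g) sums (T f + T g)" by (intro sums_add Ts)
    moreover have "(\<lambda>n. Q n f + Q n g) = (\<lambda>n. Q n (f + g))"
      by (auto simp: Q_def fun_eq_iff cinner_add_left l2c.scale_left_distrib sum.distrib)
    ultimately show ?thesis using Ts[of "f + g"] sums_unique2 by metis
  qed
  have Tsc: "T (cscale c f) = cscale c (T f)" for c f
  proof -
    have "(\<lambda>n. cscale c (Q n f)) sums cscale c (T f)" by (intro bounded_linear.sums[OF bounded_linear_cscale] Ts)
    moreover have "(\<lambda>n. cscale c (Q n f)) = (\<lambda>n. Q n (cscale c f))"
      by (auto simp: Q_def fun_eq_iff cinner_cscale_left l2c.scale_sum_right)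
    ultimately show ?thesis using Ts[of "cscale c f"] sums_unique2 by metis
  qed
  have Te: "T (e i) = u i" for i
  proof -
    obtain k where k: "i \<in> J k" using cover by blast
    have Qk: "Q n (e i) = (if n = k then u i else 0)" for n
    proof -
      have "Q n (e i) = (\<Sum>j\<in>J n. if j = i then u i else 0)"
        unfolding Q_def by (intro sum.cong) (auto simp: on)
      then show ?thesis using k disj[of n k] by auto
    qed
    have "(\<lambda>n. if n = k then u i else 0) sums T (e i)" using Ts[of "e i"] unfolding Qk .
    then show ?thesis using sums_single[of k "\<lambda>_. u i"] by (rule sums_unique2)
  qed
  have bl: "bounded_linear T"
    by (rule bounded_linear_intro[where K = C])
       (simp_all add: Tadd Tsc scaleR_l2_def Tn mult.commute[of "norm _" C])
  show ?thesis
    by (rule exI[of _ "Blinfun T"]) (simp add: bounded_linear_Blinfun_apply[OF bl] clinear_op_def Tsc Tn Te)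
qed

end

lemma onb_orth_basis: "onb e \<Longrightarrow> orth_basis e (\<lambda>n. {n})"
proof
  assume o: "onb e"
  fix f assume "\<And>i. cinner f (e i) = 0"
  then show "f = 0" using o by (intro cinner_eq_0_dense[of "range e"]) (auto simp: onb_def)
qed (auto simp: onb_def)

lemma (in orth_basis) onb_reindex: "bij r \<Longrightarrow> onb (\<lambda>n::nat. e (r n))"
  unfolding onb_def using dense
  by (auto simp: on bij_def inj_eq image_image[of e r, symmetric] simp flip: image_image)

section \<open>Trace and trace norm\<close>

lemma clinear_opD: "clinear_op T \<Longrightarrow> T (cscale c f) = cscale c (T f)"
  by (simp add: clinear_op_def)

lemma clinear_op_compose: "clinear_op S \<Longrightarrow> clinear_op T \<Longrightarrow> clinear_op (S o\<^sub>L T)"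
  by (simp add: clinear_op_def)

text \<open>An explicitly given adjoint is the only one: the values of two candidates differ by a
  vector orthogonal to itself.\<close>

lemma adj_op_eq:
  fixes T U :: "l2 \<Rightarrow>\<^sub>L l2"
  assumes "\<And>f g. cinner (T f) g = cinner f (U g)"
  shows "adj_op T = U"
  unfolding adj_op_def
proof (rule the_equality)
  show "\<forall>f g. cinner (T f) g = cinner f (U g)" using assms by blast
  fix V :: "l2 \<Rightarrow>\<^sub>L l2" assume V: "\<forall>f g. cinner (T f) g = cinner f (V g)"
  show "V = U"
  proof (rule blinfun_eqI)
    fix g
    have "cinner (V g - U g) (V g - U g) = 0"
      using V assms by (metis cinner_diff_right right_minus_eq)
    then show "V g = U g" by simp
  qed
qed

text \<open>Uniqueness of the positive square root, tested on an eigenvector b of P with eigenvalue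
  s: for another root Q and u = Q b - s b, the equation Q^2 b = s^2 b gives Q u = - s u, and
  positivity of Q with s > 0 forces u = 0.\<close>

lemma abs_op_eq:
  assumes g: "closure (l2c.span (range g)) = UNIV" and P: "positive_op P" "\<And>i. P (g i) = cscale (of_real (s i)) (g i)"
    and s: "\<And>i. s i > 0" and sq: "P o\<^sub>L P = adj_op T o\<^sub>L T"
  shows "abs_op T = P"
  unfolding abs_op_def
proof (rule the_equality)
  show "positive_op P \<and> P o\<^sub>L P = adj_op T o\<^sub>L T" using P sq by blast
  fix Q assume Q: "positive_op Q \<and> Q o\<^sub>L Q = adj_op T o\<^sub>L T"
  have lQ: "clinear_op Q" and lP: "clinear_op P" using Q P by (auto simp: positive_op_def)
  show "Q = P"
  proof (rule blinfun_eq_dense[OF g lQ lP])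
    fix b assume "b \<in> range g"
    then obtain i where b: "b = g i" by blast
    define u where "u = Q b - cscale (of_real (s i)) b"
    have "(Q o\<^sub>L Q) b = (P o\<^sub>L P) b" using Q sq by simp
    then have "Q (Q b) = cscale (of_real (s i)) (cscale (of_real (s i)) b)"
      using lP by (simp add: b P clinear_opD)
    then have "Q u = - cscale (of_real (s i)) u"
      using lQ by (simp add: u_def blinfun.diff_right clinear_opD l2c.scale_right_diff_distrib)
    then have "cinner (Q u) u = - of_real (s i * (norm u)\<^sup>2)"
      by (simp add: cinner_uminus_left cinner_cscale_left cinner_self)
    moreover have "cinner (Q u) u \<in> \<real>\<^sub>\<ge>\<^sub>0" using Q by (simp add: positive_op_def)
    ultimately have "- (s i * (norm u)\<^sup>2) \<ge> 0" by (metis of_real_minus nonneg_Reals_of_real_iff)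
    then have "(norm u)\<^sup>2 \<le> 0" using s[of i] by (simp add: mult_le_0_iff)
    then have "u = 0" by simp
    then show "Q b = P b" by (simp add: u_def b P)
  qed
qed

context orth_basis
begin

lemma cinner_diag_op:
  assumes "clinear_op P" "\<And>i. P (e i) = cscale (c i) (e i)"
  shows "cinner (P f) (e i) = c i * cinner f (e i)"
  by (rule dense_span_induct[OF dense, where Q = "\<lambda>f. cinner (P f) (e i) = c i * cinner f (e i)"])
     (use assms in \<open>auto intro!: closed_Collect_eq continuous_intros linear_continuous_on
        bounded_linear_cinner_left bounded_linear_const_mult bounded_linear_compose[OF bounded_linear_cinner_left]
        blinfun.bounded_linear_right
      simp: l2c.subspace_def clinear_opD blinfun.add_right cinner_add_left cinner_cscale_left on ring_distribs\<close>)

lemma diag_op_form: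
  assumes "clinear_op P" "\<And>i. P (e i) = cscale (of_real (s i)) (e i)"
  shows "((\<lambda>i. s i * (cmod (cinner f (e i)))\<^sup>2) has_sum Re (cinner (P f) f)) UNIV"
    and "Im (cinner (P f) f) = 0"
proof -
  have "((\<lambda>i. cinner (P f) (e i) * cnj (cinner f (e i))) has_sum cinner (P f) f) UNIV" by (rule parseval)
  moreover have "cinner (P f) (e i) * cnj (cinner f (e i)) = of_real (s i * (cmod (cinner f (e i)))\<^sup>2)" for i
    unfolding cinner_diag_op[OF assms] of_real_mult complex_norm_square by (simp add: mult.assoc)
  ultimately have h: "((\<lambda>i. complex_of_real (s i * (cmod (cinner f (e i)))\<^sup>2)) has_sum cinner (P f) f) UNIV" by simp
  show "((\<lambda>i. s i * (cmod (cinner f (e i)))\<^sup>2) has_sum Re (cinner (P f) f)) UNIV"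
    using has_sum_Re[OF h] by simp
  show "Im (cinner (P f) f) = 0"
    by (rule has_sum_unique[OF has_sum_Im[OF h] has_sum_0]) simp
qed

lemma diag_op_positive:
  assumes "clinear_op P" "\<And>i. P (e i) = cscale (of_real (s i)) (e i)" "\<And>i. s i \<ge> 0"
  shows "positive_op P"
proof -
  have "Re (cinner (P f) f) \<ge> 0" for f
    using diag_op_form(1)[OF assms(1,2)] by (rule has_sum_nonneg) (use assms(3) in auto)
  then show ?thesis
    using diag_op_form(2)[OF assms(1,2)] assms(1) by (auto simp: positive_op_def complex_nonneg_Reals_iff)
qed

text \<open>The double family s_i |<h_n, e_i>|^2 is nonnegative. Summed over n it gives s_i by
  Parseval in \<open>h\<close>; summed over i it gives the diagonal entry of \<open>P\<close> at
  h_n.\<close>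

lemma diag_op_trace:
  assumes P: "clinear_op P" "\<And>i. P (e i) = cscale (of_real (s i)) (e i)" and s: "\<And>i. s i \<ge> 0"
    and S: "(s has_sum S) UNIV" and h: "onb h"
  shows "(\<Sum>n. ennreal (Re (cinner (P (h n)) (h n)))) = ennreal S"
proof -
  interpret h: orth_basis h "\<lambda>n. {n}" by (rule onb_orth_basis[OF h])
  define F where "F = (\<lambda>(i, n). s i * (cmod (cinner (h n) (e i)))\<^sup>2)"
  have F1: "((\<lambda>n. F (i, n)) has_sum s i) UNIV" for i
  proof -
    have "((\<lambda>n. s i * (cmod (cinner (e i) (h n)))\<^sup>2) has_sum s i * (norm (e i))\<^sup>2) UNIV"
      by (intro has_sum_cmult_right h.parseval_norm)
    moreover have "cmod (cinner (e i) (h n)) = cmod (cinner (h n) (e i))" for n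
      by (metis cinner_commute complex_mod_cnj)
    ultimately show ?thesis by (simp add: F_def)
  qed
  have "F summable_on (UNIV \<times> UNIV)"
    using S by (intro summable_on_SigmaI[where g = s] F1) (auto simp: F_def s summable_on_def)
  then have "(F has_sum S) (UNIV \<times> UNIV)" using F1 S by (intro has_sum_SigmaI[where g = s]) auto
  then have "((\<lambda>(n, i). F (i, n)) has_sum S) (UNIV \<times> UNIV)" by (rule has_sum_swap[THEN iffD1])
  then have hs: "((\<lambda>n. Re (cinner (P (h n)) (h n))) has_sum S) UNIV"
    by (rule has_sum_SigmaD) (use diag_op_form(1)[OF P] in \<open>auto simp: F_def\<close>)
  have nn: "Re (cinner (P (h n)) (h n)) \<ge> 0" for n
    using diag_op_positive[OF P s] by (auto simp: positive_op_def complex_nonneg_Reals_iff)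
  show ?thesis
    using has_sum_imp_sums[OF hs] nn by (simp add: suminf_ennreal2 sums_iff)
qed

lemma trace_norm_eq:
  assumes P: "clinear_op P" "\<And>i. P (e i) = cscale (of_real (s i)) (e i)" and s: "\<And>i. s i > 0"
    and S: "(s has_sum S) UNIV" and r: "bij (r :: nat \<Rightarrow> 'i)" and sq: "P o\<^sub>L P = adj_op T o\<^sub>L T"
  shows "trace_norm T = ennreal S"
proof -
  have s0: "s i \<ge> 0" for i using s[of i] by simp
  have abs: "abs_op T = P"
    using abs_op_eq[OF dense diag_op_positive[OF P s0] P(2) s sq] .
  show ?thesis
    unfolding trace_norm_def abs
  proof (rule the_equality)
    show "\<forall>h. onb h \<longrightarrow> (\<Sum>n. ennreal (Re (cinner (P (h n)) (h n)))) = ennreal S"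
      using diag_op_trace[OF P s0 S] by blast
    \<comment> \<open>A candidate \<open>c\<close> is constrained only by orthonormal sequences that
      exist; \<open>r\<close> supplies one by enumerating \<open>e\<close>.\<close>
    then show "c = ennreal S" if "\<forall>h. onb h \<longrightarrow> (\<Sum>n. ennreal (Re (cinner (P (h n)) (h n)))) = c" for c
      using onb_reindex[OF r] that by metis
  qed
qed

text \<open>Both diagonal sums are iterated sums of one double family <T e_i, h_n> <h_n, e_i>, so
  they agree once the family converges absolutely. The explicit adjoint \<open>U\<close> identifies
  the sum over i.\<close>

lemma trace_class_swap:
  fixes T U :: "l2 \<Rightarrow>\<^sub>L l2"
  assumes T: "\<And>f g. cinner (T f) g = cinner f (U g)" and s: "(\<lambda>i. norm (T (e i))) summable_on UNIV"
  shows "\<exists>c. ((\<lambda>i. cinner (T (e i)) (e i)) has_sum c) UNIV \<and>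
    (\<forall>h. onb h \<longrightarrow> ((\<lambda>n. cinner (T (h n)) (h n)) has_sum c) UNIV)"
proof -
  have main: "\<exists>c. ((\<lambda>i. cinner (T (e i)) (e i)) has_sum c) UNIV \<and>
      ((\<lambda>n. cinner (T (h n)) (h n)) has_sum c) UNIV" if h: "onb h" for h
  proof -
    interpret h: orth_basis h "\<lambda>n. {n}" by (rule onb_orth_basis[OF h])
    define s where "s i = norm (T (e i))" for i
    have s0: "s i \<ge> 0" for i by (simp add: s_def)
    define F where "F = (\<lambda>(i, n). cinner (T (e i)) (h n) * cnj (cinner (e i) (h n)))"
    \<comment> \<open>The arithmetic-geometric mean is weighted by \<open>s i\<close> so that each
      of its two halves sums over n to half of \<open>s i\<close>. If \<open>s i\<close> = 0,
      division by zero yields 0, which is right because then \<open>T (e i)\<close> = 0.\<close>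
    define G where "G = (\<lambda>(i, n). (s i * (cmod (cinner (e i) (h n)))\<^sup>2 + (cmod (cinner (T (e i)) (h n)))\<^sup>2 / s i) / 2)"
    have G1: "((\<lambda>n. G (i, n)) has_sum s i) UNIV" for i
    proof -
      have "((\<lambda>n. G (i, n)) has_sum (s i * (norm (e i))\<^sup>2 + (norm (T (e i)))\<^sup>2 / s i) / 2) UNIV"
        unfolding G_def prod.case
        by (intro has_sum_divide_const has_sum_add has_sum_cmult_right h.parseval_norm)
      moreover have "(s i * (norm (e i))\<^sup>2 + (norm (T (e i)))\<^sup>2 / s i) / 2 = s i"
        by (simp add: s_def power2_eq_square)
      ultimately show ?thesis by simp
    qed
    have "G summable_on (UNIV \<times> UNIV)"
      using s by (intro summable_on_SigmaI[where g = s] G1) (auto simp: G_def s0 s_def[symmetric])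
    moreover have "norm (F x) \<le> G x" for x
    proof (cases x)
      case (Pair i n)
      show ?thesis
      proof (cases "s i = 0")
        case True
        then have "T (e i) = 0" by (simp add: s_def)
        then show ?thesis by (simp add: Pair F_def G_def True)
      next
        case False
        then have sp: "s i > 0" using s0[of i] by simp
        define x y where "x = cmod (cinner (e i) (h n))" and "y = cmod (cinner (T (e i)) (h n))"
        have "0 \<le> (s i * x - y)\<^sup>2" by simp
        then have "2 * (s i * (y * x)) \<le> s i * (s i * x\<^sup>2) + y\<^sup>2"
          by (simp add: power2_eq_square algebra_simps)
        then have "y * x \<le> (s i * x\<^sup>2 + y\<^sup>2 / s i) / 2" using sp by (simp add: field_simps)
        then show ?thesis by (simp add: Pair F_def G_def x_def y_def norm_mult)
      qed
    qed
    ultimately have "F summable_on (UNIV \<times> UNIV)"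
      by (intro Infinite_Sum.abs_summable_summable[of F] summable_on_comparison_test[of G _ "\<lambda>x. norm (F x)"]) auto
    then obtain c where c: "(F has_sum c) (UNIV \<times> UNIV)" by (auto simp: summable_on_def)
    have 1: "((\<lambda>i. cinner (T (e i)) (e i)) has_sum c) UNIV"
      by (rule has_sum_SigmaD[OF c]) (simp add: F_def h.parseval)
    have "((\<lambda>(n, i). F (i, n)) has_sum c) (UNIV \<times> UNIV)" using c by (rule has_sum_swap[THEN iffD1])
    then have 2: "((\<lambda>n. cinner (T (h n)) (h n)) has_sum c) UNIV"
    proof (rule has_sum_SigmaD)
      fix n
      have "((\<lambda>i. cinner (h n) (e i) * cnj (cinner (U (h n)) (e i))) has_sum cinner (h n) (U (h n))) UNIV"
        by (rule parseval)
      moreover have "cinner (h n) (e i) * cnj (cinner (U (h n)) (e i)) = F (i, n)" for i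
        unfolding F_def prod.case T cinner_commute[of "h n" "e i"] cinner_commute[of "U (h n)" "e i"] by simp
      ultimately show "((\<lambda>i. case (n, i) of (n, i) \<Rightarrow> F (i, n)) has_sum cinner (T (h n)) (h n)) UNIV"
        by (simp add: T)
    qed
    from 1 2 show ?thesis by blast
  qed
  have "(\<lambda>i. cinner (T (e i)) (e i)) summable_on UNIV"
  proof (rule Infinite_Sum.abs_summable_summable, rule summable_on_comparison_test[OF s])
    fix i show "norm (cinner (T (e i)) (e i)) \<le> norm (T (e i))"
      using cmod_cinner_le[of "T (e i)" "e i"] by simp
  qed auto
  then obtain c where c: "((\<lambda>i. cinner (T (e i)) (e i)) has_sum c) UNIV" by (auto simp: summable_on_def)
  with main show ?thesis using has_sum_unique by blast
qed

text \<open>Two bases play different roles: \<open>e\<close> is the one in which the norms of the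
  images are summable, \<open>h\<close> the one in which the trace is computed. Later these are the
  singular vectors and the Hermite functions.\<close>

lemma op_trace_eq:
  fixes T U :: "l2 \<Rightarrow>\<^sub>L l2"
  assumes T: "\<And>f g. cinner (T f) g = cinner f (U g)" and s: "(\<lambda>i. norm (T (e i))) summable_on UNIV"
    and r: "bij (r :: nat \<Rightarrow> 'i)"
    and h: "orth_basis h (J' :: nat \<Rightarrow> 'i set)"
  shows "((\<lambda>i. cinner (T (h i)) (h i)) has_sum op_trace T) UNIV"
proof -
  interpret h: orth_basis h J' by (rule h)
  obtain c where c: "\<And>h. onb h \<Longrightarrow> ((\<lambda>n. cinner (T (h n)) (h n)) has_sum c) UNIV"
    using trace_class_swap[OF T s] by blast
  have "op_trace T = c"
    unfolding op_trace_def
  proof (rule the_equality)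
    show "\<forall>e. onb e \<longrightarrow> (\<lambda>n. cinner (T (e n)) (e n)) sums c" using c has_sum_imp_sums by blast
    then show "d = c" if "\<forall>e. onb e \<longrightarrow> (\<lambda>n. cinner (T (e n)) (e n)) sums d" for d
      using onb_reindex[OF r] that sums_unique2 by blast
  qed
  moreover have "((\<lambda>n. cinner (T (h (r n))) (h (r n))) has_sum c) UNIV"
    by (rule c[OF h.onb_reindex[OF r]])
  ultimately show ?thesis
    using has_sum_reindex_bij_betw[of r UNIV UNIV "\<lambda>i. cinner (T (h i)) (h i)"] r by simp
qed

end

section \<open>Semigroups and spectra of operators with a complete system of eigenvectors\<close>

lemma C0_semigroupD:
  assumes "C0_semigroup S"
  shows "t \<ge> 0 \<Longrightarrow> clinear_op (S t)" "S 0 = id_blinfun"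
    "s \<ge> 0 \<Longrightarrow> t \<ge> 0 \<Longrightarrow> S (s + t) = S s o\<^sub>L S t" "((\<lambda>t. S t f) \<longlongrightarrow> f) (at_right 0)"
  using assms by (auto simp: C0_semigroup_def)

text \<open>Otherwise there are times t_n tending to 0 whose norms tend to infinity, while S(t_n) f
  converges for every f; this contradicts uniform boundedness.\<close>

lemma C0_semigroup_bounded_near_0:
  assumes S: "C0_semigroup S"
  shows "\<exists>d>0. \<exists>M. \<forall>t\<in>{0..d}. norm (S t) \<le> M"
proof (rule ccontr)
  assume "\<not> ?thesis"
  then have "\<forall>n. \<exists>t. t \<in> {0..1 / real (Suc n)} \<and> norm (S t) > real (Suc n)"
    by (metis not_less zero_less_divide_1_iff of_nat_0_less_iff zero_less_Suc)
  then obtain t where t: "\<And>n. t n \<in> {0..1 / real (Suc n)}" "\<And>n. norm (S (t n)) > real (Suc n)" by metis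
  have t0: "t n > 0" for n
  proof (rule ccontr)
    assume "\<not> t n > 0"
    then have "t n = 0" using t(1)[of n] by simp
    then have "norm (S (t n)) \<le> 1" using C0_semigroupD(2)[OF S] norm_blinfun_id_le by metis
    then show False using t(2)[of n] by simp
  qed
  have "t \<longlonglongrightarrow> 0"
  proof (rule Lim_null_comparison[OF _ LIMSEQ_Suc[OF lim_1_over_n]])
    show "\<forall>\<^sub>F n in sequentially. norm (t n) \<le> 1 / real (Suc n)"
      using t(1) by (intro always_eventually) auto
  qed
  then have lim: "filterlim t (at_right 0) sequentially"
    using t0 t0[THEN less_imp_neq, THEN not_sym] by (simp add: filterlim_at always_eventually)
  have "\<exists>B. \<forall>n. norm (S (t n) f) \<le> B" for f
  proof -
    have "(\<lambda>n. S (t n) f) \<longlonglongrightarrow> f" using filterlim_compose[OF C0_semigroupD(4)[OF S] lim] .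
    then have "Bseq (\<lambda>n. S (t n) f)" by (rule convergent_imp_Bseq[OF convergentI])
    then show ?thesis by (auto simp: Bseq_def)
  qed
  then obtain C where C: "\<And>n. norm (S (t n)) \<le> C" using uniform_boundedness[of "\<lambda>n. S (t n)"] by blast
  obtain n where "C \<le> real n" using real_arch_simple by blast
  then show False using C[of n] t(2)[of n] by simp
qed

lemma C0_semigroup_power:
  assumes S: "C0_semigroup S" and s: "s \<ge> 0" and M: "norm (S s) \<le> M"
  shows "norm (S (real n * s)) \<le> M ^ n"
proof (induction n)
  case 0
  show ?case using C0_semigroupD(2)[OF S] norm_blinfun_id_le by simp
next
  case (Suc n)
  have "S (real (Suc n) * s) = S s o\<^sub>L S (real n * s)"
    using C0_semigroupD(3)[OF S, of s "real n * s"] s by (simp add: distrib_right)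
  then have "norm (S (real (Suc n) * s)) \<le> norm (S s) * norm (S (real n * s))"
    by (simp add: norm_blinfun_compose)
  also have "\<dots> \<le> M * M ^ n" using M Suc order_trans[OF norm_ge_zero M] by (intro mult_mono) auto
  finally show ?case by simp
qed

lemma C0_semigroup_locally_bounded:
  assumes S: "C0_semigroup S"
  shows "\<exists>B\<ge>0. \<forall>t\<in>{0..L}. norm (S t) \<le> B"
proof -
  obtain d M where d: "d > 0" and M: "\<And>t. t \<in> {0..d} \<Longrightarrow> norm (S t) \<le> M"
    using C0_semigroup_bounded_near_0[OF S] by blast
  have M0: "M \<ge> 0" using order_trans[OF norm_ge_zero M[of 0]] d by simp
  obtain n where n: "L \<le> real n * d" and n1: "n \<ge> 1"
  proof -
    obtain k where "L / d \<le> real k" using real_arch_simple by blast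
    then have "L \<le> real (Suc k) * d" using d by (simp add: field_simps)
    then show ?thesis using that[of "Suc k"] by simp
  qed
  \<comment> \<open>The number n of steps depends on L alone, and t / n stays in the interval where
    M is a bound.\<close>
  have "norm (S t) \<le> M ^ n" if t: "t \<in> {0..L}" for t
  proof -
    have "t / real n \<in> {0..d}" using t n n1 by (auto simp: field_simps)
    then have "norm (S (real n * (t / real n))) \<le> M ^ n"
      using M by (intro C0_semigroup_power[OF S]) auto
    then show ?thesis using n1 by simp
  qed
  then show ?thesis using M0 by (intro exI[of _ "M ^ n"]) auto
qed

text \<open>Only forward increments are controlled, uniformly in the base point; adding n of them of
  length L/n bounds the total change by L \<eta>(L/n), which tends to 0.\<close>

lemma constant_if_increments_small:
  fixes \<psi> :: "real \<Rightarrow> complex"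
  assumes L: "L > 0" and e: "(\<eta> \<longlongrightarrow> 0) (at_right 0)"
    and inc: "\<And>t h. t \<ge> 0 \<Longrightarrow> h > 0 \<Longrightarrow> t + h \<le> L \<Longrightarrow> cmod (\<psi> (t + h) - \<psi> t) \<le> h * \<eta> h"
  shows "\<psi> L = \<psi> 0"
proof -
  have le: "cmod (\<psi> L - \<psi> 0) \<le> L * \<eta> (L / real (Suc n))" for n
  proof -
    define h where "h = L / real (Suc n)"
    have h: "h > 0" using L by (simp add: h_def)
    have "\<psi> L - \<psi> 0 = \<psi> (real (Suc n) * h) - \<psi> (real 0 * h)" using L by (simp add: h_def)
    also have "\<dots> = (\<Sum>k<Suc n. \<psi> (real (Suc k) * h) - \<psi> (real k * h))"
      by (rule sum_lessThan_telescope[symmetric])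
    finally have "cmod (\<psi> L - \<psi> 0) \<le> (\<Sum>k<Suc n. cmod (\<psi> (real (Suc k) * h) - \<psi> (real k * h)))"
      by (simp only: norm_sum)
    also have "\<dots> \<le> (\<Sum>k<Suc n. h * \<eta> h)"
    proof (rule sum_mono)
      fix k assume "k \<in> {..<Suc n}"
      then have "real (Suc k) * h \<le> real (Suc n) * h" using h by (intro mult_right_mono) auto
      then have "real k * h + h \<le> real (Suc n) * h" by (simp add: distrib_right add.commute)
      then have "real k * h + h \<le> L" by (simp add: h_def)
      then show "cmod (\<psi> (real (Suc k) * h) - \<psi> (real k * h)) \<le> h * \<eta> h"
        using inc[of "real k * h" h] h by (simp add: distrib_right add.commute)
    qed
    also have "\<dots> = L * \<eta> h" by (simp add: h_def)
    finally show ?thesis by (simp add: h_def)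
  qed
  have "filterlim (\<lambda>n. L / real (Suc n)) (at_right 0) sequentially"
    unfolding filterlim_at
    using L tendsto_mult[OF tendsto_const[of L] lim_1_over_n[THEN LIMSEQ_Suc]] by (auto intro!: always_eventually)
  then have "(\<lambda>n. L * \<eta> (L / real (Suc n))) \<longlonglongrightarrow> L * 0"
    by (intro tendsto_mult tendsto_const filterlim_compose[OF e])
  then have "(\<lambda>n. L * \<eta> (L / real (Suc n))) \<longlonglongrightarrow> 0" by simp
  then have "cmod (\<psi> L - \<psi> 0) \<le> 0" by (rule LIMSEQ_le_const) (use le in blast)
  then show ?thesis by simp
qed

text \<open>The second limit vanishes because exp (l h) (1 - l h) has derivative 0 at h = 0. It
  measures how far a first-order step fails to cancel the exponential factor in the uniqueness
  argument for semigroups.\<close>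

lemma exp_difference_quotient:
  fixes l :: complex
  shows "((\<lambda>h. (exp (l * of_real h) - 1) / of_real h) \<longlongrightarrow> l) (at_right 0)"
    and "((\<lambda>h. (exp (l * of_real h) * (1 - l * of_real h) - 1) / of_real h) \<longlongrightarrow> 0) (at_right 0)"
proof -
  have of: "filterlim of_real (at (0::complex)) (at_right (0::real))"
    unfolding filterlim_at by (auto intro!: tendsto_eq_intros simp: eventually_at_filter)
  have "((\<lambda>h. exp (l * h)) has_field_derivative l) (at 0)" by (auto intro!: derivative_eq_intros)
  then have "((\<lambda>h. (exp (l * h) - 1) / h) \<longlongrightarrow> l) (at 0)" by (simp add: has_field_derivative_iff)
  from filterlim_compose[OF this of] show "((\<lambda>h. (exp (l * of_real h) - 1) / of_real h) \<longlongrightarrow> l) (at_right 0)" .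
  have "((\<lambda>h. exp (l * h) * (1 - l * h)) has_field_derivative 0) (at 0)" by (auto intro!: derivative_eq_intros)
  then have "((\<lambda>h. (exp (l * h) * (1 - l * h) - 1) / h) \<longlongrightarrow> 0) (at 0)" by (simp add: has_field_derivative_iff)
  from filterlim_compose[OF this of]
  show "((\<lambda>h. (exp (l * of_real h) * (1 - l * of_real h) - 1) / of_real h) \<longlongrightarrow> 0) (at_right 0)" .
qed

lemma generator_domain_invariant:
  assumes S: "C0_semigroup S" and f: "(f, g) \<in> generator S" and t: "t \<ge> 0"
  shows "(S t f, S t g) \<in> generator S"
proof -
  have "((\<lambda>h. (1 / h) *\<^sub>R (S h f - f)) \<longlongrightarrow> g) (at_right 0)" using f by (simp add: generator_def)
  then have "((\<lambda>h. S t ((1 / h) *\<^sub>R (S h f - f))) \<longlongrightarrow> S t g) (at_right 0)" by (intro tendsto_intros)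
  moreover have "\<forall>\<^sub>F h in at_right 0. S t ((1 / h) *\<^sub>R (S h f - f)) = (1 / h) *\<^sub>R (S h (S t f) - S t f)"
    unfolding eventually_at_filter
  proof (rule always_eventually, intro allI impI)
    fix h :: real assume "h \<noteq> 0" "h \<in> {0<..}"
    then have "S h (S t f) = S t (S h f)"
      using C0_semigroupD(3)[OF S, of h t] C0_semigroupD(3)[OF S, of t h] t
      by (metis add.commute blinfun_apply_blinfun_compose greaterThan_iff less_imp_le)
    then show "S t ((1 / h) *\<^sub>R (S h f - f)) = (1 / h) *\<^sub>R (S h (S t f) - S t f)"
      by (simp add: blinfun.scaleR_right blinfun.diff_right)
  qed
  ultimately show ?thesis by (simp add: generator_def tendsto_cong)
qed

locale spectral_model =
  fixes A :: "l2 rel" and w w' :: "'i \<Rightarrow> l2" and lam :: "'i \<Rightarrow> complex" and T :: "real \<Rightarrow> (l2 \<Rightarrow>\<^sub>L l2)"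
  assumes biorth: "\<And>i j. cinner (w i) (w' j) = (if i = j then 1 else 0)"
    and dense_w: "closure (l2c.span (range w)) = UNIV"
    and dense_w': "closure (l2c.span (range w')) = UNIV"
    and A_iff: "\<And>f g. (f, g) \<in> A \<longleftrightarrow> (\<forall>i. cinner g (w' i) = lam i * cinner f (w' i))"
    and T_clinear: "\<And>t. t \<ge> 0 \<Longrightarrow> clinear_op (T t)"
    and T_norm: "\<And>t f. t \<ge> 0 \<Longrightarrow> norm (T t f) \<le> norm f"
    and T_w: "\<And>t i. t \<ge> 0 \<Longrightarrow> T t (w i) = cscale (exp (- of_real t * lam i)) (w i)"
    and fin_lam: "\<And>r. finite {i. Re (lam i) \<le> r}"
    and resolvent_exists: "\<And>z. z \<notin> range lam \<Longrightarrow>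
      \<exists>R. clinear_op R \<and> (\<forall>i. R (w i) = cscale (1 / (lam i - z)) (w i))"
begin

lemma eq_w': "(\<And>i. cinner f (w' i) = cinner g (w' i)) \<Longrightarrow> f = g"
  using cinner_eq_0_dense[OF dense_w', of "f - g"] by (auto simp: cinner_diff_left)

lemma cinner_diag:
  assumes "clinear_op R" "\<And>i. R (w i) = cscale (c i) (w i)"
  shows "cinner (R f) (w' i) = c i * cinner f (w' i)"
  by (rule dense_span_induct[OF dense_w, where Q = "\<lambda>f. cinner (R f) (w' i) = c i * cinner f (w' i)"])
     (use assms in \<open>auto intro!: closed_Collect_eq continuous_intros linear_continuous_on
        bounded_linear_cinner_left bounded_linear_const_mult bounded_linear_compose[OF bounded_linear_cinner_left]
        blinfun.bounded_linear_right
      simp: l2c.subspace_def clinear_opD blinfun.add_right cinner_add_left cinner_cscale_left biorth ring_distribs\<close>)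

lemma T_w': "t \<ge> 0 \<Longrightarrow> cinner (T t f) (w' i) = exp (- of_real t * lam i) * cinner f (w' i)"
  by (rule cinner_diag[OF T_clinear T_w])

lemma w_in_A: "(w i, cscale (lam i) (w i)) \<in> A"
  by (auto simp: A_iff cinner_cscale_left biorth)

text \<open>On finite combinations of eigenvectors continuity is that of scalar exponentials; the
  contraction bound carries it to their closure.\<close>

lemma strongly_continuous: "((\<lambda>t. T t f) \<longlongrightarrow> f) (at_right 0)"
proof (rule tendstoI)
  fix e :: real assume e: "e > 0"
  have span: "((\<lambda>t. T t y) \<longlongrightarrow> y) (at_right 0)" if "y \<in> l2c.span (range w)" for y
    using that
  proof (induction rule: l2c.span_induct)
    case base
    have *: "\<forall>\<^sub>F t::real in at_right 0. t \<ge> 0" by (auto simp: eventually_at_filter)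
    show ?case
      unfolding l2c.subspace_def
    proof (intro conjI ballI allI; clarsimp simp: blinfun.add_right)
      show "\<And>x y. ((\<lambda>t. T t x) \<longlongrightarrow> x) (at_right 0) \<Longrightarrow> ((\<lambda>t. T t y) \<longlongrightarrow> y) (at_right 0) \<Longrightarrow>
          ((\<lambda>t. T t x + T t y) \<longlongrightarrow> x + y) (at_right 0)" by (rule tendsto_add)
      fix c x assume "((\<lambda>t. T t x) \<longlongrightarrow> x) (at_right 0)"
      then have "((\<lambda>t. cscale c (T t x)) \<longlongrightarrow> cscale c x) (at_right 0)" by (rule tendsto_cscale_right)
      moreover have "\<forall>\<^sub>F t in at_right 0. cscale c (T t x) = T t (cscale c x)"
        using * by eventually_elim (simp add: T_clinear clinear_opD)
      ultimately show "((\<lambda>t. T t (cscale c x)) \<longlongrightarrow> cscale c x) (at_right 0)" by (simp add: tendsto_cong)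
    qed
  next
    case (step y)
    then obtain i where i: "y = w i" by blast
    have "((\<lambda>t::real. exp (- of_real t * lam i)) \<longlongrightarrow> exp (- of_real 0 * lam i)) (at_right 0)"
      by (intro tendsto_intros)
    then have "((\<lambda>t::real. cscale (exp (- of_real t * lam i)) y) \<longlongrightarrow> cscale (exp (- of_real 0 * lam i)) y) (at_right 0)"
      by (rule bounded_linear.tendsto[OF bounded_linear_cscale_left])
    moreover have "\<forall>\<^sub>F t::real in at_right 0. cscale (exp (- of_real t * lam i)) y = T t y"
      by (auto simp: eventually_at_filter T_w i)
    ultimately show ?case by (simp add: tendsto_cong)
  qed
  obtain y where y: "y \<in> l2c.span (range w)" "dist y f < e / 3"
    using closure_approachable[of f "l2c.span (range w)"] dense_w e by (metis UNIV_I divide_pos_pos zero_less_numeral)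
  have "\<forall>\<^sub>F t in at_right 0. dist (T t y) y < e / 3" using e by (intro tendstoD[OF span[OF y(1)]]) simp
  moreover have "\<forall>\<^sub>F t::real in at_right 0. t \<ge> 0" by (auto simp: eventually_at_filter)
  ultimately show "\<forall>\<^sub>F t in at_right 0. dist (T t f) f < e"
  proof eventually_elim
    case (elim t)
    have "T t f - f = T t (f - y) + (T t y - y) + (y - f)" by (simp add: blinfun.diff_right)
    then have "norm (T t f - f) \<le> norm (T t (f - y)) + norm (T t y - y) + norm (y - f)"
      by (metis norm_triangle_ineq norm_triangle_mono order_refl)
    also have "norm (T t (f - y)) \<le> norm (f - y)" by (rule T_norm[OF elim(2)])
    finally show ?case using elim(1) y(2) by (simp add: dist_norm norm_minus_commute)
  qed
qed

lemma C0: "C0_semigroup T"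
  unfolding C0_semigroup_def
proof (intro conjI allI impI)
  show "T 0 = id_blinfun" by (rule blinfun_eqI, rule eq_w') (simp add: T_w')
  show "T (s + t) = T s o\<^sub>L T t" if "s \<ge> 0" "t \<ge> 0" for s t
    by (rule blinfun_eqI, rule eq_w') (use that in \<open>simp add: T_w' exp_add[symmetric] algebra_simps\<close>)
qed (auto simp: T_clinear strongly_continuous)

text \<open>Weakly, against combinations of the \<open>w'\<close>, the derivative of T s f is - T s
  g, so the mean value inequality bounds the pairing with the increment. A density argument then
  permits pairing the increment with itself.\<close>

lemma increment_bound:
  assumes fg: "(f, g) \<in> A" and t: "t > 0" and c: "\<And>s. s \<in> {0..t} \<Longrightarrow> norm (T s g - g) \<le> c"
  shows "norm (T t f - f + t *\<^sub>R g) \<le> c * t"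
proof -
  have c0: "c \<ge> 0" using order_trans[OF norm_ge_zero c[of 0]] t by simp
  define y where "y = T t f - f + t *\<^sub>R g"
  have span: "\<forall>s\<ge>0. ((\<lambda>s. cinner (T s f) u) has_vector_derivative - cinner (T s g) u) (at s within {0..})"
    if "u \<in> l2c.span (range w')" for u
    using that
  proof (induction rule: l2c.span_induct)
    case base
    show ?case
      unfolding l2c.subspace_def
    proof (intro conjI ballI allI; clarsimp simp: cinner_add_right cinner_cscale_right)
      fix x y and s :: real
      assume x: "\<forall>s\<ge>0. ((\<lambda>s. cinner (T s f) x) has_vector_derivative - cinner (T s g) x) (at s within {0..})"
        and y: "\<forall>s\<ge>0. ((\<lambda>s. cinner (T s f) y) has_vector_derivative - cinner (T s g) y) (at s within {0..})"
        and s: "s \<ge> 0"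
      show "((\<lambda>s. cinner (T s f) x + cinner (T s f) y) has_vector_derivative
          - cinner (T s g) x - cinner (T s g) y) (at s within {0..})"
        using has_vector_derivative_add[OF x[rule_format, OF s] y[rule_format, OF s]] by simp
    next
      fix c x and s :: real
      assume x: "\<forall>s\<ge>0. ((\<lambda>s. cinner (T s f) x) has_vector_derivative - cinner (T s g) x) (at s within {0..})"
        and s: "0 \<le> s"
      show "((\<lambda>s. cnj c * cinner (T s f) x) has_vector_derivative - (cnj c * cinner (T s g) x)) (at s within {0..})"
        using has_vector_derivative_mult_right[OF x[rule_format, OF s], of "cnj c"] by simp
    qed
  next
    case (step u)
    then obtain i where i: "u = w' i" by blast
    show ?case
    proof (intro allI impI)
      fix s :: real assume s: "s \<ge> 0"
      have "((\<lambda>z. exp (- z * lam i) * cinner f u) has_field_derivative - (exp (- of_real s * lam i) * lam i * cinner f u))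
          (at (of_real s))"
        by (auto intro!: derivative_eq_intros)
      then have D: "((\<lambda>s. exp (- of_real s * lam i) * cinner f u) has_vector_derivative
          - (exp (- of_real s * lam i) * lam i * cinner f u)) (at s within {0..})"
        by (rule has_vector_derivative_real_field)
      have eq: "- cinner (T s g) u = - (exp (- of_real s * lam i) * lam i * cinner f u)"
        using s fg by (simp add: i T_w' A_iff)
      show "((\<lambda>s. cinner (T s f) u) has_vector_derivative - cinner (T s g) u) (at s within {0..})"
        unfolding eq by (rule has_vector_derivative_transform[OF _ _ D]) (use s in \<open>auto simp: i T_w'\<close>)
    qed
  qed
  have b: "cmod (cinner y u) \<le> c * t * norm u" if u: "u \<in> l2c.span (range w')" for u
  proof -
    define F where "F s = cinner (T s f) u + of_real s * cinner g u" for s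
    have dF: "(F has_vector_derivative cinner (g - T s g) u) (at s within {0..t})" if "s \<in> {0..t}" for s
    proof -
      have "((\<lambda>s. cinner (T s f) u) has_vector_derivative - cinner (T s g) u) (at s within {0..t})"
        using span[OF u] that by (auto intro: has_vector_derivative_within_subset)
      moreover have "((\<lambda>s. of_real s * cinner g u) has_vector_derivative cinner g u) (at s within {0..t})"
        by (auto intro!: derivative_eq_intros simp: has_vector_derivative_def scaleR_conv_of_real fun_eq_iff)
      ultimately show ?thesis
        unfolding F_def using has_vector_derivative_add by (fastforce simp: cinner_diff_left)
    qed
    have "norm (F t - F 0) \<le> (c * norm u) * norm (t - 0)"
    proof (rule differentiable_bound[of "{0..t}" F "\<lambda>s h. h *\<^sub>R cinner (g - T s g) u"])
      fix s assume s: "s \<in> {0..t}"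
      show "(F has_derivative (\<lambda>h. h *\<^sub>R cinner (g - T s g) u)) (at s within {0..t})"
        using dF[OF s] by (simp add: has_vector_derivative_def)
      have "cmod (cinner (g - T s g) u) \<le> norm (g - T s g) * norm u" by (rule cmod_cinner_le)
      also have "\<dots> \<le> c * norm u" using c[OF s] by (intro mult_right_mono) (auto simp: norm_minus_commute)
      finally have le: "cmod (cinner (g - T s g) u) \<le> c * norm u" .
      show "onorm (\<lambda>h. h *\<^sub>R cinner (g - T s g) u) \<le> c * norm u"
        by (rule onorm_le) (use le in \<open>auto simp: mult.commute[of _ "\<bar>_\<bar>"] intro!: mult_left_mono\<close>)
    qed (use t in auto)
    moreover have "F t - F 0 = cinner y u"
      using C0_semigroupD(2)[OF C0] by (simp add: F_def y_def cinner_diff_left cinner_add_left cinner_scaleR_left)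
    ultimately show ?thesis using t by (simp add: mult.assoc mult.commute[of t])
  qed
  have "closed {u. cmod (cinner y u) \<le> c * t * norm u}"
    by (intro closed_Collect_le continuous_intros linear_continuous_on bounded_linear_cinner_right)
  then have "closure (l2c.span (range w')) \<subseteq> {u. cmod (cinner y u) \<le> c * t * norm u}"
    using b by (intro closure_minimal) auto
  then have "cmod (cinner y y) \<le> c * t * norm y" using dense_w' by auto
  then have "norm y * norm y \<le> (c * t) * norm y" by (simp add: cinner_self norm_mult power2_eq_square)
  then show ?thesis
    using c0 t by (cases "y = 0") (auto simp: y_def[symmetric] mult_le_cancel_right)
qed

text \<open>Limits of coefficients show that the generator is contained in - A. For the converse,
  convergence of coefficients does not give convergence in norm; that is supplied by
  \<open>increment_bound\<close>.\<close>

lemma generator_T: "generator T = {(f, - g) | f g. (f, g) \<in> A}"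
proof -
  have sub: "(f, - g) \<in> A" if "(f, g) \<in> generator T" for f g
    unfolding A_iff
  proof
    fix i
    have "((\<lambda>h. (1 / h) *\<^sub>R (T h f - f)) \<longlongrightarrow> g) (at_right 0)" using that by (simp add: generator_def)
    then have "((\<lambda>h. cinner ((1 / h) *\<^sub>R (T h f - f)) (w' i)) \<longlongrightarrow> cinner g (w' i)) (at_right 0)"
      by (rule tendsto_cinner_left)
    moreover have "\<forall>\<^sub>F h in at_right 0. cinner ((1 / h) *\<^sub>R (T h f - f)) (w' i)
        = (exp (- lam i * of_real h) - 1) / of_real h * cinner f (w' i)"
      by (auto simp: eventually_at_filter cinner_scaleR_left cinner_diff_left T_w' field_simps intro!: always_eventually)
    ultimately have "((\<lambda>h. (exp (- lam i * of_real h) - 1) / of_real h * cinner f (w' i)) \<longlongrightarrow> cinner g (w' i)) (at_right 0)"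
      by (simp add: tendsto_cong)
    moreover have "((\<lambda>h. (exp (- lam i * of_real h) - 1) / of_real h * cinner f (w' i)) \<longlongrightarrow> - lam i * cinner f (w' i)) (at_right 0)"
      by (intro tendsto_mult tendsto_const exp_difference_quotient)
    ultimately have "cinner g (w' i) = - lam i * cinner f (w' i)" by (intro tendsto_unique) auto
    then show "cinner (- g) (w' i) = lam i * cinner f (w' i)" by (simp add: cinner_uminus_left)
  qed
  have sup: "(f, - g) \<in> generator T" if fg: "(f, g) \<in> A" for f g
    unfolding generator_def mem_Collect_eq prod.case
  proof (rule tendstoI)
    fix e :: real assume e: "e > 0"
    have "\<forall>\<^sub>F s in at_right 0. dist (T s g) g < e / 2" using e by (intro tendstoD[OF strongly_continuous]) simp
    then obtain b where b: "b > 0" "\<And>s. 0 < s \<Longrightarrow> s < b \<Longrightarrow> dist (T s g) g < e / 2"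
      unfolding eventually_at_right_field by blast
    have bd: "norm (T s g - g) \<le> e / 2" if "s \<in> {0..<b}" for s
      using b(2)[of s] that e C0_semigroupD(2)[OF C0] by (cases "s = 0") (auto simp: dist_norm)
    show "\<forall>\<^sub>F t in at_right 0. dist ((1 / t) *\<^sub>R (T t f - f)) (- g) < e"
      unfolding eventually_at_right_field
    proof (intro exI[of _ b] conjI allI impI b(1))
      fix t assume t: "0 < t" "t < b"
      have "norm (T t f - f + t *\<^sub>R g) \<le> (e / 2) * t" using t bd by (intro increment_bound[OF fg]) auto
      moreover have "(1 / t) *\<^sub>R (T t f - f) - (- g) = (1 / t) *\<^sub>R (T t f - f + t *\<^sub>R g)"
        using t by (simp add: scaleR_add_right)
      then have "dist ((1 / t) *\<^sub>R (T t f - f)) (- g) = norm (T t f - f + t *\<^sub>R g) / t"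
        unfolding dist_norm using t by simp
      ultimately have "dist ((1 / t) *\<^sub>R (T t f - f)) (- g) \<le> e / 2"
        using t by (simp only: pos_divide_le_eq)
      then show "dist ((1 / t) *\<^sub>R (T t f - f)) (- g) < e" using e by simp
    qed
  qed
  show ?thesis
  proof (intro set_eqI iffI)
    fix x assume "x \<in> generator T"
    then show "x \<in> {(f, - g) | f g. (f, g) \<in> A}"
      using sub[of "fst x" "snd x"] by (auto intro!: exI[of _ "- snd x"] simp: prod_eq_iff)
  next
    fix x assume "x \<in> {(f, - g) | f g. (f, g) \<in> A}"
    then show "x \<in> generator T" using sup by auto
  qed
qed

text \<open>For a competitor S and an eigenvector f, the function exp (lam i s) <S s f, w' i> must
  be constant. Invariance of the generator domain controls its forward increments, and local
  boundedness of S makes their error uniform in s.\<close>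

lemma semigroup_unique:
  assumes S: "C0_semigroup S" and G: "generator S = {(f, - g) | f g. (f, g) \<in> A}" and t: "t \<ge> 0"
  shows "S t = T t"
proof (cases "t = 0")
  case True
  then show ?thesis using C0_semigroupD(2)[OF S] C0_semigroupD(2)[OF C0] by simp
next
  case False
  then have L: "t > 0" using t by simp
  show ?thesis
  proof (rule blinfun_eq_dense[OF dense_w C0_semigroupD(1)[OF S t] T_clinear[OF t]])
    fix b assume "b \<in> range w"
    then obtain k where k: "b = w k" by blast
    define f g where "f = w k" and "g = cscale (lam k) (w k)"
    have fg: "(f, - g) \<in> generator S" using w_in_A[of k] by (auto simp: G f_def g_def)
    define \<epsilon> where "\<epsilon> h = norm ((1 / h) *\<^sub>R (S h f - f) + g)" for h
    have e0: "(\<epsilon> \<longlongrightarrow> 0) (at_right 0)"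
    proof -
      have "((\<lambda>h. (1 / h) *\<^sub>R (S h f - f)) \<longlongrightarrow> - g) (at_right 0)" using fg by (simp add: generator_def)
      then have "((\<lambda>h. norm ((1 / h) *\<^sub>R (S h f - f) + g)) \<longlongrightarrow> norm (- g + g)) (at_right 0)"
        by (intro tendsto_intros)
      then show ?thesis unfolding \<epsilon>_def by simp
    qed
    obtain B where B: "B \<ge> 0" "\<And>s. s \<in> {0..t} \<Longrightarrow> norm (S s) \<le> B"
      using C0_semigroup_locally_bounded[OF S] by blast
    have "cinner (S t b) (w' i) = cinner (T t b) (w' i)" for i
    proof -
      define \<phi> where "\<phi> s = cinner (S s f) (w' i)" for s
      define \<psi> where "\<psi> s = exp (lam i * of_real s) * \<phi> s" for s
      define E where "E = exp (cmod (lam i) * t)"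
      have E: "cmod (exp (lam i * of_real s)) \<le> E" if "s \<in> {0..t}" for s
      proof -
        have "cmod (exp (lam i * of_real s)) \<le> exp (cmod (lam i * of_real s))" by (rule norm_exp)
        also have "\<dots> \<le> E" unfolding E_def using that by (auto simp: norm_mult intro!: mult_left_mono)
        finally show ?thesis .
      qed
      have E0: "E \<ge> 0" by (simp add: E_def)
      define W where "W = norm (w' i)"
      \<comment> \<open>Two errors of a step h, per unit length: the deviation of exp (lam i h) (1 -
        lam i h) from 1, and the distance \<epsilon> of the difference quotient of S at f from its
        limit. E, B and W bound the exponential, S and the functional on the interval.\<close>
      define \<eta> where "\<eta> h = E * (B * norm f * W * cmod ((exp (lam i * of_real h) * (1 - lam i * of_real h) - 1) / of_real h)
          + E * (B * \<epsilon> h * W))" for h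
      have "\<psi> t = \<psi> 0"
      proof (rule constant_if_increments_small[OF L, of \<eta>])
        have "(\<eta> \<longlongrightarrow> E * (B * norm f * W * cmod 0 + E * (B * 0 * W))) (at_right 0)"
          unfolding \<eta>_def by (intro tendsto_intros e0 exp_difference_quotient)
        then show "(\<eta> \<longlongrightarrow> 0) (at_right 0)" by simp
        fix s h :: real assume sh: "s \<ge> 0" "h > 0" "s + h \<le> t"
        have "(S s f, S s (- g)) \<in> generator S" using generator_domain_invariant[OF S fg sh(1)] .
        then have "(S s f, S s g) \<in> A" by (auto simp: G blinfun.minus_right)
        then have A: "cinner (S s g) (w' i) = lam i * \<phi> s" by (simp add: A_iff \<phi>_def)
        define r where "r = cinner (S s ((1 / h) *\<^sub>R (S h f - f) + g)) (w' i)"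
        have rb: "cmod r \<le> B * \<epsilon> h * W"
        proof -
          have "cmod r \<le> norm (S s ((1 / h) *\<^sub>R (S h f - f) + g)) * W" unfolding r_def W_def by (rule cmod_cinner_le)
          also have "norm (S s ((1 / h) *\<^sub>R (S h f - f) + g)) \<le> norm (S s) * \<epsilon> h" unfolding \<epsilon>_def by (rule norm_blinfun)
          also have "norm (S s) * \<epsilon> h \<le> B * \<epsilon> h" using B(2)[of s] sh by (intro mult_right_mono) (auto simp: \<epsilon>_def)
          finally show ?thesis by (simp add: W_def mult_right_mono)
        qed
        have pb: "cmod (\<phi> s) \<le> B * norm f * W"
        proof -
          have "cmod (\<phi> s) \<le> norm (S s f) * W" unfolding \<phi>_def W_def by (rule cmod_cinner_le)
          also have "norm (S s f) \<le> norm (S s) * norm f" by (rule norm_blinfun)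
          also have "norm (S s) * norm f \<le> B * norm f" using B(2)[of s] sh by (intro mult_right_mono) auto
          finally show ?thesis by (simp add: W_def mult_right_mono)
        qed
        have "S (s + h) f = S s f - h *\<^sub>R S s g + h *\<^sub>R S s ((1 / h) *\<^sub>R (S h f - f) + g)"
          using C0_semigroupD(3)[OF S, of s h] sh
          by (simp add: blinfun.add_right blinfun.scaleR_right blinfun.diff_right scaleR_add_right)
        then have inc: "\<phi> (s + h) = \<phi> s - of_real h * (lam i * \<phi> s) + of_real h * r"
          by (simp add: \<phi>_def r_def cinner_add_left cinner_diff_left cinner_scaleR_left A[unfolded \<phi>_def])
        define q where "q = (exp (lam i * of_real h) * (1 - lam i * of_real h) - 1) / of_real h"
        have "\<psi> (s + h) - \<psi> s = exp (lam i * of_real s) * (of_real h * (\<phi> s * q + exp (lam i * of_real h) * r))"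
        proof -
          define X Y where "X = exp (lam i * of_real s)" and "Y = exp (lam i * of_real h)"
          have hq: "of_real h * q = Y * (1 - lam i * of_real h) - 1" using sh by (simp add: q_def Y_def)
          have "\<psi> (s + h) - \<psi> s = X * (\<phi> s * (Y * (1 - lam i * of_real h) - 1) + of_real h * Y * r)"
            unfolding \<psi>_def inc by (simp add: X_def Y_def exp_add algebra_simps)
          then show ?thesis unfolding hq[symmetric] X_def[symmetric] Y_def[symmetric] by (simp add: algebra_simps)
        qed
        then have "cmod (\<psi> (s + h) - \<psi> s) = cmod (exp (lam i * of_real s)) * (h * cmod (\<phi> s * q + exp (lam i * of_real h) * r))"
          using sh by (simp add: norm_mult)
        also have "\<dots> \<le> E * (h * (B * norm f * W * cmod q + E * (B * \<epsilon> h * W)))"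
        proof (intro mult_mono E order_trans[OF norm_triangle_ineq] add_mono)
          show "cmod (\<phi> s * q) \<le> B * norm f * W * cmod q" unfolding norm_mult using pb by (rule mult_right_mono) simp
          show "cmod (exp (lam i * of_real h) * r) \<le> E * (B * \<epsilon> h * W)"
            unfolding norm_mult using rb sh by (intro mult_mono E E0) auto
        qed (use sh E0 in auto)
        also have "\<dots> = h * \<eta> h" by (simp add: \<eta>_def q_def)
        finally show "cmod (\<psi> (s + h) - \<psi> s) \<le> h * \<eta> h" .
      qed
      then have "exp (lam i * of_real t) * \<phi> t = cinner f (w' i)"
        using C0_semigroupD(2)[OF S] by (simp add: \<psi>_def \<phi>_def)
      then have "\<phi> t = exp (- of_real t * lam i) * cinner f (w' i)"
        by (simp add: exp_minus field_simps)
      then show ?thesis using t by (simp add: T_w' \<phi>_def k f_def)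
    qed
    then show "S t b = T t b" by (rule eq_w')
  qed
qed

lemma exp_minus_eq: "t \<ge> 0 \<Longrightarrow> exp_minus A t = T t"
  unfolding exp_minus_def
  by (rule the_equality) (use C0 generator_T semigroup_unique in blast)+

section \<open>Resolvent, spectrum, Riesz projectors and multiplicities\<close>

lemma resolvent_atI:
  assumes "clinear_op R" "\<And>i. R (w i) = cscale (1 / (lam i - z)) (w i)" and z: "z \<notin> range lam"
  shows "resolvent_at A z R"
  unfolding resolvent_at_def
proof (intro allI)
  fix u f
  have nz: "lam i - z \<noteq> 0" for i using z by auto
  have "R u = f \<longleftrightarrow> (\<forall>i. cinner (R u) (w' i) = cinner f (w' i))" using eq_w' by blast
  also have "\<dots> \<longleftrightarrow> (\<forall>i. cinner (u + cscale z f) (w' i) = lam i * cinner f (w' i))"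
  proof (intro all_cong1)
    fix i
    show "cinner (R u) (w' i) = cinner f (w' i) \<longleftrightarrow> cinner (u + cscale z f) (w' i) = lam i * cinner f (w' i)"
      unfolding cinner_diag[OF assms(1,2)] cinner_add_left cinner_cscale_left
      using nz[of i] by (auto simp: field_simps)
  qed
  also have "\<dots> \<longleftrightarrow> (f, u + cscale z f) \<in> A" by (simp add: A_iff)
  finally show "R u = f \<longleftrightarrow> (f, u + cscale z f) \<in> A" .
qed

text \<open>At an eigenvalue a resolvent would have to map 0 to the nonzero vector
  \<open>w i\<close>. Elsewhere the resolvent exists by the assumption of the locale.\<close>

lemma spectrum_eq: "spectrum A = range lam"
proof -
  have "\<not> resolvent_at A (lam i) R" for i R
  proof
    assume R: "resolvent_at A (lam i) R"
    have "R 0 = w i" using R w_in_A[of i] unfolding resolvent_at_def by (metis add_0)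
    then show False using biorth[of i i] by (simp add: blinfun.zero_right)
  qed
  moreover have "\<exists>R. resolvent_at A z R" if "z \<notin> range lam" for z
    using resolvent_exists[OF that] resolvent_atI[OF _ _ that] by blast
  ultimately show ?thesis unfolding spectrum_def by blast
qed

lemma resolvent:
  assumes z: "z \<notin> range lam"
  shows "clinear_op (resolvent A z)" "resolvent A z (w i) = cscale (1 / (lam i - z)) (w i)"
proof -
  obtain R where R: "clinear_op R" "\<And>i. R (w i) = cscale (1 / (lam i - z)) (w i)"
    using resolvent_exists[OF z] by blast
  have at: "resolvent_at A z R" by (rule resolvent_atI[OF R z])
  have "resolvent A z = R"
    unfolding resolvent_def
  proof (rule the_equality[where P = "resolvent_at A z", OF at])
    fix Q assume "resolvent_at A z Q"
    then show "Q = R" using at by (intro blinfun_eqI) (metis resolvent_at_def)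
  qed
  with R show "clinear_op (resolvent A z)" "resolvent A z (w i) = cscale (1 / (lam i - z)) (w i)" by auto
qed

lemma norm_cmult_op: "norm (cmult_op c) \<le> cmod c"
  by (rule norm_blinfun_bound) (auto simp: cmult_op.rep_eq norm_cscale)

lemma clinear_cmult_op: "clinear_op (cmult_op c)"
  by (auto simp: clinear_op_def cmult_op.rep_eq mult.commute)

lemma resolvent_identity:
  assumes z: "z \<notin> range lam" "y \<notin> range lam"
  shows "resolvent A z - resolvent A y = cmult_op (z - y) o\<^sub>L (resolvent A z o\<^sub>L resolvent A y)"
proof -
  have "resolvent A z = resolvent A y + (cmult_op (z - y) o\<^sub>L (resolvent A z o\<^sub>L resolvent A y))"
  proof (rule blinfun_eq_dense[OF dense_w])
    show "clinear_op (resolvent A z)" using resolvent z by blast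
    show "clinear_op (resolvent A y + (cmult_op (z - y) o\<^sub>L (resolvent A z o\<^sub>L resolvent A y)))"
      using resolvent(1)[OF z(1)] resolvent(1)[OF z(2)] clinear_cmult_op[of "z - y"]
      by (simp add: clinear_op_def blinfun.add_left l2c.scale_right_distrib)
    fix b assume "b \<in> range w"
    then obtain i where b: "b = w i" by blast
    have nz: "lam i - z \<noteq> 0" "lam i - y \<noteq> 0" using z by auto
    define c d where "c = 1 / (lam i - z)" and "d = 1 / (lam i - y)"
    have cd: "d + (z - y) * (d * c) = c"
    proof -
      have 1: "c * (lam i - z) = 1" "d * (lam i - y) = 1" using nz by (simp_all add: c_def d_def)
      then have "d + (z - y) * (d * c) = d * (c * (lam i - z)) + (z - y) * (d * c)" by simp
      also have "\<dots> = c * (d * (lam i - y))" by (simp add: algebra_simps)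
      finally show ?thesis using 1 by simp
    qed
    have R: "resolvent A z b = cscale c b" "resolvent A y b = cscale d b"
      using resolvent(2) z by (simp_all add: b c_def d_def)
    show "resolvent A z b = (resolvent A y + (cmult_op (z - y) o\<^sub>L (resolvent A z o\<^sub>L resolvent A y))) b"
      by (simp add: R blinfun.add_left cmult_op.rep_eq clinear_opD[OF resolvent(1)[OF z(1)]]
          l2c.scale_left_distrib[symmetric] cd)
  qed
  then show ?thesis by (metis add_diff_cancel_left')
qed

text \<open>In the resolvent identity z - y is so small that half of the norm of the resolvent at z
  can be absorbed; this gives the local bound 2 C and then a Lipschitz estimate at y.\<close>

lemma resolvent_continuous: "continuous_on (- range lam) (resolvent A)"
  unfolding continuous_on_def
proof
  fix y assume "y \<in> - range lam"
  then have y: "y \<notin> range lam" by simp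
  define C where "C = norm (resolvent A y) + 1"
  have C: "C > 0" by (simp add: C_def add_nonneg_pos)
  have le: "norm (resolvent A z - resolvent A y) \<le> cmod (z - y) * (2 * C * C)"
    if z: "z \<notin> range lam" "cmod (z - y) < 1 / (2 * C)" for z
  proof -
    have 1: "norm (resolvent A z - resolvent A y) \<le> cmod (z - y) * (norm (resolvent A z) * C)"
      unfolding resolvent_identity[OF z(1) y]
    proof (rule order_trans[OF norm_blinfun_compose mult_mono[OF norm_cmult_op]])
      have "norm (resolvent A z o\<^sub>L resolvent A y) \<le> norm (resolvent A z) * norm (resolvent A y)"
        by (rule norm_blinfun_compose)
      also have "\<dots> \<le> norm (resolvent A z) * C" by (intro mult_left_mono) (auto simp: C_def)
      finally show "norm (resolvent A z o\<^sub>L resolvent A y) \<le> norm (resolvent A z) * C" .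
    qed auto
    have "cmod (z - y) * (norm (resolvent A z) * C) \<le> 1 / (2 * C) * (norm (resolvent A z) * C)"
      using z C by (intro mult_right_mono) auto
    also have "\<dots> = norm (resolvent A z) / 2" using C by simp
    finally have "norm (resolvent A z) \<le> norm (resolvent A y) + norm (resolvent A z) / 2"
      using 1 norm_triangle_ineq[of "resolvent A z - resolvent A y" "resolvent A y"] by simp
    then have "norm (resolvent A z) \<le> 2 * C" by (simp add: C_def)
    then have "cmod (z - y) * (norm (resolvent A z) * C) \<le> cmod (z - y) * (2 * C * C)"
      using C by (intro mult_left_mono mult_right_mono) auto
    with 1 show ?thesis by linarith
  qed
  have "((\<lambda>z. resolvent A z - resolvent A y) \<longlongrightarrow> 0) (at y within - range lam)"
  proof (rule Lim_null_comparison)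
    show "\<forall>\<^sub>F z in at y within - range lam. norm (resolvent A z - resolvent A y) \<le> cmod (z - y) * (2 * C * C)"
      unfolding eventually_at
      using C le by (intro exI[of _ "1 / (2 * C)"]) (auto simp: dist_norm)
    have "((\<lambda>z. cmod (z - y) * (2 * C * C)) \<longlongrightarrow> cmod (y - y) * (2 * C * C)) (at y within - range lam)"
      by (intro tendsto_intros)
    then show "((\<lambda>z. cmod (z - y) * (2 * C * C)) \<longlongrightarrow> 0) (at y within - range lam)" by simp
  qed
  then show "(resolvent A \<longlongrightarrow> resolvent A y) (at y within - range lam)" by (simp add: LIM_zero_iff)
qed

text \<open>Eigenvalues with real part above Re z + 1 are farther than 1 away, and only finitely
  many others remain; half of the smallest distance, capped at 1, makes the inequality
  strict.\<close>

lemma isolation_radius: "\<exists>d>0. \<forall>j. lam j \<noteq> z \<longrightarrow> cmod (lam j - z) > d"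
proof -
  define D where "D = (\<lambda>j. cmod (lam j - z)) ` {j. Re (lam j) \<le> Re z + 1 \<and> lam j \<noteq> z}"
  have fD: "finite D" unfolding D_def by (rule finite_imageI, rule finite_subset[OF _ fin_lam[of "Re z + 1"]]) auto
  define d where "d = Min (insert 1 D) / 2"
  have pos: "Min (insert 1 D) > 0" using fD by (auto simp: D_def)
  have "cmod (lam j - z) > d" if "lam j \<noteq> z" for j
  proof (cases "Re (lam j) \<le> Re z + 1")
    case True
    then have "cmod (lam j - z) \<in> insert 1 D" using that by (auto simp: D_def)
    then have "Min (insert 1 D) \<le> cmod (lam j - z)" using fD by (intro Min_le) auto
    then show ?thesis using pos by (simp add: d_def)
  next
    case False
    then have "cmod (lam j - z) > 1" using complex_Re_le_cmod[of "lam j - z"] by simp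
    moreover have "Min (insert 1 D) \<le> 1" using fD by (intro Min_le) auto
    ultimately show ?thesis using pos by (simp add: d_def)
  qed
  then show ?thesis using pos by (intro exI[of _ d]) (auto simp: d_def)
qed

text \<open>The integrand is the negative of the Cauchy kernel, hence the minus sign; the factor
  i/(2 pi) of the projector turns -2 pi i into 1.\<close>

lemma circle_integral:
  assumes e: "0 < \<epsilon>" and z: "lam j = z \<or> cmod (lam j - z) > \<epsilon>"
  shows "contour_integral (circlepath z \<epsilon>) (\<lambda>\<zeta>. 1 / (lam j - \<zeta>)) = (if lam j = z then - (2 * of_real pi * \<i>) else 0)"
proof (cases "lam j = z")
  case True
  have "contour_integral (circlepath z \<epsilon>) (\<lambda>\<zeta>. 1 / (lam j - \<zeta>))
      = contour_integral (circlepath z \<epsilon>) (\<lambda>\<zeta>. - (1 / (\<zeta> - z)))"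
    by (intro contour_integral_cong refl) (metis True minus_diff_eq minus_divide_right)
  also have "\<dots> = - (2 * of_real pi * \<i>)"
    using contour_integral_circlepath[OF e, of z] by (simp add: contour_integral_neg)
  finally show ?thesis using True by simp
next
  case False
  with z have far: "cmod (lam j - z) > \<epsilon>" by simp
  define r where "r = cmod (lam j - z)"
  have "((\<lambda>\<zeta>. 1 / (lam j - \<zeta>)) has_contour_integral 0) (circlepath z \<epsilon>)"
  proof (rule Cauchy_theorem_convex_simple[OF _ convex_ball[of z r]])
    have "lam j \<notin> ball z r" by (simp add: r_def dist_norm norm_minus_commute)
    then show "(\<lambda>\<zeta>. 1 / (lam j - \<zeta>)) holomorphic_on ball z r"
      by (intro holomorphic_intros) auto
    show "path_image (circlepath z \<epsilon>) \<subseteq> ball z r" using far e by (auto simp: r_def path_image_circlepath)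
  qed auto
  then show ?thesis using False by (simp add: contour_integral_unique)
qed

text \<open>On an eigenvector the operator-valued integral reduces to the scalar integral of 1/(lam
  j - \<zeta>). The answer is the same for all radii below the isolation radius, so density of the
  eigenvectors makes the projector the unique eventual value.\<close>

lemma riesz_projector_w:
  assumes z: "z \<in> range lam"
  shows "clinear_op (riesz_projector A z)" "riesz_projector A z (w j) = (if lam j = z then w j else 0)"
proof -
  obtain d where d: "d > 0" "\<And>j. lam j \<noteq> z \<Longrightarrow> cmod (lam j - z) > d" using isolation_radius by blast
  define P where "P \<epsilon> = cmult_op (\<i> / (2 * of_real pi)) o\<^sub>L op_contour_integral (circlepath z \<epsilon>) (resolvent A)" for \<epsilon>
  have P: "clinear_op (P \<epsilon>) \<and> (\<forall>j. P \<epsilon> (w j) = (if lam j = z then w j else 0))" if e: "0 < \<epsilon>" "\<epsilon> < d" for \<epsilon>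
  proof -
    define \<gamma> where "\<gamma> = circlepath z \<epsilon>"
    define \<gamma>' where "\<gamma>' s = vector_derivative \<gamma> (at s within {0..1})" for s
    have out: "\<gamma> s \<notin> range lam" if "s \<in> {0..1}" for s
    proof
      assume "\<gamma> s \<in> range lam"
      then obtain j where j: "\<gamma> s = lam j" by auto
      have "cmod (\<gamma> s - z) = \<epsilon>" using e by (simp add: \<gamma>_def circlepath norm_mult)
      then show False using d(2)[of j] e by (cases "lam j = z") (auto simp: j)
    qed
    have c\<gamma>: "continuous_on {0..1} \<gamma>" unfolding \<gamma>_def by (simp add: circlepath) (intro continuous_intros)
    have "\<gamma> ` {0..1} \<subseteq> - range lam"
      by (rule image_subsetI, rule ComplI) (use out in blast)
    then have cR: "continuous_on {0..1} (\<lambda>s. resolvent A (\<gamma> s))"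
      by (rule continuous_on_compose2[OF resolvent_continuous c\<gamma>])
    have c\<gamma>': "continuous_on {0..1} \<gamma>'"
    proof -
      have "continuous_on {0..1} (\<lambda>x. 2 * pi * \<i> * \<epsilon> * exp (2 * of_real pi * \<i> * of_real x))"
        by (intro continuous_intros)
      then show ?thesis
        by (rule continuous_on_eq) (auto simp: \<gamma>'_def \<gamma>_def vector_derivative_circlepath01)
    qed
    have bl: "bounded_linear cmult_op"
      by (rule bounded_linear_intro[where K = 1])
         (auto intro!: blinfun_eqI simp: cmult_op.rep_eq blinfun.add_left blinfun.scaleR_left l2c.scale_left_distrib
           scaleR_l2_def scaleR_conv_of_real norm_cmult_op)
    have "continuous_on {0..1} (\<lambda>s. cmult_op (\<gamma>' s) o\<^sub>L resolvent A (\<gamma> s))"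
      by (rule bounded_bilinear.continuous_on[OF bounded_bilinear_blinfun_compose
            bounded_linear.continuous_on[OF bl c\<gamma>'] cR])
    then have int: "(\<lambda>s. cmult_op (\<gamma>' s) o\<^sub>L resolvent A (\<gamma> s)) integrable_on {0..1}"
      by (rule integrable_continuous_real)
    define I where "I = op_contour_integral \<gamma> (resolvent A)"
    have hI: "((\<lambda>s. cmult_op (\<gamma>' s) o\<^sub>L resolvent A (\<gamma> s)) has_integral I) {0..1}"
      using integrable_integral[OF int] by (simp add: I_def op_contour_integral_def \<gamma>'_def)
    have I: "((\<lambda>s. cscale (\<gamma>' s) (resolvent A (\<gamma> s) f)) has_integral I f) {0..1}" for f
      using has_integral_linear[OF hI blinfun.bounded_linear_left[of f]] by (simp add: o_def cmult_op.rep_eq)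
    have lin: "I (cscale c f) = cscale c (I f)" for c f
    proof -
      have "((\<lambda>s. cscale c (cscale (\<gamma>' s) (resolvent A (\<gamma> s) f))) has_integral cscale c (I f)) {0..1}"
        using has_integral_linear[OF I[of f] bounded_linear_cscale[of c]] by (simp only: o_def)
      then have "((\<lambda>s. cscale (\<gamma>' s) (resolvent A (\<gamma> s) (cscale c f))) has_integral cscale c (I f)) {0..1}"
        by (rule has_integral_eq[rotated]) (use out in \<open>auto simp: clinear_opD[OF resolvent(1)] mult.commute\<close>)
      then show ?thesis using I[of "cscale c f"] has_integral_unique by blast
    qed
    have Iw: "I (w j) = cscale (if lam j = z then - (2 * of_real pi * \<i>) else 0) (w j)" for j
    proof -
      define F where "F s = 1 / (lam j - \<gamma> s) * \<gamma>' s" for s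
      have nz: "lam j - \<gamma> s \<noteq> 0" if "s \<in> {0..1}" for s using out[OF that] by (metis eq_iff_diff_eq_0 rangeI)
      have "continuous_on {0..1} F"
        unfolding F_def using nz c\<gamma> c\<gamma>' by (intro continuous_intros) auto
      then have "(F has_integral integral {0..1} F) {0..1}"
        by (intro integrable_integral integrable_continuous_real)
      \<comment> \<open>The derivative of the path within the interval and its two-sided derivative
        can differ only at the end points.\<close>
      moreover have "integral {0..1} F = contour_integral \<gamma> (\<lambda>\<zeta>. 1 / (lam j - \<zeta>))"
        unfolding contour_integral_integral
        by (rule integral_spike[of "{0,1}"])
           (auto simp: F_def \<gamma>'_def at_within_Icc_at)
      moreover have "lam j = z \<or> cmod (lam j - z) > \<epsilon>" using d(2)[of j] e by (cases "lam j = z") auto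
      then have "contour_integral \<gamma> (\<lambda>\<zeta>. 1 / (lam j - \<zeta>)) = (if lam j = z then - (2 * of_real pi * \<i>) else 0)"
        unfolding \<gamma>_def by (rule circle_integral[OF e(1)])
      ultimately have hF: "(F has_integral (if lam j = z then - (2 * of_real pi * \<i>) else 0)) {0..1}" by simp
      have "((\<lambda>s. cscale (F s) (w j)) has_integral cscale (if lam j = z then - (2 * of_real pi * \<i>) else 0) (w j)) {0..1}"
        using has_integral_linear[OF hF bounded_linear_cscale_left[of "w j"]] by (simp only: o_def)
      then have "((\<lambda>s. cscale (\<gamma>' s) (resolvent A (\<gamma> s) (w j))) has_integral
          cscale (if lam j = z then - (2 * of_real pi * \<i>) else 0) (w j)) {0..1}"
        by (rule has_integral_eq[rotated]) (use out in \<open>auto simp: resolvent(2) F_def mult.commute\<close>)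
      then show ?thesis using I[of "w j"] has_integral_unique by blast
    qed
    have "P \<epsilon> = cmult_op (\<i> / (2 * of_real pi)) o\<^sub>L I" by (simp add: P_def I_def \<gamma>_def)
    then show ?thesis
      by (auto simp: clinear_op_def cmult_op.rep_eq lin Iw mult.commute)
  qed
  have eqP: "P \<epsilon> = P (d / 2)" if "0 < \<epsilon>" "\<epsilon> < d" for \<epsilon>
    by (rule blinfun_eq_dense[OF dense_w]) (use P[of \<epsilon>] P[of "d/2"] that d(1) in auto)
  have "riesz_projector A z = P (d / 2)"
    unfolding riesz_projector_def P_def[symmetric]
  proof (rule the_equality)
    have ev: "\<forall>\<^sub>F \<epsilon> in at_right 0. P \<epsilon> = P (d / 2)"
      unfolding eventually_at_right_field using eqP d(1) by blast
    then show "\<forall>\<^sub>F \<epsilon> in at_right 0. P (d / 2) = P \<epsilon>" by eventually_elim simp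
    fix Q assume "\<forall>\<^sub>F \<epsilon> in at_right 0. Q = P \<epsilon>"
    with ev have "\<forall>\<^sub>F \<epsilon>::real in at_right 0. Q = P (d / 2)" by eventually_elim simp
    then show "Q = P (d / 2)" by (simp add: eventually_const_iff)
  qed
  then show "clinear_op (riesz_projector A z)" "riesz_projector A z (w j) = (if lam j = z then w j else 0)"
    using P[of "d/2"] d(1) by auto
qed

lemma inj_w: "inj w"
  by (rule injI) (metis biorth zero_neq_one)

lemma finite_fiber: "finite {j. lam j = z}"
  by (rule finite_subset[OF _ fin_lam[of "Re z"]]) auto

text \<open>The projector keeps exactly the eigenvectors with eigenvalue z, which are independent by
  biorthogonality; its rank is therefore the number of indices mapped to z.\<close>

lemma alg_mult_eq:
  assumes z: "z \<in> range lam"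
  shows "alg_mult A z = enat (card {j. lam j = z})"
proof -
  define B where "B = w ` {j. lam j = z}"
  define P where "P = riesz_projector A z"
  have fB: "finite B" unfolding B_def using finite_fiber by simp
  have P: "clinear_op P" "\<And>j. P (w j) = (if lam j = z then w j else 0)"
    using riesz_projector_w[OF z] by (auto simp: P_def)
  have Pf: "P f = (\<Sum>j\<in>{j. lam j = z}. cscale (cinner f (w' j)) (w j))" for f
  proof (rule eq_w')
    fix i
    have "cinner (P f) (w' i) = (if lam i = z then 1 else 0) * cinner f (w' i)"
      by (rule cinner_diag[OF P(1)]) (simp add: P(2))
    also have "\<dots> = cinner (\<Sum>j\<in>{j. lam j = z}. cscale (cinner f (w' j)) (w j)) (w' i)"
      using finite_fiber by (simp add: cinner_sum_left cinner_cscale_left biorth if_distrib cong: if_cong)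
    finally show "cinner (P f) (w' i) = cinner (\<Sum>j\<in>{j. lam j = z}. cscale (cinner f (w' j)) (w j)) (w' i)" .
  qed
  have ran: "range P = l2c.span B"
  proof (intro equalityI subsetI)
    fix x assume "x \<in> range P"
    then show "x \<in> l2c.span B"
      unfolding B_def by (auto simp: Pf intro!: l2c.span_sum l2c.span_scale intro: l2c.span_base)
  next
    fix x assume "x \<in> l2c.span B"
    then have "P x = x"
    proof (induction rule: l2c.span_induct)
      case base
      show ?case using P(1) by (auto simp: l2c.subspace_def blinfun.add_right clinear_opD)
    qed (auto simp: B_def P(2))
    then show "x \<in> range P" by (metis rangeI)
  qed
  have ind: "l2c.independent B"
    unfolding l2c.independent_explicit_finite_subsets
  proof (intro allI impI ballI)
    fix S u v assume S: "S \<subseteq> B" "finite S" "(\<Sum>v\<in>S. cscale (u v) v) = 0" "v \<in> S"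
    obtain j where j: "v = w j" using S by (auto simp: B_def)
    have "0 = cinner (\<Sum>v\<in>S. cscale (u v) v) (w' j)" using S by simp
    also have "\<dots> = (\<Sum>x\<in>S. if x = v then u v else 0)"
      unfolding cinner_sum_left cinner_cscale_left
      by (rule sum.cong) (use S(1) in \<open>auto simp: B_def j biorth inj_eq[OF inj_w]\<close>)
    also have "\<dots> = u v" using S by simp
    finally show "u v = 0" by simp
  qed
  have "op_rank P = enat (card B)"
    using fB ran l2c.dim_span_eq_card_independent[OF ind] by (auto simp: op_rank_def)
  moreover have "card B = card {j. lam j = z}"
    unfolding B_def by (rule card_image) (rule inj_on_subset[OF inj_w], simp)
  moreover have "z isolated_in spectrum A"
  proof -
    obtain d where d: "d > 0" "\<And>j. lam j \<noteq> z \<Longrightarrow> cmod (lam j - z) > d" using isolation_radius by blast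
    show ?thesis
      unfolding isolated_in_def spectrum_eq
      using z d by (intro conjI exI[of _ "ball z d"]) (force simp: dist_norm norm_minus_commute)+
  qed
  ultimately show ?thesis by (simp add: alg_mult_def P_def)
qed

text \<open>Multiplicity counts the indices over each eigenvalue, so coincidences among the
  \<open>lam i\<close> do not affect the total and indices can be counted directly.\<close>

lemma counting_eq: "counting A r = of_nat (card {i. Re (lam i) \<le> r})"
proof -
  define Z where "Z = lam ` {i. Re (lam i) \<le> r}"
  have Z: "{z \<in> spectrum A. Re z \<le> r} = Z" by (auto simp: Z_def spectrum_eq)
  have fZ: "finite Z" using fin_lam by (simp add: Z_def)
  have "counting A r = (\<Sum>z\<in>Z. ennreal_of_enat (alg_mult A z))"
    unfolding counting_def Z using fZ by simp
  also have "\<dots> = (\<Sum>z\<in>Z. of_nat (card {j. lam j = z}))"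
    by (rule sum.cong) (auto simp: Z_def alg_mult_eq ennreal_of_enat_def)
  also have "\<dots> = of_nat (\<Sum>z\<in>Z. card {j. lam j = z})" by simp
  also have "(\<Sum>z\<in>Z. card {j. lam j = z}) = card (\<Union>z\<in>Z. {j. lam j = z})"
    by (rule card_UN_disjoint[symmetric]) (use fZ finite_fiber in auto)
  also have "(\<Union>z\<in>Z. {j. lam j = z}) = {i. Re (lam i) \<le> r}" by (auto simp: Z_def)
  finally show ?thesis .
qed

end

section \<open>Symmetric powers of two-by-two matrices\<close>

text \<open>\<open>gco A N j k\<close> is the coefficient of \<open>z\<^sup>j w\<^sup>N\<^sup>-\<^sup>j\<close> in the image
  \<open>(A\<^sub>1\<^sub>1 z + A\<^sub>2\<^sub>1 w)\<^sup>k (A\<^sub>1\<^sub>2 z + A\<^sub>2\<^sub>2 w)\<^sup>N\<^sup>-\<^sup>k\<close> of \<open>z\<^sup>k w\<^sup>N\<^sup>-\<^sup>k\<close>, read off at \<open>w = 1\<close>.\<close>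

abbreviation ent :: "complex^2^2 \<Rightarrow> 2 \<Rightarrow> 2 \<Rightarrow> complex" where
  "ent A i j \<equiv> vec_nth (vec_nth A i) j"

definition gco :: "complex^2^2 \<Rightarrow> nat \<Rightarrow> nat \<Rightarrow> nat \<Rightarrow> complex" where
  "gco A N j k = coeff ([:ent A 2 1, ent A 1 1:]^k * [:ent A 2 2, ent A 1 2:]^(N-k)) j"

definition diag2 :: "complex \<Rightarrow> complex \<Rightarrow> complex^2^2" where
  "diag2 c d = (\<chi> i j. if i = j then if i = 1 then c else d else 0)"

definition adj2 :: "complex^2^2 \<Rightarrow> complex^2^2" where
  "adj2 A = (\<chi> i j. cnj (ent A j i))"

lemma diag2_nth [simp]: "ent (diag2 c d) 1 1 = c" "ent (diag2 c d) 1 2 = 0" "ent (diag2 c d) 2 1 = 0" "ent (diag2 c d) 2 2 = d"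
  by (simp_all add: diag2_def)

lemma adj2_nth [simp]: "ent (adj2 A) i j = cnj (ent A j i)"
  by (simp add: adj2_def)

lemma mult2_nth: "ent (A ** B) i j = ent A i 1 * ent B 1 j + ent A i 2 * ent B 2 j"
  by (simp add: matrix_matrix_mult_def sum_2)

lemma mat1_nth [simp]: "ent (mat 1) 1 1 = 1" "ent (mat 1) 1 2 = 0"
  "ent (mat 1) 2 1 = 0" "ent (mat 1) 2 2 = 1"
  by (simp_all add: mat_def)

lemma eq2_iff: "(A :: complex^2^2) = B \<longleftrightarrow> ent A 1 1 = ent B 1 1 \<and> ent A 1 2 = ent B 1 2 \<and> ent A 2 1 = ent B 2 1 \<and> ent A 2 2 = ent B 2 2"
  by (auto simp: vec_eq_iff forall_2)

lemma adj2_mult: "adj2 (A ** B) = adj2 B ** adj2 A"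
  by (simp add: eq2_iff mult2_nth mult.commute)

lemma adj2_adj2 [simp]: "adj2 (adj2 A) = A"
  by (simp add: eq2_iff)

lemma adj2_one [simp]: "adj2 (mat 1) = mat 1"
  by (simp add: eq2_iff)

text \<open>For w \<noteq> 0 this is the polynomial \<open>p\<close> evaluated at z / w and rescaled
  by w^N; the case w = 0 follows because both sides are continuous in w.\<close>

lemma gco_homog:
  assumes k: "k \<le> N"
  shows "(ent A 1 1 * z + ent A 2 1 * w)^k * (ent A 1 2 * z + ent A 2 2 * w)^(N-k) = (\<Sum>j\<le>N. gco A N j k * z^j * w^(N-j))"
proof -
  define p where "p = [:ent A 2 1, ent A 1 1:]^k * [:ent A 2 2, ent A 1 2:]^(N-k)"
  have deg: "degree p \<le> N"
  proof -
    have "degree p \<le> degree ([:ent A 2 1, ent A 1 1:]^k) + degree ([:ent A 2 2, ent A 1 2:]^(N-k))"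
      unfolding p_def by (rule degree_mult_le)
    also have "\<dots> \<le> 1 * k + 1 * (N - k)"
      by (intro add_mono order_trans[OF degree_power_le] mult_right_mono) auto
    finally show ?thesis using k by simp
  qed
  define f where "f w = (ent A 1 1 * z + ent A 2 1 * w)^k * (ent A 1 2 * z + ent A 2 2 * w)^(N-k) - (\<Sum>j\<le>N. gco A N j k * z^j * w^(N-j))" for w
  have nz: "f w = 0" if w: "w \<noteq> 0" for w
  proof -
    have "poly p (z / w) = (\<Sum>j\<le>N. coeff p j * (z / w)^j)"
      unfolding poly_altdef by (rule sum.mono_neutral_left) (use deg in \<open>auto simp: coeff_eq_0\<close>)
    then have "w^N * poly p (z / w) = (\<Sum>j\<le>N. w^N * (coeff p j * (z / w)^j))" by (simp add: sum_distrib_left)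
    also have "\<dots> = (\<Sum>j\<le>N. gco A N j k * z^j * w^(N-j))"
    proof (rule sum.cong[OF refl])
      fix j assume "j \<in> {..N}"
      then have "w^N = w^j * w^(N-j)" by (simp add: power_add[symmetric])
      then show "w^N * (coeff p j * (z / w)^j) = gco A N j k * z^j * w^(N-j)"
        using w by (simp add: gco_def p_def power_divide)
    qed
    also have "w^N * poly p (z / w) = (w * (ent A 2 1 + z / w * ent A 1 1))^k * (w * (ent A 2 2 + z / w * ent A 1 2))^(N-k)"
      using k by (simp add: p_def power_mult_distrib) (simp add: power_add[symmetric])
    also have "w * (ent A 2 1 + z / w * ent A 1 1) = ent A 1 1 * z + ent A 2 1 * w" using w by (simp add: field_simps)
    also have "w * (ent A 2 2 + z / w * ent A 1 2) = ent A 1 2 * z + ent A 2 2 * w" using w by (simp add: field_simps)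
    finally show ?thesis by (simp add: f_def)
  qed
  have "isCont f 0" unfolding f_def by (intro continuous_intros)
  then have "(f \<longlongrightarrow> f 0) (at 0)" by (simp add: isCont_def)
  moreover have "(f \<longlongrightarrow> 0) (at 0)"
    by (rule tendsto_eventually) (auto simp: eventually_at_filter nz)
  ultimately have "f 0 = 0" by (intro tendsto_unique[of "at (0::complex)"]) auto
  then have "f w = 0" using nz[of w] by (cases "w = 0") auto
  then show ?thesis by (simp add: f_def)
qed

lemma homog_coeffs_unique:
  assumes "\<And>z w :: complex. (\<Sum>j\<le>N. c j * z^j * w^(N-j)) = (\<Sum>j\<le>N. d j * z^j * w^(N-j))" and "j \<le> N"
  shows "c j = d j"
proof -
  have "\<forall>z. (\<Sum>j\<le>N. c j * z^j) = (\<Sum>j\<le>N. d j * z^j)" using assms(1)[of _ 1] by simp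
  then show ?thesis using assms(2) polyfun_eq_coeffs[of c N d] by blast
qed

text \<open>Symmetric powers are functorial: substituting the linear forms of \<open>A\<close> into
  those of \<open>B\<close> yields the forms of \<open>A ** B\<close>, and coefficients of
  homogeneous polynomials are unique.\<close>

lemma gco_mult:
  assumes k: "k \<le> N" and j: "j \<le> N"
  shows "gco (A ** B) N j k = (\<Sum>l\<le>N. gco A N j l * gco B N l k)"
proof (rule homog_coeffs_unique[OF _ j])
  fix z w :: complex
  let ?z = "ent A 1 1 * z + ent A 2 1 * w" and ?w = "ent A 1 2 * z + ent A 2 2 * w"
  have "(\<Sum>j\<le>N. gco (A ** B) N j k * z^j * w^(N-j))
      = (ent (A ** B) 1 1 * z + ent (A ** B) 2 1 * w)^k * (ent (A ** B) 1 2 * z + ent (A ** B) 2 2 * w)^(N-k)"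
    by (rule gco_homog[OF k, symmetric])
  also have "\<dots> = (ent B 1 1 * ?z + ent B 2 1 * ?w)^k * (ent B 1 2 * ?z + ent B 2 2 * ?w)^(N-k)"
    by (simp add: mult2_nth algebra_simps)
  also have "\<dots> = (\<Sum>l\<le>N. gco B N l k * (?z^l * ?w^(N-l)))"
    by (subst gco_homog[OF k]) (simp add: mult.assoc)
  also have "\<dots> = (\<Sum>l\<le>N. gco B N l k * (\<Sum>j\<le>N. gco A N j l * z^j * w^(N-j)))"
    by (intro sum.cong refl) (simp add: gco_homog)
  also have "\<dots> = (\<Sum>j\<le>N. (\<Sum>l\<le>N. gco A N j l * gco B N l k) * z^j * w^(N-j))"
    unfolding sum_distrib_left sum_distrib_right by (subst sum.swap) (simp add: algebra_simps)
  finally show "(\<Sum>j\<le>N. gco (A ** B) N j k * z^j * w^(N-j))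
      = (\<Sum>j\<le>N. (\<Sum>l\<le>N. gco A N j l * gco B N l k) * z^j * w^(N-j))" .
qed

lemma gco_diag: "gco (diag2 c d) N j k = (if j = k then c^k * d^(N-k) else 0)"
proof -
  have "[:0, c:]^k = monom (c^k) k" using monom_power[of c 1 k] by (simp add: monom_Suc monom_0)
  then show ?thesis by (simp add: gco_def poly_const_pow mult.commute[of _ "d^(N-k)"])
qed

text \<open>Both sides are coefficients of the N-th power of one bilinear form in (z, w) and (u, v)
  with matrix \<open>A\<close>; exchanging the two pairs of variables transposes the matrix.\<close>

lemma gco_transpose:
  assumes k: "k \<le> N" and j: "j \<le> N"
  shows "of_nat (N choose k) * gco A N j k = of_nat (N choose j) * gco (transpose A) N k j"
proof (rule homog_coeffs_unique[OF _ k, where c = "\<lambda>k. of_nat (N choose k) * gco A N j k"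
      and d = "\<lambda>k. of_nat (N choose j) * gco (transpose A) N k j"])
  fix u v :: complex
  have *: "(\<Sum>j\<le>N. (\<Sum>k\<le>N. of_nat (N choose k) * gco A N j k * u^k * v^(N-k)) * z^j * w^(N-j))
      = (\<Sum>j\<le>N. (\<Sum>k\<le>N. of_nat (N choose j) * gco (transpose A) N k j * u^k * v^(N-k)) * z^j * w^(N-j))"
    for z w :: complex
  proof -
    have "(\<Sum>j\<le>N. (\<Sum>k\<le>N. of_nat (N choose k) * gco A N j k * u^k * v^(N-k)) * z^j * w^(N-j))
        = (\<Sum>k\<le>N. of_nat (N choose k) * u^k * v^(N-k) * (\<Sum>j\<le>N. gco A N j k * z^j * w^(N-j)))"
      unfolding sum_distrib_left sum_distrib_right by (subst sum.swap) (simp add: algebra_simps)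
    also have "\<dots> = (\<Sum>k\<le>N. of_nat (N choose k) * (u * (ent A 1 1 * z + ent A 2 1 * w))^k * (v * (ent A 1 2 * z + ent A 2 2 * w))^(N-k))"
      by (intro sum.cong refl) (simp add: gco_homog[symmetric] power_mult_distrib)
    also have "\<dots> = (u * (ent A 1 1 * z + ent A 2 1 * w) + v * (ent A 1 2 * z + ent A 2 2 * w))^N"
      by (rule binomial_ring[symmetric])
    also have "\<dots> = (z * (ent A 1 1 * u + ent A 1 2 * v) + w * (ent A 2 1 * u + ent A 2 2 * v))^N"
      by (simp add: algebra_simps)
    also have "\<dots> = (\<Sum>j\<le>N. of_nat (N choose j) * (z * (ent A 1 1 * u + ent A 1 2 * v))^j * (w * (ent A 2 1 * u + ent A 2 2 * v))^(N-j))"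
      by (rule binomial_ring)
    also have "\<dots> = (\<Sum>j\<le>N. of_nat (N choose j) * z^j * w^(N-j) * (\<Sum>k\<le>N. gco (transpose A) N k j * u^k * v^(N-k)))"
      by (intro sum.cong refl) (simp add: gco_homog[symmetric] power_mult_distrib transpose_def)
    also have "\<dots> = (\<Sum>j\<le>N. (\<Sum>k\<le>N. of_nat (N choose j) * gco (transpose A) N k j * u^k * v^(N-k)) * z^j * w^(N-j))"
      unfolding sum_distrib_left sum_distrib_right by (simp add: algebra_simps)
    finally show ?thesis .
  qed
  show "(\<Sum>k\<le>N. of_nat (N choose k) * gco A N j k * u^k * v^(N-k))
      = (\<Sum>k\<le>N. of_nat (N choose j) * gco (transpose A) N k j * u^k * v^(N-k))"
    by (rule homog_coeffs_unique[OF * j])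
qed

lemma gco_adj2:
  assumes k: "k \<le> N" and j: "j \<le> N"
  shows "gco (adj2 A) N j k = cnj (gco (transpose A) N j k)"
proof (rule homog_coeffs_unique[OF _ j])
  fix z w :: complex
  have "(\<Sum>j\<le>N. gco (adj2 A) N j k * z^j * w^(N-j))
      = (cnj (ent A 1 1) * z + cnj (ent A 1 2) * w)^k * (cnj (ent A 2 1) * z + cnj (ent A 2 2) * w)^(N-k)"
    using gco_homog[OF k, of "adj2 A"] by simp
  also have "\<dots> = cnj ((ent A 1 1 * cnj z + ent A 1 2 * cnj w)^k * (ent A 2 1 * cnj z + ent A 2 2 * cnj w)^(N-k))" by simp
  also have "\<dots> = cnj (\<Sum>j\<le>N. gco (transpose A) N j k * (cnj z)^j * (cnj w)^(N-j))"
    using gco_homog[OF k, of "transpose A" "cnj z" "cnj w"] by (simp add: transpose_def)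
  finally show "(\<Sum>j\<le>N. gco (adj2 A) N j k * z^j * w^(N-j)) = (\<Sum>j\<le>N. cnj (gco (transpose A) N j k) * z^j * w^(N-j))"
    by simp
qed

text \<open>The norm of the monomial z^j w^(N-j) in the Bargmann-Fock space, so that
  \<open>Gam\<close> below is the symmetric power written in an orthonormal basis.\<close>

definition nf :: "nat \<Rightarrow> nat \<Rightarrow> real" where "nf N j = sqrt (fact j * fact (N - j))"

lemma nf_pos [simp]: "nf N j > 0" by (simp add: nf_def)
lemma nf_nz [simp]: "nf N j \<noteq> 0" using nf_pos[of N j] by linarith
lemma nf_sq: "(nf N j)\<^sup>2 = fact j * fact (N - j)" by (simp add: nf_def)

lemma choose_nf: "j \<le> N \<Longrightarrow> real (N choose j) = fact N / (nf N j)\<^sup>2"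
  by (simp add: nf_sq binomial_fact)

definition Gam :: "complex^2^2 \<Rightarrow> nat \<Rightarrow> nat \<Rightarrow> nat \<Rightarrow> complex" where
  "Gam A N j k = of_real (nf N j / nf N k) * gco A N j k"

lemma Gam_mult:
  assumes "k \<le> N" "j \<le> N"
  shows "Gam (A ** B) N j k = (\<Sum>l\<le>N. Gam A N j l * Gam B N l k)"
  unfolding Gam_def gco_mult[OF assms] sum_distrib_left
  by (intro sum.cong refl) simp

lemma Gam_diag: "Gam (diag2 c d) N j k = (if j = k then c^k * d^(N-k) else 0)"
  by (simp add: Gam_def gco_diag)

lemma mat1_diag2: "mat 1 = diag2 1 1" by (simp add: eq2_iff)

lemma Gam_one: "Gam (mat 1) N j k = (if j = k then 1 else 0)"
  unfolding mat1_diag2 Gam_diag by simp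

text \<open>The binomial factors in \<open>gco_transpose\<close> are inverse squared monomial norms
  up to a common factor, so normalising by \<open>nf\<close> turns the adjoint of the 2 x 2 matrix
  into the adjoint of its symmetric power. Unitary matrices thereby get unitary symmetric
  powers.\<close>

lemma Gam_adj2:
  assumes k: "k \<le> N" and j: "j \<le> N"
  shows "Gam (adj2 A) N j k = cnj (Gam A N k j)"
proof -
  have "complex_of_real (fact N / (nf N j)\<^sup>2) * gco A N k j = of_real (fact N / (nf N k)\<^sup>2) * gco (transpose A) N j k"
    using gco_transpose[OF j k, of A] choose_nf[OF j] choose_nf[OF k] by (metis of_real_of_nat_eq)
  then have g: "gco (transpose A) N j k = of_real ((nf N k)\<^sup>2 / (nf N j)\<^sup>2) * gco A N k j"
    by (simp add: field_simps)
  show ?thesis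
    unfolding Gam_def gco_adj2[OF k j] g by (simp add: power2_eq_square field_simps)
qed

text \<open>\<open>Der s n\<close> is the derivation \<open>s (w \<partial>\<^sub>z - z \<partial>\<^sub>w) + w \<partial>\<^sub>w\<close> on homogeneous polynomials of
  degree \<open>n\<close> in \<open>z, w\<close>, written at \<open>w = 1\<close> by means of Euler's identity \<open>w \<partial>\<^sub>w = n - z \<partial>\<^sub>z\<close>.\<close>

definition Der :: "complex \<Rightarrow> nat \<Rightarrow> complex poly \<Rightarrow> complex poly" where
  "Der s n p = [:s, -1, s:] * pderiv p + of_nat n * [:1, -s:] * p"

lemma Der_mult: "Der s (m + n) (p * q) = Der s m p * q + p * Der s n q"
  by (simp add: Der_def pderiv_mult distrib_left distrib_right of_nat_add mult.assoc mult.left_commute mult.commute del: mult_pCons_left mult_pCons_right)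

lemma Der_power:
  assumes "Der s 1 p = smult m p"
  shows "Der s k (p ^ k) = smult (of_nat k * m) (p ^ k)"
proof (induction k)
  case 0
  show ?case by (simp add: Der_def)
next
  case (Suc k)
  have "Der s (1 + k) (p * p ^ k) = Der s 1 p * p ^ k + p * Der s k (p ^ k)" by (rule Der_mult)
  then show ?case using Suc assms by (simp add: smult_add_left[symmetric] distrib_right)
qed

lemma coeff_Der:
  "coeff (Der s n p) j = (of_nat n - of_nat j) * coeff p j + s * of_nat (Suc j) * coeff p (Suc j)
     - (if j = 0 then 0 else s * (of_nat n - of_nat (j - 1)) * coeff p (j - 1))"
proof -
  have 1: "coeff ([:s, -1, s:] * q) j = s * coeff q j - (if j = 0 then 0 else coeff q (j - 1))
      + (if j < 2 then 0 else s * coeff q (j - 2))" for q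
    by (cases j; cases "j - 1") (auto simp: numeral_2_eq_2)
  have 2: "coeff (of_nat n * [:1, -s:] * q) j = of_nat n * coeff q j - (if j = 0 then 0 else of_nat n * s * coeff q (j - 1))" for q
    unfolding of_nat_poly by (cases j) (auto simp: algebra_simps)
  show ?thesis
    unfolding Der_def coeff_add 1 2 coeff_pderiv
    by (cases j; cases "j - 1") (auto simp: numeral_2_eq_2 algebra_simps)
qed

lemma nf_Suc: "j < N \<Longrightarrow> nf N (Suc j) * sqrt (real (N - j)) = nf N j * sqrt (real (Suc j))"
proof -
  assume j: "j < N"
  have "N - j = Suc (N - Suc j)" using j by simp
  then have "fact (N - j) = real (N - j) * fact (N - Suc j)" by (metis fact_Suc)
  then show ?thesis by (simp add: nf_def real_sqrt_mult[symmetric] algebra_simps)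
qed

text \<open>The hypotheses say that the columns of \<open>P\<close> are eigenvectors of the matrix
  with rows (0, -s) and (s, 1); equivalently, the linear forms L1 and L2 are eigenvectors of the
  derivation. The Leibniz rule makes L1^k L2^(N-k) an eigenvector with the sum of the eigenvalues,
  and its normalised coefficients satisfy this recurrence.\<close>

lemma Gam_eigen:
  fixes s :: real
  assumes k: "k \<le> N" and j: "j \<le> N"
    and e1: "- of_real s * ent P 2 1 = m1 * ent P 1 1" "of_real s * ent P 1 1 + ent P 2 1 = m1 * ent P 2 1"
    and e2: "- of_real s * ent P 2 2 = m2 * ent P 1 2" "of_real s * ent P 1 2 + ent P 2 2 = m2 * ent P 2 2"
  shows "of_nat (N - j) * Gam P N j k
      - of_real (s * sqrt (real j) * sqrt (real (Suc (N - j)))) * Gam P N (j - 1) k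
      + of_real (s * sqrt (real (Suc j)) * sqrt (real (N - j))) * Gam P N (Suc j) k
    = (of_nat k * m1 + of_nat (N - k) * m2) * Gam P N j k"
proof -
  define L1 L2 where "L1 = [:ent P 2 1, ent P 1 1:]" and "L2 = [:ent P 2 2, ent P 1 2:]"
  define p where "p = L1^k * L2^(N-k)"
  have D1: "Der (of_real s) 1 L1 = smult m1 L1" and D2: "Der (of_real s) 1 L2 = smult m2 L2"
    using e1 e2 by (simp_all add: Der_def L1_def L2_def pderiv_pCons algebra_simps)
  have gp: "gco P N i k = coeff p i" for i by (simp add: gco_def p_def L1_def L2_def)
  have "Der (of_real s) (k + (N - k)) p = smult (of_nat k * m1 + of_nat (N - k) * m2) p"
    unfolding p_def Der_mult Der_power[OF D1] Der_power[OF D2] by (simp add: smult_add_left)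
  then have "coeff (Der (of_real s) N p) j = (of_nat k * m1 + of_nat (N - k) * m2) * coeff p j" using k by simp
  then have main: "(of_nat N - of_nat j) * gco P N j k + of_real s * of_nat (Suc j) * gco P N (Suc j) k
     - (if j = 0 then 0 else of_real s * (of_nat N - of_nat (j - 1)) * gco P N (j - 1) k)
     = (of_nat k * m1 + of_nat (N - k) * m2) * gco P N j k"
    unfolding coeff_Der gp .
  have up: "of_real (s * sqrt (real (Suc j)) * sqrt (real (N - j))) * Gam P N (Suc j) k
      = of_real (nf N j / nf N k) * (of_real s * of_nat (Suc j) * gco P N (Suc j) k)"
  proof (cases "j < N")
    case True
    have "sqrt (real (Suc j)) * sqrt (real (N - j)) * nf N (Suc j) = nf N j * real (Suc j)"
      using nf_Suc[OF True] by (simp add: mult_ac) (metis mult.assoc mult.commute of_nat_0_le_iff of_nat_Suc real_sqrt_mult_self abs_of_nonneg)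
    then have "s * sqrt (real (Suc j)) * sqrt (real (N - j)) * (nf N (Suc j) / nf N k) = nf N j / nf N k * (s * real (Suc j))"
      by (simp add: field_simps del: of_nat_Suc)
    then show ?thesis unfolding Gam_def by (metis (no_types, opaque_lifting) mult.assoc of_real_mult of_real_of_nat_eq)
  next
    \<comment> \<open>At j = N the left side vanishes through sqrt 0; on the right the coefficient
      of degree N + 1 vanishes because \<open>p\<close> has degree at most N.\<close>
    case False
    then have jN: "j = N" using j by simp
    have "degree p \<le> degree (L1^k) + degree (L2^(N-k))" unfolding p_def by (rule degree_mult_le)
    also have "\<dots> \<le> 1 * k + 1 * (N - k)"
      by (intro add_mono order_trans[OF degree_power_le] mult_right_mono) (auto simp: L1_def L2_def)
    finally have "gco P N (Suc N) k = 0" using k by (simp add: gco_def p_def L1_def L2_def coeff_eq_0)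
    then show ?thesis by (simp add: jN)
  qed
  have down: "of_real (s * sqrt (real j) * sqrt (real (Suc (N - j)))) * Gam P N (j - 1) k
      = of_real (nf N j / nf N k) * (if j = 0 then 0 else of_real s * (of_nat N - of_nat (j - 1)) * gco P N (j - 1) k)"
  proof (cases j)
    case (Suc i)
    have iN: "i < N" using j Suc by simp
    have Ni: "Suc (N - j) = N - i" using iN Suc by simp
    have "sqrt (real j) * sqrt (real (N - i)) * nf N i = nf N j * real (N - i)"
      using nf_Suc[OF iN] Suc by (simp add: mult_ac) (metis mult.assoc mult.commute of_nat_0_le_iff real_sqrt_mult_self abs_of_nonneg)
    then have "s * sqrt (real j) * sqrt (real (N - i)) * (nf N i / nf N k) = nf N j / nf N k * (s * real (N - i))"
      by (simp add: field_simps)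
    then have "of_real (s * sqrt (real j) * sqrt (real (N - i))) * Gam P N i k
       = of_real (nf N j / nf N k) * (of_real s * of_nat (N - i) * gco P N i k)"
      unfolding Gam_def by (metis (no_types, opaque_lifting) mult.assoc of_real_mult of_real_of_nat_eq)
    then show ?thesis unfolding Ni using Suc iN by (simp add: of_nat_diff)
  qed simp
  have "of_nat (N - j) * Gam P N j k = of_real (nf N j / nf N k) * ((of_nat N - of_nat j) * gco P N j k)"
    using j by (simp add: Gam_def of_nat_diff)
  then show ?thesis
    unfolding up down using main
    by (simp only: right_diff_distrib[symmetric] distrib_left[symmetric])
       (simp add: Gam_def right_diff_distrib[symmetric] distrib_left[symmetric] diff_add_eq)
qed

text \<open>Trace and determinant of the Hermitian matrix \<open>adj2 A ** A\<close> are the squared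
  Hilbert-Schmidt norm and |det A|^2. Since both are nonnegative, so are the two real
  eigenvalues.\<close>

lemma spectral_2x2:
  fixes A :: "complex^2^2"
  obtains V d1 d2 where "adj2 V ** V = mat 1" "V ** adj2 V = mat 1"
    "adj2 A ** A = V ** diag2 (of_real d1) (of_real d2) ** adj2 V" "d1 \<ge> 0" "d2 \<ge> 0"
    "d1 + d2 = (cmod (ent A 1 1))\<^sup>2 + (cmod (ent A 1 2))\<^sup>2 + (cmod (ent A 2 1))\<^sup>2 + (cmod (ent A 2 2))\<^sup>2"
    "d1 * d2 = (cmod (det A))\<^sup>2"
proof -
  define \<alpha> \<delta> \<beta> where "\<alpha> = (cmod (ent A 1 1))\<^sup>2 + (cmod (ent A 2 1))\<^sup>2" and "\<delta> = (cmod (ent A 1 2))\<^sup>2 + (cmod (ent A 2 2))\<^sup>2"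
    and "\<beta> = cnj (ent A 1 1) * ent A 1 2 + cnj (ent A 2 1) * ent A 2 2"
  have H: "ent (adj2 A ** A) 1 1 = of_real \<alpha>" "ent (adj2 A ** A) 2 2 = of_real \<delta>"
    "ent (adj2 A ** A) 1 2 = \<beta>" "ent (adj2 A ** A) 2 1 = cnj \<beta>"
    by (simp_all add: mult2_nth \<alpha>_def \<beta>_def \<delta>_def complex_norm_square mult.commute del: of_real_power)
  have det: "(cmod (det A))\<^sup>2 = \<alpha> * \<delta> - (cmod \<beta>)\<^sup>2"
  proof -
    have "complex_of_real ((cmod (det A))\<^sup>2) = of_real (\<alpha> * \<delta> - (cmod \<beta>)\<^sup>2)"
      unfolding of_real_diff of_real_mult complex_norm_square \<alpha>_def \<delta>_def \<beta>_def of_real_add det_2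
      by (simp add: algebra_simps)
    then show ?thesis using of_real_eq_iff by blast
  qed
  obtain V d1 d2 where V: "adj2 V ** V = mat 1" "V ** adj2 V = mat 1"
    "adj2 A ** A = V ** diag2 (of_real d1) (of_real d2) ** adj2 V"
    "d1 + d2 = \<alpha> + \<delta>" "d1 * d2 = \<alpha> * \<delta> - (cmod \<beta>)\<^sup>2"
  proof (cases "\<beta> = 0")
    case True
    show ?thesis
      by (rule that[of "mat 1" \<alpha> \<delta>]) (use True H in \<open>auto simp: eq2_iff mult2_nth\<close>)
  next
    case False
    define b where "b = (cmod \<beta>)\<^sup>2"
    have b: "b > 0" using False by (simp add: b_def)
    \<comment> \<open>The positive root of e^2 + (\<alpha> - \<delta>) e = |\<beta>|^2: it makes
      (\<beta>, e) an eigenvector for \<alpha> + e, and the other eigenvalue is \<delta> -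
      e.\<close>
    define e where "e = ((\<delta> - \<alpha>) + sqrt ((\<delta> - \<alpha>)\<^sup>2 + 4 * b)) / 2"
    have ee: "e * e + (\<alpha> - \<delta>) * e = b"
    proof -
      have "(sqrt ((\<delta> - \<alpha>)\<^sup>2 + 4 * b))\<^sup>2 = (\<delta> - \<alpha>)\<^sup>2 + 4 * b" using b by simp
      moreover have "2 * e - (\<delta> - \<alpha>) = sqrt ((\<delta> - \<alpha>)\<^sup>2 + 4 * b)" by (simp add: e_def field_simps)
      ultimately have "(2 * e - (\<delta> - \<alpha>))\<^sup>2 = (\<delta> - \<alpha>)\<^sup>2 + 4 * b" by simp
      then show ?thesis by (simp add: power2_eq_square algebra_simps)
    qed
    define n where "n = sqrt (b + e\<^sup>2)"
    have n2: "n * n = b + e * e" using b by (simp add: n_def power2_eq_square)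
    have n: "n > 0" using b by (simp add: n_def add_pos_nonneg)
    define V :: "complex^2^2" where
      "V = (\<chi> i j. if i = 1 then if j = 1 then \<beta> / of_real n else - of_real (e / n)
                          else if j = 1 then of_real (e / n) else cnj \<beta> / of_real n)"
    have Vn: "ent V 1 1 = \<beta> / of_real n" "ent V 1 2 = - of_real (e / n)" "ent V 2 1 = of_real (e / n)" "ent V 2 2 = cnj \<beta> / of_real n"
      by (simp_all add: V_def)
    have bb: "\<beta> * cnj \<beta> = of_real b" by (simp add: b_def complex_norm_square del: of_real_power)
    have bb': "cnj \<beta> * \<beta> = of_real b" using bb by (simp add: mult.commute)
    have one: "complex_of_real b / (of_real n * of_real n) + of_real (e / n) * of_real (e / n) = 1"
    proof -
      have "b / (n * n) + (e / n) * (e / n) = 1"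
        using n n2[symmetric] by (simp add: add_divide_distrib[symmetric])
      then show ?thesis by (metis of_real_1 of_real_add of_real_divide of_real_mult)
    qed
    have U1: "adj2 V ** V = mat 1" and U2: "V ** adj2 V = mat 1"
      using one by (simp_all add: eq2_iff mult2_nth Vn bb bb' add.commute)
    define l1 l2 where "l1 = \<alpha> + e" and "l2 = \<delta> - e"
    have r1: "l1 * (b / (n * n)) + l2 * (e / n * (e / n)) = \<alpha>"
    proof -
      have "l1 * b + l2 * (e * e) = \<alpha> * (b + e * e) + e * (b - (e * e + (\<alpha> - \<delta>) * e))"
        by (simp add: l1_def l2_def algebra_simps)
      then have "l1 * b + l2 * (e * e) = \<alpha> * (n * n)" using ee n2 by simp
      then show ?thesis using n by (simp add: field_simps)
    qed
    have r2: "l1 * (e / n * (e / n)) + l2 * (b / (n * n)) = \<delta>"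
    proof -
      have "l1 * (e * e) + l2 * b = \<delta> * (b + e * e) - e * (b - (e * e + (\<alpha> - \<delta>) * e))"
        by (simp add: l1_def l2_def algebra_simps)
      then have "l1 * (e * e) + l2 * b = \<delta> * (n * n)" using ee n2 by simp
      then show ?thesis using n by (simp add: field_simps)
    qed
    have r3: "(l1 - l2) * (e / (n * n)) = 1"
    proof -
      have "(l1 - l2) * e = n * n" using ee n2 by (simp add: l1_def l2_def algebra_simps)
      then show ?thesis using n by simp
    qed
    have c1: "complex_of_real l1 * (of_real b / (of_real n * of_real n)) + of_real l2 * (of_real e / of_real n * (of_real e / of_real n)) = of_real \<alpha>"
      using arg_cong[OF r1, of complex_of_real] by simp
    have c2: "complex_of_real l1 * (of_real e / of_real n * (of_real e / of_real n)) + of_real l2 * (of_real b / (of_real n * of_real n)) = of_real \<delta>"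
      using arg_cong[OF r2, of complex_of_real] by simp
    have c3: "(complex_of_real l1 - of_real l2) * (of_real e / (of_real n * of_real n)) = 1"
      using arg_cong[OF r3, of complex_of_real] by simp
    have c3': "(complex_of_real l1 - of_real l2) * (of_real e / (of_real n * of_real n)) * \<beta> = \<beta>"
      "(complex_of_real l1 - of_real l2) * (of_real e / (of_real n * of_real n)) * cnj \<beta> = cnj \<beta>"
      using c3 by simp_all
    let ?M = "V ** diag2 (of_real l1) (of_real l2) ** adj2 V"
    have M11: "ent ?M 1 1 = of_real l1 * (\<beta> * cnj \<beta> / (of_real n * of_real n)) + of_real l2 * (of_real e / of_real n * (of_real e / of_real n))"
      by (simp add: mult2_nth Vn mult_ac)
    have M22: "ent ?M 2 2 = of_real l1 * (of_real e / of_real n * (of_real e / of_real n)) + of_real l2 * (\<beta> * cnj \<beta> / (of_real n * of_real n))"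
      by (simp add: mult2_nth Vn mult_ac)
    have M12: "ent ?M 1 2 = (of_real l1 - of_real l2) * (of_real e / (of_real n * of_real n)) * \<beta>"
      by (simp add: mult2_nth Vn algebra_simps diff_divide_distrib)
    have M21: "ent ?M 2 1 = (of_real l1 - of_real l2) * (of_real e / (of_real n * of_real n)) * cnj \<beta>"
      by (simp add: mult2_nth Vn algebra_simps diff_divide_distrib)
    have D: "adj2 A ** A = ?M"
      unfolding eq2_iff[of "adj2 A ** A"] H M11 M22 M12 M21 bb c1 c2 c3' by simp
    have "l1 * l2 = \<alpha> * \<delta> - b" using ee by (simp add: l1_def l2_def algebra_simps)
    then show ?thesis by (intro that[OF U1 U2 D]) (simp_all add: l1_def l2_def b_def)
  qed
  have s: "d1 + d2 \<ge> 0" using V(4) by (simp add: \<alpha>_def \<delta>_def)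
  have p: "d1 * d2 \<ge> 0" using V(5) det by (metis zero_le_power2)
  have "d1 \<ge> 0" using s p by (metis add.commute add_neg_nonpos less_le_not_le linorder_le_less_linear mult_neg_pos not_less zero_le_mult_iff)
  moreover have "d2 \<ge> 0" using s p by (metis add.commute add_neg_nonpos less_le_not_le linorder_le_less_linear mult_neg_pos not_less zero_le_mult_iff)
  ultimately show ?thesis
    using that[OF V(1-3)] V(4,5) det by (simp add: \<alpha>_def \<delta>_def)
qed

subsection \<open>Second quantisation\<close>

definition lev :: "nat \<times> nat \<Rightarrow> nat" where "lev i = fst i + snd i"

lemma lev_Pair [simp]: "lev (p, q) = p + q" by (simp add: lev_def)

lemma sum_lev: "(\<Sum>i\<in>{i. lev i = N}. f i) = (\<Sum>j\<le>N. f (j, N - j))"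
  by (rule sum.reindex_bij_witness[of _ "\<lambda>j. (j, N - j)" fst]) (auto simp: lev_def)

lemma finite_lev: "finite {i. lev i = N}"
  by (rule finite_subset[of _ "{..N} \<times> {..N}"]) (auto simp: lev_def)

locale fock = orth_basis H "\<lambda>N. {i. lev i = N}" for H :: "nat \<times> nat \<Rightarrow> l2"
begin

text \<open>Image of the Hermite vector \<open>H i\<close> under the symmetric power of
  \<open>A\<close> on its level. As a finite sum it makes sense for every matrix, whether or not the
  symmetric powers are bounded uniformly in the level.\<close>

definition W :: "complex^2^2 \<Rightarrow> nat \<times> nat \<Rightarrow> l2" where
  "W A i = (\<Sum>j\<le>lev i. cscale (Gam A (lev i) j (fst i)) (H (j, lev i - j)))"

lemma fst_le_lev [simp]: "fst i \<le> lev i" by (simp add: lev_def)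

lemma W_H: "cinner (W A i) (H h) = (if lev i = lev h then Gam A (lev i) (fst h) (fst i) else 0)"
proof -
  have "cinner (W A i) (H h) = (\<Sum>j\<le>lev i. if j = fst h then if lev i = lev h then Gam A (lev i) (fst h) (fst i) else 0 else 0)"
    unfolding W_def cinner_sum_left cinner_cscale_left on
    by (rule sum.cong) (auto simp: prod_eq_iff lev_def)
  also have "\<dots> = (if lev i = lev h then Gam A (lev i) (fst h) (fst i) else 0)"
    by (auto simp: lev_def)
  finally show ?thesis .
qed

text \<open>The Gram matrix on a level is the symmetric power of \<open>adj2 B ** A\<close>.
  Orthonormality, biorthogonality and singular values of such families thereby become statements
  about 2 x 2 matrices.\<close>

lemma cinner_W: "cinner (W A i) (W B h) = (if lev i = lev h then Gam (adj2 B ** A) (lev i) (fst h) (fst i) else 0)"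
proof -
  have "cinner (W A i) (W B h) = (\<Sum>j\<le>lev h. cnj (Gam B (lev h) j (fst h)) * cinner (W A i) (H (j, lev h - j)))"
    unfolding W_def[of B] cinner_sum_right cinner_cscale_right ..
  also have "\<dots> = (\<Sum>j\<le>lev h. Gam (adj2 B) (lev h) (fst h) j * (if lev i = lev h then Gam A (lev i) j (fst i) else 0))"
    by (rule sum.cong) (auto simp: W_H Gam_adj2)
  also have "\<dots> = (if lev i = lev h then Gam (adj2 B ** A) (lev i) (fst h) (fst i) else 0)"
  proof (cases "lev i = lev h")
    case True
    then show ?thesis by (subst Gam_mult) (metis fst_le_lev, metis fst_le_lev, simp)
  qed simp
  finally show ?thesis .
qed

lemma W_one: "W (mat 1) i = H i"
proof -
  have "W (mat 1) i = (\<Sum>j\<le>lev i. if j = fst i then H i else 0)"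
    unfolding W_def by (rule sum.cong) (auto simp: Gam_one lev_def)
  then show ?thesis by simp
qed

lemma W_mult: "W (A ** B) i = (\<Sum>l\<le>lev i. cscale (Gam B (lev i) l (fst i)) (W A (l, lev i - l)))"
proof -
  have "(\<Sum>l\<le>lev i. cscale (Gam B (lev i) l (fst i)) (W A (l, lev i - l)))
      = (\<Sum>l\<le>lev i. \<Sum>j\<le>lev i. cscale (Gam A (lev i) j l * Gam B (lev i) l (fst i)) (H (j, lev i - j)))"
    by (rule sum.cong) (auto simp: W_def l2c.scale_sum_right mult.commute)
  also have "\<dots> = (\<Sum>j\<le>lev i. cscale (\<Sum>l\<le>lev i. Gam A (lev i) j l * Gam B (lev i) l (fst i)) (H (j, lev i - j)))"
    by (subst sum.swap) (simp add: l2c.scale_sum_left)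
  also have "\<dots> = W (A ** B) i"
    unfolding W_def by (rule sum.cong) (auto simp: Gam_mult)
  finally show ?thesis by simp
qed

lemma total_W:
  assumes inv: "A ** B = mat 1" and f: "\<And>i. cinner f (W A i) = 0"
  shows "f = 0"
proof (rule total)
  fix i
  have "H i = W (A ** B) i" by (simp add: inv W_one)
  then show "cinner f (H i) = 0" by (simp add: W_mult cinner_sum_right cinner_cscale_right f)
qed

text \<open>Invertibility of \<open>A\<close> writes each \<open>H i\<close> as a finite combination
  of vectors \<open>W A\<close> of the same level.\<close>

lemma dense_W:
  assumes inv: "A ** B = mat 1"
  shows "closure (l2c.span (range (W A))) = UNIV"
proof -
  have "H i \<in> l2c.span (range (W A))" for i
  proof -
    have "H i = W (A ** B) i" by (simp add: inv W_one)
    then show ?thesis unfolding W_mult by (auto intro!: l2c.span_sum l2c.span_scale intro: l2c.span_base)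
  qed
  then have "l2c.span (range H) \<subseteq> l2c.span (range (W A))" by (intro l2c.span_minimal) auto
  then show ?thesis using closure_mono dense by blast
qed

lemma orth_basis_W:
  assumes "adj2 V ** V = mat 1" "V ** adj2 V = mat 1"
  shows "orth_basis (W V) (\<lambda>N. {i. lev i = N})"
proof
  show "cinner (W V i) (W V j) = (if i = j then 1 else 0)" for i j
    by (auto simp: cinner_W assms Gam_one lev_def prod_eq_iff)
  show "f = 0" if "\<And>i. cinner f (W V i) = 0" for f by (rule total_W[OF assms(2) that])
qed (use disj cover finite_lev in auto)

text \<open>\<open>T\<close> acts on every block as the symmetric power of \<open>A\<close>.\<close>

definition quant :: "complex^2^2 \<Rightarrow> (l2 \<Rightarrow>\<^sub>L l2) \<Rightarrow> bool" where
  "quant A T \<longleftrightarrow> clinear_op T \<and> (\<forall>B i. T (W B i) = W (A ** B) i)"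

lemma quantD: "quant A T \<Longrightarrow> clinear_op T" "quant A T \<Longrightarrow> T (W B i) = W (A ** B) i"
  unfolding quant_def by blast+

lemma quant_mult: "quant A S \<Longrightarrow> quant B T \<Longrightarrow> quant (A ** B) (S o\<^sub>L T)"
  by (simp add: quant_def clinear_op_compose matrix_mul_assoc)

lemma quant_unique: "quant A S \<Longrightarrow> quant A T \<Longrightarrow> S = T"
  by (rule blinfun_eq_dense[OF dense_W[of "mat 1" "mat 1"]]) (auto simp: quant_def)

lemma clinear_sum: "clinear_op T \<Longrightarrow> T (\<Sum>i\<in>I. cscale (c i) (f i)) = (\<Sum>i\<in>I. cscale (c i) (T (f i)))"
  by (simp add: blinfun.sum_right clinear_opD)

text \<open>Any \<open>B\<close> factors as \<open>V ** (U ** B)\<close>, so the action on the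
  single invertible frame \<open>V\<close> determines it on all others.\<close>

lemma quantI:
  assumes T: "clinear_op T" and V: "V ** U = mat 1" and TV: "\<And>i. T (W V i) = W (A ** V) i"
  shows "quant A T"
  unfolding quant_def
proof (intro conjI allI T)
  fix B i
  have "W B i = W (V ** (U ** B)) i" by (simp add: matrix_mul_assoc V)
  then have "T (W B i) = (\<Sum>l\<le>lev i. cscale (Gam (U ** B) (lev i) l (fst i)) (W (A ** V) (l, lev i - l)))"
    by (simp add: W_mult[of V] clinear_sum[OF T] TV)
  also have "\<dots> = W ((A ** V) ** (U ** B)) i" by (rule W_mult[symmetric])
  also have "(A ** V) ** (U ** B) = A ** (V ** U) ** B" by (simp only: matrix_mul_assoc)
  finally show "T (W B i) = W (A ** B) i" by (simp add: V)
qed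

lemma quant_adj:
  assumes "quant A T" "quant (adj2 A) U"
  shows "cinner (T f) g = cinner f (U g)"
proof -
  have 1: "cinner (T (H i)) (H h) = cinner (H i) (U (H h))" for i h
  proof -
    have "cinner (T (W (mat 1) i)) (W (mat 1) h) = cinner (W (mat 1) i) (U (W (mat 1) h))"
      by (auto simp: quantD[OF assms(1)] quantD[OF assms(2)] cinner_W)
    then show ?thesis by (simp add: W_one)
  qed
  have 2: "cinner (T f) (H h) = cinner f (U (H h))" for f h
    by (rule dense_span_induct[OF dense, where Q = "\<lambda>f. cinner (T f) (H h) = cinner f (U (H h))"])
       (use quantD(1)[OF assms(1)] 1[of _ h] in \<open>auto intro!: closed_Collect_eq continuous_intros linear_continuous_on
        bounded_linear_cinner_left bounded_linear_compose[OF bounded_linear_cinner_left] blinfun.bounded_linear_right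
      simp: l2c.subspace_def clinear_opD blinfun.add_right cinner_add_left cinner_cscale_left\<close>)
  show ?thesis
    by (rule dense_span_induct[OF dense, where Q = "\<lambda>g. cinner (T f) g = cinner f (U g)"])
       (use quantD(1)[OF assms(2)] 2 in \<open>auto intro!: closed_Collect_eq continuous_intros linear_continuous_on
        bounded_linear_cinner_right bounded_linear_compose[OF bounded_linear_cinner_right] blinfun.bounded_linear_right
      simp: l2c.subspace_def clinear_opD blinfun.add_right cinner_add_right cinner_cscale_right\<close>)
qed

text \<open>If \<open>A\<^sup>* A = V diag(d\<^sub>1, d\<^sub>2) V\<^sup>*\<close>, the symmetric powers of \<open>A\<close> map the orthonormal
  basis \<open>W V\<close> to an orthogonal system with squared norms \<open>d\<^sub>1\<^sup>p d\<^sub>2\<^sup>q\<close>.\<close>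

lemma quant_exists:
  assumes V: "adj2 V ** V = mat 1" "V ** adj2 V = mat 1"
    and A: "adj2 A ** A = V ** diag2 (of_real d1) (of_real d2) ** adj2 V"
    and d: "0 \<le> d1" "0 \<le> d2" "d1 \<le> \<rho>\<^sup>2" "d2 \<le> \<rho>\<^sup>2" "0 \<le> \<rho>" "\<rho> \<le> 1"
  shows "\<exists>T. quant A T \<and> (\<forall>f. norm (T f) \<le> norm f) \<and>
    (\<forall>N c. norm (T (\<Sum>i\<in>{i. lev i = N}. cscale (c i) (H i))) \<le> \<rho>^N * norm (\<Sum>i\<in>{i. lev i = N}. cscale (c i) (H i)))"
proof -
  interpret V: orth_basis "W V" "\<lambda>N. {i. lev i = N}" by (rule orth_basis_W[OF V])
  define u where "u = W (A ** V)"
  have D: "adj2 (A ** V) ** (A ** V) = diag2 (of_real d1) (of_real d2)"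
  proof -
    have "adj2 (A ** V) ** (A ** V) = adj2 V ** (adj2 A ** A) ** V" by (simp only: adj2_mult matrix_mul_assoc)
    also have "\<dots> = (adj2 V ** V) ** diag2 (of_real d1) (of_real d2) ** (adj2 V ** V)"
      unfolding A by (simp only: matrix_mul_assoc)
    finally show ?thesis by (simp add: V)
  qed
  have uu: "cinner (u i) (u j) = (if i = j then of_real (d1 ^ fst i * d2 ^ snd i) else 0)" for i j
  proof (cases "lev i = lev j")
    case True
    then show ?thesis unfolding u_def cinner_W D Gam_diag by (cases i; cases j) auto
  next
    case False
    then show ?thesis by (auto simp: u_def cinner_W)
  qed
  have nu: "(norm (u i))\<^sup>2 = d1 ^ fst i * d2 ^ snd i" for i
  proof -
    have "complex_of_real ((norm (u i))\<^sup>2) = of_real (d1 ^ fst i * d2 ^ snd i)"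
      unfolding cinner_self[symmetric] uu by simp
    then show ?thesis using of_real_eq_iff by blast
  qed
  have nu_le: "(norm (u i))\<^sup>2 \<le> (\<rho>\<^sup>2) ^ lev i" for i
    unfolding nu lev_def power_add using d by (intro mult_mono power_mono) auto
  have comb: "norm (\<Sum>i\<in>{i. lev i = N}. cscale (c i) (u i)) \<le> \<rho>^N * norm (\<Sum>i\<in>{i. lev i = N}. cscale (c i) (W V i))" for N c
  proof (rule power2_le_imp_le)
    have "(norm (\<Sum>i\<in>{i. lev i = N}. cscale (c i) (u i)))\<^sup>2 = (\<Sum>i\<in>{i. lev i = N}. (norm (cscale (c i) (u i)))\<^sup>2)"
      by (rule norm_sum_orth) (auto simp: finite_lev cinner_cscale_left cinner_cscale_right uu)
    also have "\<dots> \<le> (\<Sum>i\<in>{i. lev i = N}. (\<rho>\<^sup>2)^N * (cmod (c i))\<^sup>2)"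
    proof (rule sum_mono)
      fix i :: "nat \<times> nat" assume "i \<in> {i. lev i = N}"
      then have "(cmod (c i))\<^sup>2 * (norm (u i))\<^sup>2 \<le> (cmod (c i))\<^sup>2 * (\<rho>\<^sup>2)^N"
        using nu_le[of i] by (intro mult_left_mono) auto
      then show "(norm (cscale (c i) (u i)))\<^sup>2 \<le> (\<rho>\<^sup>2)^N * (cmod (c i))\<^sup>2"
        by (simp add: norm_cscale power_mult_distrib mult.commute)
    qed
    also have "\<dots> = (\<rho>^N * norm (\<Sum>i\<in>{i. lev i = N}. cscale (c i) (W V i)))\<^sup>2"
      unfolding power_mult_distrib V.norm_comb[OF finite_lev] sum_distrib_left
      by (simp add: power_mult[symmetric] mult.commute)
    finally show "(norm (\<Sum>i\<in>{i. lev i = N}. cscale (c i) (u i)))\<^sup>2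
      \<le> (\<rho>^N * norm (\<Sum>i\<in>{i. lev i = N}. cscale (c i) (W V i)))\<^sup>2" .
  qed (use d in auto)
  have comb1: "norm (\<Sum>i\<in>{i. lev i = N}. cscale (c i) (u i)) \<le> 1 * norm (\<Sum>i\<in>{i. lev i = N}. cscale (c i) (W V i))" for N c
    by (rule order_trans[OF comb mult_right_mono]) (use d in \<open>auto intro: power_le_one\<close>)
  have "\<exists>T. clinear_op T \<and> (\<forall>f. norm (T f) \<le> 1 * norm f) \<and> (\<forall>i. T (W V i) = u i)"
    by (rule V.block_op) (use comb1 in \<open>auto simp: uu\<close>)
  then obtain T where T: "clinear_op T" "\<And>f. norm (T f) \<le> norm f" "\<And>i. T (W V i) = u i" by auto
  have q: "quant A T" by (rule quantI[OF T(1) V(2)]) (simp add: T u_def)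
  have "norm (T f) \<le> \<rho>^N * norm f" if f: "f = (\<Sum>i\<in>{i. lev i = N}. cscale (c i) (H i))" for N c f
  proof -
    \<comment> \<open>A level-N combination of the \<open>H i\<close> is re-expanded in the singular
      vectors \<open>W V\<close> of the same level, the basis in which \<open>comb\<close> was
      proved.\<close>
    define b where "b i = cinner f (W V i)" for i
    have "f = (\<Sum>i\<in>{i. lev i = N}. cscale (b i) (W V i))"
    proof -
      have "f - (\<Sum>i\<in>{i. lev i = N}. cscale (b i) (W V i)) = 0"
      proof (rule V.total)
        fix j
        have "cinner f (W V j) = 0" if "lev j \<noteq> N"
          unfolding f cinner_sum_left cinner_cscale_left
          by (rule sum.neutral) (use that cinner_W[of "mat 1" _ V j] in \<open>auto simp: W_one\<close>)
        then show "cinner (f - (\<Sum>i\<in>{i. lev i = N}. cscale (b i) (W V i))) (W V j) = 0"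
          by (auto simp: cinner_diff_left V.cinner_comb[OF finite_lev] b_def)
      qed
      then show ?thesis by simp
    qed
    then show ?thesis using comb[of b N] by (simp add: clinear_sum[OF T(1)] T(3))
  qed
  with q T(2) show ?thesis by blast
qed

end

section \<open>Hermite functions\<close>

primrec he :: "nat \<Rightarrow> real poly" where
  "he 0 = 1"
| "he (Suc n) = [:0, 1:] * he n - pderiv (he n)"

lemma pderiv_he: "pderiv (he n) = of_nat n * he (n - 1)"
proof (induction n)
  case (Suc n)
  have "pderiv (he (Suc n)) = he n + ([:0, 1:] * pderiv (he n) - pderiv (pderiv (he n)))"
    by (simp add: pderiv_diff pderiv_mult pderiv_pCons)
  also have "[:0, 1:] * pderiv (he n) - pderiv (pderiv (he n)) = of_nat n * he n"
  proof (cases n)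
    case (Suc k)
    have "pderiv (of_nat n * he k) = of_nat n * pderiv (he k)"
      by (simp add: of_nat_poly pderiv_smult)
    then show ?thesis using Suc.IH Suc by (simp add: algebra_simps)
  qed simp
  finally show ?case by (simp add: algebra_simps)
qed simp

text \<open>Built from the probabilists' Hermite polynomials \<open>he\<close>; the normalisation
  makes the square of \<open>hf 0\<close> the standard normal density.\<close>

definition hf :: "nat \<Rightarrow> real \<Rightarrow> real" where
  "hf n x = poly (he n) x * exp (- x\<^sup>2 / 4) / sqrt (fact n * sqrt (2 * pi))"

text \<open>Multiplication by x is the sum of lowering and raising. At n = 0 the truncated index n -
  1 is harmless because its coefficient is sqrt 0; the same convention is used in the ladder
  formulas below.\<close>

lemma hf_recurrence: "x * hf n x = sqrt n * hf (n - 1) x + sqrt (Suc n) * hf (Suc n) x"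
proof -
  define E where "E = exp (- x\<^sup>2 / 4)"
  define c where "c n = sqrt (fact n * sqrt (2 * pi))" for n :: nat
  have c: "c n > 0" for n by (simp add: c_def)
  have cS: "c (Suc n) = sqrt (Suc n) * c n" for n
    by (simp add: c_def real_sqrt_mult[symmetric] mult.assoc)
  have hfE: "hf n x = poly (he n) x * E / c n" for n by (simp add: hf_def E_def c_def)
  have "sqrt (Suc n) * hf (Suc n) x = poly (he (Suc n)) x * E / c n"
    using c[of n] by (simp add: hfE cS del: he.simps of_nat_Suc)
  moreover have "sqrt n * hf (n - 1) x = poly (pderiv (he n)) x * E / c n"
  proof (cases n)
    case (Suc k)
    have "sqrt n * sqrt n = real n" by simp
    then show ?thesis using c[of k] unfolding Suc
      by (simp add: hfE cS pderiv_he of_nat_poly field_simps del: he.simps of_nat_Suc)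
  qed simp
  ultimately show ?thesis
    using c[of n] by (simp add: hfE add_divide_distrib[symmetric] algebra_simps)
qed

lemma hf_deriv: "(hf n has_real_derivative (sqrt n * hf (n - 1) x - sqrt (Suc n) * hf (Suc n) x) / 2) (at x)"
proof -
  define c where "c = sqrt (fact n * sqrt (2 * pi))"
  have c: "c > 0" by (simp add: c_def)
  have "((\<lambda>x. exp (- x\<^sup>2 / 4)) has_real_derivative exp (- x\<^sup>2 / 4) * (- x / 2)) (at x)"
    by (auto intro!: derivative_eq_intros)
  then have "((\<lambda>x. poly (he n) x * exp (- x\<^sup>2 / 4) / c) has_real_derivative
      (poly (pderiv (he n)) x * exp (- x\<^sup>2 / 4) + exp (- x\<^sup>2 / 4) * (- x / 2) * poly (he n) x) / c) (at x)"
    by (intro DERIV_cdivide DERIV_mult poly_DERIV)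
  moreover have hfc: "hf n x = poly (he n) x * exp (- x\<^sup>2 / 4) / c" by (simp add: hf_def c_def)
  have "(poly (pderiv (he n)) x * exp (- x\<^sup>2 / 4) + exp (- x\<^sup>2 / 4) * (- x / 2) * poly (he n) x) / c
      = poly (pderiv (he n)) x * exp (- x\<^sup>2 / 4) / c - x / 2 * hf n x"
    by (simp add: hfc diff_divide_distrib mult_ac)
  moreover have "hf n = (\<lambda>x. poly (he n) x * exp (- x\<^sup>2 / 4) / c)" by (rule ext) (simp add: hf_def c_def)
  ultimately have "(hf n has_real_derivative (poly (pderiv (he n)) x * exp (- x\<^sup>2 / 4) / c - x / 2 * hf n x)) (at x)"
    by simp
  moreover have "poly (pderiv (he n)) x * exp (- x\<^sup>2 / 4) / c = sqrt n * hf (n - 1) x"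
  proof (cases n)
    case (Suc k)
    have "c = sqrt (real n) * sqrt (fact k * sqrt (2 * pi))"
      unfolding c_def Suc by (simp add: real_sqrt_mult[symmetric] mult.assoc)
    moreover have "sqrt n * sqrt n = real n" by simp
    ultimately show ?thesis unfolding Suc
      by (simp add: hf_def pderiv_he of_nat_poly field_simps del: he.simps of_nat_Suc)
  qed simp
  moreover have "sqrt n * hf (n - 1) x - x / 2 * hf n x = (sqrt n * hf (n - 1) x - sqrt (Suc n) * hf (Suc n) x) / 2"
    using hf_recurrence[of x n] by (simp add: field_simps)
  ultimately show ?thesis by (simp only:)
qed

lemma continuous_on_hf [continuous_intros]: "continuous_on S f \<Longrightarrow> continuous_on S (\<lambda>x. hf n (f x))"
proof -
  have "continuous_on UNIV (hf n)"
    by (rule DERIV_continuous_on) (rule has_field_derivative_at_within[OF hf_deriv])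
  then show "continuous_on S f \<Longrightarrow> continuous_on S (\<lambda>x. hf n (f x))"
    using continuous_on_compose2 by blast
qed

lemma borel_measurable_hf [measurable]: "hf n \<in> borel_measurable borel"
  by (intro borel_measurable_continuous_onI continuous_intros)

text \<open>Each induction step pays for one factor x with half of the exponent and leaves the other
  half for the remaining polynomial.\<close>

lemma poly_gauss_bound: "c > 0 \<Longrightarrow> \<exists>C\<ge>0. \<forall>x::real. \<bar>poly p x\<bar> \<le> C * exp (c * x\<^sup>2)"
proof (induction p arbitrary: c rule: pCons_induct)
  case 0
  then show ?case by (intro exI[of _ 0]) auto
next
  case (pCons a p)
  then obtain C where C: "C \<ge> 0" "\<And>x. \<bar>poly p x\<bar> \<le> C * exp (c / 2 * x\<^sup>2)" by (meson half_gt_zero)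
  define D where "D = 1 + 2 / c"
  have D: "D \<ge> 1" "D * (c / 2) \<ge> 1" using pCons.prems by (simp_all add: D_def field_simps)
  have x: "\<bar>x\<bar> \<le> D * exp (c / 2 * x\<^sup>2)" for x :: real
  proof -
    have "\<bar>x\<bar> \<le> 1 + x\<^sup>2" using sum_squares_bound[of "\<bar>x\<bar>" 1] by (simp add: power2_eq_square)
    also have "\<dots> \<le> D * 1 + D * (c / 2) * x\<^sup>2"
      using D(1) mult_right_mono[OF D(2), of "x\<^sup>2"] by simp
    also have "\<dots> = D * (1 + c / 2 * x\<^sup>2)" by (simp add: algebra_simps)
    also have "\<dots> \<le> D * exp (c / 2 * x\<^sup>2)" using D by (intro mult_left_mono exp_ge_add_one_self) auto
    finally show ?thesis .
  qed
  have "\<bar>poly (pCons a p) x\<bar> \<le> (\<bar>a\<bar> + D * C) * exp (c * x\<^sup>2)" for x :: real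
  proof -
    have "\<bar>poly (pCons a p) x\<bar> \<le> \<bar>a\<bar> + \<bar>x\<bar> * \<bar>poly p x\<bar>" by (simp add: abs_mult[symmetric] abs_triangle_ineq)
    also have "\<dots> \<le> \<bar>a\<bar> * exp (c * x\<^sup>2) + (D * exp (c / 2 * x\<^sup>2)) * (C * exp (c / 2 * x\<^sup>2))"
    proof (intro add_mono mult_mono x C)
      have "1 \<le> exp (c * x\<^sup>2)" using pCons.prems by simp
      then show "\<bar>a\<bar> \<le> \<bar>a\<bar> * exp (c * x\<^sup>2)" by (metis abs_ge_zero mult_left_mono mult.right_neutral)
    qed (use D in auto)
    also have "(D * exp (c / 2 * x\<^sup>2)) * (C * exp (c / 2 * x\<^sup>2)) = D * C * exp (c * x\<^sup>2)"
      by (simp add: exp_add[symmetric] field_simps)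
    finally show ?thesis by (simp add: distrib_right)
  qed
  then show ?case using C(1) D(1) by (intro exI[of _ "\<bar>a\<bar> + D * C"]) auto
qed

lemma hf_bound: "\<exists>C\<ge>0. \<forall>x. \<bar>hf n x\<bar> \<le> C * exp (- x\<^sup>2 / 8)"
proof -
  obtain C where C: "C \<ge> 0" "\<And>x. \<bar>poly (he n) x\<bar> \<le> C * exp (1/8 * x\<^sup>2)" using poly_gauss_bound[of "1/8" "he n"] by auto
  define c where "c = sqrt (fact n * sqrt (2 * pi))"
  have c: "c > 0" by (simp add: c_def)
  have "\<bar>hf n x\<bar> \<le> (C / c) * exp (- x\<^sup>2 / 8)" for x
  proof -
    have "\<bar>hf n x\<bar> = \<bar>poly (he n) x\<bar> * exp (- x\<^sup>2 / 4) / c" using c by (simp add: hf_def c_def[symmetric] abs_mult)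
    also have "\<dots> \<le> C * exp (1/8 * x\<^sup>2) * exp (- x\<^sup>2 / 4) / c"
      using C c by (intro divide_right_mono mult_right_mono) auto
    also have "\<dots> = (C / c) * exp (- x\<^sup>2 / 8)" by (simp add: exp_add[symmetric] field_simps)
    finally show ?thesis .
  qed
  then show ?thesis using C c by (intro exI[of _ "C / c"]) auto
qed

lemma integrable_gauss: "c > 0 \<Longrightarrow> integrable lborel (\<lambda>x::real. exp (- (c * x\<^sup>2)))"
proof -
  assume c: "c > 0"
  define \<sigma> where "\<sigma> = sqrt (1 / (2 * c))"
  have s: "\<sigma> > 0" "2 * \<sigma>\<^sup>2 = 1 / c" using c by (simp_all add: \<sigma>_def)
  have "integrable lborel (\<lambda>x. sqrt (2 * pi * \<sigma>\<^sup>2) * normal_density 0 \<sigma> x)" using s by (intro integrable_mult_right) auto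
  moreover have "sqrt (2 * pi * \<sigma>\<^sup>2) * normal_density 0 \<sigma> x = exp (- (c * x\<^sup>2))" for x
    using s c by (simp add: normal_density_def)
  ultimately show ?thesis by simp
qed

lemma integrable_gauss_bounded:
  assumes "f \<in> borel_measurable borel" "\<And>x. norm (f x) \<le> C * exp (- (c * x\<^sup>2))" "c > 0"
  shows "integrable lborel (f :: real \<Rightarrow> 'a::{banach,second_countable_topology})"
proof (rule Bochner_Integration.integrable_bound)
  show "integrable lborel (\<lambda>x. C * exp (- (c * x\<^sup>2)))" by (intro integrable_mult_right integrable_gauss assms)
  show "AE x in lborel. norm (f x) \<le> norm (C * exp (- (c * x\<^sup>2)))"
    using assms(2) by (auto intro: order_trans[OF _ abs_ge_self])
qed (use assms in simp)

lemma hf_hf_bound: "\<exists>C\<ge>0. \<forall>x. \<bar>hf m x * hf n x\<bar> \<le> C * exp (- (1/4 * x\<^sup>2))"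
proof -
  obtain C D where C: "C \<ge> 0" "\<And>x. \<bar>hf m x\<bar> \<le> C * exp (- x\<^sup>2 / 8)" and D: "D \<ge> 0" "\<And>x. \<bar>hf n x\<bar> \<le> D * exp (- x\<^sup>2 / 8)"
    using hf_bound by metis
  have "\<bar>hf m x * hf n x\<bar> \<le> (C * D) * exp (- (1/4 * x\<^sup>2))" for x
  proof -
    have "\<bar>hf m x * hf n x\<bar> \<le> (C * exp (- x\<^sup>2 / 8)) * (D * exp (- x\<^sup>2 / 8))"
      unfolding abs_mult by (intro mult_mono C D) (use C in auto)
    also have "\<dots> = (C * D) * exp (- (1/4 * x\<^sup>2))" by (simp add: exp_add[symmetric] mult_ac)
    finally show ?thesis .
  qed
  then show ?thesis using C D by (intro exI[of _ "C * D"]) auto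
qed

lemma integrable_hf_hf: "integrable lborel (\<lambda>x. hf m x * hf n x)"
proof -
  obtain C where "\<And>x. \<bar>hf m x * hf n x\<bar> \<le> C * exp (- (1/4 * x\<^sup>2))" using hf_hf_bound by blast
  then show ?thesis by (intro integrable_gauss_bounded[where c = "1/4" and C = C]) auto
qed

lemma integral_deriv_eq_0:
  fixes F f :: "real \<Rightarrow> 'a::euclidean_space"
  assumes F: "\<And>x. (F has_vector_derivative f x) (at x)" and c: "continuous_on UNIV f" and i: "integrable lborel f"
    and lim: "(F \<longlongrightarrow> 0) at_top" "(F \<longlongrightarrow> 0) at_bot"
  shows "integral\<^sup>L lborel f = 0"
proof -
  have "(LBINT x=-\<infinity>..\<infinity>. f x) = 0 - 0"
  proof (rule interval_integral_FTC_integrable)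
    show "((F \<circ> real_of_ereal) \<longlongrightarrow> 0) (at_right (-\<infinity>))"
      unfolding at_right_MInf filterlim_filtermap using lim(2) by (simp add: o_def)
    show "((F \<circ> real_of_ereal) \<longlongrightarrow> 0) (at_left \<infinity>)"
      unfolding at_left_PInf filterlim_filtermap using lim(1) by (simp add: o_def)
    show "set_integrable lborel (einterval (- \<infinity>) \<infinity>) f" using i by (simp add: set_integrable_def)
  qed (use F c in \<open>auto simp: continuous_on_eq_continuous_at\<close>)
  then show ?thesis by (simp add: interval_lebesgue_integral_def set_lebesgue_integral_def)
qed

text \<open>The derivative of the product of \<open>hf m\<close> and \<open>hf n\<close> integrates
  to 0, and multiplication by x is symmetric. The two resulting relations combine to the ladder
  relation \<open>lad\<close>, which reduces everything to the Gaussian integral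
  \<open>a 0 0\<close>.\<close>

lemma hf_orthonormal: "(\<integral>x. hf m x * hf n x \<partial>lborel) = (if m = n then 1 else 0)"
proof -
  define a where "a m n = (\<integral>x. hf m x * hf n x \<partial>lborel)" for m n
  have sym: "a m n = a n m" for m n by (simp add: a_def mult.commute)
  have der: "sqrt m * a (m-1) n - sqrt (Suc m) * a (Suc m) n + (sqrt n * a m (n-1) - sqrt (Suc n) * a m (Suc n)) = 0" for m n
  proof -
    define f where "f x = (sqrt m * (hf (m-1) x * hf n x) - sqrt (Suc m) * (hf (Suc m) x * hf n x)
        + (sqrt n * (hf m x * hf (n-1) x) - sqrt (Suc n) * (hf m x * hf (Suc n) x))) / 2" for x
    have "integral\<^sup>L lborel f = 0"
    proof (rule integral_deriv_eq_0)
      fix x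
      have "((\<lambda>x. hf m x * hf n x) has_real_derivative f x) (at x)"
        unfolding f_def by (rule derivative_eq_intros hf_deriv refl)+ (simp add: field_simps)
      then show "((\<lambda>x. hf m x * hf n x) has_vector_derivative f x) (at x)"
        by (simp add: has_real_derivative_iff_has_vector_derivative)
    next
      show "continuous_on UNIV f" unfolding f_def by (intro continuous_intros) auto
      show "integrable lborel f" unfolding f_def
        by (intro integrable_divide Bochner_Integration.integrable_add Bochner_Integration.integrable_diff
            integrable_mult_right integrable_hf_hf)
      obtain C where C: "\<And>x. \<bar>hf m x * hf n x\<bar> \<le> C * exp (- (1/4 * x\<^sup>2))" using hf_hf_bound by blast
      have 1: "((\<lambda>x::real. C * exp (- (1/4 * x\<^sup>2))) \<longlongrightarrow> 0) at_top" and 2: "((\<lambda>x::real. C * exp (- (1/4 * x\<^sup>2))) \<longlongrightarrow> 0) at_bot"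
        by real_asymp+
      show "((\<lambda>x. hf m x * hf n x) \<longlongrightarrow> 0) at_top"
        by (rule Lim_null_comparison[OF _ 1]) (use C in \<open>auto intro: always_eventually\<close>)
      show "((\<lambda>x. hf m x * hf n x) \<longlongrightarrow> 0) at_bot"
        by (rule Lim_null_comparison[OF _ 2]) (use C in \<open>auto intro: always_eventually\<close>)
    qed
    then show ?thesis
      unfolding f_def a_def by (simp add: integrable_hf_hf)
  qed
  have rec: "sqrt m * a (m-1) n + sqrt (Suc m) * a (Suc m) n = sqrt n * a m (n-1) + sqrt (Suc n) * a m (Suc n)" for m n
  proof -
    have "(\<integral>x. (x * hf m x) * hf n x \<partial>lborel) = sqrt m * a (m-1) n + sqrt (Suc m) * a (Suc m) n"
      unfolding hf_recurrence a_def distrib_right mult.assoc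
      by (subst Bochner_Integration.integral_add) (auto intro: integrable_mult_right integrable_hf_hf)
    moreover have "(\<integral>x. (x * hf m x) * hf n x \<partial>lborel) = (\<integral>x. hf m x * (x * hf n x) \<partial>lborel)"
      by (simp add: mult_ac)
    moreover have "\<dots> = sqrt n * a m (n-1) + sqrt (Suc n) * a m (Suc n)"
      unfolding hf_recurrence a_def distrib_left mult.left_commute[of "hf m _"]
      by (subst Bochner_Integration.integral_add) (auto intro: integrable_mult_right integrable_hf_hf)
    ultimately show ?thesis by simp
  qed
  have lad: "sqrt (Suc n) * a m (Suc n) = sqrt m * a (m-1) n" for m n using der[of m n] rec[of m n] by linarith
  have "a 0 0 = 1"
  proof -
    have "hf 0 x * hf 0 x = std_normal_density x" for x
    proof -
      have "exp (- x\<^sup>2 / 4) * exp (- x\<^sup>2 / 4) = exp (- x\<^sup>2 / 2)" by (simp add: exp_add[symmetric])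
      moreover have "sqrt (sqrt (2 * pi)) * sqrt (sqrt (2 * pi)) = sqrt (2 * pi)" by simp
      ultimately show ?thesis
        unfolding hf_def std_normal_density_def by (simp add: times_divide_times_eq)
    qed
    then show ?thesis by (simp add: a_def)
  qed
  moreover have "a (Suc k) 0 = 0" for k
    using lad[of k 0] by (simp add: sym[of "Suc k" 0])
  ultimately have "a m 0 = (if m = 0 then 1 else 0)" for m by (cases m) auto
  then have "a m n = (if m = n then 1 else 0)" for m n
  proof (induction n arbitrary: m)
    case (Suc n)
    have pos: "sqrt (Suc n) > 0" by simp
    show ?case
    proof (cases m)
      case 0
      then have "sqrt (Suc n) * a m (Suc n) = 0" using lad[of n m] by simp
      then show ?thesis using 0 pos by simp
    next
      case (Suc k)
      have "sqrt (Suc n) * a m (Suc n) = sqrt m * (if k = n then 1 else 0)"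
        using lad[of n m] Suc.IH[of k, OF Suc.prems] Suc by simp
      then show ?thesis using Suc pos by (auto simp del: of_nat_Suc)
    qed
  qed simp
  then show ?thesis by (simp add: a_def)
qed

subsection \<open>Completeness\<close>

lemma exp_moment_bound: "\<bar>x\<bar>^n \<le> fact n * exp \<bar>x :: real\<bar>"
proof -
  have "\<bar>x\<bar>^n /\<^sub>R fact n \<le> (\<Sum>k. \<bar>x\<bar>^k /\<^sub>R fact k)"
    using sum_le_suminf[OF summable_exp_generic[of "\<bar>x\<bar>"], of "{n}"] by simp
  then show ?thesis by (simp add: exp_def field_simps)
qed

text \<open>The Taylor series of the character may be integrated term by term, since its partial
  sums are dominated by exp (|t| |x|) and \<open>u\<close> has all exponential moments.\<close>

lemma fourier_eq_0_of_moments: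
  fixes u :: "real \<Rightarrow> real"
  assumes [measurable]: "u \<in> borel_measurable borel" and int: "\<And>c. integrable lborel (\<lambda>x. \<bar>u x\<bar> * exp (c * \<bar>x\<bar>))"
    and zero: "\<And>n. (\<integral>x. u x * x^n \<partial>lborel) = 0"
  shows "(\<integral>x. of_real (u x) * iexp (t * x) \<partial>lborel) = 0"
proof -
  define s where "s N x = of_real (u x) * (\<Sum>n<N. (\<i> * of_real (t * x))^n /\<^sub>R fact n)" for N x
  have im: "integrable lborel (\<lambda>x. u x * x^n)" for n
  proof (rule Bochner_Integration.integrable_bound)
    show "integrable lborel (\<lambda>x. fact n * (\<bar>u x\<bar> * exp (1 * \<bar>x\<bar>)))" by (intro integrable_mult_right int)
    show "AE x in lborel. norm (u x * x^n) \<le> norm (fact n * (\<bar>u x\<bar> * exp (1 * \<bar>x\<bar>)))"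
    proof (rule AE_I2)
      fix x :: real
      show "norm (u x * x^n) \<le> norm (fact n * (\<bar>u x\<bar> * exp (1 * \<bar>x\<bar>)))"
        using mult_left_mono[OF exp_moment_bound[of x n], of "\<bar>u x\<bar>"] by (simp add: abs_mult power_abs mult_ac)
    qed
  qed simp
  have s0: "integral\<^sup>L lborel (s N) = 0" for N
  proof -
    have "s N = (\<lambda>x. \<Sum>n<N. ((\<i> * of_real t)^n / fact n) * of_real (u x * x^n))"
      by (rule ext) (simp add: s_def sum_distrib_left power_mult_distrib scaleR_conv_of_real field_simps)
    then have "integral\<^sup>L lborel (s N) = (\<Sum>n<N. \<integral>x. ((\<i> * of_real t)^n / fact n) * of_real (u x * x^n) \<partial>lborel)"
      by (simp only:) (rule Bochner_Integration.integral_sum, intro integrable_mult_right integrable_of_real im)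
    also have "\<dots> = (\<Sum>n<N. ((\<i> * of_real t)^n / fact n) * of_real (\<integral>x. u x * x^n \<partial>lborel))"
      by (simp only: integral_mult_right_zero integral_complex_of_real)
    finally show ?thesis by (simp add: zero)
  qed
  have "(\<lambda>N. integral\<^sup>L lborel (s N)) \<longlonglongrightarrow> (\<integral>x. of_real (u x) * iexp (t * x) \<partial>lborel)"
  proof (rule integral_dominated_convergence[where w = "\<lambda>x. \<bar>u x\<bar> * exp (\<bar>t\<bar> * \<bar>x\<bar>)"])
    show "(\<lambda>x. complex_of_real (u x) * iexp (t * x)) \<in> borel_measurable lborel" by measurable
    show "s N \<in> borel_measurable lborel" for N unfolding s_def by measurable
    show "AE x in lborel. (\<lambda>N. s N x) \<longlonglongrightarrow> complex_of_real (u x) * iexp (t * x)"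
      unfolding s_def using exp_converges unfolding sums_def by (intro AE_I2 tendsto_mult tendsto_const) blast
    show "AE x in lborel. norm (s N x) \<le> \<bar>u x\<bar> * exp (\<bar>t\<bar> * \<bar>x\<bar>)" for N
    proof (rule AE_I2)
      fix x
      have "cmod (\<Sum>n<N. (\<i> * of_real (t * x))^n /\<^sub>R fact n) \<le> (\<Sum>n<N. \<bar>t * x\<bar>^n /\<^sub>R fact n)"
        by (rule order_trans[OF norm_sum]) (simp add: norm_mult norm_power abs_mult)
      also have "\<dots> \<le> exp \<bar>t * x\<bar>" unfolding exp_def by (intro sum_le_suminf summable_exp_generic) auto
      finally show "norm (s N x) \<le> \<bar>u x\<bar> * exp (\<bar>t\<bar> * \<bar>x\<bar>)"
        unfolding s_def norm_mult by (intro mult_mono) (auto simp: abs_mult)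
    qed
  qed (use int in auto)
  then have "(\<lambda>N. 0) \<longlonglongrightarrow> (\<integral>x. of_real (u x) * iexp (t * x) \<partial>lborel)" by (simp only: s0)
  then show ?thesis by (simp only: LIMSEQ_const_iff)
qed

lemma real_distribution_density:
  fixes p :: "real \<Rightarrow> real"
  assumes [measurable]: "p \<in> borel_measurable borel" and p: "\<And>x. p x \<ge> 0" "integrable lborel p" "integral\<^sup>L lborel p = 1"
  shows "real_distribution (density lborel p)" "char (density lborel p) t = (\<integral>x. of_real (p x) * iexp (t * x) \<partial>lborel)"
proof -
  have "prob_space (density lborel p)"
    by (rule prob_spaceI) (use p in \<open>simp add: emeasure_density nn_integral_eq_integral\<close>)
  then show "real_distribution (density lborel p)" by (simp add: real_distribution_def real_distribution_axioms_def)
  show "char (density lborel p) t = (\<integral>x. of_real (p x) * iexp (t * x) \<partial>lborel)"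
    unfolding char_def by (subst integral_density) (use p in \<open>auto simp: scaleR_conv_of_real\<close>)
qed

text \<open>Positive and negative part have equal mass by the case t = 0; normalised, they are
  probability densities with the same characteristic function, hence equal by Levy's uniqueness
  theorem.\<close>

lemma AE_eq_0_of_fourier:
  fixes u :: "real \<Rightarrow> real"
  assumes [measurable]: "u \<in> borel_measurable borel" and int: "integrable lborel u"
    and F: "\<And>t. (\<integral>x. of_real (u x) * iexp (t * x) \<partial>lborel) = 0"
  shows "AE x in lborel. u x = 0"
proof -
  define p q where "p x = max 0 (u x)" and "q x = max 0 (- u x)" for x
  have [measurable]: "p \<in> borel_measurable borel" "q \<in> borel_measurable borel" unfolding p_def q_def by measurable
  have ip: "integrable lborel p" unfolding p_def[abs_def] using int by (intro integrable_max) auto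
  have iq: "integrable lborel q" unfolding q_def[abs_def] using int by (intro integrable_max) auto
  have pq: "u x = p x - q x" "p x \<ge> 0" "q x \<ge> 0" for x by (auto simp: p_def q_def)
  have ie: "integrable lborel (\<lambda>x. of_real (f x) * iexp (t * x))" if "integrable lborel f" for f :: "real \<Rightarrow> real" and t
    by (rule Bochner_Integration.integrable_bound[OF that]) (use that in \<open>auto simp: norm_mult\<close>)
  have Feq: "(\<integral>x. of_real (p x) * iexp (t * x) \<partial>lborel) = (\<integral>x. of_real (q x) * iexp (t * x) \<partial>lborel)" for t
    using F[of t] ie[OF ip] ie[OF iq] by (simp add: pq(1) left_diff_distrib)
  define m where "m = integral\<^sup>L lborel p"
  have mq: "integral\<^sup>L lborel q = m" using Feq[of 0] by (simp add: m_def integral_complex_of_real)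
  show ?thesis
  proof (cases "m = 0")
    case True
    then have "AE x in lborel. p x = 0" "AE x in lborel. q x = 0"
      using integral_nonneg_eq_0_iff_AE[OF ip] integral_nonneg_eq_0_iff_AE[OF iq] pq mq by (auto simp: m_def)
    then show ?thesis by eventually_elim (simp add: pq(1))
  next
    case False
    have "m \<ge> 0" unfolding m_def by (rule integral_nonneg_AE) (simp add: pq)
    then have m: "m > 0" using False by simp
    have P: "real_distribution (density lborel (\<lambda>x. ennreal (p x / m)))"
        "char (density lborel (\<lambda>x. ennreal (p x / m))) t = (\<integral>x. of_real (p x / m) * iexp (t * x) \<partial>lborel)" for t
      by (rule real_distribution_density; use ip m pq in \<open>auto simp: m_def\<close>)+
    have Q: "real_distribution (density lborel (\<lambda>x. ennreal (q x / m)))"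
        "char (density lborel (\<lambda>x. ennreal (q x / m))) t = (\<integral>x. of_real (q x / m) * iexp (t * x) \<partial>lborel)" for t
      by (rule real_distribution_density; use iq m pq mq in \<open>auto\<close>)+
    have "char (density lborel (\<lambda>x. ennreal (p x / m))) = char (density lborel (\<lambda>x. ennreal (q x / m)))"
    proof (rule ext)
      fix t
      have "(\<integral>x. of_real (f x / m) * iexp (t * x) \<partial>lborel) = (\<integral>x. of_real (f x) * iexp (t * x) \<partial>lborel) / of_real m"
        for f :: "real \<Rightarrow> real"
        by (subst integral_divide_zero[symmetric]) simp
      then show "char (density lborel (\<lambda>x. ennreal (p x / m))) t = char (density lborel (\<lambda>x. ennreal (q x / m))) t"
        unfolding P(2) Q(2) by (simp only: Feq)
    qed
    then have "density lborel (\<lambda>x. ennreal (p x / m)) = density lborel (\<lambda>x. ennreal (q x / m))"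
      by (rule Levy_uniqueness[OF P(1) Q(1)])
    then have "AE x in lborel. ennreal (p x / m) = ennreal (q x / m)"
      by (subst (asm) sigma_finite_measure.density_unique_iff[OF sigma_finite_lborel]) auto
    then show ?thesis by eventually_elim (use m pq in \<open>simp add: pq(1)\<close>)
  qed
qed

lemma gauss_exp_bound: "c > 0 \<Longrightarrow> exp (- (c * x\<^sup>2)) * exp (b * \<bar>x\<bar>) \<le> exp (b\<^sup>2 / (4 * c)) " for x b c :: real
proof -
  assume c: "c > 0"
  have "0 \<le> (2 * c * \<bar>x\<bar> - b)\<^sup>2" by simp
  then have "b * \<bar>x\<bar> - c * x\<^sup>2 \<le> b\<^sup>2 / (4 * c)"
    using c by (simp add: power2_eq_square field_simps)
  then show ?thesis by (simp add: exp_add[symmetric])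
qed

text \<open>Multiplied by a Gaussian, \<open>g\<close> has exponential moments and is orthogonal to
  all polynomials, so its Fourier transform vanishes. The integrability hypothesis is the form that
  Fubini's theorem delivers for sections and partial coefficients in two variables.\<close>

lemma hermite_complete_1d:
  fixes g :: "real \<Rightarrow> complex"
  assumes [measurable]: "g \<in> borel_measurable borel" and s: "s > 0"
    and int: "integrable lborel (\<lambda>x. cmod (g x) * exp (- (s * x)\<^sup>2 / 8))"
    and zero: "\<And>n. (\<integral>x. g x * of_real (hf n (s * x)) \<partial>lborel) = 0"
  shows "AE x in lborel. g x = 0"
proof -
  define u where "u x = g x * of_real (exp (- (s * x)\<^sup>2 / 4))" for x
  have [measurable]: "u \<in> borel_measurable borel" unfolding u_def by measurable
  have iu: "integrable lborel (\<lambda>x. cmod (u x) * exp (c * \<bar>x\<bar>))" for c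
  proof (rule Bochner_Integration.integrable_bound)
    show "integrable lborel (\<lambda>x. exp (c\<^sup>2 / (4 * (s\<^sup>2 / 8))) * (cmod (g x) * exp (- (s * x)\<^sup>2 / 8)))"
      by (intro integrable_mult_right int)
    show "AE x in lborel. norm (cmod (u x) * exp (c * \<bar>x\<bar>))
        \<le> norm (exp (c\<^sup>2 / (4 * (s\<^sup>2 / 8))) * (cmod (g x) * exp (- (s * x)\<^sup>2 / 8)))"
    proof (rule AE_I2)
      fix x
      have "cmod (u x) * exp (c * \<bar>x\<bar>) = (cmod (g x) * exp (- (s * x)\<^sup>2 / 8)) * (exp (- (s\<^sup>2 / 8 * x\<^sup>2)) * exp (c * \<bar>x\<bar>))"
        by (simp add: u_def norm_mult exp_add[symmetric] power_mult_distrib field_simps)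
      also have "\<dots> \<le> (cmod (g x) * exp (- (s * x)\<^sup>2 / 8)) * exp (c\<^sup>2 / (4 * (s\<^sup>2 / 8)))"
        using s by (intro mult_left_mono gauss_exp_bound) auto
      finally show "norm (cmod (u x) * exp (c * \<bar>x\<bar>))
        \<le> norm (exp (c\<^sup>2 / (4 * (s\<^sup>2 / 8))) * (cmod (g x) * exp (- (s * x)\<^sup>2 / 8)))" by (simp add: mult.commute)
    qed
  qed measurable
  have iup: "integrable lborel (\<lambda>x. u x * of_real (poly p (s * x)))" for p
  proof -
    obtain C where C: "C \<ge> 0" "\<And>x. \<bar>poly p x\<bar> \<le> C * exp (1/8 * x\<^sup>2)" using poly_gauss_bound[of "1/8" p] by auto
    show ?thesis
    proof (rule Bochner_Integration.integrable_bound)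
      show "integrable lborel (\<lambda>x. C * (cmod (g x) * exp (- (s * x)\<^sup>2 / 8)))" by (intro integrable_mult_right int)
      show "AE x in lborel. norm (u x * of_real (poly p (s * x))) \<le> norm (C * (cmod (g x) * exp (- (s * x)\<^sup>2 / 8)))"
      proof (rule AE_I2)
        fix x
        have "norm (u x * of_real (poly p (s * x))) = cmod (g x) * exp (- (s * x)\<^sup>2 / 4) * \<bar>poly p (s * x)\<bar>"
          by (simp add: u_def norm_mult)
        also have "\<dots> \<le> cmod (g x) * exp (- (s * x)\<^sup>2 / 4) * (C * exp (1/8 * (s * x)\<^sup>2))"
          by (intro mult_left_mono C) auto
        also have "\<dots> = C * (cmod (g x) * exp (- (s * x)\<^sup>2 / 8))" by (simp add: exp_add[symmetric] field_simps)
        finally show "norm (u x * of_real (poly p (s * x))) \<le> norm (C * (cmod (g x) * exp (- (s * x)\<^sup>2 / 8)))"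
          using C(1) by simp
      qed
      show "(\<lambda>x. u x * complex_of_real (poly p (s * x))) \<in> borel_measurable lborel"
      proof -
        have [measurable]: "(\<lambda>x. poly p (s * x)) \<in> borel_measurable borel"
          by (intro borel_measurable_continuous_onI continuous_intros)
        show ?thesis by measurable
      qed
    qed
  qed
  have he0: "(\<integral>x. u x * of_real (poly (he n) (s * x)) \<partial>lborel) = 0" for n
  proof -
    have "u x * of_real (poly (he n) (s * x)) = of_real (sqrt (fact n * sqrt (2 * pi))) * (g x * of_real (hf n (s * x)))" for x
      by (simp add: u_def hf_def)
    then show ?thesis using zero[of n] by simp
  qed
  \<comment> \<open>Powers of x are reached through x he_n = he_(n+1) + n he_(n-1); carrying an
    arbitrary \<open>n\<close> along lets the induction on the power close.\<close>
  have mon: "(\<integral>x. u x * of_real (poly ([:0,1:]^k * he n) (s * x)) \<partial>lborel) = 0" for k n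
  proof (induction k arbitrary: n)
    case 0
    then show ?case using he0 by simp
  next
    case (Suc k)
    have "[:0,1:] * he n = he (Suc n) + of_nat n * he (n - 1)" using pderiv_he[of n] by simp
    moreover have "[:0,1:]^Suc k * he n = [:0,1:]^k * ([:0,1:] * he n)" by (simp only: power_Suc mult_ac)
    ultimately have "[:0,1:]^Suc k * he n = [:0,1:]^k * he (Suc n) + of_nat n * ([:0,1:]^k * he (n - 1))"
      by (simp only: distrib_left mult.left_commute)
    then have eq: "u x * of_real (poly ([:0,1:]^Suc k * he n) (s * x)) =
        u x * of_real (poly ([:0,1:]^k * he (Suc n)) (s * x)) + of_nat n * (u x * of_real (poly ([:0,1:]^k * he (n - 1)) (s * x)))" for x
      by (simp only: poly_add poly_mult of_nat_poly poly_smult) (simp add: algebra_simps)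
    show ?case
      unfolding eq
      by (subst Bochner_Integration.integral_add, intro iup, intro integrable_mult_right iup)
         (simp only: integral_mult_right_zero Suc, simp)
  qed
  have mom: "(\<integral>x. u x * of_real (x^n) \<partial>lborel) = 0" for n
  proof -
    have "(\<integral>x. of_real (s^n) * (u x * of_real (x^n)) \<partial>lborel) = 0"
      using mon[of n 0] by (simp add: power_mult_distrib mult_ac)
    then show ?thesis using s by simp
  qed
  have part: "AE x in lborel. L (u x) = 0" if L: "L = Re \<or> L = Im" for L
  proof (rule AE_eq_0_of_fourier)
    have bl: "bounded_linear L" using L bounded_linear_Re bounded_linear_Im by blast
    show [measurable]: "(\<lambda>x. L (u x)) \<in> borel_measurable borel" using L by auto
    have Lle: "\<bar>L z\<bar> \<le> cmod z" for z using L abs_Re_le_cmod abs_Im_le_cmod by blast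
    have ic: "integrable lborel (\<lambda>x. \<bar>L (u x)\<bar> * exp (c * \<bar>x\<bar>))" for c
      by (rule Bochner_Integration.integrable_bound[OF iu[of c]]) (use Lle in \<open>auto intro: mult_right_mono\<close>)
    show "integrable lborel (\<lambda>x. L (u x))"
      by (rule Bochner_Integration.integrable_bound[OF ic[of 0]]) auto
    show "(\<integral>x. of_real (L (u x)) * iexp (t * x) \<partial>lborel) = 0" for t
    proof (rule fourier_eq_0_of_moments[OF _ ic])
      fix n
      have iux: "integrable lborel (\<lambda>x. u x * of_real (x^n))"
      proof -
        have "integrable lborel (\<lambda>x. of_real (1 / s^n) * (u x * of_real (poly ([:0,1:]^n) (s * x))))"
          by (intro integrable_mult_right iup)
        then show ?thesis using s by (simp add: power_mult_distrib)
      qed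
      have "(\<integral>x. L (u x * of_real (x^n)) \<partial>lborel) = L (\<integral>x. u x * of_real (x^n) \<partial>lborel)"
        by (rule integral_bounded_linear[OF bl iux])
      moreover have "L (z * of_real r) = L z * r" for z r using L by auto
      ultimately show "(\<integral>x. L (u x) * x^n \<partial>lborel) = 0" using mom[of n] L by auto
    qed simp
  qed
  have "AE x in lborel. Re (u x) = 0" "AE x in lborel. Im (u x) = 0" using part by auto
  then show ?thesis by eventually_elim (auto simp: u_def complex_eq_iff)
qed

section \<open>Tensor products of Hermite functions in the plane\<close>

lemma lborel_prod_integral:
  fixes u w :: "real \<Rightarrow> 'a::{real_normed_field,banach,second_countable_topology}"
  assumes u: "integrable lborel u" and w: "integrable lborel w"
  shows "integrable lborel (\<lambda>p::real \<times> real. u (fst p) * w (snd p))"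
    and "(\<integral>p. u (fst p) * w (snd p) \<partial>lborel) = integral\<^sup>L lborel u * integral\<^sup>L lborel w"
proof -
  have [measurable]: "u \<in> borel_measurable borel" "w \<in> borel_measurable borel"
    using u w by auto
  have i: "integrable (lborel \<Otimes>\<^sub>M lborel) (\<lambda>p::real \<times> real. u (fst p) * w (snd p))"
  proof (rule lborel_pair.Fubini_integrable)
    show "(\<lambda>p::real \<times> real. u (fst p) * w (snd p)) \<in> borel_measurable (lborel \<Otimes>\<^sub>M lborel)" by measurable
    show "integrable lborel (\<lambda>x. \<integral>y. norm (u (fst (x, y)) * w (snd (x, y))) \<partial>lborel)"
      using u w by (simp add: norm_mult)
    show "AE x in lborel. integrable lborel (\<lambda>y. u (fst (x, y)) * w (snd (x, y)))" using w by simp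
  qed
  then show "integrable lborel (\<lambda>p::real \<times> real. u (fst p) * w (snd p))" by (simp add: lborel_prod)
  show "(\<integral>p. u (fst p) * w (snd p) \<partial>lborel) = integral\<^sup>L lborel u * integral\<^sup>L lborel w"
    using lborel_pair.integral_fst'[OF i] by (simp add: lborel_prod)
qed

text \<open>A common square integrable majorant. The exponent 1/8 instead of 1/4 leaves room for the
  polynomial factors of Hermite functions and their derivatives.\<close>

definition gw :: "real \<Rightarrow> real \<times> real \<Rightarrow> real" where
  "gw s p = exp (- (s * fst p)\<^sup>2 / 8) * exp (- (snd p)\<^sup>2 / 8)"

lemma gw_pos: "gw s p > 0" by (simp add: gw_def)

lemma continuous_on_gw: "continuous_on UNIV (gw s)"
  unfolding gw_def by (intro continuous_intros) auto

lemma gw_measurable [measurable]: "gw s \<in> borel_measurable borel"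
  by (rule borel_measurable_continuous_onI[OF continuous_on_gw])

lemma gw_sq_integrable: "s > 0 \<Longrightarrow> integrable lborel (\<lambda>p. (gw s p)\<^sup>2)"
proof -
  assume s: "s > 0"
  have "integrable lborel (\<lambda>p::real \<times> real. exp (- (s\<^sup>2/4 * (fst p)\<^sup>2)) * exp (- (1/4 * (snd p)\<^sup>2)))"
    using lborel_prod_integral(1)[OF integrable_gauss[of "s\<^sup>2/4"] integrable_gauss[of "1/4"]] s by simp
  moreover have "exp (- (s\<^sup>2/4 * (fst p)\<^sup>2)) * exp (- (1/4 * (snd p)\<^sup>2)) = (gw s p)\<^sup>2" for p
    unfolding gw_def power_mult_distrib exp_double[symmetric] by (simp add: power_mult_distrib)
  ultimately show ?thesis by simp
qed

lemma sq_int_gw_bounded: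
  assumes "f \<in> borel_measurable borel" "s > 0" "\<And>p. cmod (f p) \<le> C * gw s p"
  shows "sq_int f"
  unfolding sq_int_def
proof
  show "integrable lborel (\<lambda>p. (cmod (f p))\<^sup>2)"
  proof (rule Bochner_Integration.integrable_bound)
    show "integrable lborel (\<lambda>p. C\<^sup>2 * (gw s p)\<^sup>2)" by (intro integrable_mult_right gw_sq_integrable assms)
    show "AE p in lborel. norm ((cmod (f p))\<^sup>2) \<le> norm (C\<^sup>2 * (gw s p)\<^sup>2)"
      using power_mono[OF assms(3), of _ 2] by (auto simp: power_mult_distrib)
  qed (use assms in measurable)
qed (use assms in simp)

lemma sq_int_gw: "s > 0 \<Longrightarrow> sq_int (\<lambda>p. complex_of_real (gw s p))"
  by (rule sq_int_gw_bounded[of _ s 1]) (auto simp: gw_pos less_imp_le)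

definition Hfun :: "real \<Rightarrow> nat \<times> nat \<Rightarrow> real \<times> real \<Rightarrow> complex" where
  "Hfun s i p = of_real (sqrt s * hf (fst i) (s * fst p) * hf (snd i) (snd p))"

lemma continuous_on_Hfun: "continuous_on UNIV (Hfun s i)"
  unfolding Hfun_def by (intro continuous_intros)

lemma Hfun_measurable [measurable]: "Hfun s i \<in> borel_measurable borel"
  by (rule borel_measurable_continuous_onI[OF continuous_on_Hfun])

lemma cnj_Hfun [simp]: "cnj (Hfun s i p) = Hfun s i p" by (simp add: Hfun_def)

lemma Hfun_bound: "\<exists>C\<ge>0. \<forall>p. cmod (Hfun s i p) \<le> C * gw s p" if "s > 0"
proof -
  obtain C D where C: "C \<ge> 0" "\<And>x. \<bar>hf (fst i) x\<bar> \<le> C * exp (- x\<^sup>2 / 8)" and D: "D \<ge> 0" "\<And>x. \<bar>hf (snd i) x\<bar> \<le> D * exp (- x\<^sup>2 / 8)"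
    using hf_bound by metis
  have "cmod (Hfun s i p) \<le> (sqrt s * C * D) * gw s p" for p
  proof -
    have "cmod (Hfun s i p) = sqrt s * \<bar>hf (fst i) (s * fst p)\<bar> * \<bar>hf (snd i) (snd p)\<bar>"
      unfolding Hfun_def norm_of_real using that by (simp add: abs_mult)
    also have "\<dots> \<le> sqrt s * (C * exp (- (s * fst p)\<^sup>2 / 8)) * (D * exp (- (snd p)\<^sup>2 / 8))"
      using that C D by (intro mult_mono mult_left_mono C(2) D(2)) auto
    finally show ?thesis by (simp add: gw_def mult_ac)
  qed
  then show ?thesis using that C D by (intro exI[of _ "sqrt s * C * D"]) auto
qed

lemma sq_int_Hfun: "s > 0 \<Longrightarrow> sq_int (Hfun s i)"
  by (metis Hfun_bound Hfun_measurable sq_int_gw_bounded)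

definition HH :: "real \<Rightarrow> nat \<times> nat \<Rightarrow> l2" where "HH s i = abs_l2 (Hfun s i)"

lemma cinner_HH: "s > 0 \<Longrightarrow> cinner f (HH s i) = (\<integral>p. rep_l2 f p * Hfun s i p \<partial>lborel)"
  using cinner_abs_l2[of "rep_l2 f" "Hfun s i"] by (simp add: HH_def sq_int_Hfun)

lemma HH_orthonormal: "s > 0 \<Longrightarrow> cinner (HH s i) (HH s j) = (if i = j then 1 else 0)"
proof -
  assume s: "s > 0"
  have "cinner (HH s i) (HH s j) = (\<integral>p. Hfun s i p * Hfun s j p \<partial>lborel)"
    unfolding HH_def using cinner_abs_l2[OF sq_int_Hfun[OF s] sq_int_Hfun[OF s]] by simp
  also have "\<dots> = (\<integral>p. complex_of_real ((s * (hf (fst i) (0 + s * fst p) * hf (fst j) (0 + s * fst p))) * (hf (snd i) (snd p) * hf (snd j) (snd p))) \<partial>lborel)"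
  proof (rule arg_cong[where f = "integral\<^sup>L lborel"], rule ext)
    fix p :: "real \<times> real"
    have "complex_of_real (sqrt s) * complex_of_real (sqrt s) = of_real s"
      using s by (simp only: of_real_mult[symmetric]) simp
    then show "Hfun s i p * Hfun s j p = complex_of_real ((s * (hf (fst i) (0 + s * fst p) * hf (fst j) (0 + s * fst p))) * (hf (snd i) (snd p) * hf (snd j) (snd p)))"
      unfolding Hfun_def by (simp add: mult_ac)
  qed
  also have "\<dots> = of_real (\<integral>p. (s * (hf (fst i) (0 + s * fst p) * hf (fst j) (0 + s * fst p))) * (hf (snd i) (snd p) * hf (snd j) (snd p)) \<partial>lborel)"
    by (rule integral_complex_of_real)
  also have "(\<integral>p. (s * (hf (fst i) (0 + s * fst p) * hf (fst j) (0 + s * fst p))) * (hf (snd i) (snd p) * hf (snd j) (snd p)) \<partial>lborel)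
     = (\<integral>x. s * (hf (fst i) (0 + s * x) * hf (fst j) (0 + s * x)) \<partial>lborel) * (\<integral>v. hf (snd i) v * hf (snd j) v \<partial>lborel)"
  proof (rule lborel_prod_integral(2)[OF _ integrable_hf_hf])
    show "integrable lborel (\<lambda>x. s * (hf (fst i) (0 + s * x) * hf (fst j) (0 + s * x)))"
      using lborel_integrable_real_affine[OF integrable_hf_hf, where c = s and t = 0] s by (intro integrable_mult_right) auto
  qed
  also have "(\<integral>x. s * (hf (fst i) (0 + s * x) * hf (fst j) (0 + s * x)) \<partial>lborel) = (\<integral>x. hf (fst i) x * hf (fst j) x \<partial>lborel)"
    using lborel_integral_real_affine[of s "\<lambda>x. hf (fst i) x * hf (fst j) x" 0] s by simp
  finally show ?thesis by (auto simp: hf_orthonormal prod_eq_iff)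
qed

text \<open>Completeness in one variable is applied twice: in x to the partial coefficients
  \<open>g n\<close>, then in v to almost every section of \<open>F\<close>. As there are countably
  many \<open>n\<close>, one null set of x serves all of them.\<close>

lemma HH_total:
  assumes s: "s > 0" and z: "\<And>i. cinner f (HH s i) = 0"
  shows "f = 0"
proof -
  define F where "F = rep_l2 f"
  have sF: "sq_int F" by (simp add: F_def)
  have [measurable]: "F \<in> borel_measurable (borel \<Otimes>\<^sub>M borel)"
    using sF by (simp add: sq_int_def borel_prod)
  have ip: "integrable (lborel \<Otimes>\<^sub>M lborel) (\<lambda>p. F p * h p)" if "sq_int h" "\<And>p. cnj (h p) = h p" for h
    using sq_int_prod[OF sF that(1)] that(2) by (simp add: lborel_prod)
  have m1: "(\<lambda>p. complex_of_real (hf n (snd p) * exp (- (s * fst p)\<^sup>2 / 8))) \<in> borel_measurable borel" for n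
    by (intro borel_measurable_continuous_onI continuous_intros) auto
  have sq1: "sq_int (\<lambda>p. complex_of_real (hf n (snd p) * exp (- (s * fst p)\<^sup>2 / 8)))" for n
  proof -
    obtain D where D: "D \<ge> 0" "\<And>x. \<bar>hf n x\<bar> \<le> D * exp (- x\<^sup>2 / 8)" using hf_bound by metis
    show ?thesis
    proof (rule sq_int_gw_bounded[OF m1 s, of _ D])
      fix p :: "real \<times> real"
      have "\<bar>hf n (snd p)\<bar> * exp (- (s * fst p)\<^sup>2 / 8) \<le> D * exp (- (snd p)\<^sup>2 / 8) * exp (- (s * fst p)\<^sup>2 / 8)"
        by (intro mult_right_mono D) auto
      then show "cmod (complex_of_real (hf n (snd p) * exp (- (s * fst p)\<^sup>2 / 8))) \<le> D * gw s p"
        unfolding norm_of_real gw_def abs_mult by (simp add: mult_ac)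
    qed
  qed
  define g where "g n x = (\<integral>v. F (x, v) * of_real (hf n v) \<partial>lborel)" for n x
  have [measurable]: "g n \<in> borel_measurable borel" for n unfolding g_def by measurable
  have g0: "AE x in lborel. g n x = 0" for n
  proof (rule hermite_complete_1d[OF _ s])
    have "integrable lborel (\<lambda>x. \<integral>v. F (x, v) * complex_of_real (hf n (snd (x, v)) * exp (- (s * fst (x, v))\<^sup>2 / 8)) \<partial>lborel)"
      by (rule lborel_pair.integrable_fst'[OF ip[OF sq1]]) simp
    moreover have "(\<integral>v. F (x, v) * complex_of_real (hf n (snd (x, v)) * exp (- (s * fst (x, v))\<^sup>2 / 8)) \<partial>lborel)
        = g n x * of_real (exp (- (s * x)\<^sup>2 / 8))" for x
      unfolding g_def integral_mult_left_zero[symmetric] by (simp add: mult_ac)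
    ultimately have "integrable lborel (\<lambda>x. g n x * of_real (exp (- (s * x)\<^sup>2 / 8)))" by simp
    from integrable_norm[OF this] show "integrable lborel (\<lambda>x. cmod (g n x) * exp (- (s * x)\<^sup>2 / 8))"
      by (simp add: norm_mult)
    fix m
    have "(\<integral>x. \<integral>v. F (x, v) * Hfun s (m, n) (x, v) \<partial>lborel \<partial>lborel) = (\<integral>p. F p * Hfun s (m, n) p \<partial>lborel)"
      using lborel_pair.integral_fst'[OF ip[OF sq_int_Hfun[OF s]]] by (simp add: lborel_prod)
    also have "\<dots> = 0" using z[of "(m, n)"] cinner_HH[OF s] by (simp add: F_def)
    finally have 0: "(\<integral>x. \<integral>v. F (x, v) * Hfun s (m, n) (x, v) \<partial>lborel \<partial>lborel) = 0" .
    have "(\<integral>v. F (x, v) * Hfun s (m, n) (x, v) \<partial>lborel) = of_real (sqrt s) * (g n x * of_real (hf m (s * x)))" for x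
      unfolding g_def integral_mult_left_zero[symmetric] integral_mult_right_zero[symmetric] Hfun_def by (simp add: mult_ac)
    with 0 show "(\<integral>x. g n x * complex_of_real (hf m (s * x)) \<partial>lborel) = 0" using s by simp
  qed simp
  have "AE x in lborel. integrable lborel (\<lambda>v. F (x, v) * complex_of_real (gw s (x, v)))"
    by (rule lborel_pair.AE_integrable_fst'[OF ip[OF sq_int_gw[OF s]]]) simp
  moreover have "AE x in lborel. \<forall>n. g n x = 0" using g0 by (simp add: AE_all_countable)
  ultimately have "AE x in lborel. AE v in lborel. F (x, v) = 0"
  proof eventually_elim
    case (elim x)
    show ?case
    proof (rule hermite_complete_1d[where s = 1])
      have "integrable lborel (\<lambda>v. cmod (F (x, v) * complex_of_real (gw s (x, v))))" using elim(1) by (rule integrable_norm)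
      then have "integrable lborel (\<lambda>v. (1 / exp (- (s * x)\<^sup>2 / 8)) * cmod (F (x, v) * complex_of_real (gw s (x, v))))"
        by (rule integrable_mult_right)
      then show "integrable lborel (\<lambda>v. cmod (F (x, v)) * exp (- (1 * v)\<^sup>2 / 8))"
        by (simp add: norm_mult gw_def mult_ac)
      show "(\<integral>v. F (x, v) * complex_of_real (hf n (1 * v)) \<partial>lborel) = 0" for n
        using elim(2) by (simp add: g_def)
    qed simp_all
  qed
  then have "AE p in lborel \<Otimes>\<^sub>M lborel. F p = 0"
  proof (rule lborel_pair.AE_pair_measure[rotated])
    have [measurable]: "F \<in> borel_measurable (lborel \<Otimes>\<^sub>M lborel)" using sF by (simp add: sq_int_def lborel_prod)
    show "{p \<in> space (lborel \<Otimes>\<^sub>M lborel). F p = 0} \<in> sets (lborel \<Otimes>\<^sub>M lborel)" by measurable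
  qed
  then have "AE p in lborel. F p = 0" unfolding lborel_prod .
  then have "abs_l2 F = abs_l2 (\<lambda>_. 0)" using abs_l2_eq_iff[OF sF sq_int_zero] by simp
  then show ?thesis by (simp add: F_def zero_l2_def)
qed

lemma fock_HH: "s > 0 \<Longrightarrow> fock (HH s)"
  unfolding fock_def
  by (rule orth_basis.intro) (auto simp: HH_orthonormal finite_lev intro: HH_total)

section \<open>Test functions\<close>

text \<open>One-variable counterpart of \<open>Ck\<close>, so that smoothness of products U(x) V(v)
  reduces to that of the factors.\<close>

primrec smooth1 :: "nat \<Rightarrow> (real \<Rightarrow> complex) \<Rightarrow> bool" where
  "smooth1 0 u \<longleftrightarrow> continuous_on UNIV u"
| "smooth1 (Suc k) u \<longleftrightarrow> (\<exists>u'. (\<forall>x. (u has_vector_derivative u' x) (at x)) \<and> smooth1 k u')"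

lemma smooth1_continuous: "smooth1 k u \<Longrightarrow> continuous_on UNIV u"
  by (cases k) (auto simp: continuous_on_eq_continuous_at intro: has_vector_derivative_continuous)

lemma smooth1_SucI: "(\<And>x. (u has_vector_derivative u' x) (at x)) \<Longrightarrow> smooth1 k u' \<Longrightarrow> smooth1 (Suc k) u"
  by auto

lemma smooth1_SucD: "smooth1 (Suc k) u \<Longrightarrow> smooth1 k u"
proof (induction k arbitrary: u)
  case 0
  then show ?case using smooth1_continuous[OF 0] by simp
next
  case (Suc k)
  then obtain u' where "\<forall>x. (u has_vector_derivative u' x) (at x)" "smooth1 (Suc k) u'" by auto
  with Suc.IH[of u'] show ?case by auto
qed

lemma smooth1_add: "smooth1 k u \<Longrightarrow> smooth1 k w \<Longrightarrow> smooth1 k (\<lambda>x. u x + w x)"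
proof (induction k arbitrary: u w)
  case 0
  then show ?case by (auto intro: continuous_intros)
next
  case (Suc k)
  then obtain u' w' where "\<forall>x. (u has_vector_derivative u' x) (at x)" "smooth1 k u'"
    "\<forall>x. (w has_vector_derivative w' x) (at x)" "smooth1 k w'" by auto
  with Suc.IH[of u' w'] show ?case by (auto intro!: exI[of _ "\<lambda>x. u' x + w' x"] has_vector_derivative_add)
qed

lemma smooth1_mult: "smooth1 k u \<Longrightarrow> smooth1 k w \<Longrightarrow> smooth1 k (\<lambda>x. u x * w x)"
proof (induction k arbitrary: u w)
  case 0
  then show ?case by (auto intro: continuous_intros)
next
  case (Suc k)
  then obtain u' w' where u: "\<forall>x. (u has_vector_derivative u' x) (at x)" "smooth1 k u'"
    and w: "\<forall>x. (w has_vector_derivative w' x) (at x)" "smooth1 k w'" by auto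
  show ?case
  proof (rule smooth1_SucI[where u' = "\<lambda>x. u x * w' x + u' x * w x"])
    show "((\<lambda>x. u x * w x) has_vector_derivative u x * w' x + u' x * w x) (at x)" for x
      using u(1) w(1) by (intro has_vector_derivative_mult) auto
    show "smooth1 k (\<lambda>x. u x * w' x + u' x * w x)"
      by (rule smooth1_add[OF Suc.IH[OF smooth1_SucD[OF Suc.prems(1)] w(2)] Suc.IH[OF u(2) smooth1_SucD[OF Suc.prems(2)]]])
  qed
qed

lemma smooth1_const: "smooth1 k (\<lambda>_. c)"
proof (induction k arbitrary: c)
  case (Suc k)
  then show ?case by (auto intro!: exI[of _ "\<lambda>_. 0"] has_vector_derivative_const)
qed simp

lemma smooth1_scale: "smooth1 k u \<Longrightarrow> smooth1 k (\<lambda>x. u (b + c * x))"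
proof (induction k arbitrary: u)
  case 0
  then show ?case by (auto intro!: continuous_on_compose2[of UNIV u] continuous_intros)
next
  case (Suc k)
  then obtain u' where u: "\<forall>x. (u has_vector_derivative u' x) (at x)" "smooth1 k u'" by auto
  have "((\<lambda>x. u (b + c * x)) has_vector_derivative c *\<^sub>R u' (b + c * x)) (at x)" for x
  proof -
    have "((\<lambda>x. b + c * x) has_vector_derivative c) (at x)"
      by (auto intro!: derivative_eq_intros simp: has_real_derivative_iff_has_vector_derivative[symmetric])
    from vector_diff_chain_at[OF this u(1)[rule_format]] show ?thesis by (simp add: o_def)
  qed
  then show ?case
    unfolding scaleR_conv_of_real
    by (rule smooth1_SucI) (intro smooth1_mult smooth1_const Suc.IH u)
qed

lemma has_vector_derivative_of_real:
  "(f has_real_derivative d) (at x) \<Longrightarrow> ((\<lambda>x. complex_of_real (f x)) has_vector_derivative of_real d) (at x)"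
  by (drule has_vector_derivative_of_real) simp_all

lemma smooth1_hf: "smooth1 k (\<lambda>x. complex_of_real (hf n x))"
proof (induction k arbitrary: n)
  case 0
  show ?case by (auto intro!: continuous_intros)
next
  case (Suc k)
  have eq: "of_real ((sqrt n * hf (n - 1) x - sqrt (Suc n) * hf (Suc n) x) / 2) =
      complex_of_real (sqrt n / 2) * of_real (hf (n - 1) x) + of_real (- sqrt (Suc n) / 2) * of_real (hf (Suc n) x)" for x
    by (simp add: field_simps)
  show ?case
    by (rule smooth1_SucI[OF has_vector_derivative_of_real[OF hf_deriv]], unfold eq)
       (intro smooth1_add smooth1_mult smooth1_const Suc)
qed

text \<open>The functions \<open>p(1/t) exp(-1/t)\<close> on \<open>t > 0\<close> for polynomials \<open>p\<close>: this class is closed under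
  differentiation.\<close>

definition flatf :: "real poly \<Rightarrow> real \<Rightarrow> real" where
  "flatf p t = (if t > 0 then poly p (1 / t) * exp (- 1 / t) else 0)"

lemma poly_exp_tendsto_0: "c > 0 \<Longrightarrow> ((\<lambda>y::real. poly p y * exp (- c * y)) \<longlongrightarrow> 0) at_top"
proof (induction p arbitrary: c rule: pCons_induct)
  case (pCons a p)
  have "((\<lambda>y::real. a * exp (- c * y) + (y * exp (- (c/2) * y)) * (poly p y * exp (- (c/2) * y))) \<longlongrightarrow> a * 0 + 0 * 0) at_top"
  proof (intro tendsto_intros)
    show "((\<lambda>y::real. exp (- c * y)) \<longlongrightarrow> 0) at_top" using pCons.prems by real_asymp
    show "((\<lambda>y::real. y * exp (- (c/2) * y)) \<longlongrightarrow> 0) at_top" using pCons.prems by real_asymp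
    show "((\<lambda>y. poly p y * exp (- (c/2) * y)) \<longlongrightarrow> 0) at_top" using pCons.IH[of "c/2"] pCons.prems by simp
  qed
  moreover have "a * exp (- c * y) + (y * exp (- (c/2) * y)) * (poly p y * exp (- (c/2) * y)) = poly (pCons a p) y * exp (- c * y)" for y
  proof -
    have "exp (- (c/2) * y) * exp (- (c/2) * y) = exp (- c * y)" by (simp add: exp_add[symmetric])
    then show ?thesis by (simp add: algebra_simps)
  qed
  ultimately show ?case by simp
qed simp

text \<open>For t > 0 the chain rule brings out t^-2 (p - p')(1/t), which explains the new
  polynomial; at t = 0 the right-hand difference quotient is y p(y) exp (- y), where y is the
  inverse of the step and tends to infinity.\<close>

lemma flatf_deriv: "(flatf p has_real_derivative flatf ([:0,0,1:] * (p - pderiv p)) t) (at t)"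
proof -
  consider "t > 0" | "t < 0" | "t = 0" by linarith
  then show ?thesis
  proof cases
    case 1
    have i: "((\<lambda>t. 1 / t) has_real_derivative - (1 / t\<^sup>2)) (at t)"
    proof (rule DERIV_cong)
      show "((\<lambda>t. 1 / t) has_real_derivative (0 * t - 1 * 1) / (t * t)) (at t)"
        by (rule DERIV_divide) (use 1 in auto)
      show "(0 * t - 1 * 1) / (t * t) = - (1 / t\<^sup>2)" unfolding power2_eq_square by simp
    qed
    have "((\<lambda>t. poly p (1 / t) * exp (- (1 / t))) has_real_derivative
        (poly (pderiv p) (1 / t) * (- (1 / t\<^sup>2))) * exp (- (1 / t)) + (exp (- (1 / t)) * (1 / t\<^sup>2)) * poly p (1 / t)) (at t)"
    proof (rule DERIV_mult[OF DERIV_chain2[OF poly_DERIV i]])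
      show "((\<lambda>t. exp (- (1 / t))) has_real_derivative exp (- (1 / t)) * (1 / t\<^sup>2)) (at t)"
        using DERIV_chain2[OF DERIV_exp DERIV_minus[OF i]] by simp
    qed
    moreover have "(poly (pderiv p) (1 / t) * (- (1 / t\<^sup>2))) * exp (- (1 / t)) + (exp (- (1 / t)) * (1 / t\<^sup>2)) * poly p (1 / t)
        = flatf ([:0,0,1:] * (p - pderiv p)) t"
    proof -
      have "1 / t\<^sup>2 = (1 / t) * (1 / t)" by (simp add: power2_eq_square)
      then show ?thesis using 1 unfolding flatf_def by (simp only:) (simp add: algebra_simps)
    qed
    ultimately have "((\<lambda>t. poly p (1 / t) * exp (- (1 / t))) has_real_derivative flatf ([:0,0,1:] * (p - pderiv p)) t) (at t)" by simp
    then show ?thesis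
      by (rule has_field_derivative_transform_within_open[of _ _ _ "{0<..}"]) (use 1 in \<open>auto simp: flatf_def\<close>)
  next
    case 2
    have "((\<lambda>_. 0) has_real_derivative flatf ([:0,0,1:] * (p - pderiv p)) t) (at t)" using 2 by (simp add: flatf_def)
    then show ?thesis
      by (rule has_field_derivative_transform_within_open[of _ _ _ "{..<0}"]) (use 2 in \<open>auto simp: flatf_def\<close>)
  next
    case 3
    have "((\<lambda>h. flatf p h / h) \<longlongrightarrow> 0) (at 0)"
    proof (rule filterlim_split_at_real)
      show "((\<lambda>h. flatf p h / h) \<longlongrightarrow> 0) (at_left 0)"
        by (rule tendsto_eventually) (auto simp: flatf_def eventually_at_filter)
      have "((\<lambda>y. poly ([:0,1:] * p) y * exp (- 1 * y)) \<longlongrightarrow> 0) at_top" by (rule poly_exp_tendsto_0) simp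
      then have "((\<lambda>h. poly ([:0,1:] * p) (1 / h) * exp (- 1 * (1 / h))) \<longlongrightarrow> 0) (at_right 0)"
        by (rule filterlim_compose) real_asymp
      moreover have "\<forall>\<^sub>F h in at_right 0. poly ([:0,1:] * p) (1 / h) * exp (- 1 * (1 / h)) = flatf p h / h"
        by (auto simp: flatf_def eventually_at_filter)
      ultimately show "((\<lambda>h. flatf p h / h) \<longlongrightarrow> 0) (at_right 0)" by (simp only: tendsto_cong)
    qed
    then show ?thesis unfolding 3 by (simp add: has_field_derivative_iff flatf_def)
  qed
qed

lemma smooth1_flat: "smooth1 k (\<lambda>x. complex_of_real (flatf p x))"
proof (induction k arbitrary: p)
  case 0
  have "continuous_on UNIV (flatf p)"
    by (rule DERIV_continuous_on) (rule has_field_derivative_at_within[OF flatf_deriv])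
  then show ?case by (auto intro!: continuous_intros)
next
  case (Suc k)
  show ?case
    by (rule smooth1_SucI[where u' = "\<lambda>x. of_real (flatf ([:0,0,1:] * (p - pderiv p)) x)"])
       (rule has_vector_derivative_of_real[OF flatf_deriv], rule Suc)
qed

text \<open>Two flat functions vanishing beyond 1 and -1; the factor exp 2 normalises the value at 0
  to 1. The arguments are written as b + c x to fit \<open>smooth1_scale\<close>.\<close>

definition bump :: "real \<Rightarrow> complex" where
  "bump x = of_real (exp 2) * (of_real (flatf 1 (1 + 1 * x)) * of_real (flatf 1 (1 + (-1) * x)))"

lemma smooth1_bump: "smooth1 k bump"
  unfolding bump_def by (intro smooth1_mult smooth1_const smooth1_scale[of k "\<lambda>x. of_real (flatf 1 x)"] smooth1_flat)

lemma bump_0: "bump 0 = 1"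
proof -
  have "exp 2 * (exp (- 1) * exp (- 1)) = (1::real)" by (simp add: exp_add[symmetric])
  then show ?thesis unfolding bump_def flatf_def by (simp flip: of_real_mult)
qed

lemma bump_outside: "\<bar>x\<bar> \<ge> 1 \<Longrightarrow> bump x = 0"
  by (auto simp: bump_def flatf_def abs_if split: if_splits)

lemma vanishing_deriv:
  assumes "(f has_vector_derivative d) (at x)" "open S" "x \<in> S" "\<And>y. y \<in> S \<Longrightarrow> f y = 0"
  shows "d = (0 :: complex)"
proof -
  have "((\<lambda>_. 0) has_vector_derivative d) (at x)"
    by (rule has_vector_derivative_transform_within_open[OF assms(1-3)]) (use assms(4) in auto)
  then show ?thesis using has_vector_derivative_const vector_derivative_unique_at by blast
qed

lemma bump_derivs:
  obtains b1 b2 B where "\<And>x. (bump has_vector_derivative b1 x) (at x)" "\<And>x. (b1 has_vector_derivative b2 x) (at x)"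
    "\<And>x. cmod (bump x) \<le> B" "\<And>x. cmod (b1 x) \<le> B" "\<And>x. cmod (b2 x) \<le> B"
proof -
  obtain b1 b2 where b1: "\<And>x. (bump has_vector_derivative b1 x) (at x)" and b2: "\<And>x. (b1 has_vector_derivative b2 x) (at x)"
    and c: "continuous_on UNIV b2"
    using smooth1_bump[of "Suc (Suc 0)"] by auto
  have c0: "continuous_on UNIV bump" and c1: "continuous_on UNIV b1"
    using smooth1_continuous[OF smooth1_bump] b2
    by (auto simp: continuous_on_eq_continuous_at intro: has_vector_derivative_continuous)
  have op: "open {x::real. \<bar>x\<bar> > 1}" by (intro open_Collect_less continuous_intros)
  have z0: "bump x = 0" if "\<bar>x\<bar> > 1" for x using that bump_outside by simp
  have z1: "b1 x = 0" if "\<bar>x\<bar> > 1" for x by (rule vanishing_deriv[OF b1 op]) (use that z0 in auto)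
  have z2: "b2 x = 0" if "\<bar>x\<bar> > 1" for x by (rule vanishing_deriv[OF b2 op]) (use that z1 in auto)
  have bd: "\<exists>B. \<forall>x. cmod (f x) \<le> B" if f: "continuous_on UNIV f" and z: "\<And>x. \<bar>x\<bar> > 1 \<Longrightarrow> f x = 0" for f :: "real \<Rightarrow> complex"
  proof -
    have "compact (f ` {-1..1})" by (rule compact_continuous_image[OF continuous_on_subset[OF f]]) auto
    then obtain B where B: "\<And>x. x \<in> {-1..1} \<Longrightarrow> cmod (f x) \<le> B" using compact_imp_bounded bounded_iff by (metis imageI)
    have "cmod (f x) \<le> max B 0" for x
    proof (cases "\<bar>x\<bar> > 1")
      case False
      then have "x \<in> {-1..1}" by auto
      then show ?thesis using B by (simp add: le_max_iff_disj)
    qed (use z in simp)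
    then show ?thesis by blast
  qed
  obtain B0 B1 B2 where B: "\<And>x. cmod (bump x) \<le> B0" "\<And>x. cmod (b1 x) \<le> B1" "\<And>x. cmod (b2 x) \<le> B2"
    using bd[OF c0 z0] bd[OF c1 z1] bd[OF c z2] by blast
  show ?thesis
  proof (rule that[OF b1 b2, of "max B0 (max B1 B2)"])
    show "cmod (bump x) \<le> max B0 (max B1 B2)" "cmod (b1 x) \<le> max B0 (max B1 B2)" "cmod (b2 x) \<le> max B0 (max B1 B2)" for x
      using B[of x] by (auto simp: le_max_iff_disj)
  qed
qed

section \<open>Test functions of product form\<close>

lemma dx_tensor:
  assumes "\<And>x. (U has_vector_derivative U' x) (at x)"
  shows "dx (\<lambda>p. U (fst p) * V (snd p)) = (\<lambda>p. U' (fst p) * V (snd p))"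
proof (rule ext, clarify)
  fix x v
  have "((\<lambda>s. U s * V v) has_vector_derivative U' x * V v) (at x)"
    by (rule has_vector_derivative_mult_left[OF assms])
  then show "dx (\<lambda>p. U (fst p) * V (snd p)) (x, v) = U' (fst (x, v)) * V (snd (x, v))"
    by (simp add: dx_def vector_derivative_at)
qed

lemma dv_tensor:
  assumes "\<And>x. (V has_vector_derivative V' x) (at x)"
  shows "dv (\<lambda>p. U (fst p) * V (snd p)) = (\<lambda>p. U (fst p) * V' (snd p))"
proof (rule ext, clarify)
  fix x v
  have "((\<lambda>s. U x * V s) has_vector_derivative U x * V' v) (at v)"
    by (rule has_vector_derivative_mult_right[OF assms])
  then show "dv (\<lambda>p. U (fst p) * V (snd p)) (x, v) = U (fst (x, v)) * V' (snd (x, v))"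
    by (simp add: dv_def vector_derivative_at)
qed

lemma Ck_tensor: "smooth1 k U \<Longrightarrow> smooth1 k V \<Longrightarrow> Ck k (\<lambda>p. U (fst p) * V (snd p))"
proof (induction k arbitrary: U V)
  case 0
  then show ?case
    by (auto intro!: continuous_intros continuous_on_compose2[of UNIV U] continuous_on_compose2[of UNIV V])
next
  case (Suc k)
  then obtain U' V' where U: "\<And>x. (U has_vector_derivative U' x) (at x)" "smooth1 k U'"
    and V: "\<And>x. (V has_vector_derivative V' x) (at x)" "smooth1 k V'" by auto
  have "(\<lambda>p. U (fst p) * V (snd p)) differentiable (at p)" for p :: "real \<times> real"
  proof (rule differentiable_mult)
    show "(\<lambda>p. U (fst p)) differentiable (at p)"
      by (rule differentiable_compose[of U fst])
         (intro differentiableI_vector[OF U(1)] bounded_linear_imp_differentiable bounded_linear_fst)+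
    show "(\<lambda>p. V (snd p)) differentiable (at p)"
      by (rule differentiable_compose[of V snd])
         (intro differentiableI_vector[OF V(1)] bounded_linear_imp_differentiable bounded_linear_snd)+
  qed
  then show ?case
    using Suc.IH[OF U(2) smooth1_SucD[OF Suc.prems(2)]] Suc.IH[OF smooth1_SucD[OF Suc.prems(1)] V(2)]
    by (simp add: dx_tensor[OF U(1)] dv_tensor[OF V(1)])
qed

lemma test_fun_tensor:
  assumes U: "\<And>k. smooth1 k U" "\<And>x. \<bar>x\<bar> \<ge> R \<Longrightarrow> U x = 0" and V: "\<And>k. smooth1 k V" "\<And>x. \<bar>x\<bar> \<ge> R \<Longrightarrow> V x = 0"
  shows "test_fun (\<lambda>p. U (fst p) * V (snd p))"
  unfolding test_fun_def
proof
  show "\<forall>k. Ck k (\<lambda>p. U (fst p) * V (snd p))" using Ck_tensor U V by blast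
  have "closure {p. U (fst p) * V (snd p) \<noteq> 0} \<subseteq> {-R..R} \<times> {-R..R}"
  proof (rule closure_minimal)
    show "{p. U (fst p) * V (snd p) \<noteq> 0} \<subseteq> {-R..R} \<times> {-R..R}"
      using U(2) V(2) by (force simp: abs_le_iff not_le mem_Times_iff)
  qed (intro closed_Times closed_atLeastAtMost)
  then have eq: "closure {p. U (fst p) * V (snd p) \<noteq> 0} = ({-R..R} \<times> {-R..R}) \<inter> closure {p. U (fst p) * V (snd p) \<noteq> 0}"
    by blast
  show "compact (closure {p. U (fst p) * V (snd p) \<noteq> 0})"
    by (rule ssubst[OF eq], rule compact_Int_closed[OF compact_Times[OF compact_Icc compact_Icc] closed_closure])
qed

lemma K_transpose_tensor:
  assumes U: "\<And>x. (U has_vector_derivative U' x) (at x)" and V: "\<And>x. (V has_vector_derivative V' x) (at x)"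
    and V': "\<And>x. (V' has_vector_derivative V'' x) (at x)"
  shows "K_transpose a (\<lambda>p. U (fst p) * V (snd p)) (x, v) =
    - of_real v * U' x * V v + of_real (a * x) * U x * V' v - U x * V'' v + of_real (v\<^sup>2 / 4 - 1 / 2) * (U x * V v)"
proof -
  have "dx (\<lambda>(x, v). of_real v * (U (fst (x, v)) * V (snd (x, v)))) (x, v) = of_real v * (U' x * V v)"
  proof -
    have "((\<lambda>s. of_real v * (U s * V v)) has_vector_derivative of_real v * (U' x * V v)) (at x)"
      by (intro has_vector_derivative_mult_right has_vector_derivative_mult_left U)
    then show ?thesis by (simp add: dx_def vector_derivative_at)
  qed
  moreover have "dv (\<lambda>(x, v). of_real (a * x) * (U (fst (x, v)) * V (snd (x, v)))) (x, v) = of_real (a * x) * (U x * V' v)"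
  proof -
    have "((\<lambda>s. of_real (a * x) * (U x * V s)) has_vector_derivative of_real (a * x) * (U x * V' v)) (at v)"
      by (intro has_vector_derivative_mult_right V)
    then show ?thesis by (simp add: dv_def vector_derivative_at)
  qed
  ultimately show ?thesis
    unfolding K_transpose_def prod.case dv_tensor[OF V] dv_tensor[OF V'] by simp
qed

section \<open>The operator in the Hermite basis\<close>

definition gb :: "real \<Rightarrow> (real \<Rightarrow> complex) \<Rightarrow> bool" where
  "gb s f \<longleftrightarrow> (\<exists>C\<ge>0. \<forall>x. cmod (f x) \<le> C * exp (- (s * x)\<^sup>2 / 8))"

lemma gb_hf: "gb s (\<lambda>x. of_real (hf n (s * x)))"
  using hf_bound[of n] by (auto simp: gb_def)

lemma gb_add: "gb s f \<Longrightarrow> gb s g \<Longrightarrow> gb s (\<lambda>x. f x + g x)"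
  unfolding gb_def
proof (elim exE conjE)
  fix C D assume "0 \<le> C" "\<forall>x. cmod (f x) \<le> C * exp (- (s * x)\<^sup>2 / 8)" "0 \<le> D" "\<forall>x. cmod (g x) \<le> D * exp (- (s * x)\<^sup>2 / 8)"
  then show "\<exists>C\<ge>0. \<forall>x. cmod (f x + g x) \<le> C * exp (- (s * x)\<^sup>2 / 8)"
    by (intro exI[of _ "C + D"]) (auto simp: distrib_right intro!: order_trans[OF norm_triangle_ineq] add_mono)
qed

lemma gb_scale: "gb s f \<Longrightarrow> gb s (\<lambda>x. c * f x)"
  unfolding gb_def
proof (elim exE conjE)
  fix C assume "0 \<le> C" "\<forall>x. cmod (f x) \<le> C * exp (- (s * x)\<^sup>2 / 8)"
  then show "\<exists>C\<ge>0. \<forall>x. cmod (c * f x) \<le> C * exp (- (s * x)\<^sup>2 / 8)"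
    by (intro exI[of _ "cmod c * C"]) (auto simp: norm_mult mult.assoc intro!: mult_left_mono)
qed

text \<open>The Hermite functions are eigenfunctions of \<open>-\<partial>\<^sub>v\<^sup>2 + v\<^sup>2/4 - 1/2\<close>, and \<open>v \<partial>\<^sub>x - s\<^sup>2 x \<partial>\<^sub>v\<close>
  moves one quantum between the two variables.\<close>

definition hf' :: "nat \<Rightarrow> real \<Rightarrow> real" where
  "hf' n x = (sqrt n * hf (n - 1) x - sqrt (Suc n) * hf (Suc n) x) / 2"

definition hf'' :: "nat \<Rightarrow> real \<Rightarrow> real" where
  "hf'' n x = (sqrt n * hf' (n - 1) x - sqrt (Suc n) * hf' (Suc n) x) / 2"

lemma hf'_deriv: "(hf n has_real_derivative hf' n x) (at x)"
  unfolding hf'_def by (rule hf_deriv)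

lemma hf''_deriv: "(hf' n has_real_derivative hf'' n x) (at x)"
proof -
  have eq: "hf' n = (\<lambda>x. (sqrt n * hf (n - 1) x - sqrt (Suc n) * hf (Suc n) x) / 2)"
    by (rule ext) (simp add: hf'_def)
  show ?thesis
    unfolding hf''_def by (subst eq) (intro DERIV_cdivide DERIV_diff DERIV_cmult hf'_deriv)
qed

lemma continuous_on_hf' [continuous_intros]: "continuous_on S f \<Longrightarrow> continuous_on S (\<lambda>x. hf' n (f x))"
  unfolding hf'_def by (intro continuous_intros) auto

lemma continuous_on_hf'' [continuous_intros]: "continuous_on S f \<Longrightarrow> continuous_on S (\<lambda>x. hf'' n (f x))"
  unfolding hf''_def by (intro continuous_intros) auto

lemma hf_oscillator: "- hf'' n v + (v\<^sup>2 / 4 - 1 / 2) * hf n v = real n * hf n v"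
proof -
  have sq: "sqrt (real k) * (sqrt (real k) * z) = real k * z" for k z
    by (simp add: mult.assoc[symmetric])
  have 1: "sqrt n * hf' (n - 1) v = (sqrt n * (sqrt (n - 1) * hf (n - 1 - 1) v) - real n * hf n v) / 2"
  proof (cases n)
    case (Suc k)
    have "sqrt n * hf' (n - 1) v = (sqrt n * (sqrt k * hf (k - 1) v) - sqrt n * (sqrt n * hf n v)) / 2"
      unfolding Suc hf'_def by (simp add: right_diff_distrib del: of_nat_Suc)
    then show ?thesis unfolding sq using Suc by simp
  qed simp
  have 2: "sqrt n * (v * hf (n - 1) v) = sqrt n * (sqrt (n - 1) * hf (n - 1 - 1) v) + real n * hf n v"
  proof (cases n)
    case (Suc k)
    have "sqrt n * (v * hf (n - 1) v) = sqrt n * (sqrt k * hf (k - 1) v) + sqrt n * (sqrt n * hf n v)"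
      unfolding Suc diff_Suc_1 hf_recurrence by (simp only: distrib_left)
    then show ?thesis unfolding sq using Suc by simp
  qed simp
  have "sqrt (Suc n) * hf' (Suc n) v = (sqrt (Suc n) * (sqrt (Suc n) * hf n v) - sqrt (Suc n) * (sqrt (Suc (Suc n)) * hf (Suc (Suc n)) v)) / 2"
    unfolding hf'_def by (simp add: right_diff_distrib del: of_nat_Suc)
  then have 3: "sqrt (Suc n) * hf' (Suc n) v = (real (Suc n) * hf n v - sqrt (Suc n) * (sqrt (Suc (Suc n)) * hf (Suc (Suc n)) v)) / 2"
    unfolding sq .
  have "sqrt (Suc n) * (v * hf (Suc n) v) = sqrt (Suc n) * (sqrt (Suc n) * hf n v) + sqrt (Suc n) * (sqrt (Suc (Suc n)) * hf (Suc (Suc n)) v)"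
    unfolding hf_recurrence[of v "Suc n"] diff_Suc_1 by (simp only: distrib_left)
  then have 4: "sqrt (Suc n) * (v * hf (Suc n) v) = real (Suc n) * hf n v + sqrt (Suc n) * (sqrt (Suc (Suc n)) * hf (Suc (Suc n)) v)"
    unfolding sq .
  have "v\<^sup>2 * hf n v = sqrt n * (v * hf (n - 1) v) + sqrt (Suc n) * (v * hf (Suc n) v)"
  proof -
    have "v\<^sup>2 * hf n v = v * (v * hf n v)" by (simp add: power2_eq_square)
    also have "\<dots> = v * (sqrt n * hf (n - 1) v + sqrt (Suc n) * hf (Suc n) v)" by (simp only: hf_recurrence)
    finally show ?thesis by (simp add: algebra_simps)
  qed
  moreover have "(v\<^sup>2 / 4 - 1 / 2) * hf n v = v\<^sup>2 * hf n v / 4 - hf n v / 2" by (simp add: algebra_simps)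
  moreover have "real (Suc n) * hf n v = real n * hf n v + hf n v" by (simp add: distrib_right)
  \<comment> \<open>P and Q stand for the terms two levels below and above; they cancel between the
    second derivative and v^2/4, and what remains is n times the function.\<close>
  moreover have "- (((P - k) / 2 - (k' - Q) / 2) / 2) + Z = k"
    if "Y = A + B" "Z = Y / 4 - h / 2" "k' = k + h" "A = P + k" "B = k' + Q" for Y A B Z h k k' P Q :: real
    using that by (simp add: field_simps)
  ultimately show ?thesis unfolding hf''_def 1 3 minus_divide_left[symmetric] using 2 4 by blast
qed

text \<open>The terms that raise both indices or lower both cancel, because the scale
  \<open>s\<close> gives the two products the same coefficient. Only exchanges of one quantum
  remain, which is why total degree is preserved.\<close>

lemma hf_transport:
  "v * hf n v * (s * hf' m y) - s * (y * hf m y) * hf' n v =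
   s * (sqrt m * sqrt (Suc n) * (hf (m - 1) y * hf (Suc n) v) - sqrt (Suc m) * sqrt n * (hf (Suc m) y * hf (n - 1) v))"
  unfolding hf'_def hf_recurrence by (simp add: field_simps)

lemma gb_combo: "gb s (\<lambda>x. complex_of_real (c * hf m (s * x) + d * hf n (s * x)))"
  using gb_add[OF gb_scale[OF gb_hf, where c = "of_real c"] gb_scale[OF gb_hf, where c = "of_real d"]] by simp

lemma gb_hf': "gb s (\<lambda>x. of_real (hf' n (s * x)))"
  using gb_combo[of s "sqrt n / 2" "n - 1" "- sqrt (Suc n) / 2" "Suc n"]
  by (simp add: hf'_def field_simps del: of_real_mult of_real_add of_real_diff)

lemma gb_hf'': "gb s (\<lambda>x. of_real (hf'' n (s * x)))"
proof -
  have "gb s (\<lambda>x. of_real (sqrt n / 2) * of_real (hf' (n - 1) (s * x)) + of_real (- sqrt (Suc n) / 2) * of_real (hf' (Suc n) (s * x)))"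
    by (intro gb_add gb_scale gb_hf')
  then show ?thesis by (simp add: hf''_def field_simps)
qed

lemma gb_x_hf: "gb s (\<lambda>x. of_real (s * x * hf n (s * x)))"
  using gb_combo[of s "sqrt n" "n - 1" "sqrt (Suc n)" "Suc n"] by (simp add: hf_recurrence del: of_real_mult of_real_add)

lemma gb_xx_hf: "gb s (\<lambda>x. of_real ((s * x)\<^sup>2 * hf n (s * x)))"
proof -
  have "gb s (\<lambda>x. of_real (sqrt n) * of_real (s * x * hf (n - 1) (s * x)) + of_real (sqrt (Suc n)) * of_real (s * x * hf (Suc n) (s * x)))"
    by (intro gb_add gb_scale gb_x_hf)
  moreover have "(s * x)\<^sup>2 * hf n (s * x) = sqrt n * (s * x * hf (n - 1) (s * x)) + sqrt (Suc n) * (s * x * hf (Suc n) (s * x))" for x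
  proof -
    have "(s * x)\<^sup>2 * hf n (s * x) = s * x * (s * x * hf n (s * x))" by (simp add: power2_eq_square)
    also have "\<dots> = s * x * (sqrt n * hf (n - 1) (s * x) + sqrt (Suc n) * hf (Suc n) (s * x))"
      by (simp only: hf_recurrence)
    finally show ?thesis by (simp add: algebra_simps)
  qed
  ultimately show ?thesis by simp
qed

lemma gb_common:
  "(\<And>f. f \<in> set fs \<Longrightarrow> gb s f) \<Longrightarrow> \<exists>C\<ge>0. \<forall>f\<in>set fs. \<forall>x. cmod (f x) \<le> C * exp (- (s * x)\<^sup>2 / 8)"
proof (induction fs)
  case (Cons g fs)
  have "\<exists>C\<ge>0. \<forall>f\<in>set fs. \<forall>x. cmod (f x) \<le> C * exp (- (s * x)\<^sup>2 / 8)" using Cons by simp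
  then obtain C where C: "C \<ge> 0" "\<forall>f\<in>set fs. \<forall>x. cmod (f x) \<le> C * exp (- (s * x)\<^sup>2 / 8)" by blast
  have "gb s g" using Cons.prems by simp
  then obtain D where D: "D \<ge> 0" "\<forall>x. cmod (g x) \<le> D * exp (- (s * x)\<^sup>2 / 8)" unfolding gb_def by blast
  have m: "C * exp (- (s * x)\<^sup>2 / 8) \<le> (C + D) * exp (- (s * x)\<^sup>2 / 8)" "D * exp (- (s * x)\<^sup>2 / 8) \<le> (C + D) * exp (- (s * x)\<^sup>2 / 8)" for x
    using C(1) D(1) by (intro mult_right_mono; simp)+
  show ?case
  proof (intro exI[of _ "C + D"] conjI ballI allI)
    fix f x assume "f \<in> set (g # fs)"
    then consider "f = g" | "f \<in> set fs" by auto
    then show "cmod (f x) \<le> (C + D) * exp (- (s * x)\<^sup>2 / 8)"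
    proof cases
      case 1
      show ?thesis unfolding 1 by (rule order_trans[OF D(2)[rule_format] m(2)])
    next
      case 2
      show ?thesis by (rule order_trans[OF C(2)[rule_format, OF 2] m(1)])
    qed
  qed (use C D in simp)
qed auto

text \<open>The operator acting on Hermite coefficients: if \<open>c\<close> are the coefficients of
  f, this is the coefficient at \<open>i\<close> of its image. Changing the sign of \<open>s\<close>
  gives the transposed action, and out-of-range indices carry the factor sqrt 0.\<close>

definition KT :: "real \<Rightarrow> nat \<times> nat \<Rightarrow> (nat \<times> nat \<Rightarrow> complex) \<Rightarrow> complex" where
  "KT s i c = of_nat (snd i) * c i
     - of_real (s * sqrt (fst i) * sqrt (Suc (snd i))) * c (fst i - 1, Suc (snd i))
     + of_real (s * sqrt (Suc (fst i)) * sqrt (snd i)) * c (Suc (fst i), snd i - 1)"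

text \<open>Oscillator eigenvalue plus transport. The two sign patterns are the formal transpose and
  the operator itself: the first is met when test functions approximate a Hermite function, the
  second after integration by parts.\<close>

lemma KT_Hfun:
  fixes s x v :: real and m n :: nat
  defines "u \<equiv> (\<lambda>x. complex_of_real (sqrt s * hf m (s * x)))" and "u' \<equiv> (\<lambda>x. complex_of_real (sqrt s * (s * hf' m (s * x))))"
    and "w \<equiv> (\<lambda>v. complex_of_real (hf n v))" and "w' \<equiv> (\<lambda>v. complex_of_real (hf' n v))" and "w'' \<equiv> (\<lambda>v. complex_of_real (hf'' n v))"
  shows "- of_real v * u' x * w v + of_real (s\<^sup>2 * x) * u x * w' v - u x * w'' v + of_real (v\<^sup>2 / 4 - 1 / 2) * (u x * w v)
    = KT s (m, n) (\<lambda>i. Hfun s i (x, v))"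
    "of_real v * u' x * w v - of_real (s\<^sup>2 * x) * u x * w' v - u x * w'' v + of_real (v\<^sup>2 / 4 - 1 / 2) * (u x * w v)
    = KT (- s) (m, n) (\<lambda>i. Hfun s i (x, v))"
proof -
  let ?y = "s * x"
  have o: "- hf'' n v + (v\<^sup>2 / 4 - 1 / 2) * hf n v = real n * hf n v" by (rule hf_oscillator)
  have t: "v * hf n v * (s * hf' m ?y) - s * (?y * hf m ?y) * hf' n v =
   s * (sqrt m * sqrt (Suc n) * (hf (m - 1) ?y * hf (Suc n) v) - sqrt (Suc m) * sqrt n * (hf (Suc m) ?y * hf (n - 1) v))"
    by (rule hf_transport)
  have "- v * (sqrt s * (s * hf' m ?y)) * hf n v + s\<^sup>2 * x * (sqrt s * hf m ?y) * hf' n v - sqrt s * hf m ?y * hf'' n v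
      + (v\<^sup>2 / 4 - 1 / 2) * (sqrt s * hf m ?y * hf n v)
    = sqrt s * hf m ?y * (- hf'' n v + (v\<^sup>2 / 4 - 1 / 2) * hf n v)
      - sqrt s * (v * hf n v * (s * hf' m ?y) - s * (?y * hf m ?y) * hf' n v)"
    by (simp add: power2_eq_square algebra_simps)
  also have "\<dots> = n * (sqrt s * hf m ?y * hf n v) - s * sqrt m * sqrt (Suc n) * (sqrt s * hf (m - 1) ?y * hf (Suc n) v)
      + s * sqrt (Suc m) * sqrt n * (sqrt s * hf (Suc m) ?y * hf (n - 1) v)"
    unfolding o t by (simp add: algebra_simps)
  finally have 1: "- v * (sqrt s * (s * hf' m ?y)) * hf n v + s\<^sup>2 * x * (sqrt s * hf m ?y) * hf' n v - sqrt s * hf m ?y * hf'' n v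
      + (v\<^sup>2 / 4 - 1 / 2) * (sqrt s * hf m ?y * hf n v) = n * (sqrt s * hf m ?y * hf n v) - s * sqrt m * sqrt (Suc n) * (sqrt s * hf (m - 1) ?y * hf (Suc n) v)
      + s * sqrt (Suc m) * sqrt n * (sqrt s * hf (Suc m) ?y * hf (n - 1) v)" .
  have "v * (sqrt s * (s * hf' m ?y)) * hf n v - s\<^sup>2 * x * (sqrt s * hf m ?y) * hf' n v - sqrt s * hf m ?y * hf'' n v
      + (v\<^sup>2 / 4 - 1 / 2) * (sqrt s * hf m ?y * hf n v)
    = sqrt s * hf m ?y * (- hf'' n v + (v\<^sup>2 / 4 - 1 / 2) * hf n v)
      + sqrt s * (v * hf n v * (s * hf' m ?y) - s * (?y * hf m ?y) * hf' n v)"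
    by (simp add: power2_eq_square algebra_simps)
  also have "\<dots> = n * (sqrt s * hf m ?y * hf n v) - (- s) * sqrt m * sqrt (Suc n) * (sqrt s * hf (m - 1) ?y * hf (Suc n) v)
      + (- s) * sqrt (Suc m) * sqrt n * (sqrt s * hf (Suc m) ?y * hf (n - 1) v)"
    unfolding o t by (simp add: algebra_simps)
  finally have 2: "v * (sqrt s * (s * hf' m ?y)) * hf n v - s\<^sup>2 * x * (sqrt s * hf m ?y) * hf' n v - sqrt s * hf m ?y * hf'' n v
      + (v\<^sup>2 / 4 - 1 / 2) * (sqrt s * hf m ?y * hf n v) = n * (sqrt s * hf m ?y * hf n v) - (- s) * sqrt m * sqrt (Suc n) * (sqrt s * hf (m - 1) ?y * hf (Suc n) v)
      + (- s) * sqrt (Suc m) * sqrt n * (sqrt s * hf (Suc m) ?y * hf (n - 1) v)" .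
  show "- of_real v * u' x * w v + of_real (s\<^sup>2 * x) * u x * w' v - u x * w'' v + of_real (v\<^sup>2 / 4 - 1 / 2) * (u x * w v)
    = KT s (m, n) (\<lambda>i. Hfun s i (x, v))"
    using arg_cong[OF 1, of complex_of_real] unfolding u_def u'_def w_def w'_def w''_def KT_def Hfun_def by simp
  show "of_real v * u' x * w v - of_real (s\<^sup>2 * x) * u x * w' v - u x * w'' v + of_real (v\<^sup>2 / 4 - 1 / 2) * (u x * w v)
    = KT (- s) (m, n) (\<lambda>i. Hfun s i (x, v))"
    using arg_cong[OF 2, of complex_of_real] unfolding u_def u'_def w_def w'_def w''_def KT_def Hfun_def by simp
qed

lemma pairing_eq: "continuous_on UNIV \<psi> \<Longrightarrow> pairing f \<psi> = (\<integral>p. rep_l2 f p * \<psi> p \<partial>lborel)"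
proof -
  assume "continuous_on UNIV \<psi>"
  then have m: "\<psi> \<in> borel_measurable borel" by (rule borel_measurable_continuous_onI)
  have "pairing (abs_l2 (rep_l2 f)) \<psi> = (\<integral>p. rep_l2 f p * \<psi> p \<partial>lborel)"
    using m by (subst pairing.abs_eq) auto
  then show ?thesis by simp
qed

lemma integrable_rep: "sq_int h \<Longrightarrow> integrable lborel (\<lambda>p. rep_l2 f p * h p)"
proof -
  assume h: "sq_int h"
  have "(\<lambda>p. cnj (h p)) \<in> borel_measurable borel"
    using h unfolding sq_int_def
    by (auto intro: borel_measurable_continuous_on[OF continuous_on_cnj[OF continuous_on_id]])
  then have "sq_int (\<lambda>p. cnj (h p))" using h by (simp add: sq_int_def)
  from sq_int_prod[OF sq_int_rep this] show ?thesis by simp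
qed

text \<open>The test functions \<open>bump (x/R) bump (v/R) H\<close> approximate the Hermite function \<open>H\<close> in the graph norm.\<close>

lemma K_op_imp_KT:
  assumes s: "s > 0" and fg: "(f, g) \<in> K_op (s\<^sup>2)"
  shows "cinner g (HH s (m, n)) = KT s (m, n) (\<lambda>i. cinner f (HH s i))"
proof -
  define u u' w w' w'' where "u x = complex_of_real (sqrt s * hf m (s * x))"
    and "u' x = complex_of_real (sqrt s * (s * hf' m (s * x)))"
    and "w v = complex_of_real (hf n v)" and "w' v = complex_of_real (hf' n v)" and "w'' v = complex_of_real (hf'' n v)" for x v
  have du: "(u has_vector_derivative u' x) (at x)" for x
  proof -
    have "((\<lambda>x. sqrt s * hf m (s * x)) has_real_derivative sqrt s * (hf' m (s * x) * s)) (at x)"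
      by (intro DERIV_cmult DERIV_chain2[OF hf'_deriv]) (auto intro!: derivative_eq_intros)
    then show ?thesis unfolding u_def[abs_def] u'_def
      by (intro has_vector_derivative_of_real) (simp add: mult.commute)
  qed
  have dw: "(w has_vector_derivative w' x) (at x)" for x
    unfolding w_def[abs_def] w'_def by (intro has_vector_derivative_of_real hf'_deriv)
  have dw': "(w' has_vector_derivative w'' x) (at x)" for x
    unfolding w''_def w'_def[abs_def] by (intro has_vector_derivative_of_real hf''_deriv)
  obtain b1 b2 B where b1: "\<And>x. (bump has_vector_derivative b1 x) (at x)" and b2: "\<And>x. (b1 has_vector_derivative b2 x) (at x)"
    and B: "\<And>x. cmod (bump x) \<le> B" "\<And>x. cmod (b1 x) \<le> B" "\<And>x. cmod (b2 x) \<le> B"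
    using bump_derivs by metis
  have B0: "B \<ge> 0" using order_trans[OF norm_ge_zero B(1)[of 0]] .
  define r where "r k = 1 / real (Suc k)" for k
  have r: "r k > 0" "r k \<le> 1" for k by (simp_all add: r_def)
  have rlim: "r \<longlonglongrightarrow> 0" unfolding r_def using LIMSEQ_Suc[OF lim_1_over_n] .
  \<comment> \<open>The cutoff and its first two derivatives; each derivative brings a factor
    \<open>r k\<close> tending to 0, so the terms in which the cutoff is differentiated disappear in
    the limit.\<close>
  define c c1 c2 where "c k x = bump (0 + r k * x)" and "c1 k x = of_real (r k) * b1 (r k * x)"
    and "c2 k x = of_real (r k)^2 * b2 (r k * x)" for k x
  have sc: "smooth1 j (c k)" for j k unfolding c_def[abs_def] by (rule smooth1_scale[OF smooth1_bump])
  have ch: "((\<lambda>x. F (r k * x)) has_vector_derivative of_real (r k) * F' (r k * x)) (at x)"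
    if "\<And>x. (F has_vector_derivative F' x) (at x)" for F F' k x
  proof -
    have "((\<lambda>x. r k * x) has_vector_derivative r k) (at x)"
      by (auto intro!: derivative_eq_intros simp: has_real_derivative_iff_has_vector_derivative[symmetric])
    from vector_diff_chain_at[OF this that] show ?thesis by (simp add: o_def scaleR_conv_of_real)
  qed
  have dc: "(c k has_vector_derivative c1 k x) (at x)" for k x
    using ch[OF b1, of k x] by (simp add: c_def[abs_def] c1_def)
  have dc1: "(c1 k has_vector_derivative c2 k x) (at x)" for k x
    using has_vector_derivative_mult_right[OF ch[OF b2, of k x], of "of_real (r k)"]
    by (simp add: c1_def[abs_def] c2_def power2_eq_square mult.assoc)
  have cb: "cmod (c k x) \<le> B" "cmod (c1 k x) \<le> B" "cmod (c2 k x) \<le> B" for k x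
  proof -
    show "cmod (c k x) \<le> B" by (simp add: c_def B)
    have "r k * cmod (b1 (r k * x)) \<le> 1 * B" using r[of k] B by (intro mult_mono) auto
    then show "cmod (c1 k x) \<le> B" using r[of k] by (simp add: c1_def norm_mult)
    have "(r k)^2 * cmod (b2 (r k * x)) \<le> 1 * B" using r[of k] B by (intro mult_mono) (auto intro: power_le_one)
    then show "cmod (c2 k x) \<le> B" using r[of k] by (simp add: c2_def norm_mult norm_power)
  qed
  have clim: "(\<lambda>k. c k x) \<longlonglongrightarrow> 1" "(\<lambda>k. c1 k x) \<longlonglongrightarrow> 0" "(\<lambda>k. c2 k x) \<longlonglongrightarrow> 0" for x
  proof -
    have rx: "(\<lambda>k. r k * x) \<longlonglongrightarrow> 0" using tendsto_mult[OF rlim tendsto_const[of x]] by simp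
    have "isCont bump 0" using smooth1_continuous[OF smooth1_bump] by (simp add: continuous_on_eq_continuous_at)
    then show "(\<lambda>k. c k x) \<longlonglongrightarrow> 1" using isCont_tendsto_compose[OF _ rx, of bump] by (simp add: c_def bump_0)
    have "(\<lambda>k. r k * B) \<longlonglongrightarrow> 0" using tendsto_mult[OF rlim tendsto_const[of B]] by simp
    then show "(\<lambda>k. c1 k x) \<longlonglongrightarrow> 0"
      by (rule Lim_null_comparison[rotated]) (use B r in \<open>auto intro!: always_eventually mult_left_mono simp: c1_def norm_mult less_imp_le abs_of_pos\<close>)
    have "(\<lambda>k. (r k)^2 * B) \<longlonglongrightarrow> 0" using tendsto_mult[OF tendsto_power[OF rlim, of 2] tendsto_const[of B]] by simp
    then show "(\<lambda>k. c2 k x) \<longlonglongrightarrow> 0"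
      by (rule Lim_null_comparison[rotated]) (use B r in \<open>auto intro!: always_eventually mult_left_mono simp: c2_def norm_mult norm_power less_imp_le abs_of_pos\<close>)
  qed
  define U U' V V' V'' where "U k x = c k x * u x" and "U' k x = c k x * u' x + c1 k x * u x"
    and "V k v = c k v * w v" and "V' k v = c k v * w' v + c1 k v * w v"
    and "V'' k v = (c k v * w'' v + c1 k v * w' v) + (c1 k v * w' v + c2 k v * w v)" for k x v
  have dU: "(U k has_vector_derivative U' k x) (at x)" for k x
    unfolding U_def[abs_def] U'_def by (intro has_vector_derivative_mult dc du)
  have dV: "(V k has_vector_derivative V' k x) (at x)" for k x
    unfolding V_def[abs_def] V'_def by (intro has_vector_derivative_mult dc dw)
  have dV': "(V' k has_vector_derivative V'' k x) (at x)" for k x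
    unfolding V'_def[abs_def] V''_def by (intro has_vector_derivative_add has_vector_derivative_mult dc dc1 dw dw')
  define \<phi> where "\<phi> k = (\<lambda>p::real \<times> real. U k (fst p) * V k (snd p))" for k
  have su: "smooth1 j u" for j
  proof -
    have "smooth1 j (\<lambda>x. of_real (sqrt s) * of_real (hf m (0 + s * x)))"
      by (intro smooth1_mult smooth1_const smooth1_scale[OF smooth1_hf])
    then show ?thesis by (simp add: u_def[abs_def])
  qed
  have tf: "test_fun (\<phi> k)" for k
    unfolding \<phi>_def
  proof (rule test_fun_tensor)
    show "smooth1 j (U k)" "smooth1 j (V k)" for j
      unfolding U_def[abs_def] V_def[abs_def] using sc su smooth1_hf by (auto intro!: smooth1_mult simp: w_def[abs_def])
    have "c k x = 0" if "\<bar>x\<bar> \<ge> real (Suc k)" for x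
      unfolding c_def using that by (intro bump_outside) (simp add: r_def abs_mult field_simps)
    then show "U k x = 0" "V k x = 0" if "\<bar>x\<bar> \<ge> real (Suc k)" for x using that by (simp_all add: U_def V_def)
  qed
  define h where "h = Hfun s (m, n)"
  have hp: "h p = u (fst p) * w (snd p)" for p by (simp add: h_def Hfun_def u_def w_def)
  define Kh where "Kh p = KT s (m, n) (\<lambda>i. Hfun s i p)" for p
  have Khp: "Kh p = - of_real (snd p) * u' (fst p) * w (snd p) + of_real (s\<^sup>2 * fst p) * u (fst p) * w' (snd p)
      - u (fst p) * w'' (snd p) + of_real ((snd p)\<^sup>2 / 4 - 1 / 2) * (u (fst p) * w (snd p))" for p
    using KT_Hfun(1)[where s = s and m = m and n = n and x = "fst p" and v = "snd p"]
    by (simp add: Kh_def u_def u'_def w_def w'_def w''_def)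
  define K\<phi> where "K\<phi> k p = - of_real (snd p) * U' k (fst p) * V k (snd p) + of_real (s\<^sup>2 * fst p) * U k (fst p) * V' k (snd p)
      - U k (fst p) * V'' k (snd p) + of_real ((snd p)\<^sup>2 / 4 - 1 / 2) * (U k (fst p) * V k (snd p))" for k p
  have K\<phi>: "K_transpose (s\<^sup>2) (\<phi> k) = K\<phi> k" for k
    unfolding \<phi>_def K\<phi>_def by (rule ext, clarify) (simp add: K_transpose_tensor[OF dU dV dV'])
  have cont: "continuous_on UNIV u" "continuous_on UNIV u'" "continuous_on UNIV w" "continuous_on UNIV w'" "continuous_on UNIV w''"
    unfolding u_def u'_def w_def w'_def w''_def by (intro continuous_intros)+
  have contc: "continuous_on UNIV (c k)" "continuous_on UNIV (c1 k)" "continuous_on UNIV (c2 k)" for k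
  proof -
    show "continuous_on UNIV (c k)" using smooth1_continuous[OF sc] .
    show "continuous_on UNIV (c1 k)" using dc1 by (auto simp: continuous_on_eq_continuous_at intro: has_vector_derivative_continuous)
    obtain d1 d2 where d: "\<And>x. (c k has_vector_derivative d1 x) (at x)" "\<And>x. (d1 has_vector_derivative d2 x) (at x)" "continuous_on UNIV d2"
      using sc[of "Suc (Suc 0)" k] by auto
    have "d1 = c1 k" using d(1) dc vector_derivative_unique_at by blast
    then have "d2 = c2 k" using d(2) dc1 vector_derivative_unique_at by blast
    then show "continuous_on UNIV (c2 k)" using d(3) by simp
  qed
  have co: "continuous_on UNIV (\<lambda>p::real \<times> real. F (fst p))" "continuous_on UNIV (\<lambda>p::real \<times> real. F (snd p))"
    if "continuous_on UNIV F" for F :: "real \<Rightarrow> complex"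
    using that by (auto intro!: continuous_on_compose2[of UNIV F] continuous_intros)
  have cU: "continuous_on UNIV (U k)" "continuous_on UNIV (U' k)" and cV: "continuous_on UNIV (V k)" "continuous_on UNIV (V' k)"
    "continuous_on UNIV (V'' k)" for k
    unfolding U_def[abs_def] U'_def[abs_def] V_def[abs_def] V'_def[abs_def] V''_def[abs_def]
    by (intro continuous_on_add continuous_on_mult cont contc)+
  have cq: "continuous_on UNIV (\<lambda>p::real \<times> real. complex_of_real (snd p))" "continuous_on UNIV (\<lambda>p::real \<times> real. complex_of_real (s\<^sup>2 * fst p))"
    "continuous_on UNIV (\<lambda>p::real \<times> real. complex_of_real ((snd p)\<^sup>2 / 4 - 1 / 2))"
    by (intro continuous_intros; simp)+
  have c\<phi>: "continuous_on UNIV (\<phi> k)" for k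
    unfolding \<phi>_def by (intro continuous_on_mult co(1)[OF cU(1)] co(2)[OF cV(1)])
  have cK\<phi>: "continuous_on UNIV (K\<phi> k)" for k
    unfolding K\<phi>_def[abs_def]
    by (intro continuous_on_add continuous_on_diff continuous_on_mult continuous_on_minus cq
        co(1)[OF cU(1)] co(1)[OF cU(2)] co(2)[OF cV(1)] co(2)[OF cV(2)] co(2)[OF cV(3)])
  have cKh: "continuous_on UNIV Kh"
    unfolding Kh_def[abs_def] KT_def by (intro continuous_intros continuous_on_Hfun)
  have gu: "gb s u" "gb s u'" "gb s (\<lambda>x. of_real (s * x) * u x)"
  proof -
    show "gb s u" unfolding u_def[abs_def] of_real_mult by (intro gb_scale gb_hf)
    show "gb s u'" unfolding u'_def[abs_def] of_real_mult by (intro gb_scale gb_hf')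
    have "gb s (\<lambda>x. of_real (sqrt s) * of_real (s * x * hf m (s * x)))" by (intro gb_scale gb_x_hf)
    then show "gb s (\<lambda>x. of_real (s * x) * u x)" by (simp add: u_def mult_ac)
  qed
  have gw: "gb 1 w" "gb 1 w'" "gb 1 w''" "gb 1 (\<lambda>v. of_real v * w v)" "gb 1 (\<lambda>v. of_real (v\<^sup>2) * w v)"
    using gb_hf[of 1 n] gb_hf'[of 1 n] gb_hf''[of 1 n] gb_x_hf[of 1 n] gb_xx_hf[of 1 n]
    by (simp_all add: w_def[abs_def] w'_def[abs_def] w''_def[abs_def])
  obtain C where C: "C \<ge> 0" "\<And>x. cmod (u x) \<le> C * exp (- (s * x)\<^sup>2 / 8)" "\<And>x. cmod (u' x) \<le> C * exp (- (s * x)\<^sup>2 / 8)"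
      "\<And>x. cmod (of_real (s * x) * u x) \<le> C * exp (- (s * x)\<^sup>2 / 8)"
    using gb_common[of "[u, u', \<lambda>x. of_real (s * x) * u x]" s] gu by auto
  obtain D where D: "D \<ge> 0" "\<And>x. cmod (w x) \<le> D * exp (- x\<^sup>2 / 8)" "\<And>x. cmod (w' x) \<le> D * exp (- x\<^sup>2 / 8)" "\<And>x. cmod (w'' x) \<le> D * exp (- x\<^sup>2 / 8)"
      "\<And>x. cmod (of_real x * w x) \<le> D * exp (- x\<^sup>2 / 8)" "\<And>x. cmod (of_real (x\<^sup>2) * w x) \<le> D * exp (- x\<^sup>2 / 8)"
  proof -
    have "\<exists>D\<ge>0. \<forall>f\<in>set [w, w', w'', \<lambda>x. of_real x * w x, \<lambda>x. of_real (x\<^sup>2) * w x]. \<forall>x. cmod (f x) \<le> D * exp (- (1 * x)\<^sup>2 / 8)"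
      by (rule gb_common) (use gw in auto)
    then obtain D where D: "D \<ge> 0"
      "\<forall>f\<in>set [w, w', w'', \<lambda>x. of_real x * w x, \<lambda>x. of_real (x\<^sup>2) * w x]. \<forall>x. cmod (f x) \<le> D * exp (- (1 * x)\<^sup>2 / 8)"
      by (elim exE conjE)
    show ?thesis by (rule that[OF D(1)]) (use D(2) in simp_all)
  qed
  have prodb: "cmod (P * Q) \<le> (k1 * C * (k2 * D)) * gw s p"
    if "cmod P \<le> k1 * (C * exp (- (s * fst p)\<^sup>2 / 8))" "cmod Q \<le> k2 * (D * exp (- (snd p)\<^sup>2 / 8))" "k1 \<ge> 0" for P Q k1 k2 p
  proof -
    have "cmod (P * Q) \<le> (k1 * (C * exp (- (s * fst p)\<^sup>2 / 8))) * (k2 * (D * exp (- (snd p)\<^sup>2 / 8)))"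
      unfolding norm_mult using that C(1) by (intro mult_mono) auto
    then show ?thesis by (simp add: gw_def mult_ac)
  qed
  have cmul: "cmod (c k x * z) \<le> B * M" "cmod (c1 k x * z) \<le> B * M" "cmod (c2 k x * z) \<le> B * M" if "cmod z \<le> M" for k x z M
    unfolding norm_mult using cb that B0 by (auto intro!: mult_mono)
  have Ub: "cmod (U k x) \<le> B * (C * exp (- (s * x)\<^sup>2 / 8))" "cmod (U' k x) \<le> 2 * B * (C * exp (- (s * x)\<^sup>2 / 8))"
    "cmod (of_real (s * x) * U k x) \<le> B * (C * exp (- (s * x)\<^sup>2 / 8))" for k x
  proof -
    show "cmod (U k x) \<le> B * (C * exp (- (s * x)\<^sup>2 / 8))" unfolding U_def by (rule cmul C)+
    show "cmod (U' k x) \<le> 2 * B * (C * exp (- (s * x)\<^sup>2 / 8))"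
      using norm_triangle_ineq[of "c k x * u' x" "c1 k x * u x"] cmul(1)[OF C(3), of k x x] cmul(2)[OF C(2), of k x x]
      unfolding U'_def by linarith
    have "of_real (s * x) * U k x = c k x * (of_real (s * x) * u x)" by (simp add: U_def)
    then show "cmod (of_real (s * x) * U k x) \<le> B * (C * exp (- (s * x)\<^sup>2 / 8))" using cmul(1)[OF C(4)] by metis
  qed
  have Vb: "cmod (V k v) \<le> B * (D * exp (- v\<^sup>2 / 8))" "cmod (V' k v) \<le> 2 * B * (D * exp (- v\<^sup>2 / 8))"
    "cmod (V'' k v) \<le> 4 * B * (D * exp (- v\<^sup>2 / 8))" "cmod (of_real v * V k v) \<le> B * (D * exp (- v\<^sup>2 / 8))"
    "cmod (of_real (v\<^sup>2 / 4 - 1 / 2) * V k v) \<le> B * (D * exp (- v\<^sup>2 / 8))" for k v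
  proof -
    show V: "cmod (V k v) \<le> B * (D * exp (- v\<^sup>2 / 8))" unfolding V_def by (rule cmul D)+
    show "cmod (V' k v) \<le> 2 * B * (D * exp (- v\<^sup>2 / 8))"
      using norm_triangle_ineq[of "c k v * w' v" "c1 k v * w v"] cmul(1)[OF D(3), of k v v] cmul(2)[OF D(2), of k v v]
      unfolding V'_def by linarith
    show "cmod (V'' k v) \<le> 4 * B * (D * exp (- v\<^sup>2 / 8))"
      using norm_triangle_ineq[of "c k v * w'' v + c1 k v * w' v" "c1 k v * w' v + c2 k v * w v"]
        norm_triangle_ineq[of "c k v * w'' v" "c1 k v * w' v"] norm_triangle_ineq[of "c1 k v * w' v" "c2 k v * w v"]
        cmul(1)[OF D(4), of k v v] cmul(2)[OF D(3), of k v v] cmul(3)[OF D(2), of k v v]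
      unfolding V''_def by linarith
    have "of_real v * V k v = c k v * (of_real v * w v)" by (simp add: V_def)
    then show "cmod (of_real v * V k v) \<le> B * (D * exp (- v\<^sup>2 / 8))" using cmul(1)[OF D(5)] by metis
    have "of_real (v\<^sup>2) * V k v = c k v * (of_real (v\<^sup>2) * w v)" by (simp add: V_def)
    then have V2: "cmod (of_real (v\<^sup>2) * V k v) \<le> B * (D * exp (- v\<^sup>2 / 8))" using cmul(1)[OF D(6)] by metis
    have "of_real (v\<^sup>2 / 4 - 1 / 2) * V k v = of_real (v\<^sup>2) * V k v / 4 - V k v / 2" by (simp add: field_simps)
    then have "cmod (of_real (v\<^sup>2 / 4 - 1 / 2) * V k v) \<le> cmod (of_real (v\<^sup>2) * V k v / 4) + cmod (V k v / 2)"
      using norm_triangle_ineq4 by metis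
    also have "\<dots> = cmod (of_real (v\<^sup>2) * V k v) / 4 + cmod (V k v) / 2"
      unfolding norm_divide norm_numeral ..
    also have "\<dots> \<le> B * (D * exp (- v\<^sup>2 / 8))"
    proof -
      have "0 \<le> B * (D * exp (- v\<^sup>2 / 8))" using B0 D(1) by simp
      then show ?thesis using V V2 by linarith
    qed
    finally show "cmod (of_real (v\<^sup>2 / 4 - 1 / 2) * V k v) \<le> B * (D * exp (- v\<^sup>2 / 8))" .
  qed
  \<comment> \<open>The terms of the transposed operator contribute 2, 2 s, 4 and 1 times the same
    product of bounds, and 2 + 2 s + 4 + 1 \<le> 10 + 2 s.\<close>
  define M where "M = (10 + s * 2) * (B * B * C * D)"
  have \<phi>b: "cmod (\<phi> k p) \<le> (B * B * C * D) * gw s p" for k p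
proof -
      have "cmod (U k (fst p) * V k (snd p)) \<le> (B * C * (B * D)) * gw s p"
        by (rule prodb[OF Ub(1) Vb(1) B0])
      then show ?thesis by (simp add: mult_ac \<phi>_def)
    qed
  have K\<phi>b: "cmod (K\<phi> k p) \<le> M * gw s p" for k p
  proof -
    let ?X = "B * B * C * D"
    have 1: "cmod (U' k (fst p) * (of_real (snd p) * V k (snd p))) \<le> 2 * ?X * gw s p"
proof -
      have "cmod (U' k (fst p) * (of_real (snd p) * V k (snd p))) \<le> (2 * B * C * (B * D)) * gw s p"
        by (rule prodb[OF Ub(2) Vb(4)]) (use B0 in simp)
      then show ?thesis by (simp add: mult_ac)
    qed
    have 2: "cmod ((of_real (s * fst p) * U k (fst p)) * V' k (snd p)) \<le> 2 * ?X * gw s p"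
proof -
      have "cmod ((of_real (s * fst p) * U k (fst p)) * V' k (snd p)) \<le> (B * C * (2 * B * D)) * gw s p"
        by (rule prodb[OF Ub(3) Vb(2) B0])
      then show ?thesis by (simp add: mult_ac)
    qed
    have 3: "cmod (U k (fst p) * V'' k (snd p)) \<le> 4 * ?X * gw s p"
proof -
      have "cmod (U k (fst p) * V'' k (snd p)) \<le> (B * C * (4 * B * D)) * gw s p"
        by (rule prodb[OF Ub(1) Vb(3) B0])
      then show ?thesis by (simp add: mult_ac)
    qed
    have 4: "cmod (U k (fst p) * (of_real ((snd p)\<^sup>2 / 4 - 1 / 2) * V k (snd p))) \<le> ?X * gw s p"
proof -
      have "cmod (U k (fst p) * (of_real ((snd p)\<^sup>2 / 4 - 1 / 2) * V k (snd p))) \<le> (B * C * (B * D)) * gw s p"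
        by (rule prodb[OF Ub(1) Vb(5) B0])
      then show ?thesis by (simp add: mult_ac)
    qed
    have eq: "K\<phi> k p = - (U' k (fst p) * (of_real (snd p) * V k (snd p))) + of_real s * ((of_real (s * fst p) * U k (fst p)) * V' k (snd p))
      - U k (fst p) * V'' k (snd p) + U k (fst p) * (of_real ((snd p)\<^sup>2 / 4 - 1 / 2) * V k (snd p))"
      by (simp add: K\<phi>_def power2_eq_square mult_ac)
    have tri: "cmod (- a + of_real s * b - c + d) \<le> cmod a + s * cmod b + cmod c + cmod d" for a b c d :: complex
    proof -
      have "cmod (- a + of_real s * b - c + d) \<le> cmod (- a) + cmod (of_real s * b) + cmod c + cmod d"
        by (intro order_trans[OF norm_triangle_ineq] order_trans[OF norm_triangle_ineq4] add_mono order_refl)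
      then show ?thesis using s by (simp add: norm_mult)
    qed
    have "cmod (K\<phi> k p) \<le> 2 * ?X * gw s p + s * (2 * ?X * gw s p) + 4 * ?X * gw s p + ?X * gw s p"
      unfolding eq by (rule order_trans[OF tri]) (intro add_mono mult_left_mono 1 2 3 4, use s in auto)
    also have "\<dots> \<le> M * gw s p"
    proof -
      have "0 \<le> ?X * gw s p" using B0 C D gw_pos[of s p] by (intro mult_nonneg_nonneg) auto
      then show ?thesis by (simp add: M_def algebra_simps)
    qed
    finally show ?thesis .
  qed
  have lim\<phi>: "(\<lambda>k. \<phi> k p) \<longlonglongrightarrow> h p" for p
  proof -
    have "(\<lambda>k. \<phi> k p) \<longlonglongrightarrow> (1 * u (fst p)) * (1 * w (snd p))"
      unfolding \<phi>_def U_def V_def by (intro tendsto_mult tendsto_const clim)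
    then show ?thesis by (simp add: hp)
  qed
  have limK: "(\<lambda>k. K\<phi> k p) \<longlonglongrightarrow> Kh p" for p
  proof -
    have U: "(\<lambda>k. U k (fst p)) \<longlonglongrightarrow> 1 * u (fst p)" "(\<lambda>k. U' k (fst p)) \<longlonglongrightarrow> 1 * u' (fst p) + 0 * u (fst p)"
      unfolding U_def U'_def by (intro tendsto_intros clim)+
    have V: "(\<lambda>k. V k (snd p)) \<longlonglongrightarrow> 1 * w (snd p)" "(\<lambda>k. V' k (snd p)) \<longlonglongrightarrow> 1 * w' (snd p) + 0 * w (snd p)"
      "(\<lambda>k. V'' k (snd p)) \<longlonglongrightarrow> (1 * w'' (snd p) + 0 * w' (snd p)) + (0 * w' (snd p) + 0 * w (snd p))"
      unfolding V_def V'_def V''_def by (intro tendsto_intros clim)+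
    note U' = U[simplified] and V' = V[simplified]
    show ?thesis unfolding K\<phi>_def Khp by (intro tendsto_intros U' V')
  qed
  \<comment> \<open>The majorant is a product of two square integrable functions, the representative
    of \<open>q\<close> and the Gaussian weight, hence integrable.\<close>
  have DCT: "(\<lambda>k. pairing q (\<theta> k)) \<longlonglongrightarrow> (\<integral>p. rep_l2 q p * \<theta>0 p \<partial>lborel)"
    if "\<And>k. continuous_on UNIV (\<theta> k)" "continuous_on UNIV \<theta>0" "\<And>p. (\<lambda>k. \<theta> k p) \<longlonglongrightarrow> \<theta>0 p" "\<And>k p. cmod (\<theta> k p) \<le> E * gw s p" for q \<theta> \<theta>0 E
  proof -
    have [measurable]: "rep_l2 q \<in> borel_measurable borel" using sq_int_rep[of q] by (simp add: sq_int_def)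
    have [measurable]: "\<theta> k \<in> borel_measurable borel" "\<theta>0 \<in> borel_measurable borel" for k
      using that(1,2) by (auto intro: borel_measurable_continuous_onI)
    show ?thesis
      unfolding pairing_eq[OF that(1)]
    proof (rule integral_dominated_convergence[where w = "\<lambda>p. E * cmod (rep_l2 q p * of_real (gw s p))"])
      show "integrable lborel (\<lambda>p. E * cmod (rep_l2 q p * of_real (gw s p)))"
        by (intro integrable_mult_right integrable_norm integrable_rep sq_int_gw s)
      show "AE p in lborel. (\<lambda>k. rep_l2 q p * \<theta> k p) \<longlonglongrightarrow> rep_l2 q p * \<theta>0 p"
        by (intro AE_I2 tendsto_intros that)
      show "AE p in lborel. cmod (rep_l2 q p * \<theta> k p) \<le> E * cmod (rep_l2 q p * of_real (gw s p))" for k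
      proof (rule AE_I2)
        fix p
        show "cmod (rep_l2 q p * \<theta> k p) \<le> E * cmod (rep_l2 q p * of_real (gw s p))"
          using mult_left_mono[OF that(4)[of k p], of "cmod (rep_l2 q p)"] gw_pos[of s p] by (simp add: norm_mult mult_ac)
      qed
    qed measurable
  qed
  have "(\<lambda>k. pairing g (\<phi> k)) \<longlonglongrightarrow> (\<integral>p. rep_l2 g p * h p \<partial>lborel)"
    by (rule DCT[OF c\<phi> _ lim\<phi> \<phi>b]) (simp add: h_def continuous_on_Hfun)
  moreover have "(\<lambda>k. pairing f (K\<phi> k)) \<longlonglongrightarrow> (\<integral>p. rep_l2 f p * Kh p \<partial>lborel)"
    by (rule DCT[OF cK\<phi> cKh limK K\<phi>b])
  moreover have "pairing f (K\<phi> k) = pairing g (\<phi> k)" for k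
    using fg tf[of k] K\<phi>[of k] by (auto simp: K_op_def)
  ultimately have "(\<integral>p. rep_l2 g p * h p \<partial>lborel) = (\<integral>p. rep_l2 f p * Kh p \<partial>lborel)"
    using LIMSEQ_unique by simp
  moreover have "(\<integral>p. rep_l2 f p * Kh p \<partial>lborel) = KT s (m, n) (\<lambda>i. \<integral>p. rep_l2 f p * Hfun s i p \<partial>lborel)"
  proof -
    have i: "integrable lborel (\<lambda>p. rep_l2 f p * Hfun s i p)" for i by (intro integrable_rep sq_int_Hfun s)
    have "rep_l2 f p * Kh p = of_nat n * (rep_l2 f p * Hfun s (m, n) p)
       - of_real (s * sqrt m * sqrt (Suc n)) * (rep_l2 f p * Hfun s (m - 1, Suc n) p)
       + of_real (s * sqrt (Suc m) * sqrt n) * (rep_l2 f p * Hfun s (Suc m, n - 1) p)" for p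
      by (simp add: Kh_def KT_def algebra_simps)
    then show ?thesis
      unfolding KT_def fst_conv snd_conv
      by (simp only:) (rule has_bochner_integral_integral_eq, intro has_bochner_integral_add has_bochner_integral_diff
          has_bochner_integral_mult_right has_bochner_integral_integrable i)
  qed
  ultimately show ?thesis by (simp add: cinner_HH[OF s] h_def)
qed

section \<open>Integration by parts against test functions\<close>

lemma compact_support_gw_bound:
  fixes F :: "real \<times> real \<Rightarrow> complex"
  assumes F: "continuous_on UNIV F" and S: "compact S" "\<And>p. p \<notin> S \<Longrightarrow> F p = 0"
  shows "\<exists>C. \<forall>p. cmod (F p) \<le> C * gw 1 p"
proof -
  have "continuous_on S (\<lambda>p. cmod (F p) / gw 1 p)"
  proof (rule continuous_on_divide)
    show "continuous_on S (\<lambda>p. cmod (F p))" "continuous_on S (gw 1)"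
      using F continuous_on_gw[of 1] by (auto intro: continuous_on_subset continuous_on_norm)
    show "\<forall>p\<in>S. gw 1 p \<noteq> 0" using gw_pos[of 1] by (simp add: order_less_imp_not_eq2)
  qed
  then have "compact ((\<lambda>p. cmod (F p) / gw 1 p) ` S)" by (rule compact_continuous_image[OF _ S(1)])
  then have "bounded ((\<lambda>p. cmod (F p) / gw 1 p) ` S)" by (rule compact_imp_bounded)
  then obtain C where C': "\<And>y. y \<in> (\<lambda>p. cmod (F p) / gw 1 p) ` S \<Longrightarrow> norm y \<le> C"
    unfolding bounded_iff by blast
  have C: "norm (cmod (F p) / gw 1 p) \<le> C" if "p \<in> S" for p by (rule C'[OF imageI[OF that]])
  have "cmod (F p) \<le> max C 0 * gw 1 p" for p
  proof (cases "p \<in> S")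
    case True
    then have "cmod (F p) / gw 1 p \<le> max C 0" using C[OF True] gw_pos[of 1 p] by (simp add: le_max_iff_disj)
    then show ?thesis using gw_pos[of 1 p] by (simp add: pos_divide_le_eq)
  qed (use S gw_pos[of 1 p] in simp)
  then show ?thesis by blast
qed

lemma integrable_gw: "integrable lborel (gw 1)"
  using lborel_prod_integral(1)[OF integrable_gauss[of "1/8"] integrable_gauss[of "1/8"]] by (simp add: gw_def[abs_def])

lemma integrable_compact_support:
  fixes F :: "real \<times> real \<Rightarrow> complex"
  assumes F: "continuous_on UNIV F" and S: "compact S" "\<And>p. p \<notin> S \<Longrightarrow> F p = 0"
  shows "integrable lborel F" "sq_int F"
proof -
  obtain C where C: "\<And>p. cmod (F p) \<le> C * gw 1 p" using compact_support_gw_bound[OF assms] by blast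
  have m [measurable]: "F \<in> borel_measurable borel" by (rule borel_measurable_continuous_onI[OF F])
  show "integrable lborel F"
    by (rule Bochner_Integration.integrable_bound[OF integrable_mult_right[OF integrable_gw, of C]])
       (auto intro!: AE_I2 order_trans[OF C])
  show "sq_int F" by (rule sq_int_gw_bounded[OF m zero_less_one C])
qed

lemma section_integral_zero:
  fixes F Fd :: "real \<Rightarrow> complex"
  assumes d: "\<And>x. (F has_vector_derivative Fd x) (at x)" and c: "continuous_on UNIV Fd"
    and R: "\<And>x. \<bar>x\<bar> > R \<Longrightarrow> F x = 0" "\<And>x. \<bar>x\<bar> > R \<Longrightarrow> Fd x = 0"
  shows "integral\<^sup>L lborel Fd = 0"
proof (rule integral_deriv_eq_0[OF d c])
  have "compact (Fd ` {-R..R})" by (rule compact_continuous_image[OF continuous_on_subset[OF c]]) auto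
  then obtain B where B: "\<And>x. x \<in> {-R..R} \<Longrightarrow> cmod (Fd x) \<le> B" using compact_imp_bounded bounded_iff by (metis imageI)
  have [measurable]: "Fd \<in> borel_measurable borel" by (rule borel_measurable_continuous_onI[OF c])
  show "integrable lborel Fd"
  proof (rule integrableI_bounded_set[where A = "{-R..R}" and B = B])
    show "AE x in lborel. x \<in> {-R..R} \<longrightarrow> norm (Fd x) \<le> B" using B by auto
    show "AE x in lborel. x \<notin> {-R..R} \<longrightarrow> Fd x = 0"
      using R(2) by (intro AE_I2) (auto simp: abs_le_iff not_le)
  qed (auto simp: emeasure_lborel_Icc_eq)
  show "(F \<longlongrightarrow> 0) at_top"
    by (rule tendsto_eventually) (use R(1) in \<open>auto simp: eventually_at_top_dense intro!: exI[of _ "\<bar>R\<bar>"]\<close>)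
  show "(F \<longlongrightarrow> 0) at_bot"
    by (rule tendsto_eventually) (use R(1) in \<open>auto simp: eventually_at_bot_dense intro!: exI[of _ "- \<bar>R\<bar>"]\<close>)
qed

lemma integral_dx_zero:
  fixes F Fd :: "real \<times> real \<Rightarrow> complex"
  assumes d: "\<And>x v. ((\<lambda>s. F (s, v)) has_vector_derivative Fd (x, v)) (at x)" and c: "continuous_on UNIV Fd"
    and S: "compact S" "\<And>p. p \<notin> S \<Longrightarrow> F p = 0" "\<And>p. p \<notin> S \<Longrightarrow> Fd p = 0"
  shows "integral\<^sup>L lborel Fd = 0"
proof -
  obtain R where R: "\<And>p. p \<in> S \<Longrightarrow> norm p \<le> R" using compact_imp_bounded[OF S(1)] bounded_iff by metis
  have out: "(x, v) \<notin> S" if "\<bar>x\<bar> > R" for x v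
    using R[of "(x, v)"] norm_fst_le[of x v] that by force
  have "(\<integral>x. Fd (x, v) \<partial>lborel) = 0" for v
    by (rule section_integral_zero[where F = "\<lambda>x. F (x, v)" and R = R])
       (use d S(2,3) out in \<open>auto intro!: continuous_on_compose2[OF c] continuous_intros\<close>)
  moreover have "integrable (lborel \<Otimes>\<^sub>M lborel) (\<lambda>(x, v). Fd (x, v))"
    using integrable_compact_support(1)[OF c S(1,3)] by (simp add: lborel_prod)
  ultimately show ?thesis
    using lborel_pair.integral_snd[of "\<lambda>x v. Fd (x, v)"] by (simp add: lborel_prod)
qed

lemma integral_dv_zero:
  fixes F Fd :: "real \<times> real \<Rightarrow> complex"
  assumes d: "\<And>x v. ((\<lambda>s. F (x, s)) has_vector_derivative Fd (x, v)) (at v)" and c: "continuous_on UNIV Fd"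
    and S: "compact S" "\<And>p. p \<notin> S \<Longrightarrow> F p = 0" "\<And>p. p \<notin> S \<Longrightarrow> Fd p = 0"
  shows "integral\<^sup>L lborel Fd = 0"
proof -
  obtain R where R: "\<And>p. p \<in> S \<Longrightarrow> norm p \<le> R" using compact_imp_bounded[OF S(1)] bounded_iff by metis
  have out: "(x, v) \<notin> S" if "\<bar>v\<bar> > R" for x v
    using R[of "(x, v)"] norm_snd_le[of v x] that by force
  have "(\<integral>v. Fd (x, v) \<partial>lborel) = 0" for x
    by (rule section_integral_zero[where F = "\<lambda>v. F (x, v)" and R = R])
       (use d S(2,3) out in \<open>auto intro!: continuous_on_compose2[OF c] continuous_intros\<close>)
  moreover have "integrable (lborel \<Otimes>\<^sub>M lborel) (\<lambda>(x, v). Fd (x, v))"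
    using integrable_compact_support(1)[OF c S(1,3)] by (simp add: lborel_prod)
  ultimately show ?thesis
    using lborel_pair.integral_fst[of "\<lambda>x v. Fd (x, v)"] by (simp add: lborel_prod)
qed

lemma has_dx: "\<phi> differentiable (at (x, v)) \<Longrightarrow> ((\<lambda>s. \<phi> (s, v)) has_vector_derivative dx \<phi> (x, v)) (at x)"
proof -
  assume "\<phi> differentiable (at (x, v))"
  then have "(\<lambda>s. \<phi> (s, v)) differentiable (at x)"
    by (intro differentiable_compose[of \<phi> "\<lambda>s. (s, v)"]) (auto intro!: derivative_intros simp: differentiable_def)
  then show ?thesis by (simp add: dx_def vector_derivative_works)
qed

lemma has_dv: "\<phi> differentiable (at (x, v)) \<Longrightarrow> ((\<lambda>s. \<phi> (x, s)) has_vector_derivative dv \<phi> (x, v)) (at v)"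
proof -
  assume "\<phi> differentiable (at (x, v))"
  then have "(\<lambda>s. \<phi> (x, s)) differentiable (at v)"
    by (intro differentiable_compose[of \<phi> "\<lambda>s. (x, s)"]) (auto intro!: derivative_intros simp: differentiable_def)
  then show ?thesis by (simp add: dv_def vector_derivative_works)
qed

lemma dx_outside:
  assumes "closed S" "\<And>p. p \<notin> S \<Longrightarrow> \<phi> p = 0" "\<And>p. \<phi> differentiable (at p)" "p \<notin> S"
  shows "dx \<phi> p = 0"
proof -
  obtain x v where p: "p = (x, v)" by (cases p)
  have "open {s. (s, v) \<in> - S}"
    using assms(1) by (intro open_vimage[of "- S" "\<lambda>s. (s, v)", unfolded vimage_def] continuous_intros) (auto simp: open_Compl)
  then have "dx \<phi> (x, v) = 0"
    by (rule vanishing_deriv[OF has_dx[OF assms(3)]]) (use assms p in auto)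
  then show ?thesis by (simp add: p)
qed

lemma dv_outside:
  assumes "closed S" "\<And>p. p \<notin> S \<Longrightarrow> \<phi> p = 0" "\<And>p. \<phi> differentiable (at p)" "p \<notin> S"
  shows "dv \<phi> p = 0"
proof -
  obtain x v where p: "p = (x, v)" by (cases p)
  have "open {s. (x, s) \<in> - S}"
    using assms(1) by (intro open_vimage[of "- S" "\<lambda>s. (x, s)", unfolded vimage_def] continuous_intros) (auto simp: open_Compl)
  then have "dv \<phi> (x, v) = 0"
    by (rule vanishing_deriv[OF has_dv[OF assms(3)]]) (use assms p in auto)
  then show ?thesis by (simp add: p)
qed

lemma ibp_x:
  fixes \<phi> h hx :: "real \<times> real \<Rightarrow> complex"
  assumes \<phi>: "\<And>p. \<phi> differentiable (at p)" "continuous_on UNIV (dx \<phi>)" and S: "compact S" "\<And>p. p \<notin> S \<Longrightarrow> \<phi> p = 0"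
    and h: "\<And>x v. ((\<lambda>s. h (s, v)) has_vector_derivative hx (x, v)) (at x)" "continuous_on UNIV h" "continuous_on UNIV hx"
  shows "(\<integral>p. dx \<phi> p * h p \<partial>lborel) = - (\<integral>p. \<phi> p * hx p \<partial>lborel)"
proof -
  have c: "continuous_on UNIV \<phi>" using \<phi>(1) by (simp add: continuous_on_eq_continuous_at differentiable_imp_continuous_within)
  have z: "dx \<phi> p = 0" if "p \<notin> S" for p by (rule dx_outside[OF compact_imp_closed[OF S(1)] S(2) \<phi>(1) that])
  have "(\<integral>p. \<phi> p * hx p + dx \<phi> p * h p \<partial>lborel) = 0"
  proof (rule integral_dx_zero[where F = "\<lambda>p. \<phi> p * h p", OF _ _ S(1)])
    show "((\<lambda>s. \<phi> (s, v) * h (s, v)) has_vector_derivative \<phi> (x, v) * hx (x, v) + dx \<phi> (x, v) * h (x, v)) (at x)" for x v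
      by (intro has_vector_derivative_mult has_dx \<phi> h)
  qed (use \<phi> h c S z in \<open>auto intro!: continuous_intros\<close>)
  moreover have "integrable lborel (\<lambda>p. \<phi> p * hx p)" "integrable lborel (\<lambda>p. dx \<phi> p * h p)"
    by (rule integrable_compact_support(1)[OF _ S(1)]; use \<phi> h c S z in \<open>auto intro!: continuous_intros\<close>)+
  ultimately show ?thesis by (simp add: add_eq_0_iff add.commute)
qed

lemma ibp_v:
  fixes \<phi> h hv :: "real \<times> real \<Rightarrow> complex"
  assumes \<phi>: "\<And>p. \<phi> differentiable (at p)" "continuous_on UNIV (dv \<phi>)" and S: "compact S" "\<And>p. p \<notin> S \<Longrightarrow> \<phi> p = 0"
    and h: "\<And>x v. ((\<lambda>s. h (x, s)) has_vector_derivative hv (x, v)) (at v)" "continuous_on UNIV h" "continuous_on UNIV hv"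
  shows "(\<integral>p. dv \<phi> p * h p \<partial>lborel) = - (\<integral>p. \<phi> p * hv p \<partial>lborel)"
proof -
  have c: "continuous_on UNIV \<phi>" using \<phi>(1) by (simp add: continuous_on_eq_continuous_at differentiable_imp_continuous_within)
  have z: "dv \<phi> p = 0" if "p \<notin> S" for p by (rule dv_outside[OF compact_imp_closed[OF S(1)] S(2) \<phi>(1) that])
  have "(\<integral>p. \<phi> p * hv p + dv \<phi> p * h p \<partial>lborel) = 0"
  proof (rule integral_dv_zero[where F = "\<lambda>p. \<phi> p * h p", OF _ _ S(1)])
    show "((\<lambda>s. \<phi> (x, s) * h (x, s)) has_vector_derivative \<phi> (x, v) * hv (x, v) + dv \<phi> (x, v) * h (x, v)) (at v)" for x v
      by (intro has_vector_derivative_mult has_dv \<phi> h)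
  qed (use \<phi> h c S z in \<open>auto intro!: continuous_intros\<close>)
  moreover have "integrable lborel (\<lambda>p. \<phi> p * hv p)" "integrable lborel (\<lambda>p. dv \<phi> p * h p)"
    by (rule integrable_compact_support(1)[OF _ S(1)]; use \<phi> h c S z in \<open>auto intro!: continuous_intros\<close>)+
  ultimately show ?thesis by (simp add: add_eq_0_iff add.commute)
qed

lemma K_transpose_eq:
  assumes "\<And>p. \<phi> differentiable (at p)"
  shows "K_transpose a \<phi> p = - (dx \<phi> p * of_real (snd p)) + dv \<phi> p * of_real (a * fst p) - dv (dv \<phi>) p
    + \<phi> p * of_real ((snd p)\<^sup>2 / 4 - 1 / 2)"
proof -
  obtain x v where p: "p = (x, v)" by (cases p)
  have "dx (\<lambda>(x, v). of_real v * \<phi> (x, v)) (x, v) = of_real v * dx \<phi> (x, v)"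
    using has_vector_derivative_mult_right[OF has_dx[OF assms], of "of_real v"]
    by (simp add: dx_def vector_derivative_at)
  moreover have "dv (\<lambda>(x, v). of_real (a * x) * \<phi> (x, v)) (x, v) = of_real (a * x) * dv \<phi> (x, v)"
    using has_vector_derivative_mult_right[OF has_dv[OF assms], of "of_real (a * x)"]
    by (simp add: dv_def vector_derivative_at)
  ultimately show ?thesis by (simp add: p K_transpose_def mult.commute)
qed

text \<open>Integration by parts moves every derivative from \<phi> to the Hermite function, and the
  compact support of \<phi> removes the boundary terms. What arrives there is the operator itself,
  which is \<open>KT\<close> with - s.\<close>

lemma integral_K_transpose_Hfun:
  assumes s: "s > 0" and \<phi>: "test_fun \<phi>"
  shows "(\<integral>p. K_transpose (s\<^sup>2) \<phi> p * Hfun s (m, n) p \<partial>lborel) = KT (- s) (m, n) (\<lambda>i. \<integral>p. \<phi> p * Hfun s i p \<partial>lborel)"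
proof -
  define S where "S = closure {p. \<phi> p \<noteq> 0}"
  have S: "compact S" using \<phi> by (simp add: test_fun_def S_def)
  have out: "\<phi> p = 0" if "p \<notin> S" for p using that closure_subset[of "{p. \<phi> p \<noteq> 0}"] by (auto simp: S_def)
  have Ck: "Ck k \<phi>" for k using \<phi> by (simp add: test_fun_def)
  have d: "\<phi> differentiable (at p)" "dv \<phi> differentiable (at p)" for p
    using Ck[of "Suc (Suc 0)"] by (simp_all only: Ck.simps)
  have c: "continuous_on UNIV \<phi>" "continuous_on UNIV (dx \<phi>)" "continuous_on UNIV (dv \<phi>)" "continuous_on UNIV (dv (dv \<phi>))"
    using Ck[of "Suc (Suc 0)"] Ck[of "Suc 0"] Ck[of 0] by auto
  have outv: "dv \<phi> p = 0" if "p \<notin> S" for p by (rule dv_outside[OF compact_imp_closed[OF S] out d(1) that])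
  have outx: "dx \<phi> p = 0" if "p \<notin> S" for p by (rule dx_outside[OF compact_imp_closed[OF S] out d(1) that])
  have outvv: "dv (dv \<phi>) p = 0" if "p \<notin> S" for p by (rule dv_outside[OF compact_imp_closed[OF S] outv d(2) that])
  define u u' w w' w'' where "u x = complex_of_real (sqrt s * hf m (s * x))"
    and "u' x = complex_of_real (sqrt s * (s * hf' m (s * x)))"
    and "w v = complex_of_real (hf n v)" and "w' v = complex_of_real (hf' n v)" and "w'' v = complex_of_real (hf'' n v)" for x v
  have du: "(u has_vector_derivative u' x) (at x)" for x
  proof -
    have "((\<lambda>x. sqrt s * hf m (s * x)) has_real_derivative sqrt s * (hf' m (s * x) * s)) (at x)"
      by (intro DERIV_cmult DERIV_chain2[OF hf'_deriv]) (auto intro!: derivative_eq_intros)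
    then show ?thesis unfolding u_def[abs_def] u'_def
      by (intro has_vector_derivative_of_real) (simp add: mult.commute)
  qed
  have dw: "(w has_vector_derivative w' x) (at x)" for x
    unfolding w_def[abs_def] w'_def by (intro has_vector_derivative_of_real hf'_deriv)
  have dw': "(w' has_vector_derivative w'' x) (at x)" for x
    unfolding w''_def w'_def[abs_def] by (intro has_vector_derivative_of_real hf''_deriv)
  have cont: "continuous_on UNIV u" "continuous_on UNIV u'" "continuous_on UNIV w" "continuous_on UNIV w'" "continuous_on UNIV w''"
    unfolding u_def u'_def w_def w'_def w''_def by (intro continuous_intros)+
  have co: "continuous_on UNIV (\<lambda>p::real \<times> real. F (fst p))" "continuous_on UNIV (\<lambda>p::real \<times> real. F (snd p))"
    if "continuous_on UNIV F" for F :: "real \<Rightarrow> complex"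
    using that by (auto intro!: continuous_on_compose2[of UNIV F] continuous_intros)
  have hp: "Hfun s (m, n) p = u (fst p) * w (snd p)" for p by (simp add: Hfun_def u_def w_def)
  define q where "q p = complex_of_real ((snd p)\<^sup>2 / 4 - 1 / 2)" for p :: "real \<times> real"
  note cs = continuous_intros c co[OF cont(1)] co[OF cont(2)] co[OF cont(3)] co[OF cont(4)] co[OF cont(5)]
  have 1: "(\<integral>p. dx \<phi> p * (of_real (snd p) * u (fst p) * w (snd p)) \<partial>lborel) = - (\<integral>p. \<phi> p * (of_real (snd p) * u' (fst p) * w (snd p)) \<partial>lborel)"
  proof (rule ibp_x[OF d(1) c(2) S out])
    show "((\<lambda>s. of_real (snd (s, v)) * u (fst (s, v)) * w (snd (s, v))) has_vector_derivative
        of_real (snd (x, v)) * u' (fst (x, v)) * w (snd (x, v))) (at x)" for x v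
      unfolding fst_conv snd_conv
      by (intro has_vector_derivative_mult_left has_vector_derivative_mult_right du)
  qed (intro cs | simp)+
  have 2: "(\<integral>p. dv \<phi> p * (of_real (s\<^sup>2 * fst p) * u (fst p) * w (snd p)) \<partial>lborel) = - (\<integral>p. \<phi> p * (of_real (s\<^sup>2 * fst p) * u (fst p) * w' (snd p)) \<partial>lborel)"
  proof (rule ibp_v[OF d(1) c(3) S out])
    show "((\<lambda>t. of_real (s\<^sup>2 * fst (x, t)) * u (fst (x, t)) * w (snd (x, t))) has_vector_derivative
        of_real (s\<^sup>2 * fst (x, v)) * u (fst (x, v)) * w' (snd (x, v))) (at v)" for x v
      unfolding fst_conv snd_conv by (intro has_vector_derivative_mult_right dw)
  qed (intro cs | simp)+
  have 3: "(\<integral>p. dv (dv \<phi>) p * (u (fst p) * w (snd p)) \<partial>lborel) = - (\<integral>p. dv \<phi> p * (u (fst p) * w' (snd p)) \<partial>lborel)"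
  proof (rule ibp_v[OF d(2) c(4) S outv])
    show "((\<lambda>t. u (fst (x, t)) * w (snd (x, t))) has_vector_derivative u (fst (x, v)) * w' (snd (x, v))) (at v)" for x v
      unfolding fst_conv snd_conv by (intro has_vector_derivative_mult_right dw)
  qed (intro cs | simp)+
  have 4: "(\<integral>p. dv \<phi> p * (u (fst p) * w' (snd p)) \<partial>lborel) = - (\<integral>p. \<phi> p * (u (fst p) * w'' (snd p)) \<partial>lborel)"
  proof (rule ibp_v[OF d(1) c(3) S out])
    show "((\<lambda>t. u (fst (x, t)) * w' (snd (x, t))) has_vector_derivative u (fst (x, v)) * w'' (snd (x, v))) (at v)" for x v
      unfolding fst_conv snd_conv by (intro has_vector_derivative_mult_right dw')
  qed (intro cs | simp)+
  have cq: "continuous_on UNIV q" unfolding q_def by (intro continuous_intros) auto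
  have I: "integrable lborel (\<lambda>p. F p * G p)"
    if "continuous_on UNIV F" "continuous_on UNIV G" "\<And>p. p \<notin> S \<Longrightarrow> F p = 0" for F G :: "real \<times> real \<Rightarrow> complex"
    by (rule integrable_compact_support(1)[OF _ S]) (use that in \<open>auto intro!: continuous_intros\<close>)
  have c1: "continuous_on UNIV (\<lambda>p. of_real (snd p) * u (fst p) * w (snd p))" and c2: "continuous_on UNIV (\<lambda>p. of_real (s\<^sup>2 * fst p) * u (fst p) * w (snd p))"
    and c3: "continuous_on UNIV (\<lambda>p. u (fst p) * w (snd p))" and c4: "continuous_on UNIV (\<lambda>p. q p * (u (fst p) * w (snd p)))"
    and c5: "continuous_on UNIV (\<lambda>p. of_real (snd p) * u' (fst p) * w (snd p))" and c6: "continuous_on UNIV (\<lambda>p. of_real (s\<^sup>2 * fst p) * u (fst p) * w' (snd p))"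
    and c7: "continuous_on UNIV (\<lambda>p. u (fst p) * w'' (snd p))"
    by (intro cs cq)+
  note Ii = I[OF c(2) c1 outx] I[OF c(3) c2 outv] I[OF c(4) c3 outvv] I[OF c(1) c4 out] I[OF c(1) c5 out] I[OF c(1) c6 out] I[OF c(1) c7 out]
  have "(\<integral>p. K_transpose (s\<^sup>2) \<phi> p * Hfun s (m, n) p \<partial>lborel)
     = (\<integral>p. - (dx \<phi> p * (of_real (snd p) * u (fst p) * w (snd p))) + dv \<phi> p * (of_real (s\<^sup>2 * fst p) * u (fst p) * w (snd p))
        - dv (dv \<phi>) p * (u (fst p) * w (snd p)) + \<phi> p * (q p * (u (fst p) * w (snd p))) \<partial>lborel)"
    by (rule arg_cong[where f = "integral\<^sup>L lborel"], rule ext)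
       (simp add: K_transpose_eq[OF d(1)] hp q_def algebra_simps)
  also have "\<dots> = - (\<integral>p. dx \<phi> p * (of_real (snd p) * u (fst p) * w (snd p)) \<partial>lborel) + (\<integral>p. dv \<phi> p * (of_real (s\<^sup>2 * fst p) * u (fst p) * w (snd p)) \<partial>lborel)
        - (\<integral>p. dv (dv \<phi>) p * (u (fst p) * w (snd p)) \<partial>lborel) + (\<integral>p. \<phi> p * (q p * (u (fst p) * w (snd p))) \<partial>lborel)"
    by (rule has_bochner_integral_integral_eq, intro has_bochner_integral_add has_bochner_integral_diff
        has_bochner_integral_minus has_bochner_integral_integrable Ii)
  also have "\<dots> = (\<integral>p. \<phi> p * (of_real (snd p) * u' (fst p) * w (snd p)) \<partial>lborel) - (\<integral>p. \<phi> p * (of_real (s\<^sup>2 * fst p) * u (fst p) * w' (snd p)) \<partial>lborel)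
        - (\<integral>p. \<phi> p * (u (fst p) * w'' (snd p)) \<partial>lborel) + (\<integral>p. \<phi> p * (q p * (u (fst p) * w (snd p))) \<partial>lborel)"
    unfolding 1 2 3 4 by simp
  also have "\<dots> = (\<integral>p. \<phi> p * (of_real (snd p) * u' (fst p) * w (snd p)) - \<phi> p * (of_real (s\<^sup>2 * fst p) * u (fst p) * w' (snd p))
        - \<phi> p * (u (fst p) * w'' (snd p)) + \<phi> p * (q p * (u (fst p) * w (snd p))) \<partial>lborel)"
    by (rule has_bochner_integral_integral_eq[symmetric], intro has_bochner_integral_add has_bochner_integral_diff
        has_bochner_integral_integrable Ii)
  also have "\<dots> = (\<integral>p. of_nat n * (\<phi> p * Hfun s (m, n) p)
       - of_real (- s * sqrt m * sqrt (Suc n)) * (\<phi> p * Hfun s (m - 1, Suc n) p)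
       + of_real (- s * sqrt (Suc m) * sqrt n) * (\<phi> p * Hfun s (Suc m, n - 1) p) \<partial>lborel)"
  proof (rule arg_cong[where f = "integral\<^sup>L lborel"], rule ext)
    fix p :: "real \<times> real"
    have K: "of_real (snd p) * u' (fst p) * w (snd p) - of_real (s\<^sup>2 * fst p) * u (fst p) * w' (snd p)
        - u (fst p) * w'' (snd p) + q p * (u (fst p) * w (snd p)) = KT (- s) (m, n) (\<lambda>i. Hfun s i p)"
      using KT_Hfun(2)[where s = s and m = m and n = n and x = "fst p" and v = "snd p"]
      by (simp add: u_def u'_def w_def w'_def w''_def q_def)
    have "\<phi> p * (of_real (snd p) * u' (fst p) * w (snd p)) - \<phi> p * (of_real (s\<^sup>2 * fst p) * u (fst p) * w' (snd p))
        - \<phi> p * (u (fst p) * w'' (snd p)) + \<phi> p * (q p * (u (fst p) * w (snd p)))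
      = \<phi> p * KT (- s) (m, n) (\<lambda>i. Hfun s i p)"
      unfolding K[symmetric] by (simp only: right_diff_distrib distrib_left)
    then show "\<phi> p * (of_real (snd p) * u' (fst p) * w (snd p)) - \<phi> p * (of_real (s\<^sup>2 * fst p) * u (fst p) * w' (snd p))
        - \<phi> p * (u (fst p) * w'' (snd p)) + \<phi> p * (q p * (u (fst p) * w (snd p)))
      = of_nat n * (\<phi> p * Hfun s (m, n) p)
       - of_real (- s * sqrt m * sqrt (Suc n)) * (\<phi> p * Hfun s (m - 1, Suc n) p)
       + of_real (- s * sqrt (Suc m) * sqrt n) * (\<phi> p * Hfun s (Suc m, n - 1) p)"
      by (simp add: KT_def algebra_simps)
  qed
  also have "\<dots> = KT (- s) (m, n) (\<lambda>i. \<integral>p. \<phi> p * Hfun s i p \<partial>lborel)"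
    unfolding KT_def fst_conv snd_conv
    by (rule has_bochner_integral_integral_eq, intro has_bochner_integral_add has_bochner_integral_diff
        has_bochner_integral_mult_right has_bochner_integral_integrable I[OF c(1) continuous_on_Hfun out])
  finally show ?thesis .
qed

text \<open>On a level \<open>KT s\<close> is a tridiagonal matrix with antisymmetric off-diagonal
  part; shifting the summation index by one exchanges the upper and the lower diagonal.\<close>

lemma KT_transpose: "(\<Sum>i\<in>{i. lev i = N}. KT s i f * c i) = (\<Sum>i\<in>{i. lev i = N}. f i * KT (- s) i c)"
proof -
  define F C where "F j = f (j, N - j)" and "C j = c (j, N - j)" for j
  define a where "a j = complex_of_real (s * sqrt (Suc j) * sqrt (real (N - j)))" for j
  have shift: "(\<Sum>j\<le>N. case j of 0 \<Rightarrow> 0 | Suc i \<Rightarrow> X i) = (\<Sum>j\<le>N. if j < N then X j else 0)" for X :: "nat \<Rightarrow> complex"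
  proof -
    have "(\<Sum>j\<le>N. case j of 0 \<Rightarrow> 0 | Suc i \<Rightarrow> X i) = (\<Sum>j<N. X j)" by (simp add: sum.atMost_shift)
    also have "\<dots> = (\<Sum>j<N. if j < N then X j else 0)" by (intro sum.cong) auto
    also have "\<dots> = (\<Sum>j\<le>N. if j < N then X j else 0)" by (simp flip: lessThan_Suc_atMost)
    finally show ?thesis .
  qed
  have up: "of_real (s * sqrt (Suc j) * sqrt (real (N - j))) * g (Suc j, N - j - 1) = (if j < N then a j * g (Suc j, N - Suc j) else 0)"
    if "j \<le> N" for j and g :: "nat \<times> nat \<Rightarrow> complex"
    using that by (auto simp: a_def)
  have down: "of_real (s * sqrt (real j) * sqrt (real (Suc (N - j)))) * g (j - 1, Suc (N - j)) = (case j of 0 \<Rightarrow> 0 | Suc i \<Rightarrow> a i * g (i, N - i))"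
    if "j \<le> N" for j and g :: "nat \<times> nat \<Rightarrow> complex"
  proof (cases j)
    case (Suc i)
    have e: "Suc (N - Suc i) = N - i" using that Suc by simp
    show ?thesis unfolding Suc by (simp only: diff_Suc_1 e nat.case a_def)
  qed simp
  have K: "KT s (j, N - j) f = of_nat (N - j) * F j - (case j of 0 \<Rightarrow> 0 | Suc i \<Rightarrow> a i * F i) + (if j < N then a j * F (Suc j) else 0)"
      if "j \<le> N" for j
    unfolding KT_def fst_conv snd_conv up[OF that] down[OF that] F_def ..
  have K': "KT (- s) (j, N - j) c = of_nat (N - j) * C j + (case j of 0 \<Rightarrow> 0 | Suc i \<Rightarrow> a i * C i) - (if j < N then a j * C (Suc j) else 0)"
      if "j \<le> N" for j
    unfolding KT_def fst_conv snd_conv C_def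
    using up[OF that, of c] down[OF that, of c] by (simp only: mult_minus_left of_real_minus)
      (simp only: minus_mult_left[symmetric] diff_minus_eq_add add_uminus_conv_diff)
  have "(\<Sum>j\<le>N. KT s (j, N - j) f * C j) = (\<Sum>j\<le>N. of_nat (N - j) * F j * C j
      - (case j of 0 \<Rightarrow> 0 | Suc i \<Rightarrow> a i * F i * C (Suc i)) + (if j < N then a j * F (Suc j) * C j else 0))"
    by (intro sum.cong) (auto simp: K algebra_simps split: nat.split)
  also have "\<dots> = (\<Sum>j\<le>N. of_nat (N - j) * F j * C j) - (\<Sum>j\<le>N. if j < N then a j * F j * C (Suc j) else 0)
      + (\<Sum>j\<le>N. case j of 0 \<Rightarrow> 0 | Suc i \<Rightarrow> a i * F (Suc i) * C i)"
    unfolding shift[symmetric] sum.distrib sum_subtractf ..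
  also have "\<dots> = (\<Sum>j\<le>N. of_nat (N - j) * F j * C j - (if j < N then a j * F j * C (Suc j) else 0)
      + (case j of 0 \<Rightarrow> 0 | Suc i \<Rightarrow> a i * F (Suc i) * C i))"
    by (simp only: sum.distrib sum_subtractf)
  also have "\<dots> = (\<Sum>j\<le>N. F j * KT (- s) (j, N - j) c)"
    by (intro sum.cong) (auto simp: K' algebra_simps split: nat.split)
  finally show ?thesis by (simp add: sum_lev F_def C_def)
qed

text \<open>Parseval turns both pairings into series over levels. Since the operator preserves
  levels, the transposition takes place inside each finite block and leaves no remainder
  term.\<close>

lemma KT_imp_K_op:
  assumes s: "s > 0" and fg: "\<And>i. cinner g (HH s i) = KT s i (\<lambda>i. cinner f (HH s i))"
  shows "(f, g) \<in> K_op (s\<^sup>2)"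
  unfolding K_op_def mem_Collect_eq prod.case
proof (intro allI impI)
  fix \<phi> assume \<phi>: "test_fun \<phi>"
  interpret fock "HH s" by (rule fock_HH[OF s])
  define S where "S = closure {p. \<phi> p \<noteq> 0}"
  have S: "compact S" using \<phi> by (simp add: test_fun_def S_def)
  have out: "\<phi> p = 0" if "p \<notin> S" for p using that closure_subset[of "{p. \<phi> p \<noteq> 0}"] by (auto simp: S_def)
  have Ck: "Ck k \<phi>" for k using \<phi> by (simp add: test_fun_def)
  have d: "\<phi> differentiable (at p)" "dv \<phi> differentiable (at p)" for p
    using Ck[of "Suc (Suc 0)"] by (simp_all only: Ck.simps)
  have c: "continuous_on UNIV \<phi>" "continuous_on UNIV (dx \<phi>)" "continuous_on UNIV (dv \<phi>)" "continuous_on UNIV (dv (dv \<phi>))"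
    using Ck[of "Suc (Suc 0)"] Ck[of "Suc 0"] Ck[of 0] by auto
  define \<psi> where "\<psi> = K_transpose (s\<^sup>2) \<phi>"
  have \<psi>: "\<psi> p = - (dx \<phi> p * of_real (snd p)) + dv \<phi> p * of_real (s\<^sup>2 * fst p) - dv (dv \<phi>) p
    + \<phi> p * of_real ((snd p)\<^sup>2 / 4 - 1 / 2)" for p
    unfolding \<psi>_def by (rule K_transpose_eq[OF d(1)])
  have c\<psi>: "continuous_on UNIV \<psi>"
    unfolding \<psi>[abs_def] by (intro continuous_intros c) auto
  have outv: "dv \<phi> p = 0" if "p \<notin> S" for p by (rule dv_outside[OF compact_imp_closed[OF S] out d(1) that])
  have outx: "dx \<phi> p = 0" if "p \<notin> S" for p by (rule dx_outside[OF compact_imp_closed[OF S] out d(1) that])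
  have outvv: "dv (dv \<phi>) p = 0" if "p \<notin> S" for p by (rule dv_outside[OF compact_imp_closed[OF S] outv d(2) that])
  have out\<psi>: "\<psi> p = 0" if "p \<notin> S" for p using that by (simp add: \<psi> out outv outx outvv)
  have pair: "(\<lambda>N. \<Sum>i\<in>{i. lev i = N}. cinner q (HH s i) * (\<integral>p. \<theta> p * Hfun s i p \<partial>lborel)) sums pairing q \<theta>"
    if \<theta>: "continuous_on UNIV \<theta>" "\<And>p. p \<notin> S \<Longrightarrow> \<theta> p = 0" for q \<theta>
  proof -
    have sq: "sq_int (\<lambda>p. cnj (\<theta> p))"
      by (rule integrable_compact_support(2)[OF _ S]) (use \<theta> in \<open>auto intro!: continuous_intros\<close>)
    define X where "X = abs_l2 (\<lambda>p. cnj (\<theta> p))"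
    have "cinner q X = (\<integral>p. rep_l2 q p * \<theta> p \<partial>lborel)"
      using cinner_abs_l2[OF sq_int_rep[of q] sq] by (simp add: X_def)
    then have "cinner q X = pairing q \<theta>" by (simp add: pairing_eq[OF \<theta>(1)])
    moreover have "cnj (cinner X (HH s i)) = (\<integral>p. \<theta> p * Hfun s i p \<partial>lborel)" for i
    proof -
      have "cnj (cinner X (HH s i)) = cinner (HH s i) X" by (rule cinner_commute[symmetric])
      then show ?thesis
        using cinner_abs_l2[OF sq_int_Hfun[OF s] sq] by (simp add: X_def HH_def mult.commute)
    qed
    ultimately show ?thesis using parseval_blocks[of q X] by simp
  qed
  have "(\<lambda>N. \<Sum>i\<in>{i. lev i = N}. cinner f (HH s i) * (\<integral>p. \<psi> p * Hfun s i p \<partial>lborel)) sums pairing f \<psi>"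
    by (rule pair[OF c\<psi> out\<psi>])
  moreover have "(\<Sum>i\<in>{i. lev i = N}. cinner f (HH s i) * (\<integral>p. \<psi> p * Hfun s i p \<partial>lborel))
      = (\<Sum>i\<in>{i. lev i = N}. cinner g (HH s i) * (\<integral>p. \<phi> p * Hfun s i p \<partial>lborel))" for N
  proof -
    have "(\<integral>p. \<psi> p * Hfun s i p \<partial>lborel) = KT (- s) i (\<lambda>i. \<integral>p. \<phi> p * Hfun s i p \<partial>lborel)" for i
      unfolding \<psi>_def by (cases i) (simp add: integral_K_transpose_Hfun[OF s \<phi>])
    then show ?thesis by (simp only: fg KT_transpose)
  qed
  ultimately have "(\<lambda>N. \<Sum>i\<in>{i. lev i = N}. cinner g (HH s i) * (\<integral>p. \<phi> p * Hfun s i p \<partial>lborel)) sums pairing f \<psi>" by simp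
  then have "pairing f \<psi> = pairing g \<phi>" using pair[OF c(1) out, of g] sums_unique2 by blast
  then show "pairing f (K_transpose (s\<^sup>2) \<phi>) = pairing g \<phi>" by (simp add: \<psi>_def)
qed

lemma K_op_iff:
  "s > 0 \<Longrightarrow> (f, g) \<in> K_op (s\<^sup>2) \<longleftrightarrow> (\<forall>i. cinner g (HH s i) = KT s i (\<lambda>i. cinner f (HH s i)))"
  using K_op_imp_KT KT_imp_K_op by (metis surj_pair)

section \<open>Geometric series and lattice points\<close>

lemma has_sum_geometric2_real:
  fixes x y :: real
  assumes "0 \<le> x" "x < 1" "0 \<le> y" "y < 1"
  shows "((\<lambda>i. x ^ fst i * y ^ snd i) has_sum 1 / ((1 - x) * (1 - y))) UNIV"
proof -
  have g: "((\<lambda>n. z ^ n) has_sum 1 / (1 - z)) UNIV" if "0 \<le> z" "z < 1" for z :: real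
    using norm_summable_imp_has_sum[of "\<lambda>n. z ^ n" "1 / (1 - z)"] geometric_sums[of z] that
    by (simp add: power_abs summable_geometric)
  have in1: "((\<lambda>q. x ^ fst (p, q) * y ^ snd (p, q)) has_sum x ^ p * (1 / (1 - y))) UNIV" for p
    using has_sum_cmult_right[OF g[OF assms(3,4)], of "x ^ p"] by simp
  have out1: "((\<lambda>p. x ^ p * (1 / (1 - y))) has_sum 1 / (1 - x) * (1 / (1 - y))) UNIV"
    by (rule has_sum_cmult_left[OF g[OF assms(1,2)]])
  have "(\<lambda>i. x ^ fst i * y ^ snd i) summable_on UNIV \<times> UNIV"
    by (rule summable_on_SigmaI[OF in1]) (use out1 assms in \<open>auto simp: summable_on_def\<close>)
  from has_sum_SigmaI[OF in1 out1 this] show ?thesis by simp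
qed

lemma has_sum_geometric2_complex:
  fixes x y :: complex
  assumes "cmod x < 1" "cmod y < 1"
  shows "((\<lambda>i. x ^ fst i * y ^ snd i) has_sum 1 / ((1 - x) * (1 - y))) UNIV"
proof -
  have g: "((\<lambda>n. z ^ n) has_sum 1 / (1 - z)) UNIV" if "cmod z < 1" for z :: complex
    using norm_summable_imp_has_sum[of "\<lambda>n. z ^ n" "1 / (1 - z)"] geometric_sums[of z] that
    by (simp add: norm_power summable_geometric)
  have in1: "((\<lambda>q. x ^ fst (p, q) * y ^ snd (p, q)) has_sum x ^ p * (1 / (1 - y))) UNIV" for p
    using has_sum_cmult_right[OF g[OF assms(2)], of "x ^ p"] by simp
  have out1: "((\<lambda>p. x ^ p * (1 / (1 - y))) has_sum 1 / (1 - x) * (1 / (1 - y))) UNIV"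
    by (rule has_sum_cmult_left[OF g[OF assms(1)]])
  have "(\<lambda>i. norm (x ^ fst i * y ^ snd i)) summable_on UNIV"
    using has_sum_geometric2_real[of "cmod x" "cmod y"] assms by (auto simp: norm_mult norm_power summable_on_def)
  then have "(\<lambda>i. x ^ fst i * y ^ snd i) summable_on UNIV \<times> UNIV"
    by (simp add: Infinite_Sum.abs_summable_summable)
  from has_sum_SigmaI[OF in1 out1 this] show ?thesis by simp
qed

definition npts :: "real \<Rightarrow> real \<Rightarrow> real \<Rightarrow> (nat \<times> nat) set" where
  "npts \<alpha> \<beta> r = {i. real (fst i) * \<alpha> + real (snd i) * \<beta> \<le> r}"

lemma npts_eq:
  assumes "\<alpha> > 0" "\<beta> > 0" "r \<ge> 0"
  shows "npts \<alpha> \<beta> r = (SIGMA p:{..nat \<lfloor>r / \<alpha>\<rfloor>}. {..nat \<lfloor>(r - real p * \<alpha>) / \<beta>\<rfloor>})"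
proof -
  have le: "(n \<le> nat \<lfloor>x\<rfloor>) = (real n \<le> x)" if "x \<ge> 0" for n x
    using that by (simp add: le_nat_iff le_floor_iff)
  have "(p, q) \<in> npts \<alpha> \<beta> r \<longleftrightarrow> p \<le> nat \<lfloor>r / \<alpha>\<rfloor> \<and> q \<le> nat \<lfloor>(r - real p * \<alpha>) / \<beta>\<rfloor>" for p q
  proof (cases "real p * \<alpha> \<le> r")
    case True
    then have "p \<le> nat \<lfloor>r / \<alpha>\<rfloor>" using assms le[of "r / \<alpha>" p] by (simp add: field_simps)
    moreover have "q \<le> nat \<lfloor>(r - real p * \<alpha>) / \<beta>\<rfloor> \<longleftrightarrow> real p * \<alpha> + real q * \<beta> \<le> r"
      using assms True le[of "(r - real p * \<alpha>) / \<beta>" q] by (simp add: field_simps)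
    ultimately show ?thesis by (simp add: npts_def)
  next
    case False
    then have "\<not> p \<le> nat \<lfloor>r / \<alpha>\<rfloor>" using assms le[of "r / \<alpha>" p] by (simp add: field_simps)
    moreover have "\<not> real p * \<alpha> + real q * \<beta> \<le> r"
      using False assms mult_nonneg_nonneg[of "real q" \<beta>] by linarith
    ultimately show ?thesis by (simp add: npts_def)
  qed
  then show ?thesis by auto
qed

lemma finite_npts: "\<alpha> > 0 \<Longrightarrow> \<beta> > 0 \<Longrightarrow> finite (npts \<alpha> \<beta> r)"
proof (cases "r \<ge> 0")
  case False
  assume "\<alpha> > 0" "\<beta> > 0"
  then have "npts \<alpha> \<beta> r = {}"
    using False by (auto simp: npts_def not_le) (meson add_nonneg_nonneg less_imp_le mult_nonneg_nonneg not_less of_nat_0_le_iff order_less_le_trans)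
  then show ?thesis by simp
qed (simp add: npts_eq)

text \<open>Counting row by row, each row is replaced by its real length with an error of at most 1;
  the lengths form an arithmetic series \<open>L r\<close>, and the number of rows is only of order
  r. The limit is the area of the triangle with legs 1/\<alpha> and 1/\<beta>.\<close>

lemma card_npts_asymp:
  assumes ab: "\<alpha> > 0" "\<beta> > 0"
  shows "((\<lambda>r. real (card (npts \<alpha> \<beta> r)) / r\<^sup>2) \<longlongrightarrow> 1 / (2 * \<alpha> * \<beta>)) at_top"
proof -
  define Q where "Q r = real (nat \<lfloor>r / \<alpha>\<rfloor>)" for r
  define L where "L r = ((Q r + 1) * r - \<alpha> * (Q r * (Q r + 1) / 2)) / \<beta>" for r
  have bounds: "L r \<le> real (card (npts \<alpha> \<beta> r))" "real (card (npts \<alpha> \<beta> r)) \<le> L r + (Q r + 1)" if r: "r \<ge> 0" for r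
  proof -
    define M where "M = nat \<lfloor>r / \<alpha>\<rfloor>"
    have Mr: "real p * \<alpha> \<le> r" if "p \<le> M" for p
    proof -
      have "real p \<le> r / \<alpha>" using that r ab by (simp add: M_def le_nat_iff le_floor_iff)
      then show ?thesis using ab by (simp add: field_simps)
    qed
    have "card (npts \<alpha> \<beta> r) = (\<Sum>p\<le>M. card {..nat \<lfloor>(r - real p * \<alpha>) / \<beta>\<rfloor>})"
      unfolding npts_eq[OF ab r] M_def by (rule card_SigmaI) auto
    then have c: "real (card (npts \<alpha> \<beta> r)) = (\<Sum>p\<le>M. real (nat \<lfloor>(r - real p * \<alpha>) / \<beta>\<rfloor>) + 1)" by (simp add: add.commute)
    have fl: "x \<le> real (nat \<lfloor>x\<rfloor>) + 1" "real (nat \<lfloor>x\<rfloor>) \<le> x" if "x \<ge> 0" for x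
      using that by linarith+
    have "(\<Sum>p\<le>M. real p) = Q r * (Q r + 1) / 2"
      unfolding Q_def M_def[symmetric] by (induction M) (auto simp: field_simps)
    then have S: "(\<Sum>p\<le>M. (r - real p * \<alpha>) / \<beta>) = L r"
      unfolding sum_divide_distrib[symmetric] sum_subtractf sum_distrib_right[symmetric] L_def
      by (simp add: Q_def M_def algebra_simps)
    have pos: "(r - real p * \<alpha>) / \<beta> \<ge> 0" if "p \<le> M" for p using Mr[OF that] ab by simp
    show "L r \<le> real (card (npts \<alpha> \<beta> r))"
      unfolding c S[symmetric] by (rule sum_mono) (use fl pos in auto)
    have "(\<Sum>p\<le>M. real (nat \<lfloor>(r - real p * \<alpha>) / \<beta>\<rfloor>) + 1) \<le> (\<Sum>p\<le>M. (r - real p * \<alpha>) / \<beta> + 1)"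
      by (rule sum_mono) (use fl pos in auto)
    also have "\<dots> = L r + (Q r + 1)" unfolding sum.distrib S by (simp add: Q_def M_def)
    finally show "real (card (npts \<alpha> \<beta> r)) \<le> L r + (Q r + 1)" unfolding c .
  qed
  have Qlim: "((\<lambda>r. Q r / r) \<longlongrightarrow> 1 / \<alpha>) at_top"
  proof (rule real_tendsto_sandwich)
    show "\<forall>\<^sub>F r in at_top. (r / \<alpha> - 1) / r \<le> Q r / r"
      using eventually_gt_at_top[of 0]
      by eventually_elim (use ab in \<open>auto simp: Q_def intro!: divide_right_mono\<close>, linarith?)
    show "\<forall>\<^sub>F r in at_top. Q r / r \<le> (r / \<alpha>) / r"
      using eventually_gt_at_top[of 0]
    proof eventually_elim
      case (elim r)
      then have "Q r \<le> r / \<alpha>" using ab by (simp add: Q_def)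
      then show ?case using elim by (intro divide_right_mono) auto
    qed
    show "((\<lambda>r. (r / \<alpha> - 1) / r) \<longlongrightarrow> 1 / \<alpha>) at_top" using ab by (real_asymp simp: field_simps)
    show "((\<lambda>r. (r / \<alpha>) / r) \<longlongrightarrow> 1 / \<alpha>) at_top" using ab by (real_asymp simp: field_simps)
  qed
  have inv: "((\<lambda>r::real. 1 / r) \<longlongrightarrow> 0) at_top" by real_asymp
  have "((\<lambda>r. ((Q r / r + 1 / r) * 1 - \<alpha> * (Q r / r * (Q r / r + 1 / r) / 2)) / \<beta>) \<longlongrightarrow>
      ((1 / \<alpha> + 0) * 1 - \<alpha> * (1 / \<alpha> * (1 / \<alpha> + 0) / 2)) / \<beta>) at_top"
    by (intro tendsto_intros Qlim inv) (use ab in auto)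
  moreover have "((1 / \<alpha> + 0) * 1 - \<alpha> * (1 / \<alpha> * (1 / \<alpha> + 0) / 2)) / \<beta> = 1 / (2 * \<alpha> * \<beta>)"
    using ab by (simp add: field_simps)
  moreover have "\<forall>\<^sub>F r in at_top. ((Q r / r + 1 / r) * 1 - \<alpha> * (Q r / r * (Q r / r + 1 / r) / 2)) / \<beta> = L r / r\<^sup>2"
    using eventually_gt_at_top[of 0]
    by eventually_elim (use ab in \<open>simp add: L_def power2_eq_square field_simps\<close>)
  ultimately have Llim: "((\<lambda>r. L r / r\<^sup>2) \<longlongrightarrow> 1 / (2 * \<alpha> * \<beta>)) at_top" by (simp only:) (rule Lim_transform_eventually)
  have "((\<lambda>r. L r / r\<^sup>2 + (Q r / r + 1 / r) * (1 / r)) \<longlongrightarrow> 1 / (2 * \<alpha> * \<beta>) + (1 / \<alpha> + 0) * 0) at_top"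
    by (intro tendsto_intros Llim Qlim inv)
  moreover have "\<forall>\<^sub>F r in at_top. L r / r\<^sup>2 + (Q r / r + 1 / r) * (1 / r) = (L r + (Q r + 1)) / r\<^sup>2"
    using eventually_gt_at_top[of 0]
    by eventually_elim (simp add: power2_eq_square add_divide_distrib)
  ultimately have Ulim: "((\<lambda>r. (L r + (Q r + 1)) / r\<^sup>2) \<longlongrightarrow> 1 / (2 * \<alpha> * \<beta>)) at_top"
    by (simp only: mult_zero_right add_0_right) (rule Lim_transform_eventually)
  show ?thesis
  proof (rule real_tendsto_sandwich[OF _ _ Llim Ulim])
    show "\<forall>\<^sub>F r in at_top. L r / r\<^sup>2 \<le> real (card (npts \<alpha> \<beta> r)) / r\<^sup>2"
      using eventually_ge_at_top[of 0] by eventually_elim (intro divide_right_mono bounds, auto)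
    show "\<forall>\<^sub>F r in at_top. real (card (npts \<alpha> \<beta> r)) / r\<^sup>2 \<le> (L r + (Q r + 1)) / r\<^sup>2"
      using eventually_ge_at_top[of 0] by eventually_elim (intro divide_right_mono bounds, auto)
  qed
qed

section \<open>The Fokker--Planck semigroup\<close>

locale fokker_planck =
  fixes a :: real
  assumes a: "a > 0" "a \<noteq> 1 / 4"
begin

definition om :: complex where
  "om = (if a < 1 / 4 then of_real (sqrt (1 / 4 - a)) else \<i> * of_real (sqrt (a - 1 / 4)))"

definition mu1 :: complex where "mu1 = 1 / 2 + om"
definition mu2 :: complex where "mu2 = 1 / 2 - om"

lemma om_sq: "om * om = 1 / 4 - of_real a"
proof (cases "a < 1 / 4")
  case True
  then have "complex_of_real (sqrt (1 / 4 - a) * sqrt (1 / 4 - a)) = of_real (1 / 4 - a)"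
    by (simp del: of_real_mult of_real_diff)
  then have "complex_of_real (sqrt (1 / 4 - a)) * of_real (sqrt (1 / 4 - a)) = 1 / 4 - of_real a"
    by (simp only: of_real_mult of_real_diff of_real_divide of_real_1 of_real_numeral)
  then show ?thesis using True by (simp only: om_def if_True)
next
  case False
  then have "complex_of_real (sqrt (a - 1 / 4) * sqrt (a - 1 / 4)) = of_real (a - 1 / 4)"
    by (simp del: of_real_mult of_real_diff)
  then have "complex_of_real (sqrt (a - 1 / 4)) * of_real (sqrt (a - 1 / 4)) = of_real a - 1 / 4"
    by (simp only: of_real_mult of_real_diff of_real_divide of_real_1 of_real_numeral)
  moreover have "om * om = - (complex_of_real (sqrt (a - 1 / 4)) * of_real (sqrt (a - 1 / 4)))"
    using False by (simp add: om_def complex_eq_iff)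
  ultimately show ?thesis by simp
qed

lemma om_nz: "om \<noteq> 0" using a by (auto simp: om_def)

lemma mu_sum: "mu1 + mu2 = 1" by (simp add: mu1_def mu2_def)
lemma mu_diff: "mu1 - mu2 = 2 * om" by (simp add: mu1_def mu2_def)
lemma mu_prod: "mu1 * mu2 = of_real a" using om_sq by (simp add: mu1_def mu2_def algebra_simps)

lemma Re_mu_pos: "Re mu1 > 0" "Re mu2 > 0"
proof -
  have "sqrt (1 / 4 - a) < 1 / 2" using a by (intro real_less_lsqrt) (auto simp: power2_eq_square)
  moreover have "sqrt (1 / 4 - a) \<ge> 0" if "a < 1 / 4" using that by simp
  ultimately show "Re mu1 > 0" "Re mu2 > 0"
    by (cases "a < 1 / 4"; simp add: mu1_def mu2_def om_def; linarith)+
qed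

text \<open>The maximum in the counting law arises here: for a < 1/4 both eigenvalues are real with
  product a, for a > 1/4 they are conjugate with real part 1/2.\<close>

lemma Re_mu_prod: "1 / (2 * Re mu1 * Re mu2) = 2 * max 1 (1 / (4 * a))"
proof (cases "a < 1 / 4")
  case True
  have "sqrt (1 / 4 - a) * sqrt (1 / 4 - a) = 1 / 4 - a" using True by simp
  then have "Re mu1 * Re mu2 = a" using True by (simp add: mu1_def mu2_def om_def algebra_simps)
  moreover have "1 / (4 * a) > 1" using True a by (simp add: field_simps)
  ultimately show ?thesis using a by (simp add: mult.assoc max_def)
next
  case False
  then have "Re mu1 = 1 / 2" "Re mu2 = 1 / 2" by (simp_all add: mu1_def mu2_def om_def)
  moreover have "1 / (4 * a) \<le> 1" using False a by (simp add: field_simps)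
  ultimately show ?thesis by (simp only:) (simp add: max_def)
qed

definition s :: real where "s = sqrt a"

lemma s_pos: "s > 0" and s_sq: "s\<^sup>2 = a" and s_s: "s * s = a"
  using a by (simp_all add: s_def)

sublocale fock "HH s" by (rule fock_HH[OF s_pos])

definition mk2 :: "complex \<Rightarrow> complex \<Rightarrow> complex \<Rightarrow> complex \<Rightarrow> complex^2^2" where
  "mk2 p q r t = (\<chi> i j. if i = 1 then if j = 1 then p else q else if j = 1 then r else t)"

lemma mk2_nth [simp]: "ent (mk2 p q r t) 1 1 = p" "ent (mk2 p q r t) 1 2 = q" "ent (mk2 p q r t) 2 1 = r" "ent (mk2 p q r t) 2 2 = t"
  by (simp_all add: mk2_def)

text \<open>The columns (s, - mu) are eigenvectors of the matrix with rows (0, -s) and (s, 1),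
  because mu^2 = mu - a for both eigenvalues. Below, \<Delta> is the determinant of \<open>P\<close>
  and \<open>Q\<close> its inverse.\<close>

definition P where "P = mk2 (of_real s) (of_real s) (- mu1) (- mu2)"
definition \<Delta> :: complex where "\<Delta> = of_real s * (2 * om)"
definition Q where "Q = mk2 (- mu2 / \<Delta>) (- of_real s / \<Delta>) (mu1 / \<Delta>) (of_real s / \<Delta>)"

lemma \<Delta>_nz: "\<Delta> \<noteq> 0" using s_pos om_nz by (simp add: \<Delta>_def)

lemma \<Delta>_eq: "of_real s * mu1 - of_real s * mu2 = \<Delta>"
  using mu_diff by (simp add: \<Delta>_def right_diff_distrib[symmetric])

lemma PQ: "P ** Q = mat 1"
  using \<Delta>_nz \<Delta>_eq by (auto simp: P_def Q_def eq2_iff mult2_nth field_simps)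

lemma QP: "Q ** P = mat 1"
  using \<Delta>_nz \<Delta>_eq by (auto simp: P_def Q_def eq2_iff mult2_nth field_simps)

text \<open>This is exp (- t M) for the matrix M with rows (0, -s) and (s, 1), written through its
  diagonalisation.\<close>

definition A :: "real \<Rightarrow> complex^2^2" where
  "A t = P ** diag2 (exp (- of_real t * mu1)) (exp (- of_real t * mu2)) ** Q"

lemma A_add: "A (t + u) = A t ** A u"
proof -
  have "A t ** A u = P ** diag2 (exp (- of_real t * mu1)) (exp (- of_real t * mu2)) ** (Q ** P) **
      diag2 (exp (- of_real u * mu1)) (exp (- of_real u * mu2)) ** Q"
    by (simp only: A_def matrix_mul_assoc)
  also have "\<dots> = P ** (diag2 (exp (- of_real t * mu1)) (exp (- of_real t * mu2)) **
      diag2 (exp (- of_real u * mu1)) (exp (- of_real u * mu2))) ** Q"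
    by (simp add: QP matrix_mul_assoc)
  also have "diag2 (exp (- of_real t * mu1)) (exp (- of_real t * mu2)) ** diag2 (exp (- of_real u * mu1)) (exp (- of_real u * mu2))
      = diag2 (exp (- of_real (t + u) * mu1)) (exp (- of_real (t + u) * mu2))"
    by (simp add: eq2_iff mult2_nth exp_add[symmetric] algebra_simps)
  finally show ?thesis by (simp add: A_def)
qed

lemma A_0: "A 0 = mat 1"
  using PQ by (simp add: A_def mat1_diag2[symmetric])

section \<open>Eigenvectors, dual system and diagonal form of the operator\<close>

definition lam :: "nat \<times> nat \<Rightarrow> complex" where "lam i = of_nat (fst i) * mu1 + of_nat (snd i) * mu2"
definition w where "w = W P"
definition w' where "w' = W (adj2 Q)"

lemma biorth_w: "cinner (w i) (w' j) = (if i = j then 1 else 0)"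
  by (auto simp: w_def w'_def cinner_W QP Gam_one lev_def prod_eq_iff)

lemma dense_w: "closure (l2c.span (range w)) = UNIV"
  unfolding w_def by (rule dense_W[OF PQ])

lemma adj_QP: "adj2 Q ** adj2 P = mat 1"
  by (simp add: adj2_mult[symmetric] PQ)

lemma dense_w': "closure (l2c.span (range w')) = UNIV"
  unfolding w'_def by (rule dense_W[OF adj_QP])

lemma coeff_via_w': "cinner f (HH s (j, N - j)) = (\<Sum>q\<le>N. Gam P N j q * cinner f (w' (q, N - q)))" if "j \<le> N"
proof -
  have l: "lev (j, N - j) = N" using that by simp
  have "HH s (j, N - j) = W (adj2 Q ** adj2 P) (j, N - j)" by (simp add: adj_QP W_one)
  also have "\<dots> = (\<Sum>q\<le>N. cscale (Gam (adj2 P) N q j) (w' (q, N - q)))"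
    unfolding W_mult l w'_def by simp
  finally show ?thesis
    using that by (simp add: cinner_sum_right cinner_cscale_right Gam_adj2)
qed

text \<open>The symmetric power of \<open>P\<close> diagonalises \<open>KT\<close>: its column q is
  an eigenvector with eigenvalue \<open>lam (q, N - q)\<close>, by \<open>Gam_eigen\<close>.\<close>

lemma KT_via_w':
  assumes j: "j \<le> N"
  shows "KT s (j, N - j) (\<lambda>i. cinner f (HH s i)) = (\<Sum>q\<le>N. Gam P N j q * (lam (q, N - q) * cinner f (w' (q, N - q))))"
proof -
  define y where "y q = cinner f (w' (q, N - q))" for q
  define c where "c k = (\<Sum>q\<le>N. Gam P N k q * y q)" for k
  have ck: "cinner f (HH s (k, N - k)) = c k" if "k \<le> N" for k
    unfolding c_def y_def by (rule coeff_via_w'[OF that])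
  \<comment> \<open>At j = 0 the vector on the left lies on level N + 1, outside the block, but it
    carries the factor sqrt 0.\<close>
  have dn: "of_real (s * sqrt (real j) * sqrt (real (Suc (N - j)))) * cinner f (HH s (j - 1, Suc (N - j)))
      = of_real (s * sqrt (real j) * sqrt (real (Suc (N - j)))) * c (j - 1)"
  proof (cases j)
    case (Suc i)
    have "Suc (N - Suc i) = N - i" using j Suc by simp
    then show ?thesis using ck[of i] j unfolding Suc by (simp del: of_nat_Suc)
  qed simp
  have up: "of_real (s * sqrt (real (Suc j)) * sqrt (real (N - j))) * cinner f (HH s (Suc j, N - j - 1))
      = of_real (s * sqrt (real (Suc j)) * sqrt (real (N - j))) * c (Suc j)"
  proof (cases "j < N")
    case True
    then show ?thesis using ck[of "Suc j"] by (simp del: of_nat_Suc)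
  qed (use j in simp)
  have "KT s (j, N - j) (\<lambda>i. cinner f (HH s i)) = of_nat (N - j) * c j
      - of_real (s * sqrt (real j) * sqrt (real (Suc (N - j)))) * c (j - 1)
      + of_real (s * sqrt (real (Suc j)) * sqrt (real (N - j))) * c (Suc j)"
    unfolding KT_def fst_conv snd_conv dn up ck[OF j] ..
  also have "\<dots> = (\<Sum>q\<le>N. (of_nat (N - j) * Gam P N j q
      - of_real (s * sqrt (real j) * sqrt (real (Suc (N - j)))) * Gam P N (j - 1) q
      + of_real (s * sqrt (real (Suc j)) * sqrt (real (N - j))) * Gam P N (Suc j) q) * y q)"
    unfolding c_def by (simp only: sum_distrib_left distrib_right left_diff_distrib sum.distrib sum_subtractf mult.assoc)
  also have "\<dots> = (\<Sum>q\<le>N. (of_nat q * mu1 + of_nat (N - q) * mu2) * Gam P N j q * y q)"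
  proof (intro sum.cong refl arg_cong2[where f = "(*)"])
    fix q assume "q \<in> {..N}"
    then have q: "q \<le> N" by simp
    have e: "mu1 * mu1 = mu1 - of_real a" "mu2 * mu2 = mu2 - of_real a"
      using om_sq by (simp_all add: mu1_def mu2_def distrib_left distrib_right left_diff_distrib right_diff_distrib add_divide_distrib diff_divide_distrib)
    have ss: "complex_of_real s * of_real s = of_real a" using s_s by (simp flip: of_real_mult)
    show "of_nat (N - j) * Gam P N j q
      - of_real (s * sqrt (real j) * sqrt (real (Suc (N - j)))) * Gam P N (j - 1) q
      + of_real (s * sqrt (real (Suc j)) * sqrt (real (N - j))) * Gam P N (Suc j) q
      = (of_nat q * mu1 + of_nat (N - q) * mu2) * Gam P N j q"
      by (rule Gam_eigen[OF q j]) (use e ss in \<open>simp_all add: P_def algebra_simps\<close>)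
  qed
  finally show ?thesis by (simp add: y_def lam_def mult_ac)
qed

lemma Gam_P_inj:
  assumes "\<And>j. j \<le> N \<Longrightarrow> (\<Sum>q\<le>N. Gam P N j q * x q) = 0" and k: "k \<le> N"
  shows "x k = 0"
proof -
  have "0 = (\<Sum>j\<le>N. Gam Q N k j * (\<Sum>q\<le>N. Gam P N j q * x q))" using assms(1) by simp
  also have "\<dots> = (\<Sum>q\<le>N. (\<Sum>j\<le>N. Gam Q N k j * Gam P N j q) * x q)"
    unfolding sum_distrib_left sum_distrib_right by (subst sum.swap) (simp add: mult.assoc)
  also have "\<dots> = (\<Sum>q\<le>N. if q = k then x k else 0)"
    using k by (intro sum.cong refl) (auto simp: Gam_mult[symmetric] QP Gam_one)
  also have "\<dots> = x k" using k by simp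
  finally show ?thesis by simp
qed

text \<open>The change from Hermite to eigenvector coefficients is an invertible matrix on each
  finite level, so no convergence question enters and the maximal domain is matched exactly.\<close>

lemma K_op_iff_w': "(f, g) \<in> K_op a \<longleftrightarrow> (\<forall>i. cinner g (w' i) = lam i * cinner f (w' i))"
proof -
  have "(f, g) \<in> K_op a \<longleftrightarrow> (\<forall>i. cinner g (HH s i) = KT s i (\<lambda>i. cinner f (HH s i)))"
    using K_op_iff[OF s_pos] s_sq by simp
  also have "\<dots> \<longleftrightarrow> (\<forall>i. cinner g (w' i) = lam i * cinner f (w' i))"
  proof (intro iffI allI)
    fix i assume h: "\<forall>i. cinner g (HH s i) = KT s i (\<lambda>i. cinner f (HH s i))"
    define N where "N = lev i"
    define x where "x q = cinner g (w' (q, N - q)) - lam (q, N - q) * cinner f (w' (q, N - q))" for q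
    have "(\<Sum>q\<le>N. Gam P N j q * x q) = 0" if "j \<le> N" for j
      using h[rule_format, of "(j, N - j)"] coeff_via_w'[OF that, of g] KT_via_w'[OF that, of f]
      by (simp add: x_def right_diff_distrib sum_subtractf)
    then have "x (fst i) = 0" by (rule Gam_P_inj) (auto simp: N_def lev_def)
    then show "cinner g (w' i) = lam i * cinner f (w' i)" by (simp add: x_def N_def lev_def)
  next
    fix i assume h: "\<forall>i. cinner g (w' i) = lam i * cinner f (w' i)"
    define N j where "N = lev i" and "j = fst i"
    have i: "i = (j, N - j)" and j: "j \<le> N" by (auto simp: N_def j_def lev_def)
    show "cinner g (HH s i) = KT s i (\<lambda>i. cinner f (HH s i))"
      unfolding i coeff_via_w'[OF j] KT_via_w'[OF j] by (simp only: h)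
  qed
  finally show ?thesis .
qed

text \<open>Real forms of \<open>(e\<^sub>2 - e\<^sub>1) / (\<mu>\<^sub>1 - \<mu>\<^sub>2)\<close> and \<open>(e\<^sub>1 + e\<^sub>2) / 2\<close>, where \<open>e\<^sub>i = exp(-t \<mu>\<^sub>i)\<close>.\<close>

definition Sr :: "real \<Rightarrow> real" where
  "Sr t = (if a < 1 / 4 then (exp (- t * (1 / 2 - sqrt (1 / 4 - a))) - exp (- t * (1 / 2 + sqrt (1 / 4 - a)))) / (2 * sqrt (1 / 4 - a))
           else exp (- t / 2) * sin (sqrt (a - 1 / 4) * t) / sqrt (a - 1 / 4))"

definition Cr :: "real \<Rightarrow> real" where
  "Cr t = (if a < 1 / 4 then (exp (- t * (1 / 2 - sqrt (1 / 4 - a))) + exp (- t * (1 / 2 + sqrt (1 / 4 - a)))) / 2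
           else exp (- t / 2) * cos (sqrt (a - 1 / 4) * t))"

lemma exp_mu: "exp (- of_real t * mu1) = of_real (Cr t) - om * of_real (Sr t)"
  "exp (- of_real t * mu2) = of_real (Cr t) + om * of_real (Sr t)"
proof -
  have "exp (- of_real t * mu1) = of_real (Cr t) - om * of_real (Sr t) \<and> exp (- of_real t * mu2) = of_real (Cr t) + om * of_real (Sr t)"
  proof (cases "a < 1 / 4")
    case True
    define b where "b = sqrt (1 / 4 - a)"
    have b: "b > 0" using True by (simp add: b_def)
    have m: "mu1 = of_real (1 / 2 + b)" "mu2 = of_real (1 / 2 - b)" "om = of_real b"
      using True by (simp_all add: mu1_def mu2_def om_def b_def)
    have "exp (- t * (1 / 2 + b)) = Cr t - b * Sr t" "exp (- t * (1 / 2 - b)) = Cr t + b * Sr t"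
    proof -
      have "x = (y + x) / 2 - b * ((y - x) / (2 * b))" "y = (y + x) / 2 + b * ((y - x) / (2 * b))" for x y
        using b by (simp_all add: field_simps)
      then show "exp (- t * (1 / 2 + b)) = Cr t - b * Sr t" "exp (- t * (1 / 2 - b)) = Cr t + b * Sr t"
        using True unfolding Cr_def Sr_def b_def[symmetric] if_P[OF True] by blast+
    qed
    then have "complex_of_real (exp (- t * (1 / 2 + b))) = of_real (Cr t - b * Sr t)"
       "complex_of_real (exp (- t * (1 / 2 - b))) = of_real (Cr t + b * Sr t)" by simp_all
    then show ?thesis unfolding m by (simp add: exp_of_real[symmetric])
  next
    case False
    define b where "b = sqrt (a - 1 / 4)"
    have b: "b > 0" using False a by (simp add: b_def)
    have m: "mu1 = Complex (1 / 2) b" "mu2 = Complex (1 / 2) (- b)" "om = Complex 0 b"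
      using False by (simp_all add: mu1_def mu2_def om_def b_def complex_eq_iff)
    show ?thesis unfolding m using b False
      by (simp add: complex_eq_iff Re_exp Im_exp Cr_def Sr_def b_def[symmetric] mult.commute[of t])
  qed
  then show "exp (- of_real t * mu1) = of_real (Cr t) - om * of_real (Sr t)"
    "exp (- of_real t * mu2) = of_real (Cr t) + om * of_real (Sr t)" by blast+
qed

lemma A_ent: "ent (A t) 1 1 = of_real (Cr t + Sr t / 2)" "ent (A t) 2 2 = of_real (Cr t - Sr t / 2)"
  "ent (A t) 1 2 = of_real (s * Sr t)" "ent (A t) 2 1 = - of_real (s * Sr t)"
proof -
  define C S where "C = complex_of_real (Cr t)" and "S = complex_of_real (Sr t)"
  have e: "exp (- of_real t * mu1) = C - om * S" "exp (- of_real t * mu2) = C + om * S" unfolding exp_mu C_def S_def by simp_all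
  have sn: "complex_of_real s \<noteq> 0" using s_pos by simp
  have AQ: "A t = P ** diag2 (C - om * S) (C + om * S) ** Q" unfolding A_def e ..
  have ss: "complex_of_real s * of_real s = mu1 * mu2" using s_s mu_prod by (simp flip: of_real_mult)
  have "ent (A t) 1 1 = of_real s * (mu1 * (C + om * S) - mu2 * (C - om * S)) / \<Delta>"
    by (simp add: AQ P_def Q_def mult2_nth algebra_simps add_divide_distrib diff_divide_distrib)
  also have "mu1 * (C + om * S) - mu2 * (C - om * S) = 2 * om * (C + S / 2)"
    by (simp add: mu1_def mu2_def algebra_simps)
  finally show "ent (A t) 1 1 = of_real (Cr t + Sr t / 2)" using \<Delta>_nz by (simp add: \<Delta>_def C_def S_def)
  have "ent (A t) 2 2 = of_real s * (mu1 * (C - om * S) - mu2 * (C + om * S)) / \<Delta>"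
    by (simp add: AQ P_def Q_def mult2_nth algebra_simps add_divide_distrib diff_divide_distrib)
  also have "mu1 * (C - om * S) - mu2 * (C + om * S) = 2 * om * (C - S / 2)"
    by (simp add: mu1_def mu2_def algebra_simps)
  finally show "ent (A t) 2 2 = of_real (Cr t - Sr t / 2)" using \<Delta>_nz by (simp add: \<Delta>_def C_def S_def)
  have "ent (A t) 1 2 = of_real s * of_real s * ((C + om * S) - (C - om * S)) / \<Delta>"
    by (simp add: AQ P_def Q_def mult2_nth algebra_simps add_divide_distrib diff_divide_distrib)
  also have "\<dots> = of_real s * S * \<Delta> / \<Delta>" by (simp add: \<Delta>_def mult_ac)
  finally show "ent (A t) 1 2 = of_real (s * Sr t)" using \<Delta>_nz by (simp add: S_def)
  have "ent (A t) 2 1 = mu1 * mu2 * ((C - om * S) - (C + om * S)) / \<Delta>"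
    by (simp add: AQ P_def Q_def mult2_nth algebra_simps add_divide_distrib diff_divide_distrib)
  also have "\<dots> = - (of_real s * S * \<Delta> / \<Delta>)" unfolding ss[symmetric] by (simp add: \<Delta>_def mult_ac)
  finally show "ent (A t) 2 1 = - of_real (s * Sr t)" using \<Delta>_nz by (simp add: S_def)
qed

text \<open>The product of the two exponentials is exp (- t) because mu1 + mu2 = 1; written in
  \<open>Cr\<close> and \<open>Sr\<close> it is a difference of squares with om^2 = 1/4 - a.\<close>

lemma Cr_sq: "(Cr t)\<^sup>2 = exp (- t) + (1 / 4 - a) * (Sr t)\<^sup>2"
proof -
  have "exp (- of_real t * mu1) * exp (- of_real t * mu2) = exp (- complex_of_real t)"
    using mu_sum by (simp add: exp_add[symmetric] distrib_left[symmetric] minus_mult_right[symmetric] flip: minus_add_distrib)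
      (simp add: algebra_simps mu1_def mu2_def)
  then have "of_real (Cr t) * of_real (Cr t) - (om * om) * (of_real (Sr t) * of_real (Sr t)) = complex_of_real (exp (- t))"
    unfolding exp_mu by (simp add: algebra_simps exp_of_real flip: of_real_minus)
  then have "complex_of_real ((Cr t)\<^sup>2) = of_real (exp (- t) + (1 / 4 - a) * (Sr t)\<^sup>2)"
    unfolding om_sq by (simp add: power2_eq_square algebra_simps)
  then show ?thesis using of_real_eq_iff by blast
qed

text \<open>This is 1 plus the squared modulus of the determinant minus the squared Hilbert-Schmidt
  norm of \<open>A t\<close>, in view of \<open>HS_A\<close> and \<open>det_A\<close> below; the
  terms without \<open>Sr\<close> form a complete square.\<close>

definition D :: "real \<Rightarrow> real" where "D t = (1 - exp (- t))\<^sup>2 - (Sr t)\<^sup>2"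

lemma HS_A: "(cmod (ent (A t) 1 1))\<^sup>2 + (cmod (ent (A t) 1 2))\<^sup>2 + (cmod (ent (A t) 2 1))\<^sup>2 + (cmod (ent (A t) 2 2))\<^sup>2
    = 2 * exp (- t) + (Sr t)\<^sup>2"
proof -
  have "(Cr t + Sr t / 2)\<^sup>2 + (s * Sr t)\<^sup>2 + (s * Sr t)\<^sup>2 + (Cr t - Sr t / 2)\<^sup>2
      = 2 * (Cr t)\<^sup>2 + (Sr t)\<^sup>2 / 2 + 2 * s\<^sup>2 * (Sr t)\<^sup>2"
    by (simp add: power2_eq_square algebra_simps)
  also have "\<dots> = 2 * exp (- t) + (Sr t)\<^sup>2" unfolding Cr_sq s_sq by (simp add: algebra_simps)
  finally show ?thesis unfolding A_ent norm_minus_cancel norm_of_real power2_abs .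
qed

lemma det_A: "det (A t) = of_real (exp (- t))"
proof -
  have "(Cr t + Sr t / 2) * (Cr t - Sr t / 2) - (s * Sr t) * (- (s * Sr t)) = (Cr t)\<^sup>2 - (Sr t)\<^sup>2 / 4 + s\<^sup>2 * (Sr t)\<^sup>2"
    by (simp add: power2_eq_square algebra_simps)
  also have "\<dots> = exp (- t)" unfolding Cr_sq s_sq by (simp add: algebra_simps)
  finally have "complex_of_real ((Cr t + Sr t / 2) * (Cr t - Sr t / 2) - (s * Sr t) * (- (s * Sr t))) = of_real (exp (- t))" by simp
  then show ?thesis unfolding det_2 A_ent by simp
qed

text \<open>Both squares start with t^2 - t^3, so the difference is first visible at order t^4,
  where the coefficients are 7/12 and 1/2 + (1/4 - a)/3.\<close>

lemma D_asymp: "((\<lambda>t. D t / t^4) \<longlongrightarrow> a / 3) (at_right 0)"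
proof (cases "a < 1 / 4")
  case True
  define b where "b = sqrt (1 / 4 - a)"
  have b: "b > 0" "a = 1 / 4 - b * b" using True by (simp_all add: b_def)
  have "((\<lambda>t. ((1 - exp (- t))\<^sup>2 - (exp (- t / 2) * (exp (b * t) - exp (- (b * t))) / (2 * b))\<^sup>2) / t^4) \<longlongrightarrow> (1 / 4 - b * b) / 3) (at_right 0)"
    using b(1) by real_asymp (simp add: field_simps power2_eq_square)
  moreover have "exp (- t / 2) * (exp (b * t) - exp (- (b * t))) = exp (- t * (1 / 2 - b)) - exp (- t * (1 / 2 + b))" for t
    by (simp add: right_diff_distrib exp_add[symmetric] algebra_simps)
  ultimately show ?thesis using True by (simp add: D_def Sr_def b_def[symmetric] b(2)[symmetric])
next
  case False
  define b where "b = sqrt (a - 1 / 4)"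
  have b: "b > 0" "a = 1 / 4 + b * b" using False a by (simp_all add: b_def)
  have "((\<lambda>t. ((1 - exp (- t))\<^sup>2 - (exp (- t / 2) * sin (b * t) / b)\<^sup>2) / t^4) \<longlongrightarrow> (1 / 4 + b * b) / 3) (at_right 0)"
    using b(1) by real_asymp (simp add: field_simps power2_eq_square)
  then show ?thesis using False by (simp add: D_def Sr_def b_def[symmetric] b(2)[symmetric])
qed

text \<open>The constants a/6 and a enclose the limit a/3; the cap 1/2 keeps the threshold below
  1.\<close>

lemma D_bounds: "\<exists>t0. 0 < t0 \<and> t0 < 1 \<and> (\<forall>t. 0 < t \<and> t < t0 \<longrightarrow> a / 6 * t^4 \<le> D t \<and> D t \<le> a * t^4)"
proof -
  have "\<forall>\<^sub>F t in at_right 0. a / 6 < D t / t^4" "\<forall>\<^sub>F t in at_right 0. D t / t^4 < a"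
    using order_tendstoD(1)[OF D_asymp, of "a / 6"] order_tendstoD(2)[OF D_asymp, of a] a by simp_all
  then have "\<forall>\<^sub>F t in at_right 0. a / 6 < D t / t^4 \<and> D t / t^4 < a" by (rule eventually_conj)
  then obtain b where b: "b > 0" "\<And>t. 0 < t \<Longrightarrow> t < b \<Longrightarrow> a / 6 < D t / t^4 \<and> D t / t^4 < a"
    unfolding eventually_at_right_field by blast
  have "a / 6 * t^4 \<le> D t \<and> D t \<le> a * t^4" if "0 < t" "t < min b (1/2)" for t
    using b(2)[of t] that by (simp add: field_simps)
  then show ?thesis using b(1) by (intro exI[of _ "min b (1/2)"]) auto
qed

end

definition hs2 :: "complex^2^2 \<Rightarrow> real" where
  "hs2 X = (cmod (ent X 1 1))\<^sup>2 + (cmod (ent X 1 2))\<^sup>2 + (cmod (ent X 2 1))\<^sup>2 + (cmod (ent X 2 2))\<^sup>2"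

text \<open>A positive product (1 - d1)(1 - d2) puts both values on the same side of 1, and d1 d2 <
  1, from the determinant, decides for the lower side.\<close>

lemma strict_contraction:
  assumes det: "cmod (det X) < 1" and hs: "hs2 X < 1 + (cmod (det X))\<^sup>2"
  obtains V d1 d2 where "adj2 V ** V = mat 1" "V ** adj2 V = mat 1"
    "adj2 X ** X = V ** diag2 (of_real d1) (of_real d2) ** adj2 V" "0 \<le> d1" "d1 < 1" "0 \<le> d2" "d2 < 1"
    "(1 - d1) * (1 - d2) = 1 + (cmod (det X))\<^sup>2 - hs2 X" "d1 * d2 = (cmod (det X))\<^sup>2"
proof -
  obtain V d1 d2 where V: "adj2 V ** V = mat 1" "V ** adj2 V = mat 1"
    "adj2 X ** X = V ** diag2 (of_real d1) (of_real d2) ** adj2 V" and d: "0 \<le> d1" "0 \<le> d2"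
    and sd: "d1 + d2 = (cmod (ent X 1 1))\<^sup>2 + (cmod (ent X 1 2))\<^sup>2 + (cmod (ent X 2 1))\<^sup>2 + (cmod (ent X 2 2))\<^sup>2"
    and pd: "d1 * d2 = (cmod (det X))\<^sup>2"
    by (rule spectral_2x2[of X])
  have p: "(1 - d1) * (1 - d2) = 1 + (cmod (det X))\<^sup>2 - hs2 X"
    using sd pd by (simp add: hs2_def algebra_simps)
  have lt: "d1 * d2 < 1" unfolding pd using det by (simp add: power_less_one_iff)
  have pos: "(1 - d1) * (1 - d2) > 0" using p hs by simp
  have "d1 < 1 \<and> d2 < 1"
  proof (rule ccontr)
    assume "\<not> (d1 < 1 \<and> d2 < 1)"
    then have "d1 > 1" "d2 > 1" using pos by (auto simp: zero_less_mult_iff)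
    then show False using lt mult_strict_mono[of 1 d1 1 d2] by simp
  qed
  then show ?thesis using that[OF V d(1) _ d(2) _ p pd] by blast
qed

context fock
begin

lemma quant_contraction:
  assumes "cmod (det X) < 1" and "hs2 X < 1 + (cmod (det X))\<^sup>2"
  shows "\<exists>T \<rho>. quant X T \<and> 0 \<le> \<rho> \<and> \<rho> < 1 \<and> (\<forall>f. norm (T f) \<le> norm f) \<and>
    (\<forall>N c. norm (T (\<Sum>i\<in>{i. lev i = N}. cscale (c i) (H i))) \<le> \<rho>^N * norm (\<Sum>i\<in>{i. lev i = N}. cscale (c i) (H i)))"
proof -
  obtain V d1 d2 where V: "adj2 V ** V = mat 1" "V ** adj2 V = mat 1"
    "adj2 X ** X = V ** diag2 (of_real d1) (of_real d2) ** adj2 V" and d: "0 \<le> d1" "d1 < 1" "0 \<le> d2" "d2 < 1"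
    by (rule strict_contraction[OF assms])
  \<comment> \<open>The larger singular value of \<open>X\<close>. On level N it enters with the
    power N, and its being less than 1 is what makes high levels decay.\<close>
  define \<rho> where "\<rho> = sqrt (max d1 d2)"
  have \<rho>: "0 \<le> \<rho>" "\<rho> < 1" "\<rho>\<^sup>2 = max d1 d2"
    using d by (simp_all add: \<rho>_def)
  then show ?thesis
    using quant_exists[OF V, of \<rho>] d by (auto simp: less_imp_le intro!: exI[of _ \<rho>])
qed

lemma W_diag: "W (X ** diag2 c d) i = cscale (c ^ fst i * d ^ snd i) (W X i)"
proof -
  have "W (X ** diag2 c d) i = (\<Sum>l\<le>lev i. if l = fst i then cscale (c ^ fst i * d ^ snd i) (W X i) else 0)"
    unfolding W_mult Gam_diag by (rule sum.cong) (auto simp: lev_def)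
  then show ?thesis by simp
qed

lemma quant_id: "quant (mat 1) id_blinfun"
  by (simp add: quant_def clinear_op_def)

end

lemma det_adj2: "det (adj2 X) = cnj (det X)"
  by (simp add: det_2 mult.commute)

lemma hs2_adj2: "hs2 (adj2 X) = hs2 X"
  by (simp add: hs2_def)

context fokker_planck
begin

section \<open>Construction of the semigroup from small times\<close>

lemma A_contraction:
  assumes "t > 0" "D t > 0"
  shows "cmod (det (A t)) < 1" "hs2 (A t) < 1 + (cmod (det (A t)))\<^sup>2" "1 + (cmod (det (A t)))\<^sup>2 - hs2 (A t) = D t"
proof -
  show "1 + (cmod (det (A t)))\<^sup>2 - hs2 (A t) = D t"
    unfolding hs2_def HS_A det_A by (simp add: D_def power2_eq_square algebra_simps)
  then show "hs2 (A t) < 1 + (cmod (det (A t)))\<^sup>2" using assms by simp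
  show "cmod (det (A t)) < 1" unfolding det_A using assms by simp
qed

lemma small_time: "\<exists>t0. 0 < t0 \<and> t0 < 1 \<and> (\<forall>t. 0 < t \<and> t < t0 \<longrightarrow> D t > 0 \<and> a / 6 * t^4 \<le> D t \<and> D t \<le> a * t^4)"
proof -
  obtain t0 where t0: "0 < t0" "t0 < 1" "\<And>t. 0 < t \<Longrightarrow> t < t0 \<Longrightarrow> a / 6 * t^4 \<le> D t \<and> D t \<le> a * t^4"
    using D_bounds by blast
  have "D t > 0" if "0 < t" "t < t0" for t
    using t0(3)[OF that] a that by (smt (verit) divide_pos_pos mult_pos_pos zero_less_power)
  then show ?thesis using t0 by blast
qed

definition tz :: real where
  "tz = (SOME t0. 0 < t0 \<and> t0 < 1 \<and> (\<forall>t. 0 < t \<and> t < t0 \<longrightarrow> D t > 0 \<and> a / 6 * t^4 \<le> D t \<and> D t \<le> a * t^4))"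

lemma tz: "0 < tz" "tz < 1" "\<And>t. 0 < t \<Longrightarrow> t < tz \<Longrightarrow> D t > 0"
  "\<And>t. 0 < t \<Longrightarrow> t < tz \<Longrightarrow> a / 6 * t^4 \<le> D t" "\<And>t. 0 < t \<Longrightarrow> t < tz \<Longrightarrow> D t \<le> a * t^4"
  using someI_ex[OF small_time] unfolding tz_def[symmetric] by blast+

text \<open>Positivity of \<open>D\<close> is known only below \<open>tz\<close>. A larger time is
  cut into n equal steps u below \<open>tz\<close>, and products of contractions quantising
  \<open>A u\<close> quantise \<open>A\<close> at the multiples of u.\<close>

lemma semigroup_exists:
  assumes "t \<ge> 0"
  shows "\<exists>T. quant (A t) T \<and> (\<forall>f. norm (T f) \<le> norm f)"
proof -
  obtain n where n: "t / tz < real n" using reals_Archimedean2 by blast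
  then have n0: "n > 0" using assms tz(1) by (cases n) (auto simp: divide_less_0_iff)
  define u where "u = t / real n"
  have u: "0 \<le> u" "u < tz" using n n0 assms tz(1) by (auto simp: u_def field_simps)
  have base: "\<exists>T. quant (A u) T \<and> (\<forall>f. norm (T f) \<le> norm f)"
  proof (cases "u = 0")
    case True
    then show ?thesis using quant_id by (auto simp: A_0)
  next
    case False
    then have "u > 0" using u by simp
    from quant_contraction[OF A_contraction(1,2)[OF this tz(3)[OF this u(2)]]] show ?thesis by blast
  qed
  then obtain U where U: "quant (A u) U" "\<And>f. norm (U f) \<le> norm f" by blast
  have "\<exists>T. quant (A (real m * u)) T \<and> (\<forall>f. norm (T f) \<le> norm f)" for m
  proof (induction m)
    case 0
    then show ?case using quant_id by (auto simp: A_0)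
  next
    case (Suc m)
    then obtain T where T: "quant (A (real m * u)) T" "\<And>f. norm (T f) \<le> norm f" by blast
    have "quant (A (real (Suc m) * u)) (U o\<^sub>L T)"
      using quant_mult[OF U(1) T(1)] by (simp add: A_add distrib_right)
    moreover have "norm ((U o\<^sub>L T) f) \<le> norm f" for f using U(2)[of "T f"] T(2)[of f] by simp
    ultimately show ?case by blast
  qed
  from this[of n] show ?thesis using n0 by (simp add: u_def)
qed

definition semi :: "real \<Rightarrow> (l2 \<Rightarrow>\<^sub>L l2)" where
  "semi t = (SOME T. quant (A t) T \<and> (\<forall>f. norm (T f) \<le> norm f))"

lemma semi: "t \<ge> 0 \<Longrightarrow> quant (A t) (semi t)" "t \<ge> 0 \<Longrightarrow> norm (semi t f) \<le> norm f"
  using someI_ex[OF semigroup_exists] unfolding semi_def[symmetric] by blast+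

lemma AP: "A t ** P = P ** diag2 (exp (- of_real t * mu1)) (exp (- of_real t * mu2))"
proof -
  have "A t ** P = P ** diag2 (exp (- of_real t * mu1)) (exp (- of_real t * mu2)) ** (Q ** P)"
    by (simp only: A_def matrix_mul_assoc)
  then show ?thesis by (simp add: QP)
qed

lemma semi_w: "t \<ge> 0 \<Longrightarrow> semi t (w i) = cscale (exp (- of_real t * lam i)) (w i)"
proof -
  assume t: "t \<ge> 0"
  have "semi t (w i) = cscale (exp (- of_real t * mu1) ^ fst i * exp (- of_real t * mu2) ^ snd i) (w i)"
    unfolding w_def quantD(2)[OF semi(1)[OF t]] AP W_diag ..
  also have "exp (- of_real t * mu1) ^ fst i * exp (- of_real t * mu2) ^ snd i = exp (- of_real t * lam i)"
    by (simp add: exp_of_nat_mult[symmetric] exp_add[symmetric] lam_def algebra_simps)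
  finally show ?thesis .
qed

section \<open>Level sets of the eigenvalues, diagonal operators and the resolvent\<close>

lemma level_set_lam: "{i. Re (lam i) \<le> r} = npts (Re mu1) (Re mu2) r"
  by (simp add: npts_def lam_def)

text \<open>The image of \<open>HH s i\<close> under the operator that multiplies each eigenvector
  \<open>w l\<close> by \<open>g l\<close>: the symmetric power of \<open>Q\<close> gives the
  eigenvector coordinates of \<open>HH s i\<close>.\<close>

definition spec :: "(nat \<times> nat \<Rightarrow> complex) \<Rightarrow> nat \<times> nat \<Rightarrow> l2" where
  "spec g i = (\<Sum>l\<le>lev i. cscale (Gam Q (lev i) l (fst i) * g (l, lev i - l)) (w (l, lev i - l)))"

text \<open>Coordinates in the eigenvectors \<open>w\<close> of the level-N vector whose Hermite
  coordinates are \<open>c\<close>.\<close>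

definition xco :: "nat \<Rightarrow> (nat \<times> nat \<Rightarrow> complex) \<Rightarrow> nat \<Rightarrow> complex" where
  "xco N c l = (\<Sum>j\<le>N. c (j, N - j) * Gam Q N l j)"

lemma spec_comb: "(\<Sum>i\<in>{i. lev i = N}. cscale (c i) (spec g i)) = (\<Sum>l\<le>N. cscale (xco N c l * g (l, N - l)) (w (l, N - l)))"
proof -
  have "(\<Sum>i\<in>{i. lev i = N}. cscale (c i) (spec g i))
      = (\<Sum>j\<le>N. \<Sum>l\<le>N. cscale (c (j, N - j) * Gam Q N l j * g (l, N - l)) (w (l, N - l)))"
    unfolding sum_lev by (rule sum.cong) (auto simp: spec_def l2c.scale_sum_right mult.assoc)
  also have "\<dots> = (\<Sum>l\<le>N. cscale (xco N c l * g (l, N - l)) (w (l, N - l)))"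
    by (subst sum.swap) (simp add: xco_def sum_distrib_right l2c.scale_sum_left)
  finally show ?thesis .
qed

lemma spec_one: "spec (\<lambda>_. 1) i = HH s i"
proof -
  have "HH s i = W (P ** Q) i" by (simp add: PQ W_one)
  then show ?thesis unfolding W_mult by (simp add: spec_def w_def)
qed

lemma w_eq: "w (k, N - k) = (\<Sum>i\<in>{i. lev i = N}. cscale (Gam P N (fst i) k) (HH s i))" if "k \<le> N"
  unfolding sum_lev w_def W_def using that by simp

lemma cinner_spec: "lev i \<noteq> lev j \<Longrightarrow> cinner (spec g i) (spec g j) = 0"
  unfolding spec_def cinner_sum_left cinner_sum_right cinner_cscale_left cinner_cscale_right
  by (intro sum.neutral ballI) (simp add: w_def cinner_W)

lemma xco_P: "k \<le> N \<Longrightarrow> l \<le> N \<Longrightarrow> xco N (\<lambda>i. Gam P N (fst i) k) l = (if l = k then 1 else 0)"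
  using Gam_mult[of k N l Q P] by (simp add: xco_def QP Gam_one mult.commute)

lemma spec_w:
  assumes R: "clinear_op R" "\<And>i. R (HH s i) = spec g i"
  shows "R (w i) = cscale (g i) (w i)"
proof -
  define N k where "N = lev i" and "k = fst i"
  have i: "i = (k, N - k)" and k: "k \<le> N" by (auto simp: N_def k_def lev_def)
  have "R (w i) = (\<Sum>l\<le>N. cscale (xco N (\<lambda>i. Gam P N (fst i) k) l * g (l, N - l)) (w (l, N - l)))"
    unfolding i w_eq[OF k] clinear_sum[OF R(1)] R(2) spec_comb ..
  also have "\<dots> = (\<Sum>l\<le>N. if l = k then cscale (g i) (w i) else 0)"
    by (rule sum.cong) (use k i in \<open>auto simp: xco_P\<close>)
  finally show ?thesis using k by simp
qed

text \<open>The resolvent \<open>y = (K - z)\<^sup>-\<^sup>1 f\<close> on one block: \<open>e\<^sup>t\<^sup>z e\<^sup>-\<^sup>t\<^sup>K y\<close> has derivative \<open>-e\<^sup>t\<^sup>z e\<^sup>-\<^sup>t\<^sup>K f\<close>, so if it has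
  dropped to half its initial norm at time \<open>t1\<close>, then \<open>y\<close> is bounded by \<open>f\<close> uniformly in the block.\<close>

lemma level_estimate:
  assumes t1: "0 < t1" "t1 \<le> 1" and \<rho>: "cmod (exp (of_real t1 * z)) * r \<le> 1 / 2"
    and z: "z \<notin> range lam"
    and dec: "\<And>c. norm (semi t1 (\<Sum>i\<in>{i. lev i = N}. cscale (c i) (HH s i))) \<le> r * norm (\<Sum>i\<in>{i. lev i = N}. cscale (c i) (HH s i))"
  shows "norm (\<Sum>i\<in>{i. lev i = N}. cscale (c i) (spec (\<lambda>i. 1 / (lam i - z)) i))
     \<le> 2 * exp (cmod z) * norm (\<Sum>i\<in>{i. lev i = N}. cscale (c i) (HH s i))"
proof -
  define x where "x l = xco N c l" for l
  define m where "m l = lam (l, N - l) - z" for l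
  define f where "f = (\<Sum>i\<in>{i. lev i = N}. cscale (c i) (HH s i))"
  define y where "y = (\<Sum>l\<le>N. cscale (x l * (1 / m l)) (w (l, N - l)))"
  have f: "f = (\<Sum>l\<le>N. cscale (x l) (w (l, N - l)))"
    using spec_comb[where N = N and c = c and g = "\<lambda>_. 1"] by (simp add: f_def spec_one x_def)
  have m: "m l \<noteq> 0" for l using z by (auto simp: m_def)
  define \<phi> where "\<phi> \<tau> = (\<Sum>l\<le>N. cscale (x l / m l * exp (- (of_real \<tau> * m l))) (w (l, N - l)))" for \<tau> :: real
  define \<phi>' where "\<phi>' \<tau> = (\<Sum>l\<le>N. cscale (x l / m l * (- m l * exp (- (of_real \<tau> * m l)))) (w (l, N - l)))" for \<tau> :: real
  have ex: "exp (- (of_real \<tau> * m l)) = exp (of_real \<tau> * z) * exp (- of_real \<tau> * lam (l, N - l))" for \<tau> l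
    by (simp add: m_def exp_add[symmetric] algebra_simps)
  have \<phi>: "\<phi> \<tau> = cscale (exp (of_real \<tau> * z)) (semi \<tau> y)" if "\<tau> \<ge> 0" for \<tau>
    unfolding y_def clinear_sum[OF quantD(1)[OF semi(1)[OF that]]] semi_w[OF that] l2c.scale_sum_right \<phi>_def ex
    by (simp add: mult_ac)
  have \<phi>': "\<phi>' \<tau> = - cscale (exp (of_real \<tau> * z)) (semi \<tau> f)" if "\<tau> \<ge> 0" for \<tau>
  proof -
    have "\<phi>' \<tau> = (\<Sum>l\<le>N. cscale (- 1) (cscale (exp (of_real \<tau> * z) * x l * exp (- of_real \<tau> * lam (l, N - l))) (w (l, N - l))))"
      unfolding \<phi>'_def ex using m by (intro sum.cong refl) (simp add: field_simps)
    also have "\<dots> = cscale (- 1) (cscale (exp (of_real \<tau> * z)) (semi \<tau> f))"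
      unfolding f clinear_sum[OF quantD(1)[OF semi(1)[OF that]]] semi_w[OF that] l2c.scale_sum_right by (simp add: mult_ac)
    finally show ?thesis by simp
  qed
  have der: "(\<phi> has_vector_derivative \<phi>' \<tau>) (at \<tau>)" for \<tau>
    unfolding \<phi>_def \<phi>'_def
  proof (rule has_vector_derivative_sum, rule bounded_linear.has_vector_derivative[OF bounded_linear_cscale_left])
    fix l
    have "((\<lambda>\<zeta>. x l / m l * exp (- (\<zeta> * m l))) has_field_derivative x l / m l * (- m l * exp (- (of_real \<tau> * m l)))) (at (of_real \<tau>))"
      by (auto intro!: derivative_eq_intros)
    from has_vector_derivative_real_field[OF this]
    show "((\<lambda>\<tau>. x l / m l * exp (- (of_real \<tau> * m l))) has_vector_derivative x l / m l * (- m l * exp (- (of_real \<tau> * m l)))) (at \<tau>)" .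
  qed
  have exb: "cmod (exp (of_real \<tau> * z)) \<le> exp (cmod z)" if "0 \<le> \<tau>" "\<tau> \<le> 1" for \<tau>
  proof -
    have "\<tau> * Re z \<le> \<tau> * cmod z" using that complex_Re_le_cmod by (intro mult_left_mono) auto
    also have "\<dots> \<le> cmod z" using that mult_right_mono[of \<tau> 1 "cmod z"] by simp
    finally show ?thesis by simp
  qed
  have "norm (\<phi> t1 - \<phi> 0) \<le> (exp (cmod z) * norm f) * t1 - (exp (cmod z) * norm f) * 0"
  proof (rule differentiable_bound_general[OF t1(1)])
    show "continuous_on {0..t1} \<phi>"
      using der by (meson continuous_at_imp_continuous_on has_vector_derivative_continuous)
    show "((\<lambda>t. exp (cmod z) * norm f * t) has_vector_derivative exp (cmod z) * norm f) (at \<tau>)" for \<tau>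
      by (auto intro!: derivative_eq_intros simp: has_real_derivative_iff_has_vector_derivative[symmetric])
    fix \<tau> assume \<tau>: "0 < \<tau>" "\<tau> < t1"
    have "norm (\<phi>' \<tau>) = cmod (exp (of_real \<tau> * z)) * norm (semi \<tau> f)"
      using \<tau> by (simp only: \<phi>' less_imp_le norm_minus_cancel norm_cscale)
    also have "\<dots> \<le> exp (cmod z) * norm f"
      using \<tau> t1 exb[of \<tau>] semi(2)[of \<tau> f] by (intro mult_mono) auto
    finally show "norm (\<phi>' \<tau>) \<le> exp (cmod z) * norm f" .
  qed (use der in \<open>auto intro!: continuous_intros\<close>)
  also have "\<dots> \<le> exp (cmod z) * norm f"
    using t1 mult_left_mono[of t1 1 "exp (cmod z) * norm f"] by simp
  finally have 1: "norm (\<phi> t1 - \<phi> 0) \<le> exp (cmod z) * norm f" .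
  have y0: "\<phi> 0 = y" by (simp add: \<phi>_def y_def)
  have "y = (\<Sum>l\<le>N. \<Sum>i\<in>{i. lev i = N}. cscale (x l * (1 / m l) * Gam P N (fst i) l) (HH s i))"
    unfolding y_def by (rule sum.cong) (auto simp: w_eq l2c.scale_sum_right)
  also have "\<dots> = (\<Sum>i\<in>{i. lev i = N}. cscale (\<Sum>l\<le>N. x l * (1 / m l) * Gam P N (fst i) l) (HH s i))"
    by (subst sum.swap) (simp add: l2c.scale_sum_left)
  finally have y2: "y = (\<Sum>i\<in>{i. lev i = N}. cscale (\<Sum>l\<le>N. x l * (1 / m l) * Gam P N (fst i) l) (HH s i))" .
  have "norm (\<phi> t1) \<le> cmod (exp (of_real t1 * z)) * (r * norm y)"
    using t1 dec[of "\<lambda>i. \<Sum>l\<le>N. x l * (1 / m l) * Gam P N (fst i) l"]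
    by (simp only: \<phi> less_imp_le norm_cscale y2[symmetric]) (intro mult_left_mono, auto)
  also have "\<dots> \<le> 1 / 2 * norm y" using mult_right_mono[OF \<rho>, of "norm y"] by (simp add: mult.assoc)
  finally have "norm y \<le> 2 * (exp (cmod z) * norm f)"
    using 1 norm_triangle_ineq2[of "\<phi> 0" "\<phi> t1"] unfolding y0 by (simp add: norm_minus_commute)
  then show ?thesis unfolding spec_comb y_def m_def x_def f_def by simp
qed

text \<open>On level N the semigroup at time t1 shrinks by \<rho>^N, which eventually beats the
  growth factor |exp (t1 z)|, so \<open>level_estimate\<close> gives one constant for all high
  levels. The finitely many low levels are finite-dimensional and are bounded individually.\<close>

lemma resolvent_exists:
  assumes z: "z \<notin> range lam"
  shows "\<exists>R. clinear_op R \<and> (\<forall>i. R (w i) = cscale (1 / (lam i - z)) (w i))"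
proof -
  define g where "g = (\<lambda>i. 1 / (lam i - z))"
  define t1 where "t1 = tz / 2"
  have t1: "0 < t1" "t1 < tz" "t1 \<le> 1" using tz(1,2) by (simp_all add: t1_def)
  obtain T \<rho> where T: "quant (A t1) T" and \<rho>: "0 \<le> \<rho>" "\<rho> < 1"
    and dec: "\<And>N c. norm (T (\<Sum>i\<in>{i. lev i = N}. cscale (c i) (HH s i))) \<le> \<rho>^N * norm (\<Sum>i\<in>{i. lev i = N}. cscale (c i) (HH s i))"
    using quant_contraction[OF A_contraction(1,2)[OF t1(1) tz(3)[OF t1(1,2)]]] by blast
  have Tt: "semi t1 = T" using quant_unique semi(1)[of t1] T t1 by simp
  have "(\<lambda>N. cmod (exp (of_real t1 * z)) * \<rho>^N) \<longlonglongrightarrow> cmod (exp (of_real t1 * z)) * 0"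
    using \<rho> by (intro tendsto_intros LIMSEQ_realpow_zero) auto
  then have "\<forall>\<^sub>F N in sequentially. cmod (exp (of_real t1 * z)) * \<rho>^N < 1 / 2" by (rule order_tendstoD(2)) simp
  then obtain N0 where N0: "\<And>N. N \<ge> N0 \<Longrightarrow> cmod (exp (of_real t1 * z)) * \<rho>^N < 1 / 2"
    unfolding eventually_sequentially by blast
  \<comment> \<open>Crude bound through the dual vectors: an eigenvector coordinate of f is at most
    the norm of its \<open>w'\<close> times the norm of f. It depends on the level and is applied
    below N0 only.\<close>
  define K where "K N = (\<Sum>l\<le>N. norm (w' (l, N - l)) * cmod (g (l, N - l)) * norm (w (l, N - l)))" for N
  have K0: "K N \<ge> 0" for N unfolding K_def by (intro sum_nonneg) auto
  have KN: "norm (\<Sum>i\<in>{i. lev i = N}. cscale (c i) (spec g i)) \<le> K N * norm (\<Sum>i\<in>{i. lev i = N}. cscale (c i) (HH s i))" for N c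
  proof -
    define f where "f = (\<Sum>i\<in>{i. lev i = N}. cscale (c i) (HH s i))"
    have f: "f = (\<Sum>l\<le>N. cscale (xco N c l) (w (l, N - l)))"
      using spec_comb[where N = N and c = c and g = "\<lambda>_. 1"] by (simp add: f_def spec_one)
    have x: "cmod (xco N c l) \<le> norm (w' (l, N - l)) * norm f" if "l \<le> N" for l
    proof -
      have "cinner f (w' (l, N - l)) = (\<Sum>k\<le>N. if k = l then xco N c l else 0)"
        unfolding f cinner_sum_left cinner_cscale_left biorth_w by (rule sum.cong) auto
      then have "cinner f (w' (l, N - l)) = xco N c l" using that by simp
      then show ?thesis using cmod_cinner_le[of f "w' (l, N - l)"] by (simp add: mult.commute)
    qed
    have "norm (\<Sum>i\<in>{i. lev i = N}. cscale (c i) (spec g i)) \<le> (\<Sum>l\<le>N. norm (cscale (xco N c l * g (l, N - l)) (w (l, N - l))))"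
      unfolding spec_comb by (rule norm_sum)
    also have "\<dots> \<le> (\<Sum>l\<le>N. norm (w' (l, N - l)) * norm f * cmod (g (l, N - l)) * norm (w (l, N - l)))"
      by (rule sum_mono) (use x in \<open>auto simp: norm_cscale norm_mult intro!: mult_right_mono\<close>)
    also have "\<dots> = K N * norm f" unfolding K_def sum_distrib_right by (simp add: mult_ac)
    finally show ?thesis unfolding f_def .
  qed
  define C where "C = 2 * exp (cmod z) + (\<Sum>N<N0. K N)"
  have sK: "(\<Sum>N<N0. K N) \<ge> 0" by (intro sum_nonneg K0)
  have b: "norm (\<Sum>i\<in>{i. lev i = N}. cscale (c i) (spec g i)) \<le> C * norm (\<Sum>i\<in>{i. lev i = N}. cscale (c i) (HH s i))" for N c
  proof (cases "N < N0")
    case True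
    have "K N \<le> (\<Sum>N<N0. K N)" using True K0 by (intro member_le_sum) auto
    then have "K N \<le> C" by (simp add: C_def add_increasing)
    then show ?thesis using KN[where N = N and c = c] by (meson mult_right_mono norm_ge_zero order_trans)
  next
    case False
    have "norm (\<Sum>i\<in>{i. lev i = N}. cscale (c i) (spec g i)) \<le> 2 * exp (cmod z) * norm (\<Sum>i\<in>{i. lev i = N}. cscale (c i) (HH s i))"
      unfolding g_def by (rule level_estimate[OF t1(1,3) _ z, of "\<rho>^N"]) (use N0[of N] False dec Tt in auto)
    also have "\<dots> \<le> C * norm (\<Sum>i\<in>{i. lev i = N}. cscale (c i) (HH s i))"
      unfolding C_def using sK by (intro mult_right_mono) auto
    finally show ?thesis .
  qed
  have "\<exists>R. clinear_op R \<and> (\<forall>f. norm (R f) \<le> C * norm f) \<and> (\<forall>i. R (HH s i) = spec g i)"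
    by (rule block_op) (use b cinner_spec sK in \<open>auto simp: C_def\<close>)
  then obtain R where R: "clinear_op R" "\<And>i. R (HH s i) = spec g i" by blast
  have "\<forall>i. R (w i) = cscale (1 / (lam i - z)) (w i)" using spec_w[OF R] by (simp add: g_def)
  with R(1) show ?thesis by blast
qed

sublocale spectral: spectral_model "K_op a" w w' lam semi
proof
  show "finite {i. Re (lam i) \<le> r}" for r
    unfolding level_set_lam by (rule finite_npts[OF Re_mu_pos])
qed (use biorth_w dense_w dense_w' K_op_iff_w' semi_w semi(2) quantD(1)[OF semi(1)] resolvent_exists in blast)+

text \<open>The absolute value of the semigroup operator is the quantisation of the positive square
  root \<open>B\<close> of \<open>adj2 (A t) ** A t\<close>, diagonal in \<open>W V\<close> with
  eigenvalues s1^p s2^q. Comparison with \<open>D t\<close> loses only the factor (1 + s1)(1 + s2),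
  which lies between 1 and 4.\<close>

lemma trace_norm_semi:
  assumes t: "t > 0" "D t > 0"
  shows "\<exists>S. trace_norm (semi t) = ennreal S \<and> 1 / D t \<le> S \<and> S \<le> 4 / D t"
    and "((\<lambda>i. cinner (semi t (HH s i)) (HH s i)) has_sum op_trace (semi t)) UNIV"
proof -
  note c = A_contraction[OF t]
  obtain V d1 d2 where V: "adj2 V ** V = mat 1" "V ** adj2 V = mat 1"
    and AV: "adj2 (A t) ** A t = V ** diag2 (of_real d1) (of_real d2) ** adj2 V" and d: "0 \<le> d1" "d1 < 1" "0 \<le> d2" "d2 < 1"
    and p: "(1 - d1) * (1 - d2) = D t" and pd: "d1 * d2 = (cmod (det (A t)))\<^sup>2"
    by (rule strict_contraction[OF c(1,2)]) (simp add: c(3))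
  have "d1 * d2 > 0" unfolding pd det_A by simp
  then have d0: "d1 > 0" "d2 > 0" using d by (auto simp: zero_less_mult_iff)
  define s1 s2 where "s1 = sqrt d1" and "s2 = sqrt d2"
  have s12: "0 < s1" "s1 < 1" "0 < s2" "s2 < 1" "s1 * s1 = d1" "s2 * s2 = d2"
    using d0 d by (simp_all add: s1_def s2_def)
  define B where "B = V ** diag2 (of_real s1) (of_real s2) ** adj2 V"
  have dd: "diag2 (of_real s1) (of_real s2) ** diag2 (of_real s1) (of_real s2) = diag2 (of_real d1) (of_real d2)"
    by (simp add: eq2_iff mult2_nth s12(5,6)[symmetric])
  have ad: "adj2 (diag2 (of_real s1) (of_real s2)) = diag2 (of_real s1) (of_real s2)"
    by (simp add: eq2_iff)
  have adB: "adj2 B = B" by (simp add: B_def adj2_mult ad matrix_mul_assoc)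
  have BB: "B ** B = adj2 (A t) ** A t"
  proof -
    have "B ** B = V ** diag2 (of_real s1) (of_real s2) ** (adj2 V ** V) ** diag2 (of_real s1) (of_real s2) ** adj2 V"
      by (simp only: B_def matrix_mul_assoc)
    also have "\<dots> = V ** (diag2 (of_real s1) (of_real s2) ** diag2 (of_real s1) (of_real s2)) ** adj2 V"
      by (simp add: V matrix_mul_assoc)
    finally show ?thesis by (simp add: dd AV)
  qed
  obtain P0 where P0: "quant B P0"
    using quant_exists[OF V, of B d1 d2 1] BB adB AV d by auto
  obtain U where U: "quant (adj2 (A t)) U"
    using quant_contraction[of "adj2 (A t)"] c by (auto simp: det_adj2 hs2_adj2)
  have T: "quant (A t) (semi t)" using semi(1) t by simp
  have TU: "cinner (semi t f) g = cinner f (U g)" for f g by (rule quant_adj[OF T U])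
  have sq: "P0 o\<^sub>L P0 = U o\<^sub>L semi t"
    using quant_mult[OF P0 P0] quant_mult[OF U T] unfolding BB by (rule quant_unique)
  define \<sigma> where "\<sigma> i = s1 ^ fst i * s2 ^ snd i" for i :: "nat \<times> nat"
  have \<sigma>: "\<sigma> i > 0" for i using s12 by (simp add: \<sigma>_def)
  have PW: "P0 (W V i) = cscale (of_real (\<sigma> i)) (W V i)" for i
  proof -
    have "B ** V = V ** diag2 (of_real s1) (of_real s2) ** (adj2 V ** V)" by (simp only: B_def matrix_mul_assoc)
    then have "B ** V = V ** diag2 (of_real s1) (of_real s2)" by (simp add: V)
    then show ?thesis by (simp add: quantD(2)[OF P0] W_diag \<sigma>_def)
  qed
  interpret V: orth_basis "W V" "\<lambda>N. {i. lev i = N}" by (rule orth_basis_W[OF V])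
  define S where "S = 1 / ((1 - s1) * (1 - s2))"
  have \<sigma>S: "(\<sigma> has_sum S) UNIV"
    unfolding \<sigma>_def S_def using s12 by (intro has_sum_geometric2_real) auto
  have "trace_norm (semi t) = ennreal S"
    using V.trace_norm_eq[OF quantD(1)[OF P0] PW \<sigma> \<sigma>S bij_prod_decode] sq adj_op_eq[OF TU] by simp
  moreover have "1 / D t \<le> S" "S \<le> 4 / D t"
  proof -
    have D: "D t = ((1 - s1) * (1 - s2)) * ((1 + s1) * (1 + s2))"
      unfolding p[symmetric] s12(5,6)[symmetric] by (simp add: algebra_simps)
    have "(1 + s1) * (1 + s2) \<le> 2 * 2" "1 * 1 \<le> (1 + s1) * (1 + s2)"
      using s12 by (intro mult_mono; simp)+
    moreover have m: "(1 - s1) * (1 - s2) > 0" using s12 by simp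
    ultimately have "D t \<le> ((1 - s1) * (1 - s2)) * 4" "((1 - s1) * (1 - s2)) * 1 \<le> D t"
      unfolding D by (intro mult_left_mono; simp)+
    then show "1 / D t \<le> S" "S \<le> 4 / D t"
      using m t by (simp_all add: S_def divide_simps)
  qed
  ultimately show "\<exists>S. trace_norm (semi t) = ennreal S \<and> 1 / D t \<le> S \<and> S \<le> 4 / D t" by blast
  \<comment> \<open>In the singular basis the norms of the images are the singular values, so their
    summability is that of \<sigma>; this allows the trace to be taken in the Hermite basis
    instead.\<close>
  have "norm (semi t (W V i)) = \<sigma> i" for i
  proof -
    have "(U o\<^sub>L semi t) (W V i) = cscale (of_real ((\<sigma> i)\<^sup>2)) (W V i)"
      unfolding sq[symmetric] by (simp add: PW clinear_opD[OF quantD(1)[OF P0]] power2_eq_square)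
    then have "cinner (semi t (W V i)) (semi t (W V i)) = of_real ((\<sigma> i)\<^sup>2)"
      unfolding TU by (simp add: cinner_cscale_right V.on)
    then have "(norm (semi t (W V i)))\<^sup>2 = (\<sigma> i)\<^sup>2"
      unfolding cinner_self using of_real_eq_iff by blast
    then show ?thesis using \<sigma>[of i] by (simp add: power2_eq_iff_nonneg)
  qed
  then have "(\<lambda>i. norm (semi t (W V i))) summable_on UNIV"
    using \<sigma>S by (auto simp: summable_on_def)
  from V.op_trace_eq[OF TU this bij_prod_decode orth_basis_axioms]
  show "((\<lambda>i. cinner (semi t (HH s i)) (HH s i)) has_sum op_trace (semi t)) UNIV" .
qed

text \<open>Cyclicity of the finite trace on level N, applied to the symmetric powers of
  \<open>P\<close>, the diagonal matrix and \<open>Q\<close>.\<close>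

lemma block_trace:
  "(\<Sum>j\<le>N. Gam (A t) N j j) = (\<Sum>j\<le>N. exp (- of_real t * mu1) ^ j * exp (- of_real t * mu2) ^ (N - j))"
proof -
  define E where "E = diag2 (exp (- of_real t * mu1)) (exp (- of_real t * mu2))"
  have A: "A t = P ** (E ** Q)" by (simp add: A_def E_def matrix_mul_assoc)
  have "(\<Sum>j\<le>N. Gam (A t) N j j) = (\<Sum>j\<le>N. \<Sum>l\<le>N. Gam P N j l * Gam (E ** Q) N l j)"
    unfolding A by (rule sum.cong) (auto simp: Gam_mult)
  also have "\<dots> = (\<Sum>l\<le>N. \<Sum>j\<le>N. Gam (E ** Q) N l j * Gam P N j l)"
    by (subst sum.swap) (simp add: mult.commute)
  also have "\<dots> = (\<Sum>l\<le>N. Gam (E ** Q ** P) N l l)"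
    by (rule sum.cong) (auto simp: Gam_mult)
  also have "E ** Q ** P = E ** (Q ** P)" by (simp only: matrix_mul_assoc)
  finally show ?thesis by (simp add: QP E_def Gam_diag)
qed

text \<open>The eigenvectors need not be orthonormal, so the trace is taken in the Hermite basis.
  Its diagonal entries are compared with the eigenvalues through block sums, and these add up to a
  double geometric series.\<close>

lemma op_trace_semi:
  assumes t: "t > 0" "D t > 0"
  shows "op_trace (semi t) = 1 / ((1 - exp (- of_real t * mu1)) * (1 - exp (- of_real t * mu2)))"
proof -
  have d: "cinner (semi t (HH s i)) (HH s i) = Gam (A t) (lev i) (fst i) (fst i)" for i
    using W_H[of "A t" i i] quantD(2)[OF semi(1)[of t], of "mat 1" i] t by (simp add: W_one)
  have "(\<Sum>i\<in>{i. lev i = N}. Gam (A t) (lev i) (fst i) (fst i)) = (\<Sum>j\<le>N. Gam (A t) N j j)" for N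
    unfolding sum_lev by (rule sum.cong) auto
  then have "(\<lambda>N. \<Sum>j\<le>N. Gam (A t) N j j) sums op_trace (semi t)"
    using has_sum_blocks[OF trace_norm_semi(2)[OF t]] unfolding d by simp
  moreover have "(\<lambda>N. \<Sum>j\<le>N. exp (- of_real t * mu1) ^ j * exp (- of_real t * mu2) ^ (N - j))
      sums (1 / ((1 - exp (- of_real t * mu1)) * (1 - exp (- of_real t * mu2))))"
    using has_sum_blocks[OF has_sum_geometric2_complex[of "exp (- of_real t * mu1)" "exp (- of_real t * mu2)"]] t Re_mu_pos
    unfolding sum_lev by simp
  ultimately show ?thesis unfolding block_trace using sums_unique2 by blast
qed

section \<open>The three asymptotic statements\<close>

lemma exp_minus_K: "t \<ge> 0 \<Longrightarrow> exp_minus (K_op a) t = semi t"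
  by (rule spectral.exp_minus_eq)

lemma trace_norm_bounds:
  "\<exists>t0 c0 c1 :: real. 0 < t0 \<and> t0 < 1 \<and> 0 < c0 \<and> 0 < c1 \<and>
        (\<forall>t. 0 < t \<and> t < t0 \<longrightarrow>
           ennreal (c0 * t powi (-4)) \<le> trace_norm (exp_minus (K_op a) t) \<and>
           trace_norm (exp_minus (K_op a) t) \<le> ennreal (c1 * t powi (-4)))"
proof (intro exI conjI allI impI)
  \<comment> \<open>From 1/D \<le> S \<le> 4/D and (a/6) t^4 \<le> D \<le> a t^4 the constants are
    1/a and 4/(a/6) = 24/a.\<close>
  show "0 < tz" "tz < 1" "0 < 1 / a" "0 < 24 / a" using tz(1,2) a by simp_all
  fix t assume "0 < t \<and> t < tz"
  then have t: "0 < t" "t < tz" by simp_all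
  note b = tz(3-5)[OF t]
  obtain S where S: "trace_norm (semi t) = ennreal S" "1 / D t \<le> S" "S \<le> 4 / D t"
    using trace_norm_semi(1)[OF t(1) b(1)] by blast
  have pw: "t powi (-4) = 1 / t^4" by (simp add: power_int_minus divide_inverse)
  have "1 / a * t powi (-4) = 1 / (a * t^4)" by (simp add: pw)
  also have "\<dots> \<le> 1 / D t" using b a t by (intro divide_left_mono) auto
  finally have lo: "1 / a * t powi (-4) \<le> S" using S by simp
  have "4 / D t \<le> 4 / (a / 6 * t^4)" using b a t by (intro divide_left_mono) auto
  also have "\<dots> = 24 / a * t powi (-4)" by (simp add: pw)
  finally have hi: "S \<le> 24 / a * t powi (-4)" using S by simp
  have e: "trace_norm (exp_minus (K_op a) t) = ennreal S" using exp_minus_K[of t] S t by simp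
  show "ennreal (1 / a * t powi (-4)) \<le> trace_norm (exp_minus (K_op a) t)"
    unfolding e using lo by (rule ennreal_leI)
  show "trace_norm (exp_minus (K_op a) t) \<le> ennreal (24 / a * t powi (-4))"
    unfolding e using hi by (rule ennreal_leI)
qed

text \<open>Each factor (1 - exp (- t mu))/t of the denominator tends to mu, and mu1 mu2 =
  a.\<close>

lemma op_trace_asymp:
  "(\<lambda>t. op_trace (exp_minus (K_op a) t)) \<sim>[at_right 0] (\<lambda>t. complex_of_real (1 / a * t powi (-2)))"
proof (rule asymp_equivI')
  have mu_nz: "mu1 \<noteq> 0" "mu2 \<noteq> 0" using mu_prod a by auto
  define q where "q mu t = (1 - exp (- of_real t * mu)) / of_real t" for mu :: complex and t :: real
  have q: "(q mu \<longlongrightarrow> mu) (at_right 0)" for mu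
    using tendsto_minus[OF exp_difference_quotient(1)[of "- mu"]]
    by (simp add: q_def[abs_def] mult.commute minus_divide_left)
  have "((\<lambda>t. of_real a / (q mu1 t * q mu2 t)) \<longlongrightarrow> of_real a / (mu1 * mu2)) (at_right 0)"
    using mu_nz by (intro tendsto_intros q) auto
  then have lim: "((\<lambda>t. of_real a / (q mu1 t * q mu2 t)) \<longlongrightarrow> 1) (at_right 0)" using a by (simp add: mu_prod)
  have "\<forall>\<^sub>F t in at_right 0. t \<in> {0<..<tz}" using tz(1) by (rule eventually_at_right_real)
  then have "\<forall>\<^sub>F t in at_right 0. of_real a / (q mu1 t * q mu2 t)
      = op_trace (exp_minus (K_op a) t) / complex_of_real (1 / a * t powi (-2))"
  proof eventually_elim
    case (elim t)
    then have t: "0 < t" "t < tz" by simp_all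
    have pw: "t powi (-2) = 1 / t\<^sup>2" by (simp add: power_int_minus divide_inverse)
    show ?case
      unfolding exp_minus_K[OF less_imp_le[OF t(1)]] op_trace_semi[OF t(1) tz(3)[OF t]] pw q_def
      using t a by (simp add: divide_simps power2_eq_square)
  qed
  with lim show "((\<lambda>t. op_trace (exp_minus (K_op a) t) / complex_of_real (1 / a * t powi (-2))) \<longlongrightarrow> 1) (at_right 0)"
    by (rule Lim_transform_eventually)
qed

lemma counting_asymp:
  "(\<lambda>r. enn2real (counting (K_op a) r)) \<sim>[at_top] (\<lambda>r. 2 * max 1 (1 / (4 * a)) * r\<^sup>2)"
proof (rule asymp_equivI')
  define k where "k = 2 * max 1 (1 / (4 * a))"
  have k: "k > 0" by (simp add: k_def less_max_iff_disj)
  have c: "enn2real (counting (K_op a) r) = real (card (npts (Re mu1) (Re mu2) r))" for r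
    unfolding spectral.counting_eq level_set_lam by (simp add: ennreal_of_nat_eq_real_of_nat)
  have "((\<lambda>r. real (card (npts (Re mu1) (Re mu2) r)) / r\<^sup>2 / k) \<longlongrightarrow> k / k) at_top"
    using card_npts_asymp[OF Re_mu_pos] k by (intro tendsto_intros) (auto simp: Re_mu_prod k_def)
  then show "((\<lambda>r. enn2real (counting (K_op a) r) / (2 * max 1 (1 / (4 * a)) * r\<^sup>2)) \<longlongrightarrow> 1) at_top"
    unfolding c k_def[symmetric] using k by (simp add: mult.commute)
qed

end

theorem theoremC1:
  fixes a :: real
  assumes "a > 0" and "a \<noteq> 1 / 4"
  shows
    "(\<exists>t0 c0 c1 :: real. 0 < t0 \<and> t0 < 1 \<and> 0 < c0 \<and> 0 < c1 \<and>
        (\<forall>t. 0 < t \<and> t < t0 \<longrightarrow>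
           ennreal (c0 * t powi (-4)) \<le> trace_norm (exp_minus (K_op a) t) \<and>
           trace_norm (exp_minus (K_op a) t) \<le> ennreal (c1 * t powi (-4)))) \<and>
     (\<lambda>t. op_trace (exp_minus (K_op a) t)) \<sim>[at_right 0]
        (\<lambda>t. complex_of_real (1 / a * t powi (-2))) \<and>
     (\<lambda>r. enn2real (counting (K_op a) r)) \<sim>[at_top]
        (\<lambda>r. 2 * max 1 (1 / (4 * a)) * r\<^sup>2)"
proof -
  interpret fokker_planck a using assms by unfold_locales
  show ?thesis by (intro conjI trace_norm_bounds op_trace_asymp counting_asymp)
qed

end
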